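(* Let $a=(a_1,a_2)\in\mathbb C^2$ and $r>0$, let $B_1=\{z\in\mathbb C^2: |z_1|^2+|z_2|^2<1\}$ and $B_2=\{z\in\mathbb C^2: |z_1-a_1|^2+|z_2-a_2|^2<r^2\}$, and assume that $\partial B_1$ and $\partial B_2$ have nonempty, real transversal intersection. Let $\Omega=B_1\cap B_2$, let $K_\Omega$ be its Bergman kernel, and let $p,q$ be the two complex tangent points of $\partial B_1\cap\partial B_2$. Then: (i) For each $\zeta\in\Omega$ the function $z\mapsto K_\Omega(z,\zeta)$ is holomorphic in (i.e. extends holomorphically to) a neighborhood of $\overline\Omega\setminus\{p,q\}$. (ii) For $z\in\Omega$ near a complex tangent point $q$ there is an asymptotic expansion of the form $$K_\Omega(z,\zeta)\sim\sum_j \langle z-q,{}^{T}a\rangle^{n_j}\,\langle z-q,a\rangle^{\gamma_j}\,P_j\big(\log\langle z-q,a\rangle,\zeta\big),$$ where the $n_j$ are nonnegative integers, the $\gamma_j$ are (possibly complex) exponents with $\operatorname{Re}\gamma_j>-1-\frac{n_j}{2}$, and the $P_j(\log\langle z-q,a\rangle,\zeta)$ are polynomials in $\log\langle z-q,a\rangle$ whose coefficients vary anti-holomorphically with $\zeta\in\Omega$.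
   Context: The Bergman kernel $K_\Omega$ on $\Omega\times\Omega$ is characterized by: $\overline{K_\Omega(z,\cdot)}$ is holomorphic and square-integrable on $\Omega$ for all $z\in\Omega$, and $\int_\Omega K_\Omega(z,\zeta)f(\zeta)\,dV_\zeta=f(z)$ for all holomorphic square-integrable $f$ on $\Omega$. A complex tangent point is a point of $\partial B_1\cap\partial B_2$ at which the maximal complex subspaces of the tangent spaces of $\partial B_1$ and $\partial B_2$ coincide; there are exactly two such points. $\langle z,w\rangle=z_1\overline{w_1}+z_2\overline{w_2}$ is the hermitian inner product on $\mathbb C^2$, and ${}^{T}a=(\overline{a_2},-\overline{a_1})$. The function $\langle z-q,a\rangle$ has no zeros on the convex set $\Omega$; powers and logarithms of it are formed with a fixed holomorphic branch of $\log\langle z-q,a\rangle$ on $\Omega$. Meaning of $\sim$: the sequence $(n_j,\gamma_j,P_j)$ does not depend on $z$ (nor do $n_j,\gamma_j$ depend on $\zeta$), and for every $\zeta\in\Omega$ and every $N>0$, for all sufficiently large $m$ the difference between $K_\Omega(z,\zeta)$ and the sum of the first $m$ terms is $O(|\langle z-q,a\rangle|^{N})$ as $z\to q$ in $\Omega$. *)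

theory Defs
  imports "HOL-Analysis.Analysis" "HOL-Library.Landau_Symbols"
begin

section \<open>Holomorphic functions of several complex variables\<close>

text \<open>Only used for open \<open>S\<close>.\<close>

definition holomorphic_Cn_on :: "(complex ^ 'n \<Rightarrow> complex) \<Rightarrow> (complex ^ 'n) set \<Rightarrow> bool" where
  "holomorphic_Cn_on f S \<longleftrightarrow>
     (\<forall>z\<in>S. \<exists>D. (f has_derivative D) (at z) \<and> (\<forall>c v. D (c *s v) = c * D v))"

definition antiholomorphic_Cn_on :: "(complex ^ 'n \<Rightarrow> complex) \<Rightarrow> (complex ^ 'n) set \<Rightarrow> bool" where
  "antiholomorphic_Cn_on f S \<longleftrightarrow> holomorphic_Cn_on (\<lambda>z. cnj (f z)) S"

definition holomorphic_log_branch ::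
    "(complex ^ 'n \<Rightarrow> complex) \<Rightarrow> (complex ^ 'n) set \<Rightarrow> (complex ^ 'n \<Rightarrow> complex) \<Rightarrow> bool" where
  "holomorphic_log_branch g S L \<longleftrightarrow> holomorphic_Cn_on L S \<and> (\<forall>z\<in>S. exp (L z) = g z)"

text \<open>For a holomorphic (hence continuous) function on an open set, membership in \<open>L\<^sup>2\<close>
  amounts to integrability of the squared modulus. \<open>lborel\<close> is Lebesgue measure on
  \<open>\<complex>\<^sup>n = \<real>\<^sup>2\<^sup>n\<close>.\<close>

definition bergman_space :: "(complex ^ 'n) set \<Rightarrow> (complex ^ 'n \<Rightarrow> complex) set" where
  "bergman_space \<Omega> =
     {f. holomorphic_Cn_on f \<Omega> \<and> set_integrable lborel \<Omega> (\<lambda>z. (cmod (f z))\<^sup>2)}"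

text \<open>The defining characterization of the Bergman kernel; it determines \<open>K\<close> on \<open>\<Omega> \<times> \<Omega>\<close>
  (see \<open>is_bergman_kernel_unique\<close>), and values elsewhere are irrelevant.\<close>

definition is_bergman_kernel ::
    "(complex ^ 'n) set \<Rightarrow> (complex ^ 'n \<Rightarrow> complex ^ 'n \<Rightarrow> complex) \<Rightarrow> bool" where
  "is_bergman_kernel \<Omega> K \<longleftrightarrow>
     (\<forall>z\<in>\<Omega>. (\<lambda>\<zeta>. cnj (K z \<zeta>)) \<in> bergman_space \<Omega>) \<and>
     (\<forall>f\<in>bergman_space \<Omega>. \<forall>z\<in>\<Omega>. (LINT \<zeta>:\<Omega>|lborel. K z \<zeta> * f \<zeta>) = f z)"

section \<open>Tangent spaces\<close>

text \<open>Velocities at \<open>z\<close> of curves in \<open>S\<close> through \<open>z\<close>; for a smooth hypersurface \<open>S\<close> this is the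
  usual real tangent space. Requiring the curve to stay in \<open>S\<close> for all times is no restriction,
  since it may be replaced by the constant \<open>z\<close> away from \<open>0\<close>.\<close>

definition tangent_space :: "'a::real_normed_vector set \<Rightarrow> 'a \<Rightarrow> 'a set" where
  "tangent_space S z =
     {v. \<exists>\<gamma> :: real \<Rightarrow> 'a. \<gamma> 0 = z \<and> range \<gamma> \<subseteq> S \<and> (\<gamma> has_vector_derivative v) (at 0)}"

definition real_transversal :: "'a::real_normed_vector set \<Rightarrow> 'a set \<Rightarrow> bool" where
  "real_transversal S T \<longleftrightarrow>
     (\<forall>z\<in>S \<inter> T. {u + v | u v. u \<in> tangent_space S z \<and> v \<in> tangent_space T z} = UNIV)"

text \<open>The usual \<open>V \<inter> \<i>V\<close>; cf. \<open>max_complex_subspace_greatest\<close>.\<close>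

definition max_complex_subspace :: "(complex ^ 'n) set \<Rightarrow> (complex ^ 'n) set" where
  "max_complex_subspace V = V \<inter> (\<lambda>v. \<i> *s v) ` V"

definition complex_tangent_points ::
    "(complex ^ 'n) set \<Rightarrow> (complex ^ 'n) set \<Rightarrow> (complex ^ 'n) set" where
  "complex_tangent_points S T =
     {z \<in> S \<inter> T. max_complex_subspace (tangent_space S z) = max_complex_subspace (tangent_space T z)}"

section \<open>Asymptotic expansions\<close>

definition hermitian :: "complex ^ 2 \<Rightarrow> complex ^ 2 \<Rightarrow> complex" where
  "hermitian z w = z $ 1 * cnj (w $ 1) + z $ 2 * cnj (w $ 2)"

definition perp :: "complex ^ 2 \<Rightarrow> complex ^ 2" where
  "perp a = vector [cnj (a $ 2), - cnj (a $ 1)]"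

text \<open>Finite expansions are included, as terms may vanish identically.\<close>

definition has_asymptotic_expansion ::
    "('a::topological_space \<Rightarrow> complex) \<Rightarrow> (nat \<Rightarrow> 'a \<Rightarrow> complex) \<Rightarrow> ('a \<Rightarrow> complex) \<Rightarrow> 'a \<Rightarrow> 'a set \<Rightarrow> bool"
  where
  "has_asymptotic_expansion f t w q S \<longleftrightarrow>
     (\<forall>N::real. N > 0 \<longrightarrow> (\<forall>\<^sub>F m in sequentially.
        (\<lambda>z. cmod (f z - (\<Sum>j<m. t j z))) \<in> O[at q within S](\<lambda>z. cmod (w z) powr N)))"

text \<open>A polynomial in one indeterminate over the ring of antiholomorphic functions on \<open>S\<close>; in
  particular its degree is bounded independently of the parameter.\<close>

definition antiholomorphic_poly_on :: "(complex ^ 'n \<Rightarrow> complex poly) \<Rightarrow> (complex ^ 'n) set \<Rightarrow> bool" where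
  "antiholomorphic_poly_on P S \<longleftrightarrow>
     (\<exists>d. \<forall>\<zeta>\<in>S. degree (P \<zeta>) \<le> d) \<and>
     (\<forall>k. antiholomorphic_Cn_on (\<lambda>\<zeta>. coeff (P \<zeta>) k) S)"

section \<open>Sanity checks\<close>

lemma ball_C2_iff:
  fixes z c :: "complex ^ 2"
  assumes "r > 0"
  shows "z \<in> ball c r \<longleftrightarrow> (cmod (z $ 1 - c $ 1))\<^sup>2 + (cmod (z $ 2 - c $ 2))\<^sup>2 < r\<^sup>2"
proof -
  have "z \<in> ball c r \<longleftrightarrow> norm (z - c) < r"
    by (simp add: dist_norm norm_minus_commute)
  also have "\<dots> \<longleftrightarrow> (norm (z - c))\<^sup>2 < r\<^sup>2"
    using assms by (smt (verit) norm_ge_zero power_mono_iff zero_less_numeral)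
  also have "(norm (z - c))\<^sup>2 = (cmod (z $ 1 - c $ 1))\<^sup>2 + (cmod (z $ 2 - c $ 2))\<^sup>2"
    by (simp add: norm_vec_def L2_set_def sum_2)
  finally show ?thesis .
qed

lemma hermitian_perp: "hermitian a (perp a) = 0"
  by (simp add: hermitian_def perp_def vector_def algebra_simps)

lemma max_complex_subspace_greatest:
  assumes "subspace V"
  shows "vec.subspace (max_complex_subspace V)"
    and "vec.subspace W \<Longrightarrow> W \<subseteq> V \<Longrightarrow> W \<subseteq> max_complex_subspace V"
proof -
  have i: "\<i> *s v \<in> max_complex_subspace V" if v: "v \<in> max_complex_subspace V" for v
  proof -
    obtain u where u: "u \<in> V" "v = \<i> *s u" and "v \<in> V"
      using v by (auto simp: max_complex_subspace_def)
    have "\<i> *s v = - u" by (simp add: u vec_eq_iff flip: mult.assoc)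
    moreover have "- u \<in> V" using u subspace_neg[OF assms] by blast
    ultimately show ?thesis
      using \<open>v \<in> V\<close> unfolding max_complex_subspace_def by (metis IntI imageI)
  qed
  have add: "u + v \<in> max_complex_subspace V"
    if "u \<in> max_complex_subspace V" "v \<in> max_complex_subspace V" for u v
    using that subspace_add[OF assms]
    by (auto simp: max_complex_subspace_def image_iff vec.scale_right_distrib) (metis vec.scale_right_distrib)
  have sc: "x *\<^sub>R v \<in> max_complex_subspace V" if v: "v \<in> max_complex_subspace V" for x v
  proof -
    obtain u where u: "u \<in> V" "v = \<i> *s u" and "v \<in> V"
      using v by (auto simp: max_complex_subspace_def)
    have "x *\<^sub>R v = \<i> *s (x *\<^sub>R u)" by (simp add: u vec_eq_iff)
    moreover have "x *\<^sub>R u \<in> V" "x *\<^sub>R v \<in> V"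
      using u(1) \<open>v \<in> V\<close> subspace_scale[OF assms] by blast+
    ultimately show ?thesis unfolding max_complex_subspace_def by blast
  qed
  have "c *s v \<in> max_complex_subspace V" if "v \<in> max_complex_subspace V" for c v
  proof -
    have "c *s v = Re c *\<^sub>R v + Im c *\<^sub>R (\<i> *s v)"
      by (simp add: vec_eq_iff complex_eq_iff algebra_simps)
    with add sc i that show ?thesis by metis
  qed
  moreover have "0 \<in> max_complex_subspace V"
    using subspace_0[OF assms] by (auto simp: max_complex_subspace_def image_iff intro!: bexI[of _ 0])
  ultimately show "vec.subspace (max_complex_subspace V)"
    using add by (auto simp: vec.subspace_def)
  assume W: "vec.subspace W" "W \<subseteq> V"
  show "W \<subseteq> max_complex_subspace V"
  proof
    fix w assume w: "w \<in> W"
    have "w = \<i> *s (- \<i> *s w)" by (simp add: vec_eq_iff flip: mult.assoc)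
    moreover have "- \<i> *s w \<in> V" using W w vec.subspace_scale by blast
    ultimately show "w \<in> max_complex_subspace V"
      using W w unfolding max_complex_subspace_def by blast
  qed
qed

lemma tangent_space_sphere:
  fixes c z :: "'a::euclidean_space"
  assumes "z \<in> sphere c r" "r > 0"
  shows "tangent_space (sphere c r) z = {v. v \<bullet> (z - c) = 0}"
proof (intro equalityI subsetI)
  fix v assume "v \<in> tangent_space (sphere c r) z"
  then obtain \<gamma> where g: "\<gamma> 0 = z" "range \<gamma> \<subseteq> sphere c r" "(\<gamma> has_vector_derivative v) (at 0)"
    by (auto simp: tangent_space_def)
  have eq: "(\<lambda>t. (\<gamma> t - c) \<bullet> (\<gamma> t - c)) = (\<lambda>t. r\<^sup>2)"
  proof
    fix t
    have "norm (\<gamma> t - c) = r"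
      using g(2) by (metis dist_commute dist_norm mem_sphere rangeI subsetD)
    then show "(\<gamma> t - c) \<bullet> (\<gamma> t - c) = r\<^sup>2" by (simp add: dot_square_norm)
  qed
  have "((\<lambda>t. (\<gamma> t - c) \<bullet> (\<gamma> t - c)) has_derivative
      (\<lambda>h. (\<gamma> 0 - c) \<bullet> (h *\<^sub>R v - 0) + (h *\<^sub>R v - 0) \<bullet> (\<gamma> 0 - c))) (at 0)"
    using g(3) unfolding has_vector_derivative_def by (intro derivative_intros)
  then have "(\<lambda>h. (\<gamma> 0 - c) \<bullet> (h *\<^sub>R v - 0) + (h *\<^sub>R v - 0) \<bullet> (\<gamma> 0 - c)) = (\<lambda>_. 0)"
    unfolding eq by (intro has_derivative_unique[OF _ has_derivative_const])
  from fun_cong[OF this, of 1] show "v \<in> {v. v \<bullet> (z - c) = 0}"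
    using g(1) by (simp add: inner_commute)
next
  fix v assume "v \<in> {v. v \<bullet> (z - c) = 0}"
  then have v: "v \<bullet> (z - c) = 0" by simp
  have n: "norm (z - c) = r" using assms by (simp add: dist_norm norm_minus_commute)
  define \<gamma> where "\<gamma> t = c + (r / sqrt (r\<^sup>2 + t\<^sup>2 * (norm v)\<^sup>2)) *\<^sub>R ((z - c) + t *\<^sub>R v)" for t
  have pos: "r\<^sup>2 + t\<^sup>2 * (norm v)\<^sup>2 > 0" for t
    using assms by (intro add_pos_nonneg) auto
  have nn: "norm ((z - c) + t *\<^sub>R v) = sqrt (r\<^sup>2 + t\<^sup>2 * (norm v)\<^sup>2)" for t
  proof -
    have "(norm ((z - c) + t *\<^sub>R v))\<^sup>2 = (norm (z - c))\<^sup>2 + (norm (t *\<^sub>R v))\<^sup>2"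
      using v by (intro norm_add_Pythagorean) (simp add: orthogonal_def inner_commute)
    then have "(norm ((z - c) + t *\<^sub>R v))\<^sup>2 = r\<^sup>2 + t\<^sup>2 * (norm v)\<^sup>2"
      unfolding n by (simp add: power_mult_distrib)
    then show ?thesis by (metis norm_ge_zero real_sqrt_unique)
  qed
  have "\<gamma> 0 = z" using assms by (simp add: \<gamma>_def)
  moreover have "range \<gamma> \<subseteq> sphere c r"
    using assms pos less_imp_neq[OF pos, symmetric]
    by (auto simp: \<gamma>_def dist_norm nn abs_of_pos real_sqrt_gt_zero less_imp_le)
  moreover have "(\<gamma> has_vector_derivative v) (at 0)"
  proof -
    have "((\<lambda>t. r / sqrt (r\<^sup>2 + t\<^sup>2 * (norm v)\<^sup>2)) has_real_derivative 0) (at 0)"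
      using assms(2) by (auto intro!: derivative_eq_intros)
    then have "(\<gamma> has_vector_derivative
        (r / sqrt (r\<^sup>2 + 0\<^sup>2 * (norm v)\<^sup>2)) *\<^sub>R v + 0 *\<^sub>R ((z - c) + 0 *\<^sub>R v)) (at 0)"
      unfolding \<gamma>_def
      using assms(2) by (auto intro!: derivative_eq_intros)
    then show ?thesis using assms by simp
  qed
  ultimately show "v \<in> tangent_space (sphere c r) z" by (auto simp: tangent_space_def)
qed

lemma holomorphic_Cn_on_imp_continuous_on: "holomorphic_Cn_on f S \<Longrightarrow> continuous_on S f"
  unfolding holomorphic_Cn_on_def
  by (meson continuous_at_imp_continuous_on has_derivative_continuous)

lemma set_integrable_cmod_square_imp_mult:
  fixes f g :: "complex ^ 'n \<Rightarrow> complex"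
  assumes "open S" "continuous_on S f" "continuous_on S g"
    and "set_integrable lborel S (\<lambda>z. (cmod (f z))\<^sup>2)" "set_integrable lborel S (\<lambda>z. (cmod (g z))\<^sup>2)"
  shows "set_integrable lborel S (\<lambda>z. f z * g z)"
proof (rule set_integrable_bound)
  show "set_integrable lborel S (\<lambda>z. (cmod (f z))\<^sup>2 + (cmod (g z))\<^sup>2)"
    using assms by (intro set_integral_add)
  have "continuous_on S (\<lambda>z. f z * g z)" using assms by (intro continuous_intros)
  then show "set_borel_measurable lborel S (\<lambda>z. f z * g z)"
    unfolding set_borel_measurable_def
    using borel_measurable_continuous_on_indicator[of S "\<lambda>z. f z * g z"] assms(1) by auto
  have "cmod (f z * g z) \<le> (cmod (f z))\<^sup>2 + (cmod (g z))\<^sup>2" for z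
    using sum_squares_bound[of "cmod (f z)" "cmod (g z)"]
      mult_nonneg_nonneg[OF norm_ge_zero[of "f z"] norm_ge_zero[of "g z"]]
    unfolding norm_mult by linarith
  then show "AE z in lborel. z \<in> S \<longrightarrow> norm (f z * g z) \<le> norm ((cmod (f z))\<^sup>2 + (cmod (g z))\<^sup>2)"
    by auto
qed

lemma is_bergman_kernel_unique:
  assumes "open \<Omega>" "is_bergman_kernel \<Omega> K" "is_bergman_kernel \<Omega> K'" "z \<in> \<Omega>" "\<zeta> \<in> \<Omega>"
  shows "K z \<zeta> = K' z \<zeta>"
proof -
  define g where "g w = cnj (K z w - K' z w)" for w
  note B = bergman_space_def is_bergman_kernel_def
  have hol: "holomorphic_Cn_on (\<lambda>w. cnj (K z w)) \<Omega>" "holomorphic_Cn_on (\<lambda>w. cnj (K' z w)) \<Omega>"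
    and int: "set_integrable lborel \<Omega> (\<lambda>w. (cmod (K z w))\<^sup>2)" "set_integrable lborel \<Omega> (\<lambda>w. (cmod (K' z w))\<^sup>2)"
    using assms by (auto simp: B)
  note cont' = hol[THEN holomorphic_Cn_on_imp_continuous_on]
  have cont: "continuous_on \<Omega> (K z)" "continuous_on \<Omega> (K' z)"
    using cont'[THEN continuous_on_cnj] by simp_all
  have holg: "holomorphic_Cn_on g \<Omega>"
    unfolding holomorphic_Cn_on_def
  proof
    fix w assume "w \<in> \<Omega>"
    then obtain D D' where "((\<lambda>w. cnj (K z w)) has_derivative D) (at w)" "\<And>c v. D (c *s v) = c * D v"
      "((\<lambda>w. cnj (K' z w)) has_derivative D') (at w)" "\<And>c v. D' (c *s v) = c * D' v"
      using hol unfolding holomorphic_Cn_on_def by metis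
    then have "(g has_derivative (\<lambda>v. D v - D' v)) (at w)" "\<forall>c v. D (c *s v) - D' (c *s v) = c * (D v - D' v)"
      by (auto simp: g_def[abs_def] algebra_simps intro: has_derivative_diff)
    then show "\<exists>D. (g has_derivative D) (at w) \<and> (\<forall>c v. D (c *s v) = c * D v)" by blast
  qed
  note contg = holomorphic_Cn_on_imp_continuous_on[OF holg]
  have intg: "set_integrable lborel \<Omega> (\<lambda>w. (cmod (g w))\<^sup>2)"
  proof (rule set_integrable_bound)
    show "set_integrable lborel \<Omega> (\<lambda>w. 2 * (cmod (K z w))\<^sup>2 + 2 * (cmod (K' z w))\<^sup>2)"
      using int by (intro set_integral_add set_integrable_mult_right) auto
    have "continuous_on \<Omega> (\<lambda>w. (cmod (g w))\<^sup>2)" using contg by (intro continuous_intros)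
    then show "set_borel_measurable lborel \<Omega> (\<lambda>w. (cmod (g w))\<^sup>2)"
      unfolding set_borel_measurable_def
      using borel_measurable_continuous_on_indicator[of \<Omega> "\<lambda>w. (cmod (g w))\<^sup>2"] assms(1) by auto
    have "(cmod (g w))\<^sup>2 \<le> 2 * (cmod (K z w))\<^sup>2 + 2 * (cmod (K' z w))\<^sup>2" for w
    proof -
      have "cmod (g w) \<le> cmod (K z w) + cmod (K' z w)"
        unfolding g_def complex_mod_cnj by (rule norm_triangle_ineq4)
      then have "(cmod (g w))\<^sup>2 \<le> (cmod (K z w) + cmod (K' z w))\<^sup>2" by (intro power_mono) auto
      also have "\<dots> \<le> 2 * (cmod (K z w))\<^sup>2 + 2 * (cmod (K' z w))\<^sup>2"
        using sum_squares_bound[of "cmod (K z w)" "cmod (K' z w)"] by (simp add: power2_sum)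
      finally show ?thesis .
    qed
    then show "AE w in lborel. w \<in> \<Omega> \<longrightarrow>
        norm ((cmod (g w))\<^sup>2) \<le> norm (2 * (cmod (K z w))\<^sup>2 + 2 * (cmod (K' z w))\<^sup>2)"
      by auto
  qed
  have gB: "g \<in> bergman_space \<Omega>" using holg intg by (simp add: bergman_space_def)
  have "(LINT w:\<Omega>|lborel. K z w * g w - K' z w * g w) = 0"
    using assms gB cont contg int intg
    by (subst set_integral_diff) (auto simp: is_bergman_kernel_def intro!: set_integrable_cmod_square_imp_mult)
  also have "(\<lambda>w. K z w * g w - K' z w * g w) = (\<lambda>w. complex_of_real ((cmod (g w))\<^sup>2))"
  proof
    fix w
    have "K z w * g w - K' z w * g w = g w * cnj (g w)" by (simp add: g_def algebra_simps)
    then show "K z w * g w - K' z w * g w = complex_of_real ((cmod (g w))\<^sup>2)"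
      by (simp only: complex_norm_square)
  qed
  finally have "(LINT w:\<Omega>|lborel. (cmod (g w))\<^sup>2) = 0"
    using set_integral_complex_of_real[of lborel \<Omega> "\<lambda>w. (cmod (g w))\<^sup>2"] by simp
  then have "AE w in lborel. indicator \<Omega> w *\<^sub>R (cmod (g w))\<^sup>2 = 0"
    using intg unfolding set_lebesgue_integral_def set_integrable_def
    by (subst (asm) integral_nonneg_eq_0_iff_AE) auto
  then have "AE w in lebesgue. indicator \<Omega> w *\<^sub>R (cmod (g w))\<^sup>2 = 0" by (rule AE_completion)
  then have "AE w \<in> \<Omega> in lebesgue. w \<in> \<Omega> \<inter> g -` {0} \<union> (- \<Omega>)"
    by eventually_elim auto
  moreover have "closed (\<Omega> \<inter> g -` {0} \<union> (- \<Omega>))"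
  proof -
    have "open (\<Omega> \<inter> g -` (- {0}))"
      using continuous_on_open_vimage[OF assms(1), of g] contg open_Compl[OF closed_singleton[of "0 :: complex"]]
      by (simp add: Int_commute del: vimage_Compl)
    moreover have "- (\<Omega> \<inter> g -` (- {0})) = \<Omega> \<inter> g -` {0} \<union> (- \<Omega>)" by auto
    ultimately show ?thesis by (metis closed_Compl)
  qed
  ultimately have "\<zeta> \<in> \<Omega> \<inter> g -` {0} \<union> (- \<Omega>)"
    using mem_closed_if_AE_lebesgue_open[OF assms(1)] assms(5) by blast
  then show ?thesis using assms(5) by (simp add: g_def)
qed

end

theory Submission
  imports Defs "HOL-Probability.Probability" "HOL-Complex_Analysis.Complex_Analysis"
begin

text \<open>
In unitary coordinates \<open>(x, y)\<close> with \<open>x\<close> in the direction of \<open>a\<close>, the domain is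
\<open>{\<bar>y\<bar>\<^sup>2 < rho x}\<close>, where \<open>rho > 0\<close> describes a plane lens bounded by two circular arcs. The vertices of the
lens are the complex tangent points (\<open>complex_tangent_point_on_line\<close>). Expanding in powers of \<open>y\<close>
turns the Bergman space into an orthogonal sum of weighted Bergman spaces on the lens, with weights
proportional to \<open>rho ^ Suc n\<close>. A Moebius map followed by a logarithm maps the lens onto a strip in such
a way that \<open>rho\<close> becomes \<open>h (Im s) / \<bar>M s\<bar>\<^sup>2\<close> with \<open>M\<close> holomorphic (\<open>rho_M\<close>); hence the weights become
\<open>h (Im s) ^ Suc n\<close>, invariant under real translations (\<open>transfer\<close>).

On the strip the reproducing kernel is a Fourier integral, \<open>kker n 0 \<tau>\<close> being the integral of
\<open>exp (\<i> \<xi> \<tau>) / G n \<xi>\<close> with \<open>\<tau> = s - cnj s'\<close> and \<open>G n\<close> the Laplace transform of \<open>h ^ Suc n\<close>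
(\<open>strip_reproducing\<close>). Multiplying back and summing over \<open>n\<close> gives the Bergman kernel as a series
(\<open>bergman_kernel_Dom\<close>, with uniqueness of the kernel). For fixed \<open>\<zeta>\<close> in the domain the midpoint
inequality for \<open>h\<close> and the decay estimate \<open>kker_decay\<close> let the series converge locally uniformly on a
neighbourhood of the closure without the two vertices (\<open>Kt_hol\<close>, \<open>Dom_Uz\<close>). This is the first claim.

For the second claim the contour of the Fourier integral is moved down to \<open>Im \<xi> = - E\<close>. The remaining
integrals are \<open>O(exp (E Re s))\<close> uniformly in \<open>n\<close>, and \<open>exp s\<close> is comparable to \<open>\<langle>z - q, a\<rangle>\<close> near the vertex.
The residues at the zeros \<open>l\<close> of \<open>G n\<close> that are crossed, finitely many over all \<open>n\<close>, are \<open>exp (\<i> l \<tau>)\<close> times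
polynomials in \<open>\<tau>\<close> (\<open>residue_Fk\<close>, \<open>Kt_split\<close>). Rewriting \<open>s\<close> as the logarithm \<open>L\<close> plus a holomorphic
function of \<open>x\<close> and expanding the latter in powers of \<open>x - qq\<close> (\<open>expandable_poly\<close>) yields terms
with exponents \<open>\<gamma> = \<i> l - (n + 3) / 2 + m\<close>, where \<open>m\<close> is a nonnegative integer. The lower bound on \<open>Re \<gamma>\<close>
is equivalent to \<open>Im l < - 1/2\<close> in case \<open>m = 0\<close>, and \<open>G n\<close> has no zeros with \<open>\<bar>Im l\<bar> \<le> 1/2\<close>
because the strip is narrower than \<open>\<pi>\<close> (\<open>G_nonzero_small\<close>, \<open>Z_Im\<close>). That \<open>G n\<close> has few zeros in horizontal
strips rests on the concentration of \<open>h ^ Suc n\<close> (\<open>G_lower_large_n\<close>, \<open>G_lower_large_xi\<close>).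
\<close>

section \<open>Images of Lebesgue measure\<close>

lemma distr_Complex_lborel:
 "distr (lborel \<Otimes>\<^sub>M lborel) borel (\<lambda>(x, y). Complex x y) = (lborel :: complex measure)"
proof (rule lborel_eqI[symmetric])
 have m: "(\<lambda>(x, y). Complex x y) \<in> borel_measurable (lborel \<Otimes>\<^sub>M lborel)"
  unfolding lborel_prod case_prod_beta Complex_eq
  by (simp, intro borel_measurable_continuous_onI continuous_intros)
 fix l u :: complex
 assume "\<And>b. b \<in> Basis ==> l \<bullet> b \<le> u \<bullet> b"
 then have le: "Re l \<le> Re u" "Im l \<le> Im u"
  by (metis Basis_complex_def complex_inner_1_right complex_inner_i_right insert_iff)+
 have "(\<lambda>(x, y). Complex x y) -` box l u = box (Re l) (Re u) \<times> box (Im l) (Im u)"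
  by (auto simp: box_def Basis_complex_def)
 then show "emeasure (distr (lborel \<Otimes>\<^sub>M lborel) borel (\<lambda>(x, y). Complex x y)) (box l u)
   = ennreal (\<Prod>b\<in>Basis. (u - l) \<bullet> b)"
  using le
  by (simp add: emeasure_distr[OF m] space_pair_measure lborel.emeasure_pair_measure_Times
    Basis_complex_def ennreal_mult)
qed simp

text \<open>Both sides are translation invariant. For two such measures \<open>M\<close> and \<open>N\<close>, computing
 the double integral of \<open>1\<^sub>A(x) 1\<^sub>B(x + y)\<close> in both orders gives \<open>M A * N B = M B * N A\<close>, and \<open>B\<close>
 may be taken to be a cube.\<close>

lemma distr_lborel_linear:
 fixes T :: "'a::euclidean_space \<Rightarrow> 'b::euclidean_space"
 assumes T: "linear T" "bij T"
 obtains c :: real where "c > 0" "distr lborel borel T = density lborel (\<lambda>_. ennreal c)"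
proof -
 define M where "M = distr lborel borel T"
 define T' where "T' = inv T"
 have T': "T (T' y) = y" "T' (T x) = x" for x y
  using T(2) by (simp_all add: T'_def bij_is_surj surj_f_inv_f bij_is_inj inv_f_f)
 have linT': "linear T'"
 proof (rule linearI)
  show "T' (b1 + b2) = T' b1 + T' b2" for b1 b2
   using T' linear_add[OF T(1)] by metis
  show "T' (r *\<^sub>R b) = r *\<^sub>R T' b" for r b
   using T' linear_scale[OF T(1)] by metis
 qed
 have cT: "continuous_on UNIV T" "continuous_on UNIV T'"
  using T(1) linT' linear_continuous_on linear_conv_bounded_linear by blast+
 have mT[measurable]: "T \<in> borel_measurable borel" "T' \<in> borel_measurable borel"
  using cT by (auto intro: borel_measurable_continuous_onI)
 have sM[measurable_cong]: "sets M = sets borel" by (simp add: M_def)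
 have plus: "distr lborel borel (\<lambda>x. x + c) = lborel" for c :: "'x::euclidean_space"
 proof -
  have "(\<lambda>x. x + c) = (+) c" by (auto simp: add.commute)
  then show ?thesis using lborel_distr_plus[of c] by simp
 qed
 have invM: "distr M borel (\<lambda>x. x + t) = M" for t
 proof -
  have "distr M borel (\<lambda>x. x + t) = distr lborel borel ((\<lambda>x. x + t) \<circ> T)"
   unfolding M_def by (subst distr_distr) auto
  also have "(\<lambda>x. x + t) \<circ> T = T \<circ> (\<lambda>x. x + T' t)"
   by (auto simp: fun_eq_iff linear_add[OF T(1)] T')
  also have "distr lborel borel \<dots> = distr (distr lborel borel (\<lambda>x. x + T' t)) borel T"
   by (subst distr_distr) auto
  finally show ?thesis unfolding plus M_def .
 qed
 have emT: "emeasure M A = emeasure lborel (T -` A)" if "A \<in> sets borel" for A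
  unfolding M_def using that by (simp add: emeasure_distr)
 have vim: "T -` A = T' ` A" for A using T' by (auto simp: image_iff) metis+
 have fin: "emeasure M A < \<infinity>" if "A \<in> sets borel" "bounded A" for A
 proof -
  have "bounded (T' ` A)" using that(2) linT' by (simp add: bounded_linear_image linear_conv_bounded_linear)
  then show ?thesis unfolding emT[OF that(1)] vim by (rule emeasure_bounded_finite)
 qed
 interpret M: sigma_finite_measure M
 proof
  show "\<exists>A. countable A \<and> A \<subseteq> sets M \<and> \<Union> A = space M \<and> (\<forall>a\<in>A. emeasure M a \<noteq> \<infinity>)"
  proof (intro exI conjI ballI)
   show "\<Union> (range (\<lambda>n::nat. ball (0::'b) n)) = space M"
    by (auto simp: M_def) (metis reals_Archimedean2)
  qed (use fin[of "ball 0 _"] in \<open>auto simp: M_def less_top[symmetric]\<close>)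
 qed
 interpret P: pair_sigma_finite M "lborel :: 'b measure" ..
 have refl: "(\<integral>\<^sup>+ y. f (x - y) \<partial>lborel) = (\<integral>\<^sup>+ y. f y \<partial>lborel)"
  if [measurable]: "f \<in> borel_measurable borel" for f and x :: 'b
 proof -
  have "(\<integral>\<^sup>+ y. f y \<partial>lborel) = (\<integral>\<^sup>+ y. f y \<partial>distr lborel borel (\<lambda>y. x + (-1) *\<^sub>R y))"
   by (subst lborel_affine[of "-1" x]) (simp_all add: density_1)
  also have "\<dots> = (\<integral>\<^sup>+ y. f (x - y) \<partial>lborel)"
   by (subst nn_integral_distr) simp_all
  finally show ?thesis by simp
 qed
 have tr: "(\<integral>\<^sup>+ x. f (x + t) \<partial>N) = (\<integral>\<^sup>+ x. f x \<partial>N)"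
  if [measurable]: "f \<in> borel_measurable borel"
   and s: "sets N = sets borel" and i: "distr N borel (\<lambda>x. x + t) = N" for f N and t :: 'b
 proof -
  have "(\<integral>\<^sup>+ x. f x \<partial>distr N borel (\<lambda>x. x + t)) = (\<integral>\<^sup>+ x. f (x + t) \<partial>N)"
   using s by (subst nn_integral_distr) (auto cong: measurable_cong_sets)
  then show ?thesis unfolding i ..
 qed
 have key: "emeasure M A * emeasure lborel B = emeasure M B * emeasure lborel A"
  if [measurable]: "A \<in> sets borel" "B \<in> sets borel" for A B :: "'b set"
 proof -
  have "emeasure M A * emeasure lborel B
    = (\<integral>\<^sup>+ x. indicator A x * (\<integral>\<^sup>+ y. indicator B y \<partial>lborel) \<partial>M)"
   by (simp add: nn_integral_multc)
  also have "\<dots> = (\<integral>\<^sup>+ x. \<integral>\<^sup>+ y. indicator A x * indicator B (x + y) \<partial>lborel \<partial>M)"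
  proof (rule nn_integral_cong)
   fix x
   have "(\<integral>\<^sup>+ y. indicator B (x + y) \<partial>lborel) = (\<integral>\<^sup>+ y. indicator B y \<partial>lborel)"
    using tr[of "indicator B" lborel x] plus[of x] by (simp add: add.commute[of x])
   then show "indicator A x * (\<integral>\<^sup>+ y. indicator B y \<partial>lborel)
     = (\<integral>\<^sup>+ y. indicator A x * indicator B (x + y) \<partial>lborel)"
    by (subst nn_integral_cmult) auto
  qed
  also have "\<dots> = (\<integral>\<^sup>+ y. \<integral>\<^sup>+ x. indicator A x * indicator B (x + y) \<partial>M \<partial>lborel)"
   by (subst P.Fubini') auto
  also have "\<dots> = (\<integral>\<^sup>+ y. \<integral>\<^sup>+ x. indicator A (x - y) * indicator B x \<partial>M \<partial>lborel)"
  proof (rule nn_integral_cong)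
   fix y :: 'b
   show "(\<integral>\<^sup>+ x. indicator A x * indicator B (x + y) \<partial>M) = (\<integral>\<^sup>+ x. indicator A (x - y) * indicator B x \<partial>M)"
    using tr[of "\<lambda>x. indicator A (x - y) * indicator B x" M y] invM sM by simp
  qed
  also have "\<dots> = (\<integral>\<^sup>+ x. \<integral>\<^sup>+ y. indicator A (x - y) * indicator B x \<partial>lborel \<partial>M)"
   by (subst P.Fubini') auto
  also have "\<dots> = (\<integral>\<^sup>+ x. indicator B x * (\<integral>\<^sup>+ y. indicator A y \<partial>lborel) \<partial>M)"
  proof (rule nn_integral_cong)
   fix x
   show "(\<integral>\<^sup>+ y. indicator A (x - y) * indicator B x \<partial>lborel) = indicator B x * (\<integral>\<^sup>+ y. indicator A y \<partial>lborel)"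
    using refl[of "indicator A" x] by (subst nn_integral_multc) (auto simp: mult.commute)
  qed
  also have "\<dots> = emeasure M B * emeasure lborel A"
   by (simp add: nn_integral_multc)
  finally show ?thesis .
 qed
 define B where "B = box (0::'b) One"
 have B1: "emeasure lborel B = 1"
  unfolding B_def by (subst emeasure_lborel_box) auto
 have [measurable]: "B \<in> sets borel" by (simp add: B_def)
 define c where "c = measure M B"
 have cM: "emeasure M B = ennreal c"
  using fin[of B] by (simp add: c_def B_def emeasure_eq_ennreal_measure less_top[symmetric])
 have "open (T -` B)" unfolding B_def by (rule open_vimage[OF open_box cT(1)])
 moreover have "T -` B \<noteq> {}"
 proof -
  have "(1/2) *\<^sub>R One \<in> B" by (auto simp: B_def mem_box inner_sum_left_Basis)
  then show ?thesis unfolding vim by auto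
 qed
 ultimately have "emeasure lborel (T -` B) > 0"
  using open_not_negligible negligible_iff_null_sets[of "T -` B"] null_sets_completionI[of "T -` B" lborel]
  by (auto simp: null_sets_def zero_less_iff_neq_zero)
 then have "c > 0" using emT[of B] cM ennreal_neg not_le less_irrefl by (metis \<open>B \<in> sets borel\<close>)
 moreover have "distr lborel borel T = density lborel (\<lambda>_. ennreal c)"
 proof (rule measure_eqI)
  fix A assume "A \<in> sets (distr lborel borel T)"
  then have A: "A \<in> sets borel" by simp
  have "emeasure M A = c * emeasure lborel A"
   using key[OF A, of B] cM B1 by simp
  then show "emeasure (distr lborel borel T) A = emeasure (density lborel (\<lambda>_. ennreal c)) A"
   using A by (simp add: M_def emeasure_density_const)
 qed simp
 ultimately show ?thesis by (rule that)
qed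

lemma integral_distr_lborel_const:
 fixes T :: "'a::euclidean_space \<Rightarrow> 'b::euclidean_space" and f :: "'b \<Rightarrow> 'c::{banach,second_countable_topology}"
 assumes c: "c > 0" "distr lborel borel T = density lborel (\<lambda>_. ennreal c)"
  and T: "T \<in> borel_measurable borel" and f: "f \<in> borel_measurable borel"
 shows "integrable lborel (\<lambda>x. f (T x)) \<longleftrightarrow> integrable lborel f"
  and "(\<integral>x. f (T x) \<partial>lborel) = c *\<^sub>R (\<integral>x. f x \<partial>lborel)"
proof -
 have "integrable lborel (\<lambda>x. f (T x)) \<longleftrightarrow> integrable (distr lborel borel T) f"
  using T f by (simp add: integrable_distr_eq)
 also have "\<dots> \<longleftrightarrow> integrable lborel (\<lambda>x. c *\<^sub>R f x)"
  unfolding c(2) using c(1) f by (subst integrable_density) auto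
 also have "\<dots> \<longleftrightarrow> integrable lborel f"
  using c(1) integrable_scaleR_right[of "inverse c" lborel "\<lambda>x. c *\<^sub>R f x"] integrable_scaleR_right[of c lborel f]
  by auto
 finally show "integrable lborel (\<lambda>x. f (T x)) \<longleftrightarrow> integrable lborel f" .
 have "(\<integral>x. f (T x) \<partial>lborel) = integral\<^sup>L (distr lborel borel T) f"
  using T f by (simp add: integral_distr)
 also have "\<dots> = (\<integral>x. c *\<^sub>R f x \<partial>lborel)"
  unfolding c(2) using c(1) f by (subst integral_density) auto
 finally show "(\<integral>x. f (T x) \<partial>lborel) = c *\<^sub>R (\<integral>x. f x \<partial>lborel)" by simp
qed

section \<open>Conformal change of variables\<close>

text \<open>The Jacobian determinant of a holomorphic map \<open>g\<close> is \<open>\<bar>g'\<bar>\<^sup>2\<close>; the statement is the real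
 change of variables formula, transported from \<open>\<real>\<^sup>2\<close> to \<open>\<complex>\<close>.\<close>

lemma conformal_change_of_variables:
 fixes f g :: "complex \<Rightarrow> complex"
 assumes S: "open S" and g: "g holomorphic_on S" "inj_on g S"
  and f: "(\<lambda>w. indicator (g ` S) w *\<^sub>R f w) \<in> borel_measurable borel"
 shows "set_integrable lborel (g ` S) f \<longleftrightarrow> set_integrable lborel S (\<lambda>w. (cmod (deriv g w))\<^sup>2 * f (g w))"
  and "(LINT w:g ` S|lborel. f w) = (LINT w:S|lborel. (cmod (deriv g w))\<^sup>2 * f (g w))"
proof -
 define T :: "real^2 \<Rightarrow> complex" where "T v = Complex (v $ 1) (v $ 2)" for v
 define T' :: "complex \<Rightarrow> real^2" where "T' z = vector [Re z, Im z]" for z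
 have T'T: "T' (T v) = v" for v by (simp add: T_def T'_def vec_eq_iff forall_2)
 have TT': "T (T' z) = z" for z by (simp add: T_def T'_def)
 have linT: "linear T" by (intro linearI) (simp_all add: T_def complex_eq_iff)
 have linT': "linear T'" by (intro linearI) (simp_all add: T'_def vec_eq_iff forall_2)
 have bijT: "bij T" by (rule bij_betw_byWitness[where f' = T']) (auto simp: T'T TT')
 have bl: "bounded_linear T" "bounded_linear T'"
  using linT linT' by (simp_all add: linear_conv_bounded_linear)
 have [measurable]: "T \<in> borel_measurable borel" "T' \<in> borel_measurable borel"
  by (rule borel_measurable_continuous_onI linear_continuous_on bl)+
 obtain c where c: "c > 0" "distr lborel borel T = density lborel (\<lambda>_. ennreal c)"
  using distr_lborel_linear[OF linT bijT] by blast
 define h where "h v = T' (f (T v))" for v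
 define k where "k v = T' (g (T v))" for v
 define R where "R = T -` S"
 have kR: "k ` R = T -` (g ` S)"
 proof
  show "k ` R \<subseteq> T -` (g ` S)" by (auto simp: k_def R_def TT')
  show "T -` (g ` S) \<subseteq> k ` R"
  proof
   fix v assume "v \<in> T -` (g ` S)"
   then obtain w where "w \<in> S" "T v = g w" by auto
   then have "T' w \<in> R" "v = k (T' w)" by (simp_all add: R_def k_def TT') (metis T'T)
   then show "v \<in> k ` R" by blast
  qed
 qed
 define k' where "k' v = (\<lambda>u. T' (deriv g (T v) * T u))" for v
 have oR: "open R" unfolding R_def by (rule open_vimage[OF S linear_continuous_on[OF bl(1)]])
 have derk: "(k has_derivative k' v) (at v within R)" if "v \<in> R" for v
 proof -
  have "(g has_field_derivative deriv g (T v)) (at (T v))"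
   using that S g(1) by (auto simp: R_def intro: holomorphic_derivI)
  then have "((\<lambda>v. g (T v)) has_derivative (\<lambda>u. deriv g (T v) * T u)) (at v within R)"
   unfolding has_field_derivative_def
   by (rule has_derivative_compose[OF bounded_linear.has_derivative[OF bl(1) has_derivative_ident]])
  then show ?thesis unfolding k_def k'_def
   by (rule bounded_linear.has_derivative[OF bl(2)])
 qed
 have injk: "inj_on k R"
  using g(2) T'T TT' unfolding inj_on_def k_def R_def by (metis vimageE)
 have det: "\<bar>det (matrix (k' v))\<bar> = (cmod (deriv g (T v)))\<^sup>2" for v
  unfolding cmod_power2 by (simp add: det_2 matrix_def k'_def T_def T'_def axis_def power2_eq_square)
 have ogS: "open (g ` S)" using open_mapping_thm3[OF g(1) S g(2)] .
 define F where "F w = indicator (g ` S) w *\<^sub>R f w" for w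
 have [measurable]: "F \<in> borel_measurable borel" using f unfolding F_def .
 define H where "H w = indicator S w *\<^sub>R ((cmod (deriv g w))\<^sup>2 * f (g w))" for w
 have Hm[measurable]: "H \<in> borel_measurable borel"
 proof -
  have [measurable]: "(\<lambda>w. if w \<in> S then g w else 0) \<in> borel_measurable borel"
   "(\<lambda>w. if w \<in> S then deriv g w else 0) \<in> borel_measurable borel"
   using S g(1) by (auto intro!: borel_measurable_continuous_on_if holomorphic_on_imp_continuous_on
     holomorphic_deriv)
  have "H = (\<lambda>w. indicator S w *\<^sub>R ((cmod (if w \<in> S then deriv g w else 0))\<^sup>2 * F (if w \<in> S then g w else 0)))"
   by (auto simp: H_def F_def fun_eq_iff indicator_def)
  then show ?thesis using S by simp
 qed
 have TF: "integrable lborel (\<lambda>v. T' (F (T v))) \<longleftrightarrow> integrable lborel F"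
  "(\<integral>v. T' (F (T v)) \<partial>lborel) = c *\<^sub>R T' (\<integral>w. F w \<partial>lborel)"
  if [measurable]: "F \<in> borel_measurable borel" for F
 proof -
  have iff: "integrable lborel (\<lambda>w. T' (F w)) \<longleftrightarrow> integrable lborel F"
   using integrable_bounded_linear[OF bl(2), of lborel F]
    integrable_bounded_linear[OF bl(1), of lborel "\<lambda>w. T' (F w)"] by (auto simp: TT')
  then show "integrable lborel (\<lambda>v. T' (F (T v))) \<longleftrightarrow> integrable lborel F"
   using integral_distr_lborel_const(1)[OF c, of "\<lambda>w. T' (F w)"] by simp
  have "T' (\<integral>w. F w \<partial>lborel) = (\<integral>w. T' (F w) \<partial>lborel)"
  proof (cases "integrable lborel F")
   case True then show ?thesis by (rule integral_bounded_linear[OF bl(2), symmetric])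
  next
   case False
   then show ?thesis using iff linear_0[OF linT'] by (simp add: not_integrable_integral_eq)
  qed
  then show "(\<integral>v. T' (F (T v)) \<partial>lborel) = c *\<^sub>R T' (\<integral>w. F w \<partial>lborel)"
   using integral_distr_lborel_const(2)[OF c, of "\<lambda>w. T' (F w)"] by simp
 qed
 have leb: "set_integrable lebesgue A u \<longleftrightarrow> integrable lborel (\<lambda>v. indicator A v *\<^sub>R u v)"
  "(LINT v:A|lebesgue. u v) = (\<integral>v. indicator A v *\<^sub>R u v \<partial>lborel)"
  if "(\<lambda>v. indicator A v *\<^sub>R u v) \<in> borel_measurable lborel" for A and u :: "real^2 \<Rightarrow> real^2"
  using that unfolding set_integrable_def set_lebesgue_integral_def
  by (auto simp: integrable_completion integral_completion)
 have e1: "(\<lambda>v. indicator (k ` R) v *\<^sub>R h v) = (\<lambda>v. T' (F (T v)))"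
  unfolding kR by (auto simp: fun_eq_iff h_def F_def indicator_def linear_0[OF linT'])
 have e2: "(\<lambda>v. indicator R v *\<^sub>R (\<bar>det (matrix (k' v))\<bar> *\<^sub>R h (k v))) = (\<lambda>v. T' (H (T v)))"
 proof
  fix v
  show "indicator R v *\<^sub>R (\<bar>det (matrix (k' v))\<bar> *\<^sub>R h (k v)) = T' (H (T v))"
   unfolding det h_def k_def H_def R_def TT'
   by (cases "T v \<in> S")
    (simp_all only: linear_0[OF linT'] linear_scale[OF linT'] indicator_simps scaleR_one scaleR_zero_left
     scaleR_conv_of_real[where 'a = complex, symmetric] vimage_eq not_False_eq_True)
 qed
 have m1: "(\<lambda>v. indicator (k ` R) v *\<^sub>R h v) \<in> borel_measurable lborel" unfolding e1 by simp
 have m2: "(\<lambda>v. indicator R v *\<^sub>R (\<bar>det (matrix (k' v))\<bar> *\<^sub>R h (k v))) \<in> borel_measurable lborel"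
  unfolding e2 by simp
 note CV = has_absolute_integral_change_of_variables[OF _ derk injk, of h]
 have Rl: "R \<in> sets lebesgue" using oR by simp
 have "set_integrable lebesgue (k ` R) h \<longleftrightarrow>
   set_integrable lebesgue R (\<lambda>v. \<bar>det (matrix (k' v))\<bar> *\<^sub>R h (k v))"
  using CV[OF Rl, of "integral R (\<lambda>v. \<bar>det (matrix (k' v))\<bar> *\<^sub>R h (k v))"] CV[OF Rl, of "integral (k ` R) h"]
  by blast
 then have iff: "integrable lborel F \<longleftrightarrow> integrable lborel H"
  unfolding leb(1)[OF m1] leb(1)[OF m2] e1 e2 by (simp add: TF)
 then show "set_integrable lborel (g ` S) f \<longleftrightarrow> set_integrable lborel S (\<lambda>w. (cmod (deriv g w))\<^sup>2 * f (g w))"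
  by (simp add: set_integrable_def F_def[abs_def] H_def[abs_def])
 have "integral\<^sup>L lborel F = integral\<^sup>L lborel H"
 proof (cases "integrable lborel F")
  case True
  then have i1: "set_integrable lebesgue (k ` R) h"
   unfolding leb(1)[OF m1] e1 by (simp add: TF)
  then have i2: "set_integrable lebesgue R (\<lambda>v. \<bar>det (matrix (k' v))\<bar> *\<^sub>R h (k v))"
   and eq: "integral R (\<lambda>v. \<bar>det (matrix (k' v))\<bar> *\<^sub>R h (k v)) = integral (k ` R) h"
   using CV[OF Rl, of "integral (k ` R) h"] by auto
  have "(LINT v:R|lebesgue. \<bar>det (matrix (k' v))\<bar> *\<^sub>R h (k v)) = (LINT v:k ` R|lebesgue. h v)"
   using eq set_lebesgue_integral_eq_integral(2)[OF i1] set_lebesgue_integral_eq_integral(2)[OF i2] by simp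
  then have "c *\<^sub>R T' (integral\<^sup>L lborel H) = c *\<^sub>R T' (integral\<^sup>L lborel F)"
   unfolding leb(2)[OF m1] leb(2)[OF m2] e1 e2 by (simp add: TF)
  then show ?thesis using c(1) TT' by (metis real_vector.scale_cancel_left less_irrefl)
 next
  case False
  then show ?thesis using iff by (simp add: not_integrable_integral_eq)
 qed
 then show "(LINT w:g ` S|lborel. f w) = (LINT w:S|lborel. (cmod (deriv g w))\<^sup>2 * f (g w))"
  by (simp add: set_lebesgue_integral_def F_def[abs_def] H_def[abs_def])
qed

section \<open>Holomorphic dependence on parameters\<close>

lemma holomorphic_Cn_on_const [intro]: "holomorphic_Cn_on (\<lambda>_. c) S"
 unfolding holomorphic_Cn_on_def by (auto intro!: exI[of _ "\<lambda>_. 0"])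

lemma holomorphic_Cn_on_add [intro]:
 "holomorphic_Cn_on f S ==> holomorphic_Cn_on g S ==> holomorphic_Cn_on (\<lambda>z. f z + g z) S"
 unfolding holomorphic_Cn_on_def
proof safe
 fix z assume "\<forall>z\<in>S. \<exists>D. (f has_derivative D) (at z) \<and> (\<forall>c v. D (c *s v) = c * D v)"
  "\<forall>z\<in>S. \<exists>D. (g has_derivative D) (at z) \<and> (\<forall>c v. D (c *s v) = c * D v)" "z \<in> S"
 then obtain D E where "(f has_derivative D) (at z)" "\<forall>c v. D (c *s v) = c * D v"
   "(g has_derivative E) (at z)" "\<forall>c v. E (c *s v) = c * E v" by blast
 then show "\<exists>D. ((\<lambda>z. f z + g z) has_derivative D) (at z) \<and> (\<forall>c v. D (c *s v) = c * D v)"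
  by (intro exI[of _ "\<lambda>v. D v + E v"]) (auto intro: has_derivative_add simp: algebra_simps)
qed

lemma holomorphic_Cn_on_mult [intro]:
 "holomorphic_Cn_on f S ==> holomorphic_Cn_on g S ==> holomorphic_Cn_on (\<lambda>z. f z * g z) S"
 unfolding holomorphic_Cn_on_def
proof safe
 fix z assume "\<forall>z\<in>S. \<exists>D. (f has_derivative D) (at z) \<and> (\<forall>c v. D (c *s v) = c * D v)"
  "\<forall>z\<in>S. \<exists>D. (g has_derivative D) (at z) \<and> (\<forall>c v. D (c *s v) = c * D v)" "z \<in> S"
 then obtain D E where "(f has_derivative D) (at z)" "\<forall>c v. D (c *s v) = c * D v"
   "(g has_derivative E) (at z)" "\<forall>c v. E (c *s v) = c * E v" by blast
 then show "\<exists>D. ((\<lambda>z. f z * g z) has_derivative D) (at z) \<and> (\<forall>c v. D (c *s v) = c * D v)"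
  by (intro exI[of _ "\<lambda>v. f z * E v + D v * g z"] conjI has_derivative_mult) (auto simp: distrib_left mult_ac)
qed

lemma holomorphic_Cn_on_power [intro]:
 "holomorphic_Cn_on f S ==> holomorphic_Cn_on (\<lambda>z. f z ^ k) S"
 by (induction k) auto

lemma holomorphic_Cn_on_subset: "holomorphic_Cn_on f S ==> R \<subseteq> S ==> holomorphic_Cn_on f R"
 by (auto simp: holomorphic_Cn_on_def)

lemma holomorphic_Cn_on_cong:
 fixes S :: "(complex ^ 'n) set"
 assumes "open S" "\<And>z. z \<in> S ==> f z = g z"
 shows "holomorphic_Cn_on f S \<longleftrightarrow> holomorphic_Cn_on g S"
proof -
 have "holomorphic_Cn_on g S" if f: "holomorphic_Cn_on f S" and fg: "\<And>z. z \<in> S ==> f z = g z" for f g :: "complex^'n \<Rightarrow> complex"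
  unfolding holomorphic_Cn_on_def
 proof
  fix z assume z: "z \<in> S"
  then obtain D where "(f has_derivative D) (at z)" "\<forall>c v. D (c *s v) = c * D v"
   using f unfolding holomorphic_Cn_on_def by meson
  then show "\<exists>D. (g has_derivative D) (at z) \<and> (\<forall>c v. D (c *s v) = c * D v)"
   using has_derivative_transform_within_open[OF _ assms(1) z, of f D UNIV g] fg by auto
 qed
 then show ?thesis using assms by metis
qed

lemma holomorphic_Cn_on_compose:
 assumes "\<psi> holomorphic_on V" "open V" "holomorphic_Cn_on f S" "\<And>z. z \<in> S ==> f z \<in> V"
 shows "holomorphic_Cn_on (\<lambda>z. \<psi> (f z)) S"
 unfolding holomorphic_Cn_on_def
proof
 fix z assume z: "z \<in> S"
 then obtain D where D: "(f has_derivative D) (at z)" "\<forall>c v. D (c *s v) = c * D v"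
  using assms(3) by (auto simp: holomorphic_Cn_on_def)
 have "(\<psi> has_derivative (*) (deriv \<psi> (f z))) (at (f z))"
  using assms z holomorphic_derivI unfolding has_field_derivative_def by blast
 from has_derivative_compose[OF D(1) this]
 show "\<exists>D. ((\<lambda>z. \<psi> (f z)) has_derivative D) (at z) \<and> (\<forall>c v. D (c *s v) = c * D v)"
  using D(2) by (intro exI[of _ "\<lambda>v. deriv \<psi> (f z) * D v"]) (auto simp: o_def)
qed

lemma holomorphic_Cn_on_nth [intro]: "holomorphic_Cn_on (\<lambda>z. z $ i) S"
 unfolding holomorphic_Cn_on_def
 by (auto intro!: exI[of _ "\<lambda>v. v $ i"] bounded_linear_imp_has_derivative bounded_linear_vec_nth)

lemma holomorphic_Cn_on_line:
 assumes h: "holomorphic_Cn_on h U" and W: "\<And>t. t \<in> W ==> z + t *s v \<in> U"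
 shows "(\<lambda>t. h (z + t *s v)) holomorphic_on W"
 unfolding holomorphic_on_def
proof
 fix t assume "t \<in> W"
 then obtain D where D: "(h has_derivative D) (at (z + t *s v))" "\<forall>c v. D (c *s v) = c * D v"
  using h W unfolding holomorphic_Cn_on_def by meson
 have bl: "bounded_linear (\<lambda>t. t *s v)"
  by (simp add: linear_conv_bounded_linear[symmetric] linear_iff vec_eq_iff algebra_simps)
 have "((\<lambda>t. z + t *s v) has_derivative (\<lambda>s. s *s v)) (at t)"
  by (auto intro!: derivative_eq_intros bounded_linear_imp_has_derivative bl)
 from has_derivative_compose[OF this D(1)]
 have "((\<lambda>t. h (z + t *s v)) has_field_derivative D v) (at t)"
  using D(2) unfolding has_field_derivative_def by (simp add: mult_commute_abs)
 then show "(\<lambda>t. h (z + t *s v)) field_differentiable at t within W"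
  using field_differentiable_at_within field_differentiable_def by blast
qed

text \<open>Quantitative differentiability: on a complex line the second derivative is controlled by
 Cauchy's inequality. This is what allows to differentiate under an integral sign when only the
 functions themselves are dominated.\<close>

lemma holomorphic_Cn_on_second_order:
 assumes h: "holomorphic_Cn_on h (ball z r)" and b: "\<And>w. w \<in> ball z r ==> cmod (h w) \<le> b"
  and D: "(h has_derivative D) (at z)" "\<forall>c v. D (c *s v) = c * D v"
  and v: "norm v \<le> r / 4" and r: "r > 0"
 shows "cmod (h (z + v) - h z - D v) \<le> 32 * b / r\<^sup>2 * (norm v)\<^sup>2"
  and "cmod (D v) \<le> 4 * b / r * norm v"
proof -
 have "b \<ge> 0" using b[of z] r by (meson centre_in_ball norm_ge_zero order_trans)
 have "cmod (h (z + v) - h z - D v) \<le> 32 * b / r\<^sup>2 * (norm v)\<^sup>2 \<and> cmod (D v) \<le> 4 * b / r * norm v"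
 proof (cases "v = 0")
  case True
  then show ?thesis using linear_0[OF has_derivative_linear[OF D(1)]] by simp
 next
  case False
  define \<rho> where "\<rho> = r / norm v"
  have \<rho>: "\<rho> \<ge> 4" using v False r by (simp add: \<rho>_def field_simps)
  define \<phi> where "\<phi> t = h (z + t *s v)" for t
  have nsv: "norm (t *s v) = cmod t * norm v" for t
   unfolding norm_vec_def by (simp add: norm_mult L2_set_right_distrib)
  have inb: "z + t *s v \<in> ball z r" if "cmod t < \<rho>" for t
   using that False by (simp add: dist_norm nsv \<rho>_def field_simps)
  have hol: "\<phi> holomorphic_on ball 0 \<rho>"
   unfolding \<phi>_def by (rule holomorphic_Cn_on_line[OF h]) (use inb in auto)
  have bnd: "cmod (\<phi> t) \<le> b" if "cmod t < \<rho>" for t using b inb that by (simp add: \<phi>_def)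
  have d1: "deriv \<phi> 0 = D v"
  proof -
   have bl: "bounded_linear (\<lambda>t. t *s v)"
    by (simp add: linear_conv_bounded_linear[symmetric] linear_iff vec_eq_iff algebra_simps)
   have "((\<lambda>t. z + t *s v) has_derivative (\<lambda>s. s *s v)) (at 0)"
    by (auto intro!: derivative_eq_intros bounded_linear_imp_has_derivative bl)
   from has_derivative_compose[OF this, of h D] D
   have "(\<phi> has_derivative (\<lambda>s. s * D v)) (at 0)" by (simp add: \<phi>_def[abs_def])
   then have "(\<phi> has_field_derivative D v) (at 0)"
    unfolding has_field_derivative_def by (simp add: mult_commute_abs)
   then show ?thesis by (rule DERIV_imp_deriv)
  qed
  have cauchy: "cmod ((deriv ^^ n) \<phi> t) \<le> fact n * b / (\<rho>/4) ^ n" if "cmod t \<le> \<rho>/4" for t n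
  proof (rule Cauchy_inequality)
   have *: "cball t (\<rho>/4) \<subseteq> ball 0 \<rho>"
   proof
    fix x assume "x \<in> cball t (\<rho>/4)"
    then show "x \<in> ball 0 \<rho>" using norm_triangle_ineq[of t "x - t"] that \<rho>
     by (simp add: dist_norm norm_minus_commute)
   qed
   show "\<phi> holomorphic_on ball t (\<rho>/4)" using hol * by (meson ball_subset_cball holomorphic_on_subset)
   show "continuous_on (cball t (\<rho>/4)) \<phi>" using hol * by (meson holomorphic_on_imp_continuous_on holomorphic_on_subset)
   show "0 < \<rho>/4" using \<rho> by simp
   show "cmod (\<phi> x) \<le> b" if "cmod (t - x) = \<rho>/4" for x
   proof -
    have "x \<in> ball 0 \<rho>" using * that by (auto simp: dist_norm)
    then show ?thesis using bnd by simp
   qed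
  qed
  have "cmod ((deriv ^^ 0) \<phi> 1 - (\<Sum>i\<le>1. (deriv ^^ i) \<phi> 0 * (1 - 0) ^ i / fact i))
    \<le> (2 * b / (\<rho>/4)\<^sup>2) * cmod (1 - 0) ^ Suc 1 / fact 1"
  proof (rule complex_Taylor[where S = "cball 0 1"])
   fix i :: nat and x :: complex assume x: "x \<in> cball 0 1"
   then have "x \<in> ball 0 \<rho>" using \<rho> by auto
   then show "((deriv ^^ i) \<phi> has_field_derivative (deriv ^^ Suc i) \<phi> x) (at x within cball 0 1)"
    using holomorphic_higher_deriv[OF hol open_ball, of i]
    by (auto intro: has_field_derivative_at_within holomorphic_derivI)
   show "cmod ((deriv ^^ Suc 1) \<phi> x) \<le> 2 * b / (\<rho>/4)\<^sup>2"
    using cauchy[of x 2] x \<rho> by (simp add: numeral_2_eq_2)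
  qed auto
  then have "cmod (\<phi> 1 - \<phi> 0 - D v) \<le> 2 * b / (\<rho>/4)\<^sup>2" by (simp add: d1 algebra_simps)
  moreover have "2 * b / (\<rho>/4)\<^sup>2 = 32 * b / r\<^sup>2 * (norm v)\<^sup>2"
   using False r by (simp add: \<rho>_def power2_eq_square field_simps)
  moreover have "cmod (D v) \<le> b / (\<rho>/4)" using cauchy[of 0 1] \<rho> d1 by simp
  moreover have "b / (\<rho>/4) = 4 * b / r * norm v" using False r by (simp add: \<rho>_def)
  ultimately show ?thesis by (simp add: \<phi>_def)
 qed
 then show "cmod (h (z + v) - h z - D v) \<le> 32 * b / r\<^sup>2 * (norm v)\<^sup>2"
  "cmod (D v) \<le> 4 * b / r * norm v" by auto
qed

no_notation fps_nth (infixl "$" 75)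

lemma norm_integral_le:
 fixes f :: "'w \<Rightarrow> 'b::{banach,second_countable_topology}"
 assumes "integrable M f" "integrable M g" "\<And>x. x \<in> space M ==> norm (f x) \<le> g x"
 shows "norm (\<integral>x. f x \<partial>M) \<le> (\<integral>x. g x \<partial>M)"
 using integral_mono[OF integrable_norm[OF assms(1)] assms(2,3)]
 by (rule order_trans[OF integral_norm_bound])

text \<open>The derivative of the integral is the integral of the derivatives: by the quadratic estimate
 \<open>holomorphic_Cn_on_second_order\<close> the local majorant of the integrand also controls the error of
 the linear approximation.\<close>

lemma holomorphic_Cn_on_integral:
 fixes f :: "complex ^ 'n \<Rightarrow> 'w \<Rightarrow> complex"
 assumes U: "open U"
  and meas: "\<And>z. z \<in> U ==> f z \<in> borel_measurable M"
  and hol: "\<And>\<omega>. \<omega> \<in> space M ==> holomorphic_Cn_on (\<lambda>z. f z \<omega>) U"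
  and dom: "\<And>z. z \<in> U ==> \<exists>r>0. \<exists>B. integrable M B \<and> (\<forall>w\<in>ball z r \<inter> U. \<forall>\<omega>\<in>space M. cmod (f w \<omega>) \<le> B \<omega>)"
 shows "holomorphic_Cn_on (\<lambda>z. \<integral>\<omega>. f z \<omega> \<partial>M) U"
 unfolding holomorphic_Cn_on_def
proof
 fix z assume z: "z \<in> U"
 obtain r1 B where r1: "r1 > 0" and B: "integrable M B"
   "\<And>w \<omega>. w \<in> ball z r1 ==> w \<in> U ==> \<omega> \<in> space M ==> cmod (f w \<omega>) \<le> B \<omega>"
  using dom[OF z] by blast
 obtain r0 where r0: "r0 > 0" "ball z r0 \<subseteq> U" using U z openE by blast
 define r where "r = min r0 r1"
 have r: "r > 0" "ball z r \<subseteq> U" using r0 r1 by (auto simp: r_def)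
 have bnd: "cmod (f w \<omega>) \<le> B \<omega>" if "w \<in> ball z r" "\<omega> \<in> space M" for w \<omega>
  using that r(2) B(2)[of w \<omega>] by (auto simp: r_def)
 have int: "integrable M (f w)" if "w \<in> ball z r" for w
 proof (rule Bochner_Integration.integrable_bound[OF B(1)])
  show "f w \<in> borel_measurable M" using that r(2) meas by auto
  show "AE \<omega> in M. norm (f w \<omega>) \<le> norm (B \<omega>)"
   using bnd[OF that] by (intro AE_I2) (metis abs_ge_self order_trans real_norm_def)
 qed
 have "\<forall>\<omega>\<in>space M. \<exists>D. ((\<lambda>z. f z \<omega>) has_derivative D) (at z) \<and> (\<forall>c v. D (c *s v) = c * D v)"
  using hol z by (auto simp: holomorphic_Cn_on_def)
 then obtain D where D: "\<And>\<omega>. \<omega> \<in> space M ==> ((\<lambda>z. f z \<omega>) has_derivative D \<omega>) (at z)"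
   "\<And>\<omega>. \<omega> \<in> space M ==> \<forall>c v. D \<omega> (c *s v) = c * D \<omega> v"
  by metis
 have est: "cmod (f (z + v) \<omega> - f z \<omega> - D \<omega> v) \<le> 32 * B \<omega> / r\<^sup>2 * (norm v)\<^sup>2"
  and est': "cmod (D \<omega> v) \<le> 4 * B \<omega> / r * norm v"
  if "\<omega> \<in> space M" "norm v \<le> r / 4" for v \<omega>
  using holomorphic_Cn_on_second_order[OF holomorphic_Cn_on_subset[OF hol[OF that(1)] r(2)] _ D(1)[OF that(1)] D(2)[OF that(1)] that(2) r(1)]
   bnd that by auto
 note lin = has_derivative_linear[OF D(1)]
 have shrink: "norm ((r / (4 * (norm v + 1))) *\<^sub>R v) \<le> r / 4" "0 < r / (4 * (norm v + 1))" for v :: "complex ^ 'n"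
 proof -
  show "0 < r / (4 * (norm v + 1))" using r(1) by (simp add: add_nonneg_pos)
  have "norm v / (norm v + 1) \<le> 1" by (simp add: divide_le_eq add_nonneg_pos)
  then have "r / 4 * (norm v / (norm v + 1)) \<le> r / 4 * 1" using r(1) by (intro mult_left_mono) auto
  then show "norm ((r / (4 * (norm v + 1))) *\<^sub>R v) \<le> r / 4" using r(1) by (simp add: abs_of_nonneg add_nonneg_nonneg)
 qed
 have Dbound: "cmod (D \<omega> v) \<le> 4 * B \<omega> / r * norm v" if w: "\<omega> \<in> space M" for v \<omega>
 proof -
  define s where "s = r / (4 * (norm v + 1))"
  have s: "s > 0" "norm (s *\<^sub>R v) \<le> r / 4" using shrink[of v] by (auto simp: s_def)
  have "s * cmod (D \<omega> v) \<le> s * (4 * B \<omega> / r * norm v)"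
   using est'[OF w s(2)] s(1) by (simp add: linear_scale[OF lin[OF w]] mult_ac)
  then show ?thesis using s(1) by (rule mult_left_le_imp_le)
 qed
 have Dmeas: "(\<lambda>\<omega>. D \<omega> v) \<in> borel_measurable M" for v
 proof (rule borel_measurable_LIMSEQ_metric)
  define s where "s n = r / (4 * (norm v + 1)) / real (Suc n)" for n
  have s: "s n > 0" "norm (s n *\<^sub>R v) \<le> r / 4" for n
  proof -
   show "s n > 0" unfolding s_def using shrink(2)[of v] by (rule divide_pos_pos) simp
   have "norm (s n *\<^sub>R v) = norm ((r / (4 * (norm v + 1))) *\<^sub>R v) / real (Suc n)"
    by (simp add: s_def)
   also have "\<dots> \<le> norm ((r / (4 * (norm v + 1))) *\<^sub>R v) / 1"
    by (intro divide_left_mono) auto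
   finally show "norm (s n *\<^sub>R v) \<le> r / 4" using shrink(1)[of v] by linarith
  qed
  have inb: "z + s n *\<^sub>R v \<in> ball z r" for n
   using s(2)[of n] r(1) by (simp add: dist_norm)
  show "(\<lambda>\<omega>. (f (z + s n *\<^sub>R v) \<omega> - f z \<omega>) / of_real (s n)) \<in> borel_measurable M" for n
  proof -
   have "z + s n *\<^sub>R v \<in> U" using inb[of n] r(2) by blast
   then have m: "f (z + s n *\<^sub>R v) \<in> borel_measurable M" "f z \<in> borel_measurable M"
    using meas z by blast+
   show ?thesis by (rule borel_measurable_divide[OF borel_measurable_diff[OF m] borel_measurable_const])
  qed
  fix \<omega> assume w: "\<omega> \<in> space M"
  have lim: "(\<lambda>n. 32 * B \<omega> / r\<^sup>2 * (norm v)\<^sup>2 * (r / (4 * (norm v + 1))) / real (Suc n)) \<longlonglongrightarrow> 0"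
   unfolding divide_inverse[of _ "real (Suc _)"] by (rule tendsto_mult_right_zero[OF LIMSEQ_inverse_real_of_nat])
  have le: "cmod ((f (z + s n *\<^sub>R v) \<omega> - f z \<omega>) / of_real (s n) - D \<omega> v)
    \<le> 32 * B \<omega> / r\<^sup>2 * (norm v)\<^sup>2 * (r / (4 * (norm v + 1))) / real (Suc n)" for n
  proof -
   have sn: "complex_of_real (s n) \<noteq> 0" using s(1)[of n] by simp
   have "(f (z + s n *\<^sub>R v) \<omega> - f z \<omega>) / of_real (s n) - D \<omega> v
     = (f (z + s n *\<^sub>R v) \<omega> - f z \<omega> - D \<omega> (s n *\<^sub>R v)) / of_real (s n)"
    using sn by (simp add: linear_scale[OF lin[OF w]] scaleR_conv_of_real[where 'a = complex] diff_divide_distrib)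
   then have "cmod ((f (z + s n *\<^sub>R v) \<omega> - f z \<omega>) / of_real (s n) - D \<omega> v)
     = cmod (f (z + s n *\<^sub>R v) \<omega> - f z \<omega> - D \<omega> (s n *\<^sub>R v)) / s n"
    using s(1)[of n] by (simp add: norm_divide)
   also have "\<dots> \<le> 32 * B \<omega> / r\<^sup>2 * (norm (s n *\<^sub>R v))\<^sup>2 / s n"
    using est[OF w s(2)[of n]] s(1)[of n] by (intro divide_right_mono) auto
   also have "\<dots> = 32 * B \<omega> / r\<^sup>2 * (norm v)\<^sup>2 * s n"
    using s(1)[of n] by (simp add: power_mult_distrib power2_eq_square)
   finally show ?thesis by (simp add: s_def)
  qed
  show "(\<lambda>n. (f (z + s n *\<^sub>R v) \<omega> - f z \<omega>) / of_real (s n)) \<longlonglongrightarrow> D \<omega> v"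
   using Lim_null_comparison[OF always_eventually[OF allI[OF le]] lim] by (simp add: LIM_zero_iff)
 qed
 have Dint: "integrable M (\<lambda>\<omega>. D \<omega> v)" for v
 proof (rule Bochner_Integration.integrable_bound)
  show "integrable M (\<lambda>\<omega>. 4 * B \<omega> / r * norm v)" using B(1) by auto
  show "AE \<omega> in M. norm (D \<omega> v) \<le> norm (4 * B \<omega> / r * norm v)"
   using Dbound by (intro AE_I2) (metis abs_ge_self order_trans real_norm_def)
 qed (rule Dmeas)
 define E where "E v = (\<integral>\<omega>. D \<omega> v \<partial>M)" for v
 define C where "C = (\<integral>\<omega>. 32 * B \<omega> / r\<^sup>2 \<partial>M)"
 have Ebl: "bounded_linear E"
 proof (rule bounded_linear_intro)
  show "E (u + v) = E u + E v" for u v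
  proof -
   have "E (u + v) = (\<integral>\<omega>. D \<omega> u + D \<omega> v \<partial>M)"
    unfolding E_def by (intro Bochner_Integration.integral_cong) (auto simp: linear_add[OF lin])
   then show ?thesis using Dint by (simp add: E_def)
  qed
  show "E (c *\<^sub>R v) = c *\<^sub>R E v" for c v
  proof -
   have "E (c *\<^sub>R v) = (\<integral>\<omega>. c *\<^sub>R D \<omega> v \<partial>M)"
    unfolding E_def by (intro Bochner_Integration.integral_cong) (auto simp: linear_scale[OF lin])
   then show ?thesis by (simp add: E_def)
  qed
  show "norm (E v) \<le> norm v * (\<integral>\<omega>. 4 * B \<omega> / r \<partial>M)" for v
  proof -
   have "norm (E v) \<le> (\<integral>\<omega>. 4 * B \<omega> / r * norm v \<partial>M)"
    unfolding E_def by (rule norm_integral_le[OF Dint]) (use B(1) Dbound in auto)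
   also have "\<dots> = norm v * (\<integral>\<omega>. 4 * B \<omega> / r \<partial>M)" by (simp add: mult.commute)
   finally show ?thesis .
  qed
 qed
 have Ec: "E (c *s v) = c * E v" for c v
 proof -
  have "E (c *s v) = (\<integral>\<omega>. c * D \<omega> v \<partial>M)"
   unfolding E_def using D(2) by (intro Bochner_Integration.integral_cong) auto
  then show ?thesis by (simp add: E_def)
 qed
 have main: "cmod ((\<integral>\<omega>. f (z + v) \<omega> \<partial>M) - (\<integral>\<omega>. f z \<omega> \<partial>M) - E v) \<le> C * (norm v)\<^sup>2"
  if v: "norm v \<le> r / 4" for v
 proof -
  have ib: "z + v \<in> ball z r" "z \<in> ball z r" using v r(1) by (auto simp: dist_norm)
  have "(\<integral>\<omega>. f (z + v) \<omega> \<partial>M) - (\<integral>\<omega>. f z \<omega> \<partial>M) - E v = (\<integral>\<omega>. f (z + v) \<omega> - f z \<omega> - D \<omega> v \<partial>M)"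
   using int[OF ib(1)] int[OF ib(2)] Dint[of v] by (simp add: E_def)
  also have "cmod \<dots> \<le> (\<integral>\<omega>. 32 * B \<omega> / r\<^sup>2 * (norm v)\<^sup>2 \<partial>M)"
   by (rule norm_integral_le)
    (use int[OF ib(1)] int[OF ib(2)] Dint[of v] B(1) est[OF _ v] in auto)
  also have "\<dots> = C * (norm v)\<^sup>2" by (simp add: C_def)
  finally show ?thesis .
 qed
 have C0: "C \<ge> 0"
  unfolding C_def
 proof (intro integral_nonneg_AE AE_I2)
  fix \<omega> assume "\<omega> \<in> space M"
  then have "0 \<le> B \<omega>" using bnd[of z \<omega>] r(1) by (meson centre_in_ball norm_ge_zero order_trans)
  then show "0 \<le> 32 * B \<omega> / r\<^sup>2" by simp
 qed
 have "((\<lambda>z. \<integral>\<omega>. f z \<omega> \<partial>M) has_derivative E) (at z)"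
  unfolding has_derivative_at_alt
 proof (intro conjI allI impI Ebl)
  fix e :: real assume e: "e > 0"
  define d where "d = min (r / 4) (e / (C + 1))"
  have d: "d > 0" using r(1) e C0 by (simp add: d_def)
  have "cmod ((\<integral>\<omega>. f y \<omega> \<partial>M) - (\<integral>\<omega>. f z \<omega> \<partial>M) - E (y - z)) \<le> e * norm (y - z)"
   if y: "norm (y - z) < d" for y
  proof -
   have "cmod ((\<integral>\<omega>. f y \<omega> \<partial>M) - (\<integral>\<omega>. f z \<omega> \<partial>M) - E (y - z)) \<le> C * (norm (y - z))\<^sup>2"
    using main[of "y - z"] y by (simp add: d_def)
   also have "\<dots> = (C * norm (y - z)) * norm (y - z)" by (simp add: power2_eq_square)
   also have "C * norm (y - z) \<le> (C + 1) * (e / (C + 1))"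
    using y C0 by (intro mult_mono) (auto simp: d_def)
   also have "\<dots> = e" using C0 by simp
   finally show ?thesis by (simp add: mult_right_mono)
  qed
  then show "\<exists>d>0. \<forall>y. norm (y - z) < d \<longrightarrow>
    cmod ((\<integral>\<omega>. f y \<omega> \<partial>M) - (\<integral>\<omega>. f z \<omega> \<partial>M) - E (y - z)) \<le> e * norm (y - z)"
   using d by blast
 qed
 then show "\<exists>D. ((\<lambda>z. \<integral>\<omega>. f z \<omega> \<partial>M) has_derivative D) (at z) \<and> (\<forall>c v. D (c *s v) = c * D v)"
  using Ec by blast
qed

lemma holomorphic_on_integral:
 fixes f :: "complex \<Rightarrow> 'w \<Rightarrow> complex"
 assumes U: "open U"
  and meas: "\<And>z. z \<in> U ==> f z \<in> borel_measurable M"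
  and hol: "\<And>\<omega>. \<omega> \<in> space M ==> (\<lambda>z. f z \<omega>) holomorphic_on U"
  and dom: "\<And>z. z \<in> U ==> \<exists>r>0. \<exists>B. integrable M B \<and> (\<forall>w\<in>ball z r \<inter> U. \<forall>\<omega>\<in>space M. cmod (f w \<omega>) \<le> B \<omega>)"
 shows "(\<lambda>z. \<integral>\<omega>. f z \<omega> \<partial>M) holomorphic_on U"
proof -
 define V where "V = {v :: complex ^ 1. v $ 1 \<in> U}"
 have "V = (\<lambda>v. v $ 1) -` U" by (auto simp: V_def)
 then have V: "open V"
  using open_vimage[OF U linear_continuous_on[OF bounded_linear_vec_nth]] by metis
 have "holomorphic_Cn_on (\<lambda>v. \<integral>\<omega>. f (v $ 1) \<omega> \<partial>M) V"
 proof (rule holomorphic_Cn_on_integral[OF V])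
  show "holomorphic_Cn_on (\<lambda>v. f (v $ 1) \<omega>) V" if "\<omega> \<in> space M" for \<omega>
   by (rule holomorphic_Cn_on_compose[OF hol[OF that] U]) (auto simp: V_def)
  show "\<exists>r>0. \<exists>B. integrable M B \<and> (\<forall>w\<in>ball v r \<inter> V. \<forall>\<omega>\<in>space M. cmod (f (w $ 1) \<omega>) \<le> B \<omega>)"
   if v: "v \<in> V" for v
  proof -
   obtain r B where r: "r > 0" "integrable M B" "\<forall>w\<in>ball (v $ 1) r \<inter> U. \<forall>\<omega>\<in>space M. cmod (f w \<omega>) \<le> B \<omega>"
    using dom[of "v $ 1"] v unfolding V_def by blast
   have "w $ 1 \<in> ball (v $ 1) r \<inter> U" if "w \<in> ball v r \<inter> V" for w
    using that Finite_Cartesian_Product.norm_nth_le[of "v - w" 1] by (auto simp: V_def dist_norm)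
   then show ?thesis using r by blast
  qed
 qed (use meas in \<open>auto simp: V_def\<close>)
 from holomorphic_Cn_on_line[OF this, of U 0 1]
 show ?thesis by (simp add: V_def vec_eq_iff)
qed

section \<open>Shifting a horizontal line of integration\<close>

lemma integrable_exp_abs:
 fixes \<delta> :: real
 assumes "\<delta> > 0"
 shows "integrable lborel (\<lambda>x. exp (- \<delta> * \<bar>x\<bar>))"
proof -
 have "(\<lambda>x. exp (- \<delta> * x)) absolutely_integrable_on {0..}"
  using integrable_on_exp_minus_to_infinity[OF assms, of 0]
  by (intro nonnegative_absolutely_integrable_1) auto
 then have i: "integrable lborel (\<lambda>x. indicator {0..} x * exp (- \<delta> * x))"
  unfolding set_integrable_def by (subst (asm) integrable_completion) auto
 have "integrable lborel (\<lambda>x. indicator {0..} (0 + (-1) * x) * exp (- \<delta> * (0 + (-1) * x)))"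
  by (rule lborel_integrable_real_affine[OF i]) simp
 then have "integrable lborel (\<lambda>x. indicator {0..} x * exp (- \<delta> * x) + indicator {0..} (0 + (-1) * x) * exp (- \<delta> * (0 + (-1) * x)))"
  using i by simp
 then show ?thesis
  by (rule Bochner_Integration.integrable_bound) (auto simp: indicator_def)
qed

lemma integrable_exp_decay:
 fixes F :: "real \<Rightarrow> complex"
 assumes "continuous_on UNIV F" "\<delta> > 0" "\<And>x. \<bar>x\<bar> \<ge> R ==> cmod (F x) \<le> C * exp (- \<delta> * \<bar>x\<bar>)"
 shows "integrable lborel F"
proof -
 have "compact (F ` {-R..R})"
  using assms(1) by (intro compact_continuous_image) (auto intro: continuous_on_subset)
 then obtain K where K: "\<And>x. \<bar>x\<bar> \<le> R ==> cmod (F x) \<le> K"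
  using compact_imp_bounded bounded_iff by (metis (mono_tags) abs_le_iff atLeastAtMost_iff image_eqI minus_le_iff)
 show ?thesis
 proof (rule Bochner_Integration.integrable_bound)
  show "integrable lborel (\<lambda>x. \<bar>K\<bar> * indicator {-R..R} x + \<bar>C\<bar> * exp (- \<delta> * \<bar>x\<bar>))"
   using integrable_exp_abs[OF assms(2)] emeasure_bounded_finite[of "{-R..R}"]
   by (intro Bochner_Integration.integrable_add integrable_mult_right integrable_real_indicator) auto
  show "F \<in> borel_measurable lborel" using assms(1) by (simp add: borel_measurable_continuous_onI)
  show "AE x in lborel. norm (F x) \<le> norm (\<bar>K\<bar> * indicator {-R..R} x + \<bar>C\<bar> * exp (- \<delta> * \<bar>x\<bar>))"
  proof (rule AE_I2)
   fix x :: real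
   show "norm (F x) \<le> norm (\<bar>K\<bar> * indicator {-R..R} x + \<bar>C\<bar> * exp (- \<delta> * \<bar>x\<bar>))"
   proof (cases "\<bar>x\<bar> \<le> R")
    case True
    then show ?thesis using K[OF True] by (auto simp: indicator_def) (smt (verit) exp_ge_zero mult_nonneg_nonneg)
   next
    case False
    then have "norm (F x) \<le> \<bar>C\<bar> * exp (- \<delta> * \<bar>x\<bar>)"
     using assms(3)[of x] by (smt (verit) exp_gt_zero mult_right_mono)
    then show ?thesis by (smt (verit) indicator_pos_le mult_nonneg_nonneg real_norm_def abs_ge_zero)
   qed
  qed
 qed
qed

lemma tendsto_integral_symmetric:
 fixes F :: "real \<Rightarrow> complex"
 assumes "integrable lborel F" "continuous_on UNIV F"
 shows "(\<lambda>n. integral {-real n..real n} F) \<longlonglongrightarrow> (\<integral>x. F x \<partial>lborel)"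
proof -
 have "(\<lambda>n. \<integral>x. indicator {-real n..real n} x *\<^sub>R F x \<partial>lborel) \<longlonglongrightarrow> (\<integral>x. F x \<partial>lborel)"
 proof (rule integral_dominated_convergence[where w = "\<lambda>x. norm (F x)"])
  show "AE x in lborel. (\<lambda>n. indicator {-real n..real n} x *\<^sub>R F x) \<longlonglongrightarrow> F x"
  proof (rule AE_I2)
   fix x :: real
   obtain N :: nat where "\<bar>x\<bar> \<le> real N" using real_arch_simple by blast
   then have "\<forall>n\<ge>N. indicator {-real n..real n} x *\<^sub>R F x = F x" by (auto simp: indicator_def)
   then show "(\<lambda>n. indicator {-real n..real n} x *\<^sub>R F x) \<longlonglongrightarrow> F x"
    by (intro tendsto_eventually) (auto simp: eventually_sequentially)
  qed
 qed (use assms in \<open>auto simp: indicator_def intro!: AE_I2 borel_measurable_scaleR borel_measurable_continuous_onI\<close>)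
 moreover have "(\<integral>x. indicator {-real n..real n} x *\<^sub>R F x \<partial>lborel) = integral {-real n..real n} F" for n
 proof -
  have "set_integrable lborel {-real n..real n} F"
   using assms(1) unfolding set_integrable_def by (intro integrable_mult_indicator) auto
  from set_borel_integral_eq_integral(2)[OF this] show ?thesis by (simp add: set_lebesgue_integral_def)
 qed
 ultimately show ?thesis by simp
qed

lemma contour_integral_horizontal:
 assumes "continuous_on UNIV (\<lambda>x. f (Complex x b))" "n > 0"
 shows "(f has_contour_integral integral {-n..n} (\<lambda>x. f (Complex x b))) (linepath (Complex (-n) b) (Complex n b))"
proof -
 define F where "F x = f (Complex x b)" for x
 have "F integrable_on {-n..n}"
  using assms(1) unfolding F_def[abs_def] by (intro integrable_continuous_interval) (auto intro: continuous_on_subset)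
 then have "(F has_integral integral {-n..n} F) (cbox (-n) n)" by (simp add: integrable_integral)
 from has_integral_affinity'[OF this, of "2 * n" "-n"] assms(2)
 have "((\<lambda>x. F (2 * n * x - n)) has_integral integral {-n..n} F /\<^sub>R (2 * n)) {0..1}" by simp
 from has_integral_mult_left[OF this, of "of_real (2 * n)"]
 have "((\<lambda>x. F (2 * n * x - n) * of_real (2 * n)) has_integral integral {-n..n} F) {0..1}"
  using assms(2) by (simp add: scaleR_conv_of_real field_simps)
 moreover have "linepath (Complex (-n) b) (Complex n b) x = Complex (2 * n * x - n) b" for x
  by (simp add: linepath_def complex_eq_iff algebra_simps)
 moreover have "Complex n b - Complex (-n) b = of_real (2 * n)" by (simp add: complex_eq_iff)
 ultimately show ?thesis unfolding has_contour_integral_linepath F_def by simp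
qed

text \<open>The residue theorem for rectangles whose vertical sides are moved to infinity.\<close>

lemma contour_shift:
 assumes b: "b0 < b1" and \<mu>: "\<mu> > 0" and pts: "finite pts" "\<And>p. p \<in> pts ==> Im p \<noteq> b0 \<and> Im p \<noteq> b1"
  and hol: "f holomorphic_on {z. b0 - \<mu> < Im z \<and> Im z < b1 + \<mu>} - pts"
  and \<delta>: "\<delta> > 0"
  and bnd: "\<And>x y. \<bar>x\<bar> \<ge> R ==> b0 \<le> y ==> y \<le> b1 ==> cmod (f (Complex x y)) \<le> C * exp (- \<delta> * \<bar>x\<bar>)"
 shows "integrable lborel (\<lambda>x. f (Complex x b0))" "integrable lborel (\<lambda>x. f (Complex x b1))"
  and "(\<integral>x. f (Complex x b0) \<partial>lborel) = (\<integral>x. f (Complex x b1) \<partial>lborel)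
    + 2 * pi * \<i> * (\<Sum>p\<in>{p \<in> pts. b0 < Im p \<and> Im p < b1}. residue f p)"
proof -
 define S where "S = {z. b0 - \<mu> < Im z \<and> Im z < b1 + \<mu>}"
 have S: "open S" "convex S"
 proof -
  have eq: "S = {z. b0 - \<mu> < Im z} \<inter> {z. Im z < b1 + \<mu>}" by (auto simp: S_def)
  show "open S" unfolding eq by (intro open_Int open_halfspace_Im_gt open_halfspace_Im_lt)
  show "convex S" unfolding eq by (intro convex_Int convex_halfspace_Im_gt convex_halfspace_Im_lt)
 qed
 have contf: "continuous_on (S - pts) f" using hol unfolding S_def by (rule holomorphic_on_imp_continuous_on)
 have contl: "continuous_on UNIV (\<lambda>x. f (Complex x c))" if "c = b0 \<or> c = b1" for c
 proof (rule continuous_on_compose2[OF contf])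
  show "continuous_on UNIV (\<lambda>x. Complex x c)" unfolding Complex_eq by (intro continuous_intros)
  show "(\<lambda>x. Complex x c) ` UNIV \<subseteq> S - pts" using that b \<mu> pts(2) by (force simp: S_def)
 qed
 have int: "integrable lborel (\<lambda>x. f (Complex x c))" if "c = b0 \<or> c = b1" for c
  using contl[OF that] \<delta> by (rule integrable_exp_decay[where C = C and R = R]) (use that b bnd in auto)
 show "integrable lborel (\<lambda>x. f (Complex x b0))" "integrable lborel (\<lambda>x. f (Complex x b1))"
  using int by auto
 define I where "I c n = integral {-real n..real n} (\<lambda>x. f (Complex x c))" for c n
 define \<Sigma> where "\<Sigma> = 2 * pi * \<i> * (\<Sum>p\<in>{p \<in> pts. b0 < Im p \<and> Im p < b1}. residue f p)"
 obtain M :: nat where M: "\<And>p. p \<in> pts ==> \<bar>Re p\<bar> < M" "R < M" "M > 0"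
 proof -
  have "\<exists>K. \<forall>p\<in>pts. \<bar>Re p\<bar> \<le> K"
   using pts(1) by (intro exI[of _ "Max ((\<lambda>p. \<bar>Re p\<bar>) ` pts)"]) auto
  then obtain K where K: "\<And>p. p \<in> pts ==> \<bar>Re p\<bar> \<le> K" by blast
  obtain M :: nat where M: "max (max K R) 0 < M" using reals_Archimedean2 by blast
  show ?thesis
  proof (rule that[of M])
   show "\<bar>Re p\<bar> < M" if "p \<in> pts" for p using K[OF that] M by linarith
   show "R < M" "M > 0" using M by auto
  qed
 qed
 have est: "cmod (I b0 n - I b1 n - \<Sigma>) \<le> 2 * (\<bar>C\<bar> * exp (- \<delta> * real n) * (b1 - b0))" if n: "n \<ge> M" for n
 proof -
  define a1 a3 where "a1 = Complex (- real n) b0" and "a3 = Complex (real n) b1"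
  define a2 a4 where "a2 = Complex (real n) b0" and "a4 = Complex (- real n) b1"
  have n0: "real n > 0" "R \<le> real n" using n M by auto
  have le: "Re a1 \<le> Re a3" "Im a1 \<le> Im a3" using b n0 by (auto simp: a1_def a3_def)
  have p_in: "p \<in> box a1 a3 \<longleftrightarrow> b0 < Im p \<and> Im p < b1" if "p \<in> pts" for p
   using M(1)[OF that] n by (auto simp: in_box_complex_iff a1_def a3_def)
  have p_cb: "p \<in> cbox a1 a3 \<longleftrightarrow> b0 < Im p \<and> Im p < b1" if "p \<in> pts" for p
   using M(1)[OF that] n pts(2)[OF that] by (auto simp: in_cbox_complex_iff a1_def a3_def)
  have cbS: "cbox a1 a3 \<subseteq> S" using b \<mu> by (auto simp: in_cbox_complex_iff a1_def a3_def S_def)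
  have img: "path_image (rectpath a1 a3) \<subseteq> S - pts"
   using le p_in p_cb cbS by (auto simp: path_image_rectpath_cbox_minus_box)
  have "contour_integral (rectpath a1 a3) f = 2 * pi * \<i> * (\<Sum>p\<in>pts. winding_number (rectpath a1 a3) p * residue f p)"
  proof (rule Residue_theorem[of S])
   show "\<forall>z. z \<notin> S \<longrightarrow> winding_number (rectpath a1 a3) z = 0"
    using winding_number_rectpath_outside[OF le] cbS by blast
  qed (use S pts(1) hol img in \<open>auto simp: convex_connected S_def\<close>)
  also have "(\<Sum>p\<in>pts. winding_number (rectpath a1 a3) p * residue f p)
    = (\<Sum>p\<in>pts. if b0 < Im p \<and> Im p < b1 then residue f p else 0)"
  proof (intro sum.cong refl)
   fix p assume p: "p \<in> pts"
   show "winding_number (rectpath a1 a3) p * residue f p = (if b0 < Im p \<and> Im p < b1 then residue f p else 0)"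
    using winding_number_rectpath[of p a1 a3] winding_number_rectpath_outside[OF le, of p] p_in[OF p] p_cb[OF p] by auto
  qed
  also have "\<dots> = (\<Sum>p\<in>{p \<in> pts. b0 < Im p \<and> Im p < b1}. residue f p)"
   using pts(1) by (simp add: sum.If_cases Int_def)
  finally have rect: "contour_integral (rectpath a1 a3) f = \<Sigma>" by (simp add: \<Sigma>_def)
  have r_eq: "rectpath a1 a3 = linepath a1 a2 +++ linepath a2 a3 +++ linepath a3 a4 +++ linepath a4 a1"
   by (simp add: rectpath_def Let_def a1_def a2_def a3_def a4_def)
  have segs: "closed_segment a1 a2 \<union> closed_segment a2 a3 \<union> closed_segment a3 a4 \<union> closed_segment a4 a1 \<subseteq> S - pts"
   using img unfolding r_eq by (simp add: path_image_join Un_assoc)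
  have cint: "f contour_integrable_on linepath a1 a2" "f contour_integrable_on linepath a2 a3"
   "f contour_integrable_on linepath a3 a4" "f contour_integrable_on linepath a4 a1"
   using segs by (auto intro!: contour_integrable_continuous_linepath continuous_on_subset[OF contf])
  have "contour_integral (rectpath a1 a3) f = contour_integral (linepath a1 a2) f + (contour_integral (linepath a2 a3) f
    + (contour_integral (linepath a3 a4) f + contour_integral (linepath a4 a1) f))"
   unfolding r_eq using cint by (simp add: contour_integrable_join)
  moreover have "contour_integral (linepath a1 a2) f = I b0 n"
   using contour_integral_unique[OF contour_integral_horizontal[OF contl[of b0] n0(1)]] by (simp add: a1_def a2_def I_def)
  moreover have "contour_integral (linepath a3 a4) f = - I b1 n"
  proof -
   have "contour_integral (linepath a4 a3) f = I b1 n"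
    using contour_integral_unique[OF contour_integral_horizontal[OF contl[of b1] n0(1)]] by (simp add: a3_def a4_def I_def)
   then show ?thesis using contour_integral_reverse_linepath[of a4 a3 f] segs
    by (metis closed_segment_commute contf continuous_on_subset le_sup_iff minus_minus)
  qed
  moreover have vert: "cmod (contour_integral (linepath u v) f) \<le> \<bar>C\<bar> * exp (- \<delta> * real n) * cmod (v - u)"
   if "f contour_integrable_on linepath u v" "\<And>x. x \<in> closed_segment u v ==> \<bar>Re x\<bar> = n \<and> b0 \<le> Im x \<and> Im x \<le> b1" for u v
  proof (rule contour_integral_bound_linepath[OF that(1)])
   fix x assume "x \<in> closed_segment u v"
   then have x: "\<bar>Re x\<bar> = n" "b0 \<le> Im x" "Im x \<le> b1" using that(2) by auto
   have "cmod (f x) \<le> C * exp (- \<delta> * real n)"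
    using bnd[of "Re x" "Im x"] x n0 by simp
   also have "\<dots> \<le> \<bar>C\<bar> * exp (- \<delta> * real n)" by (intro mult_right_mono) auto
   finally show "cmod (f x) \<le> \<bar>C\<bar> * exp (- \<delta> * real n)" .
  qed auto
  moreover have "cmod (a3 - a2) = b1 - b0" "cmod (a1 - a4) = b1 - b0"
   using b by (simp_all add: a1_def a2_def a3_def a4_def cmod_def)
  moreover have "\<bar>Re x\<bar> = n \<and> b0 \<le> Im x \<and> Im x \<le> b1" if "x \<in> closed_segment a2 a3 \<or> x \<in> closed_segment a4 a1" for x
  proof -
   have "x \<in> closed_segment a2 a3 \<longleftrightarrow> Re x = n \<and> Im x \<in> closed_segment b0 b1"
    "x \<in> closed_segment a4 a1 \<longleftrightarrow> Re x = - n \<and> Im x \<in> closed_segment b1 b0"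
    by (simp_all add: closed_segment_same_Re a1_def a2_def a3_def a4_def)
   then show ?thesis using that b by (auto simp: closed_segment_eq_real_ivl)
  qed
  ultimately have c2: "I b0 n - I b1 n - \<Sigma> = - (contour_integral (linepath a2 a3) f + contour_integral (linepath a4 a1) f)"
   and nrm: "cmod (a3 - a2) = b1 - b0" "cmod (a1 - a4) = b1 - b0"
   and seg: "\<And>x. x \<in> closed_segment a2 a3 \<or> x \<in> closed_segment a4 a1 ==> \<bar>Re x\<bar> = n \<and> b0 \<le> Im x \<and> Im x \<le> b1"
   using rect by (simp_all add: algebra_simps)
  have c1: "cmod (contour_integral (linepath a2 a3) f) \<le> \<bar>C\<bar> * exp (- \<delta> * real n) * (b1 - b0)"
   using vert[OF cint(2) seg] nrm by simp
  have c1': "cmod (contour_integral (linepath a4 a1) f) \<le> \<bar>C\<bar> * exp (- \<delta> * real n) * (b1 - b0)"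
   using vert[OF cint(4) seg] nrm by simp
  show ?thesis unfolding c2 norm_minus_cancel using c1 c1'
   by (intro norm_triangle_le) linarith
 qed
 have l0: "(\<lambda>n. 2 * (\<bar>C\<bar> * exp (- \<delta> * real n) * (b1 - b0))) \<longlonglongrightarrow> 0"
  using \<delta> by real_asymp
 have "(\<lambda>n. I b0 n - I b1 n - \<Sigma>) \<longlonglongrightarrow> 0"
  by (rule Lim_null_comparison[OF _ l0]) (use est in \<open>auto simp: eventually_sequentially\<close>)
 moreover have "(\<lambda>n. I b0 n - I b1 n - \<Sigma>) \<longlonglongrightarrow>
   (\<integral>x. f (Complex x b0) \<partial>lborel) - (\<integral>x. f (Complex x b1) \<partial>lborel) - \<Sigma>"
  unfolding I_def by (intro tendsto_intros tendsto_integral_symmetric int contl) auto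
 ultimately have "(\<integral>x. f (Complex x b0) \<partial>lborel) - (\<integral>x. f (Complex x b1) \<partial>lborel) - \<Sigma> = 0"
  using LIMSEQ_unique by blast
 then show "(\<integral>x. f (Complex x b0) \<partial>lborel) = (\<integral>x. f (Complex x b1) \<partial>lborel)
    + 2 * pi * \<i> * (\<Sum>p\<in>{p \<in> pts. b0 < Im p \<and> Im p < b1}. residue f p)"
  by (simp add: \<Sigma>_def algebra_simps)
qed

section \<open>Weights on a strip and their Laplace transforms\<close>

text \<open>For one ball the weight is a cosine up to scaling and translation; for a lens it is the minimum
 of two such functions. The midpoint inequality is the quantitative logarithmic concavity that
 survives taking minima, and it forces \<open>h ^ n\<close> to concentrate at the maximum. A width below \<open>\<pi>\<close>
 corresponds to transversal circles; it makes the Laplace transform \<open>G\<close> nonzero for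
 \<open>\<bar>Im l\<bar> \<le> 1/2\<close>.\<close>

locale strip_weight =
 fixes h :: "real \<Rightarrow> real" and \<alpha> \<beta> :: real
 assumes ab: "\<alpha> < \<beta>" "\<beta> - \<alpha> < pi"
  and cont_h: "continuous_on {\<alpha>..\<beta>} h"
  and h_nonneg: "\<And>\<phi>. \<alpha> \<le> \<phi> ==> \<phi> \<le> \<beta> ==> 0 \<le> h \<phi>"
  and h_pos: "\<And>\<phi>. \<alpha> < \<phi> ==> \<phi> < \<beta> ==> 0 < h \<phi>"
  and midpoint: "\<And>\<phi> \<psi>. \<phi> \<in> {\<alpha>..\<beta>} ==> \<psi> \<in> {\<alpha>..\<beta>} ==>
   h \<phi> * h \<psi> \<le> (h ((\<phi> + \<psi>) / 2))\<^sup>2 * (cos ((\<phi> - \<psi>) / 2))\<^sup>2"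
begin

text \<open>\<open>Gr n \<xi>\<close> is, up to a constant, the factor that appears in Plancherel's formula for the weight
 \<open>h ^ Suc n\<close> on the strip, and \<open>G n\<close> is its continuation to complex frequencies.\<close>

definition wt :: "nat \<Rightarrow> real \<Rightarrow> real \<Rightarrow> real" where
 "wt n \<xi> \<phi> = exp (- 2 * \<xi> * \<phi>) * h \<phi> ^ Suc n"

definition Gr :: "nat \<Rightarrow> real \<Rightarrow> real" where
 "Gr n \<xi> = (LINT \<phi>:{\<alpha>..\<beta>}|lborel. wt n \<xi> \<phi>)"

definition G :: "nat \<Rightarrow> complex \<Rightarrow> complex" where
 "G n l = (LINT \<phi>:{\<alpha>..\<beta>}|lborel. exp (- 2 * l * of_real \<phi>) * of_real (h \<phi> ^ Suc n))"

lemma wt_cont: "continuous_on {\<alpha>..\<beta>} (wt n \<xi>)"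
 unfolding wt_def by (intro continuous_intros cont_h)

lemma wt_nonneg: "\<alpha> \<le> \<phi> ==> \<phi> \<le> \<beta> ==> 0 \<le> wt n \<xi> \<phi>"
 unfolding wt_def using h_nonneg by simp

lemma wt_pos: "\<alpha> < \<phi> ==> \<phi> < \<beta> ==> 0 < wt n \<xi> \<phi>"
 unfolding wt_def using h_pos by simp

lemma wt_integrable: "set_integrable lborel {\<alpha>..\<beta>} (wt n \<xi>)"
 by (rule borel_integrable_atLeastAtMost'[OF wt_cont])

lemma integrable_indicator_Icc: "integrable lborel (\<lambda>\<phi>. indicator {c..d::real} \<phi> * (K::real))"
 using emeasure_bounded_finite[of "{c..d}"] by (intro integrable_mult_left integrable_real_indicator) auto

lemma Gr_lower:
 assumes "\<alpha> \<le> c" "c \<le> d" "d \<le> \<beta>" "\<And>\<phi>. c \<le> \<phi> ==> \<phi> \<le> d ==> K \<le> wt n \<xi> \<phi>"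
 shows "(d - c) * K \<le> Gr n \<xi>"
proof -
 have "(d - c) * K = (\<integral>\<phi>. indicator {c..d} \<phi> * K \<partial>lborel)" using assms by simp
 also have "\<dots> \<le> (\<integral>\<phi>. indicator {\<alpha>..\<beta>} \<phi> * wt n \<xi> \<phi> \<partial>lborel)"
 proof (rule integral_mono)
  show "integrable lborel (\<lambda>\<phi>. indicator {c..d} \<phi> * K)" by (rule integrable_indicator_Icc)
  show "integrable lborel (\<lambda>\<phi>. indicator {\<alpha>..\<beta>} \<phi> * wt n \<xi> \<phi>)"
   using wt_integrable[of n \<xi>] by (simp add: set_integrable_def)
  show "indicator {c..d} \<phi> * K \<le> indicator {\<alpha>..\<beta>} \<phi> * wt n \<xi> \<phi>" for \<phi>
   using assms wt_nonneg[of \<phi> n \<xi>] by (auto simp: indicator_def)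
 qed
 finally show ?thesis by (simp add: Gr_def set_lebesgue_integral_def)
qed

lemma compact_subinterval_min:
 assumes "\<alpha> < c" "c \<le> d" "d < \<beta>"
 obtains m where "m > 0" "\<And>\<phi>. c \<le> \<phi> ==> \<phi> \<le> d ==> m \<le> h \<phi>"
proof -
 have "continuous_on {c..d} h" using assms by (intro continuous_on_subset[OF cont_h]) auto
 then obtain x where "x \<in> {c..d}" "\<forall>y\<in>{c..d}. h x \<le> h y"
  using continuous_attains_inf[of "{c..d}" h] assms by auto
 then show ?thesis using that[of "h x"] h_pos[of x] assms by auto
qed

lemma Gr_pos: "Gr n \<xi> > 0"
proof -
 define c d where "c = (2 * \<alpha> + \<beta>) / 3" and "d = (\<alpha> + 2 * \<beta>) / 3"
 have cd: "\<alpha> < c" "c < d" "d < \<beta>" using ab by (auto simp: c_def d_def)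
 have "continuous_on {c..d} (wt n \<xi>)" using cd by (intro continuous_on_subset[OF wt_cont]) auto
 then obtain x where x: "x \<in> {c..d}" "\<forall>y\<in>{c..d}. wt n \<xi> x \<le> wt n \<xi> y"
  using continuous_attains_inf[of "{c..d}" "wt n \<xi>"] cd by auto
 have "(d - c) * wt n \<xi> x \<le> Gr n \<xi>" using x(2) cd by (intro Gr_lower) auto
 moreover have "(d - c) * wt n \<xi> x > 0" using cd x(1) by (intro mult_pos_pos wt_pos) auto
 ultimately show ?thesis by linarith
qed

lemma h_upper: obtains H where "H > 0" "\<And>\<phi>. \<alpha> \<le> \<phi> ==> \<phi> \<le> \<beta> ==> h \<phi> \<le> H"
proof -
 obtain x where x: "x \<in> {\<alpha>..\<beta>}" "\<forall>y\<in>{\<alpha>..\<beta>}. h y \<le> h x"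
  using continuous_attains_sup[of "{\<alpha>..\<beta>}" h] cont_h ab by auto
 have "0 < h ((\<alpha> + \<beta>) / 2)" using ab by (intro h_pos) auto
 also have "\<dots> \<le> h x" using x ab by (auto simp: field_simps)
 finally show ?thesis using that x(2) by auto
qed

lemma G_integrand_cont: "continuous_on {\<alpha>..\<beta>} (\<lambda>\<phi>. exp (- 2 * l * of_real \<phi>) * of_real (h \<phi> ^ Suc n) :: complex)"
 by (intro continuous_intros cont_h)

lemma G_integrable: "set_integrable lborel {\<alpha>..\<beta>} (\<lambda>\<phi>. exp (- 2 * l * of_real \<phi>) * of_real (h \<phi> ^ Suc n) :: complex)"
 by (rule borel_integrable_atLeastAtMost'[OF G_integrand_cont])

lemma G_of_real: "G n (of_real \<xi>) = of_real (Gr n \<xi>)"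
proof -
 have "(\<lambda>\<phi>. exp (- 2 * of_real \<xi> * of_real \<phi>) * of_real (h \<phi> ^ Suc n)) = (\<lambda>\<phi>. complex_of_real (wt n \<xi> \<phi>))"
  by (auto simp: wt_def exp_of_real[symmetric])
 then show ?thesis unfolding G_def Gr_def by (simp only: set_integral_complex_of_real)
qed

lemma G_holomorphic: "G n holomorphic_on UNIV"
proof -
 obtain H where H: "H > 0" "\<And>\<phi>. \<alpha> \<le> \<phi> ==> \<phi> \<le> \<beta> ==> h \<phi> \<le> H" by (rule h_upper) blast
 have "(\<lambda>l. \<integral>\<phi>. indicator {\<alpha>..\<beta>} \<phi> *\<^sub>R (exp (- 2 * l * of_real \<phi>) * of_real (h \<phi> ^ Suc n)) \<partial>lborel) holomorphic_on UNIV"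
 proof (rule holomorphic_on_integral)
  fix l :: complex
  show "(\<lambda>\<phi>. indicator {\<alpha>..\<beta>} \<phi> *\<^sub>R (exp (- 2 * l * of_real \<phi>) * of_real (h \<phi> ^ Suc n))) \<in> borel_measurable lborel"
   using G_integrable[of l n] unfolding set_integrable_def by (rule borel_measurable_integrable)
  define K where "K = exp (2 * (cmod l + 1) * (\<bar>\<alpha>\<bar> + \<bar>\<beta>\<bar>)) * H ^ Suc n"
  have "cmod (indicator {\<alpha>..\<beta>} \<phi> *\<^sub>R (exp (- 2 * w * of_real \<phi>) * of_real (h \<phi> ^ Suc n))) \<le> indicator {\<alpha>..\<beta>} \<phi> * K"
   if w: "w \<in> ball l 1" for w \<phi>
  proof (cases "\<phi> \<in> {\<alpha>..\<beta>}")
   case True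
   have "cmod w \<le> cmod l + 1" using w norm_triangle_ineq[of l "w - l"] by (simp add: dist_norm norm_minus_commute)
   then have "cmod w * \<bar>\<phi>\<bar> \<le> (cmod l + 1) * (\<bar>\<alpha>\<bar> + \<bar>\<beta>\<bar>)" using True by (intro mult_mono) auto
   moreover have "Re (- 2 * w * of_real \<phi>) \<le> 2 * (cmod w * \<bar>\<phi>\<bar>)"
    using complex_Re_le_cmod[of "- 2 * w * of_real \<phi>"] by (simp add: norm_mult)
   ultimately have "Re (- 2 * w * of_real \<phi>) \<le> 2 * ((cmod l + 1) * (\<bar>\<alpha>\<bar> + \<bar>\<beta>\<bar>))" by linarith
   then have "exp (Re (- 2 * w * of_real \<phi>)) \<le> exp (2 * (cmod l + 1) * (\<bar>\<alpha>\<bar> + \<bar>\<beta>\<bar>))"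
    by (simp only: exp_le_cancel_iff mult.assoc)
   moreover have "h \<phi> ^ Suc n \<le> H ^ Suc n" "0 \<le> h \<phi> ^ Suc n"
    using True H h_nonneg[of \<phi>] by (auto intro!: power_mono simp del: power_Suc)
   ultimately have "exp (Re (- 2 * w * of_real \<phi>)) * h \<phi> ^ Suc n \<le> K"
    unfolding K_def using H(1) by (intro mult_mono) auto
   then show ?thesis using True h_nonneg[of \<phi>] by (simp add: norm_mult norm_power)
  qed simp
  then show "\<exists>r>0. \<exists>B. integrable lborel B \<and> (\<forall>w\<in>ball l r \<inter> UNIV. \<forall>\<phi>\<in>space lborel.
    cmod (indicator {\<alpha>..\<beta>} \<phi> *\<^sub>R (exp (- 2 * w * of_real \<phi>) * of_real (h \<phi> ^ Suc n))) \<le> B \<phi>)"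
   using integrable_indicator_Icc[of \<alpha> \<beta> K]
   by (intro exI[of _ "1::real"] conjI exI[of _ "\<lambda>\<phi>. indicator {\<alpha>..\<beta>} \<phi> * K"]) auto
 qed (auto intro!: holomorphic_intros)
 then show ?thesis unfolding G_def[abs_def] set_lebesgue_integral_def .
qed

lemma G_cont: "continuous_on S (G n)"
 using G_holomorphic holomorphic_on_imp_continuous_on continuous_on_subset by blast

lemma Gr_cont: "continuous_on S (Gr n)"
proof -
 have "continuous_on S (\<lambda>\<xi>. Re (G n (of_real \<xi>)))"
  by (intro continuous_intros continuous_on_compose2[OF G_cont[of UNIV]]) auto
 then show ?thesis by (simp add: G_of_real)
qed

text \<open>Turning the integrand of \<open>G n (\<xi> + \<i> \<eta>)\<close> by the constant phase \<open>exp (2 \<i> \<eta> M)\<close> leaves the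
 modulus of the integral unchanged, so a lower bound for \<open>cos (2 \<eta> (\<phi> - M))\<close> where the weight
 lives keeps the integral away from zero.\<close>

lemma G_lower:
 assumes k: "\<And>\<phi>. \<alpha> \<le> \<phi> ==> \<phi> \<le> \<beta> ==> k \<phi> \<le> cos (2 * \<eta> * (\<phi> - M))"
  and int: "set_integrable lborel {\<alpha>..\<beta>} (\<lambda>\<phi>. k \<phi> * wt n \<xi> \<phi>)"
 shows "(LINT \<phi>:{\<alpha>..\<beta>}|lborel. k \<phi> * wt n \<xi> \<phi>) \<le> cmod (G n (Complex \<xi> \<eta>))"
proof -
 let ?l = "Complex \<xi> \<eta>"
 define u where "u = cis (2 * \<eta> * M)"
 define F where "F \<phi> = u * (exp (- 2 * ?l * of_real \<phi>) * of_real (h \<phi> ^ Suc n))" for \<phi>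
 have pt: "Re (F \<phi>) = cos (2 * \<eta> * (\<phi> - M)) * wt n \<xi> \<phi>" for \<phi>
 proof -
  have "- 2 * ?l * of_real \<phi> = of_real (- 2 * \<xi> * \<phi>) + \<i> * of_real (- 2 * \<eta> * \<phi>)"
   by (simp add: complex_eq_iff)
  then have "exp (- 2 * ?l * of_real \<phi>) = of_real (exp (- 2 * \<xi> * \<phi>)) * cis (- 2 * \<eta> * \<phi>)"
   by (simp only: exp_add exp_of_real cis_conv_exp)
  then have "F \<phi> = (u * cis (- 2 * \<eta> * \<phi>)) * of_real (wt n \<xi> \<phi>)" by (simp add: wt_def F_def)
  also have "u * cis (- 2 * \<eta> * \<phi>) = cis (- (2 * \<eta> * (\<phi> - M)))"
   unfolding u_def cis_mult by (simp add: algebra_simps)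
  finally show ?thesis by simp
 qed
 have iu: "integrable lborel (\<lambda>\<phi>. indicator {\<alpha>..\<beta>} \<phi> *\<^sub>R F \<phi>)"
  using set_integrable_mult_right[of u, OF G_integrable[of ?l n]] unfolding set_integrable_def F_def .
 have "(LINT \<phi>:{\<alpha>..\<beta>}|lborel. k \<phi> * wt n \<xi> \<phi>) \<le> (\<integral>\<phi>. Re (indicator {\<alpha>..\<beta>} \<phi> *\<^sub>R F \<phi>) \<partial>lborel)"
  unfolding set_lebesgue_integral_def
 proof (rule integral_mono)
  fix \<phi> :: real
  show "indicator {\<alpha>..\<beta>} \<phi> *\<^sub>R (k \<phi> * wt n \<xi> \<phi>) \<le> Re (indicator {\<alpha>..\<beta>} \<phi> *\<^sub>R F \<phi>)"
  proof (cases "\<phi> \<in> {\<alpha>..\<beta>}")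
   case True
   then show ?thesis using mult_right_mono[OF k[of \<phi>] wt_nonneg[of \<phi> n \<xi>]] by (simp add: pt)
  qed simp
 qed (use int integrable_Re[OF iu] in \<open>simp_all only: set_integrable_def\<close>)
 also have "\<dots> = Re (\<integral>\<phi>. indicator {\<alpha>..\<beta>} \<phi> *\<^sub>R F \<phi> \<partial>lborel)"
  by (rule integral_Re[OF iu])
 also have "(\<integral>\<phi>. indicator {\<alpha>..\<beta>} \<phi> *\<^sub>R F \<phi> \<partial>lborel) = u * G n ?l"
  unfolding G_def F_def set_lebesgue_integral_def[symmetric] by (rule set_integral_mult_right)
 also have "Re (u * G n ?l) \<le> cmod (u * G n ?l)" by (rule complex_Re_le_cmod)
 also have "\<dots> = cmod (G n ?l)" by (simp add: norm_mult u_def)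
 finally show ?thesis .
qed

text \<open>The phase of the midpoint of the interval is the best choice for small \<open>\<eta>\<close>.\<close>

lemma G_lower_small:
 assumes "\<bar>\<eta>\<bar> * (\<beta> - \<alpha>) \<le> pi / 2"
 shows "cos (\<eta> * (\<beta> - \<alpha>)) * Gr n \<xi> \<le> cmod (G n (Complex \<xi> \<eta>))"
proof -
 have "(LINT \<phi>:{\<alpha>..\<beta>}|lborel. cos (\<eta> * (\<beta> - \<alpha>)) * wt n \<xi> \<phi>) \<le> cmod (G n (Complex \<xi> \<eta>))"
 proof (rule G_lower[where M = "(\<alpha> + \<beta>) / 2"])
  fix \<phi> assume p: "\<alpha> \<le> \<phi>" "\<phi> \<le> \<beta>"
  have "2 * \<eta> * (\<phi> - (\<alpha> + \<beta>) / 2) = \<eta> * (2 * \<phi> - (\<alpha> + \<beta>))" by (simp add: algebra_simps)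
  then have "\<bar>2 * \<eta> * (\<phi> - (\<alpha> + \<beta>) / 2)\<bar> = \<bar>\<eta>\<bar> * \<bar>2 * \<phi> - (\<alpha> + \<beta>)\<bar>"
   by (simp only: abs_mult)
  also have "\<dots> \<le> \<bar>\<eta>\<bar> * (\<beta> - \<alpha>)" using p by (intro mult_left_mono) auto
  finally have le: "\<bar>2 * \<eta> * (\<phi> - (\<alpha> + \<beta>) / 2)\<bar> \<le> \<bar>\<eta>\<bar> * (\<beta> - \<alpha>)" .
  have "cos (\<bar>\<eta>\<bar> * (\<beta> - \<alpha>)) \<le> cos \<bar>2 * \<eta> * (\<phi> - (\<alpha> + \<beta>) / 2)\<bar>"
   using le assms pi_gt_zero by (intro cos_monotone_0_pi_le) linarith+
  moreover have "cos (\<bar>\<eta>\<bar> * (\<beta> - \<alpha>)) = cos (\<eta> * (\<beta> - \<alpha>))"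
   by (cases "\<eta> \<ge> 0") auto
  ultimately show "cos (\<eta> * (\<beta> - \<alpha>)) \<le> cos (2 * \<eta> * (\<phi> - (\<alpha> + \<beta>) / 2))" by simp
 qed (rule set_integrable_mult_right[OF wt_integrable])
 then show ?thesis by (simp add: Gr_def)
qed

lemma indicator_wt_integrable:
 assumes "J \<in> sets borel"
 shows "set_integrable lborel {\<alpha>..\<beta>} (\<lambda>\<phi>. indicator J \<phi> * wt n \<xi> \<phi>)"
 using integrable_mult_indicator[of J lborel, OF _ wt_integrable[of n \<xi>, unfolded set_integrable_def]] assms
 unfolding set_integrable_def by (simp add: mult.left_commute)

text \<open>Near \<open>M\<close> the phase varies by at most \<open>1/2\<close>, and the mass elsewhere is too small to compensate.\<close>

lemma G_lower_concentrated:
 assumes "(LINT \<phi>:{\<alpha>..\<beta>}|lborel. indicator {\<phi>. e \<le> \<bar>\<phi> - M\<bar>} \<phi> * wt n \<xi> \<phi>) \<le> Gr n \<xi> / 5" "\<bar>\<eta>\<bar> * e \<le> 1 / 4"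
 shows "Gr n \<xi> / 2 \<le> cmod (G n (Complex \<xi> \<eta>))"
proof -
 define J where "J = {\<phi>. e \<le> \<bar>\<phi> - M\<bar>}"
 have iJ: "set_integrable lborel {\<alpha>..\<beta>} (\<lambda>\<phi>. indicator J \<phi> * wt n \<xi> \<phi>)"
  by (rule indicator_wt_integrable) (simp add: J_def)
 have eq: "(\<lambda>\<phi>. (7/8 - 15/8 * indicator J \<phi>) * wt n \<xi> \<phi>) = (\<lambda>\<phi>. 7/8 * wt n \<xi> \<phi> - 15/8 * (indicator J \<phi> * wt n \<xi> \<phi>))"
  by (auto simp: algebra_simps)
 have "(LINT \<phi>:{\<alpha>..\<beta>}|lborel. (7/8 - 15/8 * indicator J \<phi>) * wt n \<xi> \<phi>) \<le> cmod (G n (Complex \<xi> \<eta>))"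
 proof (rule G_lower[where M = M])
  fix \<phi>
  show "7/8 - 15/8 * indicator J \<phi> \<le> cos (2 * \<eta> * (\<phi> - M))"
  proof (cases "\<phi> \<in> J")
   case True
   then show ?thesis using cos_ge_minus_one[of "2 * \<eta> * (\<phi> - M)"] by simp
  next
   case False
   then have "\<bar>\<phi> - M\<bar> \<le> e" by (simp add: J_def)
   then have "\<bar>\<eta>\<bar> * \<bar>\<phi> - M\<bar> \<le> \<bar>\<eta>\<bar> * e" by (intro mult_left_mono) auto
   then have "\<bar>\<eta> * (\<phi> - M)\<bar> \<le> 1/4" using assms(2) by (simp add: abs_mult)
   then have "\<bar>sin (\<eta> * (\<phi> - M))\<bar> \<le> 1/4"
    using abs_sin_x_le_abs_x[of "\<eta> * (\<phi> - M)"] by linarith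
   then have "\<bar>sin (\<eta> * (\<phi> - M))\<bar>\<^sup>2 \<le> (1/4)\<^sup>2" by (intro power_mono) auto
   then have "(sin (\<eta> * (\<phi> - M)))\<^sup>2 \<le> 1/16" by (simp add: power2_eq_square)
   moreover have "cos (2 * \<eta> * (\<phi> - M)) = 1 - 2 * (sin (\<eta> * (\<phi> - M)))\<^sup>2"
    using cos_double_sin[of "\<eta> * (\<phi> - M)"] by (simp add: mult_ac)
   ultimately show ?thesis using False by simp
  qed
 next
  show "set_integrable lborel {\<alpha>..\<beta>} (\<lambda>\<phi>. (7/8 - 15/8 * indicator J \<phi>) * wt n \<xi> \<phi>)"
   unfolding eq by (intro set_integral_diff set_integrable_mult_right wt_integrable iJ)
 qed
 also have "(LINT \<phi>:{\<alpha>..\<beta>}|lborel. (7/8 - 15/8 * indicator J \<phi>) * wt n \<xi> \<phi>)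
   = 7/8 * Gr n \<xi> - 15/8 * (LINT \<phi>:{\<alpha>..\<beta>}|lborel. indicator J \<phi> * wt n \<xi> \<phi>)"
  unfolding eq Gr_def
  by (simp only: set_integral_diff(2)[OF set_integrable_mult_right[OF wt_integrable] set_integrable_mult_right[OF iJ]] set_integral_mult_right)
 finally show ?thesis using assms(1) by (simp add: J_def)
qed

text \<open>Comparison of the weight at \<open>\<phi>\<close> with its Laplace transform: the mass of \<open>wt n \<xi>\<close> on a short
 interval next to \<open>\<phi>\<close>, on the side where the exponential is larger, already exceeds the value at
 \<open>\<phi>\<close> by a factor \<open>exp (\<delta> \<bar>\<xi>\<bar>)\<close>, while \<open>h\<close> loses at most a factor \<open>k'\<close> with \<open>k < k' < 1\<close>.\<close>

lemma core_bound:
 assumes a: "\<alpha> < a" "a \<le> b" "b < \<beta>" and k: "0 < k" "k < 1"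
 obtains C \<theta> \<delta> where "C > 0" "0 < \<theta>" "\<theta> < 1" "\<delta> > 0"
  "\<And>n \<xi> \<phi>. a \<le> \<phi> ==> \<phi> \<le> b ==> (k * h \<phi>) ^ n * exp (- 2 * \<xi> * \<phi>) \<le> C * \<theta> ^ n * exp (- \<delta> * \<bar>\<xi>\<bar>) * Gr n \<xi>"
proof -
 define e0 where "e0 = min (a - \<alpha>) (\<beta> - b) / 2"
 define c d where "c = a - e0" and "d = b + e0"
 have e0: "e0 > 0" and cd: "\<alpha> < c" "c \<le> d" "d < \<beta>" "c < a" "b < d"
  using a by (auto simp: e0_def c_def d_def min_def field_simps split: if_splits)
 obtain hm where hm: "hm > 0" "\<And>\<phi>. c \<le> \<phi> ==> \<phi> \<le> d ==> hm \<le> h \<phi>"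
  using compact_subinterval_min[of c d] cd by metis
 define k' where "k' = (1 + k) / 2"
 have k': "k < k'" "k' < 1" "0 < k'" using k by (auto simp: k'_def)
 have "uniformly_continuous_on {c..d} h"
  using cd by (intro compact_uniformly_continuous continuous_on_subset[OF cont_h]) auto
 moreover have "(1 - k') * hm > 0" using k' hm by simp
 ultimately obtain e1 where e1: "e1 > 0" "\<And>x y. x \<in> {c..d} ==> y \<in> {c..d} ==> dist y x < e1 ==> dist (h y) (h x) < (1 - k') * hm"
  unfolding uniformly_continuous_on_def by metis
 define e where "e = min e0 e1 / 4"
 have e: "e > 0" "2 * e < e0" "2 * e < e1" using e0 e1(1) by (auto simp: e_def min_def)
 have near: "k' * h \<phi> \<le> h \<psi>" if "a \<le> \<phi>" "\<phi> \<le> b" "\<bar>\<psi> - \<phi>\<bar> \<le> 2 * e" for \<phi> \<psi>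
 proof -
  have in_cd: "\<phi> \<in> {c..d}" "\<psi> \<in> {c..d}" using that e cd by (auto simp: c_def d_def abs_le_iff)
  then have "\<bar>h \<psi> - h \<phi>\<bar> < (1 - k') * hm" using e1(2)[of \<phi> \<psi>] that(3) e by (auto simp: dist_real_def)
  moreover have "(1 - k') * hm \<le> (1 - k') * h \<phi>"
   using hm(2)[of \<phi>] in_cd k' by (intro mult_left_mono) auto
  ultimately have "h \<phi> - h \<psi> \<le> (1 - k') * h \<phi>" by linarith
  then show ?thesis by (simp add: algebra_simps)
 qed
 have main: "e * (exp (- 2 * \<xi> * \<phi>) * exp (2 * e * \<bar>\<xi>\<bar>) * (k' * h \<phi>) ^ Suc n) \<le> Gr n \<xi>"
  if p: "a \<le> \<phi>" "\<phi> \<le> b" for n \<xi> \<phi>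
 proof -
  define u where "u = (if \<xi> \<ge> 0 then \<phi> - 2 * e else \<phi> + e)"
  have u: "\<alpha> \<le> u" "u + e \<le> \<beta>" using p e cd e0 by (auto simp: u_def c_def d_def)
  have "(u + e - u) * (exp (- 2 * \<xi> * \<phi>) * exp (2 * e * \<bar>\<xi>\<bar>) * (k' * h \<phi>) ^ Suc n) \<le> Gr n \<xi>"
  proof (rule Gr_lower)
   fix \<psi> assume q: "u \<le> \<psi>" "\<psi> \<le> u + e"
   have "k' * h \<phi> \<le> h \<psi>" using q p e by (intro near) (auto simp: u_def abs_le_iff split: if_splits)
   moreover have nn: "0 \<le> k' * h \<phi>" using k' h_nonneg[of \<phi>] p a by simp
   ultimately have 1: "(k' * h \<phi>) ^ Suc n \<le> h \<psi> ^ Suc n" by (rule power_mono)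
   have "e * \<bar>\<xi>\<bar> \<le> \<xi> * (\<phi> - \<psi>)"
   proof (cases "\<xi> \<ge> 0")
    case True
    then have "e \<le> \<phi> - \<psi>" using q by (simp add: u_def)
    then show ?thesis using mult_left_mono[of e "\<phi> - \<psi>" \<xi>] True by (simp add: mult.commute)
   next
    case False
    then have "e \<le> \<psi> - \<phi>" using q by (simp add: u_def)
    then have "- \<xi> * e \<le> - \<xi> * (\<psi> - \<phi>)" using False by (intro mult_left_mono) auto
    then show ?thesis using False by (simp add: algebra_simps)
   qed
   then have "- 2 * \<xi> * \<phi> + 2 * e * \<bar>\<xi>\<bar> \<le> - 2 * \<xi> * \<psi>" by (simp add: algebra_simps)
   then have 2: "exp (- 2 * \<xi> * \<phi>) * exp (2 * e * \<bar>\<xi>\<bar>) \<le> exp (- 2 * \<xi> * \<psi>)" by (simp only: exp_add[symmetric] exp_le_cancel_iff)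
   show "exp (- 2 * \<xi> * \<phi>) * exp (2 * e * \<bar>\<xi>\<bar>) * (k' * h \<phi>) ^ Suc n \<le> wt n \<xi> \<psi>"
    unfolding wt_def using 1 2 nn by (intro mult_mono) (auto simp del: power_Suc)
  qed (use u e in auto)
  then show ?thesis by simp
 qed
 show ?thesis
 proof (rule that[of "1 / (e * (k' * hm))" "k / k'" "2 * e"])
  show "1 / (e * (k' * hm)) > 0" "0 < k / k'" "k / k' < 1" "2 * e > 0" using e k k' hm by auto
  fix n \<xi> \<phi> assume p: "a \<le> \<phi>" "\<phi> \<le> b"
  have hmp: "hm \<le> h \<phi>" using hm(2) p cd by auto
  define X where "X = exp (- 2 * \<xi> * \<phi>) * (k' * h \<phi>) ^ n"
  have X0: "X \<ge> 0" unfolding X_def using k' hmp hm(1) by simp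
  have "e * (k' * hm) * exp (2 * e * \<bar>\<xi>\<bar>) * X \<le> e * (k' * h \<phi>) * exp (2 * e * \<bar>\<xi>\<bar>) * X"
   using X0 e k' hmp by (intro mult_right_mono mult_left_mono) auto
  also have "\<dots> \<le> Gr n \<xi>" using main[OF p, of \<xi> n] by (simp add: X_def mult_ac)
  finally have "X \<le> 1 / (e * (k' * hm)) * exp (- (2 * e) * \<bar>\<xi>\<bar>) * Gr n \<xi>"
   using e k' hm(1) by (simp add: field_simps exp_minus)
  then have "(k / k') ^ n * X \<le> (k / k') ^ n * (1 / (e * (k' * hm)) * exp (- (2 * e) * \<bar>\<xi>\<bar>) * Gr n \<xi>)"
   using k k' by (intro mult_left_mono) auto
  moreover have "(k / k') ^ n * X = (k * h \<phi>) ^ n * exp (- 2 * \<xi> * \<phi>)"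
  proof -
   have "(k / k') ^ n * (k' * h \<phi>) ^ n = (k * h \<phi>) ^ n"
    using k' by (simp add: power_mult_distrib[symmetric])
   then show ?thesis by (simp add: X_def mult.left_commute)
  qed
  ultimately show "(k * h \<phi>) ^ n * exp (- 2 * \<xi> * \<phi>) \<le> 1 / (e * (k' * hm)) * (k / k') ^ n * exp (- (2 * e) * \<bar>\<xi>\<bar>) * Gr n \<xi>"
   by (simp add: mult_ac)
 qed
qed

lemma core_bound_fixed:
 assumes a: "\<alpha> < a" "a \<le> b" "b < \<beta>"
 obtains C \<delta> where "C > 0" "\<delta> > 0"
  "\<And>\<xi> \<phi>. a \<le> \<phi> ==> \<phi> \<le> b ==> exp (- 2 * \<xi> * \<phi>) \<le> C * exp (- \<delta> * \<bar>\<xi>\<bar>) * Gr n \<xi>"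
proof -
 have half: "0 < (1/2::real)" "(1/2::real) < 1" by auto
 obtain C \<theta> \<delta> where C: "C > 0" "0 < \<theta>" "\<theta> < 1" "\<delta> > 0"
  "\<And>n \<xi> \<phi>. a \<le> \<phi> ==> \<phi> \<le> b ==> (1/2 * h \<phi>) ^ n * exp (- 2 * \<xi> * \<phi>) \<le> C * \<theta> ^ n * exp (- \<delta> * \<bar>\<xi>\<bar>) * Gr n \<xi>"
  by (rule core_bound[OF a half]) blast
 obtain hm where hm: "hm > 0" "\<And>\<phi>. a \<le> \<phi> ==> \<phi> \<le> b ==> hm \<le> h \<phi>"
  using compact_subinterval_min[OF a] by blast
 show ?thesis
 proof (rule that[of "C * \<theta> ^ n / (1/2 * hm) ^ n" \<delta>])
  fix \<xi> \<phi> assume p: "a \<le> \<phi>" "\<phi> \<le> b"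
  have "(1/2 * hm) ^ n * exp (- 2 * \<xi> * \<phi>) \<le> (1/2 * h \<phi>) ^ n * exp (- 2 * \<xi> * \<phi>)"
   using hm(1) hm(2)[OF p] by (intro mult_right_mono power_mono) auto
  also have "\<dots> \<le> C * \<theta> ^ n * exp (- \<delta> * \<bar>\<xi>\<bar>) * Gr n \<xi>" by (rule C(5)[OF p])
  finally have "exp (- 2 * \<xi> * \<phi>) * (1/2 * hm) ^ n \<le> C * \<theta> ^ n * exp (- \<delta> * \<bar>\<xi>\<bar>) * Gr n \<xi>" by (simp only: mult.commute)
  moreover have "(1/2 * hm) ^ n > 0" using hm(1) by simp
  ultimately have "exp (- 2 * \<xi> * \<phi>) \<le> C * \<theta> ^ n * exp (- \<delta> * \<bar>\<xi>\<bar>) * Gr n \<xi> / (1/2 * hm) ^ n"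
   by (simp only: pos_le_divide_eq)
  then show "exp (- 2 * \<xi> * \<phi>) \<le> C * \<theta> ^ n / (1/2 * hm) ^ n * exp (- \<delta> * \<bar>\<xi>\<bar>) * Gr n \<xi>"
   by (simp only: times_divide_eq_left)
 qed (use C hm in auto)
qed

end

context strip_weight
begin

text \<open>For large \<open>n\<close> the weight is concentrated near its maximum \<open>M\<close>, uniformly in \<open>\<xi>\<close>: the midpoint
 inequality bounds the weight at \<open>\<phi>\<close> by its value half way to \<open>M\<close> times a power of
 \<open>cos ((\<phi> - M) / 2) ^ 2\<close>, and halving the distance to \<open>M\<close> at most doubles an integral.\<close>

lemma G_lower_large_n:
 assumes "E \<ge> 0"
 obtains n0 where "\<And>n \<xi> \<eta>. n \<ge> n0 ==> \<bar>\<eta>\<bar> \<le> E ==> Gr n \<xi> / 2 \<le> cmod (G n (Complex \<xi> \<eta>))"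
proof -
 define e where "e = 1 / (4 * (E + 1))"
 have e: "e > 0" "e < 1" "E * e \<le> 1 / 4" using assms by (auto simp: e_def field_simps)
 define \<kappa> where "\<kappa> = (cos (e / 2))\<^sup>2"
 have ce: "0 < cos (e/2)" using e pi_gt3 by (intro cos_gt_zero) auto
 have "cos (e/2) < cos 0" using e pi_gt3 by (intro cos_monotone_0_pi) auto
 then have \<kappa>: "0 \<le> \<kappa>" "\<kappa> < 1" using ce by (auto simp: \<kappa>_def power_less_one_iff)
 then have "(\<lambda>n. \<kappa> ^ n) \<longlonglongrightarrow> 0" by (simp add: LIMSEQ_power_zero)
 then have "eventually (\<lambda>n. \<kappa> ^ n < 1/10) sequentially" by (rule order_tendstoD) simp
 then obtain n0 where n0: "\<And>n. n \<ge> n0 ==> \<kappa> ^ n < 1/10" by (auto simp: eventually_sequentially)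
 show ?thesis
 proof (rule that[of n0])
  fix n \<xi> \<eta> assume n: "n \<ge> n0" and \<eta>: "\<bar>\<eta>\<bar> \<le> E"
  obtain M where M: "M \<in> {\<alpha>..\<beta>}" "\<And>\<phi>. \<phi> \<in> {\<alpha>..\<beta>} ==> wt n \<xi> \<phi> \<le> wt n \<xi> M"
   using continuous_attains_sup[of "{\<alpha>..\<beta>}" "wt n \<xi>"] wt_cont ab by auto
  have "0 < wt n \<xi> ((\<alpha> + \<beta>) / 2)" using ab by (intro wt_pos) auto
  also have "\<dots> \<le> wt n \<xi> M" using ab by (intro M(2)) auto
  finally have wM: "0 < wt n \<xi> M" .
  define J where "J = {\<phi>. e \<le> \<bar>\<phi> - M\<bar>}"
  have pt: "wt n \<xi> \<phi> \<le> \<kappa> ^ Suc n * wt n \<xi> ((\<phi> + M) / 2)" if p: "\<phi> \<in> {\<alpha>..\<beta>}" "\<phi> \<in> J" for \<phi>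
  proof -
   let ?m = "(\<phi> + M) / 2"
   have m: "?m \<in> {\<alpha>..\<beta>}" using p M(1) by auto
   have "\<bar>\<phi> - M\<bar> / 2 = \<bar>(\<phi> - M) / 2\<bar>" by simp
   then have "cos ((\<phi> - M) / 2) = cos (\<bar>\<phi> - M\<bar> / 2)" by (simp only: cos_abs_real)
   moreover have "\<bar>\<phi> - M\<bar> / 2 \<le> pi / 2" using p M(1) ab by auto
   moreover have "cos (\<bar>\<phi> - M\<bar> / 2) \<le> cos (e / 2)"
    using p(2) e \<open>\<bar>\<phi> - M\<bar> / 2 \<le> pi / 2\<close> pi_gt_zero by (intro cos_monotone_0_pi_le) (auto simp: J_def)
   moreover have "0 \<le> cos (\<bar>\<phi> - M\<bar> / 2)"
   proof (rule cos_ge_zero)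
    have "- (pi / 2) \<le> 0" "0 \<le> \<bar>\<phi> - M\<bar> / 2" by simp_all
    then show "- (pi / 2) \<le> \<bar>\<phi> - M\<bar> / 2" by (rule order_trans)
    show "\<bar>\<phi> - M\<bar> / 2 \<le> pi / 2" by fact
   qed
   ultimately have "(cos ((\<phi> - M) / 2))\<^sup>2 \<le> \<kappa>" unfolding \<kappa>_def by (auto intro: power_mono)
   then have "(h ?m)\<^sup>2 * (cos ((\<phi> - M) / 2))\<^sup>2 \<le> (h ?m)\<^sup>2 * \<kappa>" by (intro mult_left_mono) auto
   then have "h \<phi> * h M \<le> (h ?m)\<^sup>2 * \<kappa>" using midpoint[OF p(1) M(1)] by linarith
   then have "(h \<phi> * h M) ^ Suc n \<le> ((h ?m)\<^sup>2 * \<kappa>) ^ Suc n"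
    using h_nonneg[of \<phi>] h_nonneg[of M] p M(1) by (intro power_mono) auto
   then have "exp (- 2 * \<xi> * (\<phi> + M)) * (h \<phi> * h M) ^ Suc n \<le> exp (- 2 * \<xi> * (\<phi> + M)) * ((h ?m)\<^sup>2 * \<kappa>) ^ Suc n"
    by (intro mult_left_mono) auto
   moreover have "exp (- 2 * \<xi> * (\<phi> + M)) * (h \<phi> * h M) ^ Suc n = wt n \<xi> \<phi> * wt n \<xi> M"
   proof -
    have "exp (- 2 * \<xi> * (\<phi> + M)) = exp (- 2 * \<xi> * \<phi>) * exp (- 2 * \<xi> * M)"
     by (simp add: exp_add[symmetric] algebra_simps)
    then show ?thesis unfolding wt_def power_mult_distrib by (simp only: mult_ac)
   qed
   moreover have "exp (- 2 * \<xi> * (\<phi> + M)) * ((h ?m)\<^sup>2 * \<kappa>) ^ Suc n = wt n \<xi> ?m * wt n \<xi> ?m * \<kappa> ^ Suc n"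
   proof -
    have "exp (- 2 * \<xi> * (\<phi> + M)) = exp (- 2 * \<xi> * ?m) * exp (- 2 * \<xi> * ?m)"
     by (simp add: exp_add[symmetric] algebra_simps)
    then show ?thesis unfolding wt_def power_mult_distrib power2_eq_square by (simp only: mult_ac)
   qed
   ultimately have "wt n \<xi> \<phi> * wt n \<xi> M \<le> wt n \<xi> ?m * wt n \<xi> ?m * \<kappa> ^ Suc n" by (simp only:)
   also have "\<dots> \<le> wt n \<xi> ?m * wt n \<xi> M * \<kappa> ^ Suc n"
    using M(2)[OF m] wt_nonneg[of ?m n \<xi>] m \<kappa> by (intro mult_right_mono mult_left_mono) auto
   finally have "wt n \<xi> \<phi> * wt n \<xi> M \<le> (\<kappa> ^ Suc n * wt n \<xi> ?m) * wt n \<xi> M" by (simp only: mult_ac)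
   then show ?thesis using wM by (simp only: mult_le_cancel_right_pos)
  qed
  define f where "f \<phi> = indicator {\<alpha>..\<beta>} \<phi> * wt n \<xi> \<phi>" for \<phi>
  have fint: "integrable lborel f" using wt_integrable[of n \<xi>] by (simp add: set_integrable_def f_def[abs_def])
  have fint2: "integrable lborel (\<lambda>\<phi>. f (M/2 + (1/2) * \<phi>))"
   by (rule lborel_integrable_real_affine[OF fint]) simp
  have f2: "(\<integral>\<phi>. f \<phi> \<partial>lborel) = \<bar>1/2\<bar> *\<^sub>R (\<integral>\<phi>. f (M/2 + (1/2) * \<phi>) \<partial>lborel)"
   by (rule lborel_integral_real_affine) simp
  have "(LINT \<phi>:{\<alpha>..\<beta>}|lborel. indicator J \<phi> * wt n \<xi> \<phi>) \<le> (\<integral>\<phi>. \<kappa> ^ Suc n * f (M/2 + (1/2) * \<phi>) \<partial>lborel)"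
   unfolding set_lebesgue_integral_def
  proof (rule integral_mono)
   show "integrable lborel (\<lambda>\<phi>. indicator {\<alpha>..\<beta>} \<phi> *\<^sub>R (indicator J \<phi> * wt n \<xi> \<phi>))"
    using indicator_wt_integrable[of J n \<xi>] by (simp add: set_integrable_def J_def)
   show "integrable lborel (\<lambda>\<phi>. \<kappa> ^ Suc n * f (M/2 + (1/2) * \<phi>))" using fint2 by (rule integrable_mult_right)
   fix \<phi> :: real
   show "indicator {\<alpha>..\<beta>} \<phi> *\<^sub>R (indicator J \<phi> * wt n \<xi> \<phi>) \<le> \<kappa> ^ Suc n * f (M/2 + (1/2) * \<phi>)"
   proof (cases "\<phi> \<in> {\<alpha>..\<beta>} \<and> \<phi> \<in> J")
    case True
    then have "(\<phi> + M) / 2 \<in> {\<alpha>..\<beta>}" using M(1) by auto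
    moreover have eq: "M/2 + (1/2) * \<phi> = (\<phi> + M) / 2" by (simp add: field_simps)
    ultimately show ?thesis using pt[of \<phi>] True unfolding eq f_def by simp
   next
    case False
    have "0 \<le> f (M/2 + (1/2) * \<phi>)" unfolding f_def using wt_nonneg by (auto simp: indicator_def)
    then show ?thesis using False \<kappa>(1) by (auto simp: indicator_def)
   qed
  qed
  also have "\<dots> = \<kappa> ^ Suc n * (2 * Gr n \<xi>)"
   using f2 by (simp add: Gr_def f_def[abs_def] set_lebesgue_integral_def)
  also have "\<dots> \<le> (1/10) * (2 * Gr n \<xi>)"
   using n0[of "Suc n"] n Gr_pos[of n \<xi>] by (intro mult_right_mono) auto
  finally have "(LINT \<phi>:{\<alpha>..\<beta>}|lborel. indicator {\<phi>. e \<le> \<bar>\<phi> - M\<bar>} \<phi> * wt n \<xi> \<phi>) \<le> Gr n \<xi> / 5" by (simp add: J_def)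
  moreover have "\<bar>\<eta>\<bar> * e \<le> 1/4" using mult_right_mono[OF \<eta>, of e] e by linarith
  ultimately show "Gr n \<xi> / 2 \<le> cmod (G n (Complex \<xi> \<eta>))" by (rule G_lower_concentrated)
 qed
qed

text \<open>For fixed \<open>n\<close> and large \<open>\<bar>\<xi>\<bar>\<close> the weight is concentrated near the end point \<open>M\<close> of the
 interval at which the exponential is largest.\<close>

lemma G_lower_large_xi:
 assumes "E \<ge> 0"
 obtains R where "\<And>\<xi> \<eta>. \<bar>\<xi>\<bar> \<ge> R ==> \<bar>\<eta>\<bar> \<le> E ==> Gr n \<xi> / 2 \<le> cmod (G n (Complex \<xi> \<eta>))"
proof -
 define e where "e = min (1 / (4 * (E + 1))) (\<beta> - \<alpha>)"
 have "1 / (4 * (E + 1)) > 0" using assms by simp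
 then have e: "e > 0" "e \<le> \<beta> - \<alpha>" "e \<le> 1 / (4 * (E + 1))" using ab by (auto simp: e_def)
 have "E * e \<le> E * (1 / (4 * (E + 1)))" using e(3) assms by (rule mult_left_mono)
 also have "\<dots> \<le> 1/4" using assms by (simp add: field_simps)
 finally have eE: "E * e \<le> 1/4" .
 obtain H where H: "H > 0" "\<And>\<phi>. \<alpha> \<le> \<phi> ==> \<phi> \<le> \<beta> ==> h \<phi> \<le> H" by (rule h_upper) blast
 have side: "\<exists>R. \<forall>\<xi> \<eta>. \<bar>\<xi>\<bar> \<ge> R \<longrightarrow> P \<xi> \<longrightarrow> \<bar>\<eta>\<bar> \<le> E \<longrightarrow> Gr n \<xi> / 2 \<le> cmod (G n (Complex \<xi> \<eta>))"
  if cd: "\<alpha> < c" "c < d" "d < \<beta>" "\<And>\<phi>. c \<le> \<phi> ==> \<phi> \<le> d ==> \<bar>\<phi> - M\<bar> \<le> e / 2"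
   and P: "\<And>\<xi> \<phi>. P \<xi> ==> \<phi> \<in> {\<alpha>..\<beta>} ==> \<xi> * (\<phi> - M) = \<bar>\<xi>\<bar> * \<bar>\<phi> - M\<bar>" for M c d P
 proof -
  obtain hm where hm: "hm > 0" "\<And>\<phi>. c \<le> \<phi> ==> \<phi> \<le> d ==> hm \<le> h \<phi>"
   using compact_subinterval_min[of c d] cd by auto
  define K where "K = (\<beta> - \<alpha>) * H ^ Suc n / ((d - c) * hm ^ Suc n)"
  have K: "K > 0" using ab H(1) hm(1) cd by (simp add: K_def)
  have "((\<lambda>x. K * exp (- e * x)) \<longlongrightarrow> 0) at_top" using e(1) by real_asymp
  then have "eventually (\<lambda>x. K * exp (- e * x) < 1/5) at_top" by (rule order_tendstoD) simp
  then obtain R where R: "\<And>x. x \<ge> R ==> K * exp (- e * x) < 1/5" by (auto simp: eventually_at_top_linorder)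
  have "Gr n \<xi> / 2 \<le> cmod (G n (Complex \<xi> \<eta>))" if \<xi>: "\<bar>\<xi>\<bar> \<ge> R" "P \<xi>" and \<eta>: "\<bar>\<eta>\<bar> \<le> E" for \<xi> \<eta>
  proof (rule G_lower_concentrated)
   define J where "J = {\<phi>. e \<le> \<bar>\<phi> - M\<bar>}"
   define X where "X = exp (- 2 * \<xi> * M)"
   have X: "exp (- 2 * \<xi> * \<phi>) = X * exp (- 2 * (\<bar>\<xi>\<bar> * \<bar>\<phi> - M\<bar>))" if "\<phi> \<in> {\<alpha>..\<beta>}" for \<phi>
   proof -
    have "- 2 * \<xi> * \<phi> = - 2 * \<xi> * M + (- 2 * (\<xi> * (\<phi> - M)))" by (simp add: algebra_simps)
    then show ?thesis unfolding X_def P[OF \<xi>(2) that] by (simp only: exp_add)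
   qed
   have "(LINT \<phi>:{\<alpha>..\<beta>}|lborel. indicator J \<phi> * wt n \<xi> \<phi>)
     \<le> (\<integral>\<phi>. indicator {\<alpha>..\<beta>} \<phi> * (X * exp (- 2 * (\<bar>\<xi>\<bar> * e)) * H ^ Suc n) \<partial>lborel)"
    unfolding set_lebesgue_integral_def
   proof (rule integral_mono)
    show "integrable lborel (\<lambda>\<phi>. indicator {\<alpha>..\<beta>} \<phi> *\<^sub>R (indicator J \<phi> * wt n \<xi> \<phi>))"
     using indicator_wt_integrable[of J n \<xi>] by (simp add: set_integrable_def J_def)
    show "integrable lborel (\<lambda>\<phi>. indicator {\<alpha>..\<beta>} \<phi> * (X * exp (- 2 * (\<bar>\<xi>\<bar> * e)) * H ^ Suc n))"
     by (rule integrable_indicator_Icc)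
    fix \<phi> :: real
    show "indicator {\<alpha>..\<beta>} \<phi> *\<^sub>R (indicator J \<phi> * wt n \<xi> \<phi>)
      \<le> indicator {\<alpha>..\<beta>} \<phi> * (X * exp (- 2 * (\<bar>\<xi>\<bar> * e)) * H ^ Suc n)"
    proof (cases "\<phi> \<in> {\<alpha>..\<beta>} \<and> \<phi> \<in> J")
     case True
     then have p: "\<phi> \<in> {\<alpha>..\<beta>}" "e \<le> \<bar>\<phi> - M\<bar>" by (auto simp: J_def)
     have "\<bar>\<xi>\<bar> * e \<le> \<bar>\<xi>\<bar> * \<bar>\<phi> - M\<bar>" using p by (intro mult_left_mono) auto
     then have "exp (- 2 * (\<bar>\<xi>\<bar> * \<bar>\<phi> - M\<bar>)) \<le> exp (- 2 * (\<bar>\<xi>\<bar> * e))" by simp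
     then have "wt n \<xi> \<phi> \<le> X * exp (- 2 * (\<bar>\<xi>\<bar> * e)) * H ^ Suc n"
      unfolding wt_def X[OF p(1)] using H p h_nonneg[of \<phi>]
      by (intro mult_mono power_mono mult_left_mono) (auto simp: X_def)
     then show ?thesis using True by simp
    next
     case False
     then show ?thesis using H(1) by (auto simp: indicator_def X_def)
    qed
   qed
   also have "\<dots> = (\<beta> - \<alpha>) * (X * exp (- 2 * (\<bar>\<xi>\<bar> * e)) * H ^ Suc n)" using ab by simp
   also have "\<dots> = K * exp (- e * \<bar>\<xi>\<bar>) * ((d - c) * (X * exp (- (\<bar>\<xi>\<bar> * e)) * hm ^ Suc n))"
   proof -
    have "exp (- 2 * (\<bar>\<xi>\<bar> * e)) = exp (- e * \<bar>\<xi>\<bar>) * exp (- (\<bar>\<xi>\<bar> * e))"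
     by (simp add: exp_add[symmetric])
    moreover have "K * ((d - c) * hm ^ Suc n) = (\<beta> - \<alpha>) * H ^ Suc n" using cd hm(1) by (simp add: K_def)
    ultimately have "(\<beta> - \<alpha>) * H ^ Suc n * (X * exp (- 2 * (\<bar>\<xi>\<bar> * e)))
      = K * ((d - c) * hm ^ Suc n) * (X * (exp (- e * \<bar>\<xi>\<bar>) * exp (- (\<bar>\<xi>\<bar> * e))))" by simp
    then show ?thesis by (simp only: mult_ac)
   qed
   also have "\<dots> \<le> K * exp (- e * \<bar>\<xi>\<bar>) * Gr n \<xi>"
   proof (rule mult_left_mono)
    show "(d - c) * (X * exp (- (\<bar>\<xi>\<bar> * e)) * hm ^ Suc n) \<le> Gr n \<xi>"
    proof (rule Gr_lower)
     fix \<phi> assume p: "c \<le> \<phi>" "\<phi> \<le> d"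
     have p': "\<phi> \<in> {\<alpha>..\<beta>}" using p cd by auto
     have "\<bar>\<xi>\<bar> * \<bar>\<phi> - M\<bar> \<le> \<bar>\<xi>\<bar> * (e / 2)" using cd(4)[OF p] by (intro mult_left_mono) auto
     then have "exp (- (\<bar>\<xi>\<bar> * e)) \<le> exp (- 2 * (\<bar>\<xi>\<bar> * \<bar>\<phi> - M\<bar>))" by simp
     then show "X * exp (- (\<bar>\<xi>\<bar> * e)) * hm ^ Suc n \<le> wt n \<xi> \<phi>"
      unfolding wt_def X[OF p'] using hm(1) hm(2)[OF p]
      by (intro mult_mono power_mono mult_left_mono) (auto simp: X_def)
    qed (use cd in auto)
   qed (use K in auto)
   also have "\<dots> \<le> (1/5) * Gr n \<xi>" using R[OF \<xi>(1)] Gr_pos[of n \<xi>] by (intro mult_right_mono) auto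
   finally show "(LINT \<phi>:{\<alpha>..\<beta>}|lborel. indicator {\<phi>. e \<le> \<bar>\<phi> - M\<bar>} \<phi> * wt n \<xi> \<phi>) \<le> Gr n \<xi> / 5"
    by (simp add: J_def)
   show "\<bar>\<eta>\<bar> * e \<le> 1/4" using mult_right_mono[OF \<eta>, of e] e(1) eE by linarith
  qed
  then show ?thesis by blast
 qed
 have "\<exists>R. \<forall>\<xi> \<eta>. \<bar>\<xi>\<bar> \<ge> R \<longrightarrow> \<xi> \<ge> 0 \<longrightarrow> \<bar>\<eta>\<bar> \<le> E \<longrightarrow> Gr n \<xi> / 2 \<le> cmod (G n (Complex \<xi> \<eta>))"
  by (rule side[of "\<alpha> + e/4" "\<alpha> + e/2" \<alpha>]) (use e ab in auto)
 then obtain R1 where R1: "\<And>\<xi> \<eta>. \<bar>\<xi>\<bar> \<ge> R1 ==> \<xi> \<ge> 0 ==> \<bar>\<eta>\<bar> \<le> E ==> Gr n \<xi> / 2 \<le> cmod (G n (Complex \<xi> \<eta>))"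
  by blast
 have "\<exists>R. \<forall>\<xi> \<eta>. \<bar>\<xi>\<bar> \<ge> R \<longrightarrow> \<xi> \<le> 0 \<longrightarrow> \<bar>\<eta>\<bar> \<le> E \<longrightarrow> Gr n \<xi> / 2 \<le> cmod (G n (Complex \<xi> \<eta>))"
 proof (rule side[of "\<beta> - e/2" "\<beta> - e/4" \<beta>])
  fix \<xi> \<phi> :: real assume "\<xi> \<le> 0" "\<phi> \<in> {\<alpha>..\<beta>}"
  then have a: "\<bar>\<xi>\<bar> = - \<xi>" "\<bar>\<phi> - \<beta>\<bar> = - (\<phi> - \<beta>)"
   using abs_of_nonpos[of \<xi>] abs_of_nonpos[of "\<phi> - \<beta>"] by simp_all
  show "\<xi> * (\<phi> - \<beta>) = \<bar>\<xi>\<bar> * \<bar>\<phi> - \<beta>\<bar>" unfolding a by (simp only: minus_mult_minus)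
 qed (use e ab in auto)
 then obtain R2 where R2: "\<And>\<xi> \<eta>. \<bar>\<xi>\<bar> \<ge> R2 ==> \<xi> \<le> 0 ==> \<bar>\<eta>\<bar> \<le> E ==> Gr n \<xi> / 2 \<le> cmod (G n (Complex \<xi> \<eta>))"
  by blast
 show ?thesis
 proof (rule that[of "max R1 R2"])
  fix \<xi> \<eta> assume "max R1 R2 \<le> \<bar>\<xi>\<bar>" "\<bar>\<eta>\<bar> \<le> E"
  then show "Gr n \<xi> / 2 \<le> cmod (G n (Complex \<xi> \<eta>))" using R1[of \<xi> \<eta>] R2[of \<xi> \<eta>] by (cases "\<xi> \<ge> 0") auto
 qed
qed

lemma G_nonzero_small:
 assumes "\<bar>Im l\<bar> * (\<beta> - \<alpha>) < pi / 2"
 shows "G n l \<noteq> 0"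
proof -
 have "\<bar>Im l * (\<beta> - \<alpha>)\<bar> < pi / 2" using assms ab by (simp add: abs_mult)
 then have "0 < cos (Im l * (\<beta> - \<alpha>))" by (intro cos_gt_zero_pi) (auto simp: abs_less_iff)
 then have "0 < cos (Im l * (\<beta> - \<alpha>)) * Gr n (Re l)" using Gr_pos by (rule mult_pos_pos)
 also have "\<dots> \<le> cmod (G n (Complex (Re l) (Im l)))" using assms by (intro G_lower_small) auto
 finally show ?thesis by auto
qed

lemma G_not_constant_zero: "\<exists>l. G n l = 0 ==> \<not> G n constant_on UNIV"
 using G_of_real[of n 0] Gr_pos[of n 0] by (auto simp: constant_on_def) (metis of_real_eq_0_iff less_irrefl of_real_0)

lemma finite_zeros: "finite {l. G n l = 0 \<and> \<bar>Im l\<bar> \<le> E}"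
proof (cases "E \<ge> 0 \<and> (\<exists>l. G n l = 0)")
 case True
 then have E: "E \<ge> 0" by simp
 obtain R where R: "\<And>\<xi> \<eta>. \<bar>\<xi>\<bar> \<ge> R ==> \<bar>\<eta>\<bar> \<le> E ==> Gr n \<xi> / 2 \<le> cmod (G n (Complex \<xi> \<eta>))"
  using G_lower_large_xi[OF E] by blast
 let ?K = "cbox (Complex (-R) (-E)) (Complex R E)"
 have "finite {l \<in> ?K. G n l = 0}"
  using True by (intro holomorphic_compact_finite_zeros[OF G_holomorphic] G_not_constant_zero) auto
 moreover have "{l. G n l = 0 \<and> \<bar>Im l\<bar> \<le> E} \<subseteq> {l \<in> ?K. G n l = 0}"
 proof safe
  fix l assume l: "G n l = 0" "\<bar>Im l\<bar> \<le> E"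
  then have "\<not> R \<le> \<bar>Re l\<bar>" using R[of "Re l" "Im l"] Gr_pos[of n "Re l"] by auto
  then show "l \<in> ?K" using l by (auto simp: in_cbox_complex_iff abs_le_iff)
 qed
 ultimately show ?thesis by (rule rev_finite_subset)
next
 case False
 then have "{l. G n l = 0 \<and> \<bar>Im l\<bar> \<le> E} = {}" by (auto dest: order_trans[OF abs_ge_zero])
 then show ?thesis by (simp only: finite.emptyI)
qed

text \<open>These zeros become the poles that are crossed when the contour of \<open>kker\<close> is pushed downwards.\<close>

definition Z :: "nat \<Rightarrow> complex set" where "Z n = {l. G n l = 0 \<and> Im l < 0}"

text \<open>The source of the bound \<open>Re \<gamma> > - 1 - n / 2\<close> on the exponents.\<close>

lemma Z_Im: "l \<in> Z n ==> Im l < - 1/2"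
proof (rule ccontr)
 assume l: "l \<in> Z n" "\<not> Im l < - 1/2"
 then have "\<bar>Im l\<bar> \<le> 1/2" by (auto simp: Z_def)
 then have "\<bar>Im l\<bar> * (\<beta> - \<alpha>) \<le> 1/2 * (\<beta> - \<alpha>)" using ab by (intro mult_right_mono) auto
 also have "\<dots> < pi / 2" using ab by simp
 finally show False using G_nonzero_small[of l n] l by (simp add: Z_def)
qed

text \<open>Large \<open>n\<close> contribute no zeros by \<open>G_lower_large_n\<close>, and each remaining \<open>n\<close> finitely many by
 \<open>G_lower_large_xi\<close>.\<close>

lemma finite_Z_all: "finite {(n, l). l \<in> Z n \<and> - E \<le> Im l}"
proof -
 obtain n0 where n0: "\<And>n \<xi> \<eta>. n \<ge> n0 ==> \<bar>\<eta>\<bar> \<le> \<bar>E\<bar> ==> Gr n \<xi> / 2 \<le> cmod (G n (Complex \<xi> \<eta>))"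
  using G_lower_large_n[of "\<bar>E\<bar>"] by auto
 have "{(n, l). l \<in> Z n \<and> - E \<le> Im l} \<subseteq> (SIGMA n:{..<n0}. {l. G n l = 0 \<and> \<bar>Im l\<bar> \<le> \<bar>E\<bar>})"
 proof (rule subsetI)
  fix x assume "x \<in> {(n, l). l \<in> Z n \<and> - E \<le> Im l}"
  then obtain n l where x: "x = (n, l)" and l: "l \<in> Z n" "- E \<le> Im l" by auto
  then have E: "\<bar>Im l\<bar> \<le> \<bar>E\<bar>" "G n l = 0" by (auto simp: Z_def)
  then have "\<not> n0 \<le> n" using n0[of n "Im l" "Re l"] Gr_pos[of n "Re l"] by auto
  then show "x \<in> (SIGMA n:{..<n0}. {l. G n l = 0 \<and> \<bar>Im l\<bar> \<le> \<bar>E\<bar>})" using E x by auto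
 qed
 moreover have "finite (SIGMA n:{..<n0}. {l. G n l = 0 \<and> \<bar>Im l\<bar> \<le> \<bar>E\<bar>})"
  by (intro finite_SigmaI finite_zeros) auto
 ultimately show ?thesis by (rule finite_subset)
qed

lemma zero_free_line:
 assumes E0: "E0 > 0"
 obtains E where "E0 < E" "\<And>n l. G n l = 0 ==> Im l \<noteq> - E"
proof -
 have "finite ((\<lambda>(n, l). - Im l) ` {(n, l). l \<in> Z n \<and> - (E0 + 1) \<le> Im l})" (is "finite ?F")
  by (intro finite_imageI finite_Z_all)
 then have "infinite ({E0<..<E0 + 1} - ?F)" by (intro Diff_infinite_finite) (auto simp: infinite_Ioo)
 then have "{E0<..<E0 + 1} - ?F \<noteq> {}" by (rule infinite_imp_nonempty)
 then obtain E where E: "E \<in> {E0<..<E0 + 1} - ?F" by blast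
 show thesis
 proof (rule that[of E])
  show "E0 < E" using E by auto
  fix n l assume l0: "G n l = 0"
  show "Im l \<noteq> - E"
  proof
   assume "Im l = - E"
   then have "(n, l) \<in> {(n, l). l \<in> Z n \<and> - (E0 + 1) \<le> Im l}" "- Im l = E"
    using E l0 E0 by (auto simp: Z_def)
   then have "E \<in> ?F" by (force simp: image_iff)
   then show False using E by auto
  qed
 qed
qed

text \<open>Large \<open>n\<close> and large \<open>\<bar>\<xi>\<bar>\<close> are covered by concentration; what remains is compact and free of zeros.\<close>

lemma G_lower_line:
 assumes nz: "\<And>n l. G n l = 0 ==> Im l \<noteq> y"
 obtains c where "c > 0" "\<And>n \<xi>. c * Gr n \<xi> \<le> cmod (G n (Complex \<xi> y))"
proof -
 obtain n0 where n0: "\<And>n \<xi> \<eta>. n \<ge> n0 ==> \<bar>\<eta>\<bar> \<le> \<bar>y\<bar> ==> Gr n \<xi> / 2 \<le> cmod (G n (Complex \<xi> \<eta>))"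
  using G_lower_large_n[of "\<bar>y\<bar>"] by auto
 have ex: "\<exists>c>0. \<forall>\<xi>. c * Gr n \<xi> \<le> cmod (G n (Complex \<xi> y))" for n
 proof -
  obtain R where R: "\<And>\<xi> \<eta>. \<bar>\<xi>\<bar> \<ge> R ==> \<bar>\<eta>\<bar> \<le> \<bar>y\<bar> ==> Gr n \<xi> / 2 \<le> cmod (G n (Complex \<xi> \<eta>))"
   using G_lower_large_xi[of "\<bar>y\<bar>" n] by auto
  define F where "F \<xi> = cmod (G n (Complex \<xi> y)) / Gr n \<xi>" for \<xi>
  have "continuous_on {-\<bar>R\<bar>..\<bar>R\<bar>} F"
   unfolding F_def Complex_eq using Gr_pos[of n]
   by (intro continuous_intros Gr_cont continuous_on_compose2[OF G_cont[of UNIV]]) (auto simp: less_imp_neq[symmetric])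
  then obtain x where x: "\<forall>\<xi>\<in>{-\<bar>R\<bar>..\<bar>R\<bar>}. F x \<le> F \<xi>"
   using continuous_attains_inf[of "{-\<bar>R\<bar>..\<bar>R\<bar>}" F] by auto
  have "G n (Complex x y) \<noteq> 0" using nz[of n "Complex x y"] by auto
  then have Fx: "F x > 0" unfolding F_def using Gr_pos[of n x] by (intro divide_pos_pos) auto
  have "min (1/2) (F x) * Gr n \<xi> \<le> cmod (G n (Complex \<xi> y))" for \<xi>
  proof (cases "\<bar>\<xi>\<bar> \<ge> R")
   case True
   have "min (1/2) (F x) * Gr n \<xi> \<le> 1/2 * Gr n \<xi>" using Gr_pos[of n \<xi>] by (intro mult_right_mono) auto
   then show ?thesis using R[OF True, of y] by simp
  next
   case False
   then have "\<xi> \<in> {-\<bar>R\<bar>..\<bar>R\<bar>}" by (simp only: atLeastAtMost_iff) linarith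
   then have "F x \<le> F \<xi>" using x by blast
   then have "min (1/2) (F x) * Gr n \<xi> \<le> F \<xi> * Gr n \<xi>" using Gr_pos[of n \<xi>] by (intro mult_right_mono) auto
   then show ?thesis using Gr_pos[of n \<xi>] by (simp add: F_def)
  qed
  then show ?thesis using Fx by (intro exI[of _ "min (1/2) (F x)"]) auto
 qed
 then obtain c where c: "\<And>n. c n > 0" "\<And>n \<xi>. c n * Gr n \<xi> \<le> cmod (G n (Complex \<xi> y))" by metis
 define c' where "c' = Min (insert (1/2) (c ` {..<n0}))"
 have "c' > 0" using c(1) unfolding c'_def by (subst Min_gr_iff) auto
 moreover have "c' \<le> 1/2" unfolding c'_def by (rule Min_le) auto
 moreover have "c' \<le> c n" if "n < n0" for n unfolding c'_def using that by (intro Min_le) auto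
 ultimately have c': "c' > 0" "c' \<le> 1/2" "\<And>n. n < n0 ==> c' \<le> c n" by auto
 show ?thesis
 proof (rule that[OF c'(1)])
  fix n \<xi>
  show "c' * Gr n \<xi> \<le> cmod (G n (Complex \<xi> y))"
  proof (cases "n < n0")
   case True
   have "c' * Gr n \<xi> \<le> c n * Gr n \<xi>" using c'(3)[OF True] Gr_pos[of n \<xi>] by (intro mult_right_mono) auto
   then show ?thesis using c(2)[of n \<xi>] by linarith
  next
   case False
   have "c' * Gr n \<xi> \<le> 1/2 * Gr n \<xi>" using c'(2) Gr_pos[of n \<xi>] by (intro mult_right_mono) auto
   then show ?thesis using n0[of n y \<xi>] False by simp
  qed
 qed
qed

end

section \<open>The kernel of the weighted Bergman space on a strip\<close>

context strip_weight
begin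

text \<open>Up to a factor \<open>2 \<pi>\<close>, \<open>kker n 0 (\<sigma> - cnj \<sigma>')\<close> is the reproducing kernel of the holomorphic
 functions on the strip that are square integrable with respect to the weight \<open>h ^ Suc n\<close>. The
 Gaussian factor with \<open>\<epsilon> > 0\<close> regularises the inverse Fourier transform.\<close>

definition Fk :: "nat \<Rightarrow> real \<Rightarrow> complex \<Rightarrow> complex \<Rightarrow> complex" where
 "Fk n \<epsilon> \<tau> l = exp (\<i> * l * \<tau> - of_real \<epsilon> * l\<^sup>2 / 2) / G n l"

definition kker :: "nat \<Rightarrow> real \<Rightarrow> complex \<Rightarrow> complex" where
 "kker n \<epsilon> \<tau> = (\<integral>\<xi>. Fk n \<epsilon> \<tau> (of_real \<xi>) \<partial>lborel)"

lemma cmod_Fk: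
 "cmod (Fk n \<epsilon> \<tau> (Complex x y)) = exp (- 2 * x * (Im \<tau> / 2)) * exp (- y * Re \<tau>) * exp (- \<epsilon> * (x\<^sup>2 - y\<^sup>2) / 2) / cmod (G n (Complex x y))"
proof -
 have "Re (\<i> * Complex x y * \<tau> - of_real \<epsilon> * (Complex x y)\<^sup>2 / 2) = - 2 * x * (Im \<tau> / 2) + (- y * Re \<tau>) + (- \<epsilon> * (x\<^sup>2 - y\<^sup>2) / 2)"
  by (simp add: power2_eq_square field_simps)
 then show ?thesis unfolding Fk_def norm_divide norm_exp_eq_Re by (simp only: exp_add)
qed

lemma cmod_Fk_le:
 assumes "0 \<le> \<epsilon>" "\<epsilon> \<le> 1" "c > 0" "c * Gr n x \<le> cmod (G n (Complex x y))"
 shows "cmod (Fk n \<epsilon> \<tau> (Complex x y)) \<le> exp (- 2 * x * (Im \<tau> / 2)) / Gr n x * (exp (- y * Re \<tau>) * exp (y\<^sup>2 / 2) / c)"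
proof -
 have "\<epsilon> * (y\<^sup>2 - x\<^sup>2) \<le> \<epsilon> * y\<^sup>2" using assms(1) by (intro mult_left_mono) auto
 also have "\<dots> \<le> 1 * y\<^sup>2" using assms(2) by (intro mult_right_mono) auto
 finally have "- \<epsilon> * (x\<^sup>2 - y\<^sup>2) / 2 \<le> y\<^sup>2 / 2" by (simp add: algebra_simps)
 then have 1: "exp (- \<epsilon> * (x\<^sup>2 - y\<^sup>2) / 2) \<le> exp (y\<^sup>2 / 2)" by (simp only: exp_le_cancel_iff)
 have pos: "c * Gr n x > 0" using assms(3) Gr_pos by simp
 have "cmod (Fk n \<epsilon> \<tau> (Complex x y)) \<le> exp (- 2 * x * (Im \<tau> / 2)) * exp (- y * Re \<tau>) * exp (y\<^sup>2 / 2) / (c * Gr n x)"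
  unfolding cmod_Fk using 1 assms(4) pos by (intro frac_le mult_left_mono) auto
 then show ?thesis by (simp add: field_simps)
qed

text \<open>The gain of \<open>core_bound\<close> makes the integrals summable over \<open>n\<close> after multiplication by
 \<open>(k h) ^ n\<close>, uniformly in the horizontal line of integration.\<close>

lemma line_integral_bound:
 assumes a: "\<alpha> < a" "a \<le> b" "b < \<beta>" and k: "0 < k" "k < 1"
 obtains C \<theta> where "C > 0" "0 < \<theta>" "\<theta> < 1"
  "\<And>n \<epsilon> y c \<tau>. \<lbrakk>0 \<le> \<epsilon>; \<epsilon> \<le> 1; c > 0; \<And>\<xi>. c * Gr n \<xi> \<le> cmod (G n (Complex \<xi> y)); a \<le> Im \<tau> / 2; Im \<tau> / 2 \<le> b\<rbrakk> \<Longrightarrow>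
   (k * h (Im \<tau> / 2)) ^ n * cmod (\<integral>\<xi>. Fk n \<epsilon> \<tau> (Complex \<xi> y) \<partial>lborel) \<le> C * \<theta> ^ n * (exp (- y * Re \<tau>) * exp (y\<^sup>2 / 2) / c)"
proof -
 obtain C \<theta> \<delta> where C: "C > 0" "0 < \<theta>" "\<theta> < 1" "\<delta> > 0"
  "\<And>n \<xi> \<phi>. a \<le> \<phi> ==> \<phi> \<le> b ==> (k * h \<phi>) ^ n * exp (- 2 * \<xi> * \<phi>) \<le> C * \<theta> ^ n * exp (- \<delta> * \<bar>\<xi>\<bar>) * Gr n \<xi>"
  by (rule core_bound[OF a k]) blast
 note ie = integrable_exp_abs[OF C(4)]
 define I where "I = (\<integral>\<xi>. exp (- \<delta> * \<bar>\<xi>\<bar>) \<partial>lborel)"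
 have I0: "I \<ge> 0" unfolding I_def by (intro integral_nonneg_AE) simp
 show ?thesis
 proof (rule that[of "C * (I + 1)" \<theta>])
  fix n and \<epsilon> y c :: real and \<tau>
  assume eps: "0 \<le> \<epsilon>" "\<epsilon> \<le> 1" and c: "c > 0" "\<And>\<xi>. c * Gr n \<xi> \<le> cmod (G n (Complex \<xi> y))"
   and \<tau>: "a \<le> Im \<tau> / 2" "Im \<tau> / 2 \<le> b"
  define D where "D = exp (- y * Re \<tau>) * exp (y\<^sup>2 / 2) / c"
  define K where "K = (k * h (Im \<tau> / 2)) ^ n"
  have D: "D > 0" using c(1) by (simp add: D_def)
  have K: "K \<ge> 0" unfolding K_def using k h_nonneg[of "Im \<tau> / 2"] \<tau> a by simp
  have pt: "K * cmod (Fk n \<epsilon> \<tau> (Complex \<xi> y)) \<le> C * \<theta> ^ n * D * exp (- \<delta> * \<bar>\<xi>\<bar>)" for \<xi>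
  proof -
   have "K * cmod (Fk n \<epsilon> \<tau> (Complex \<xi> y)) \<le> K * (exp (- 2 * \<xi> * (Im \<tau> / 2)) / Gr n \<xi> * D)"
    unfolding D_def using K by (intro mult_left_mono cmod_Fk_le eps c)
   also have "\<dots> = (K * exp (- 2 * \<xi> * (Im \<tau> / 2))) / Gr n \<xi> * D" by simp
   also have "\<dots> \<le> (C * \<theta> ^ n * exp (- \<delta> * \<bar>\<xi>\<bar>) * Gr n \<xi>) / Gr n \<xi> * D"
    unfolding K_def using D Gr_pos[of n \<xi>] C(5)[OF \<tau>] by (intro mult_right_mono divide_right_mono) auto
   also have "\<dots> = C * \<theta> ^ n * D * exp (- \<delta> * \<bar>\<xi>\<bar>)" using Gr_pos[of n \<xi>] by simp
   finally show ?thesis .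
  qed
  have "K * cmod (\<integral>\<xi>. Fk n \<epsilon> \<tau> (Complex \<xi> y) \<partial>lborel) \<le> C * \<theta> ^ n * D * I"
  proof (cases "integrable lborel (\<lambda>\<xi>. Fk n \<epsilon> \<tau> (Complex \<xi> y))")
   case True
   have "cmod (\<integral>\<xi>. of_real K * Fk n \<epsilon> \<tau> (Complex \<xi> y) \<partial>lborel) \<le> (\<integral>\<xi>. C * \<theta> ^ n * D * exp (- \<delta> * \<bar>\<xi>\<bar>) \<partial>lborel)"
    by (rule norm_integral_le) (use True ie pt K in \<open>auto simp: norm_mult\<close>)
   then show ?thesis using K by (simp add: norm_mult I_def)
  next
   case False
   then show ?thesis using C D I0 by (simp add: not_integrable_integral_eq)
  qed
  also have "C * \<theta> ^ n * D * I \<le> C * \<theta> ^ n * D * (I + 1)" using C D by (intro mult_left_mono) auto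
  finally show "(k * h (Im \<tau> / 2)) ^ n * cmod (\<integral>\<xi>. Fk n \<epsilon> \<tau> (Complex \<xi> y) \<partial>lborel)
    \<le> C * (I + 1) * \<theta> ^ n * (exp (- y * Re \<tau>) * exp (y\<^sup>2 / 2) / c)"
   by (simp add: K_def D_def mult_ac)
 qed (use C I0 in auto)
qed

lemma Fk_contour:
 assumes eps: "0 \<le> \<epsilon>" "\<epsilon> \<le> 1" and \<tau>: "\<alpha> < Im \<tau> / 2" "Im \<tau> / 2 < \<beta>" and b: "b0 < b1"
  and nz: "\<And>l. G n l = 0 ==> Im l \<noteq> b0 \<and> Im l \<noteq> b1"
 shows "integrable lborel (\<lambda>x. Fk n \<epsilon> \<tau> (Complex x b0))" "integrable lborel (\<lambda>x. Fk n \<epsilon> \<tau> (Complex x b1))"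
  "(\<integral>x. Fk n \<epsilon> \<tau> (Complex x b0) \<partial>lborel) = (\<integral>x. Fk n \<epsilon> \<tau> (Complex x b1) \<partial>lborel)
   + 2 * pi * \<i> * (\<Sum>p\<in>{l. G n l = 0 \<and> b0 < Im l \<and> Im l < b1}. residue (Fk n \<epsilon> \<tau>) p)"
proof -
 define E where "E = \<bar>b0\<bar> + \<bar>b1\<bar> + 1"
 have E0: "E \<ge> 0" by (simp add: E_def)
 obtain R where R: "\<And>\<xi> \<eta>. \<bar>\<xi>\<bar> \<ge> R ==> \<bar>\<eta>\<bar> \<le> E ==> Gr n \<xi> / 2 \<le> cmod (G n (Complex \<xi> \<eta>))"
  using G_lower_large_xi[OF E0, of n] by blast
 obtain C \<delta> where C: "C > 0" "\<delta> > 0"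
  "\<And>\<xi> \<phi>. Im \<tau> / 2 \<le> \<phi> ==> \<phi> \<le> Im \<tau> / 2 ==> exp (- 2 * \<xi> * \<phi>) \<le> C * exp (- \<delta> * \<bar>\<xi>\<bar>) * Gr n \<xi>"
  by (rule core_bound_fixed[OF \<tau>(1) order_refl \<tau>(2)]) blast
 define D where "D = exp (E * \<bar>Re \<tau>\<bar>) * exp (E\<^sup>2 / 2) * 2"
 define pts where "pts = {l. G n l = 0 \<and> \<bar>Im l\<bar> \<le> E}"
 have bnd: "cmod (Fk n \<epsilon> \<tau> (Complex x y)) \<le> (C * D) * exp (- \<delta> * \<bar>x\<bar>)" if x: "\<bar>x\<bar> \<ge> R" and y: "b0 \<le> y" "y \<le> b1" for x y
 proof -
  have yE: "\<bar>y\<bar> \<le> E" using y by (auto simp: E_def)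
  have "1/2 * Gr n x \<le> cmod (G n (Complex x y))" using R[OF x yE] by simp
  from cmod_Fk_le[OF eps _ this]
  have "cmod (Fk n \<epsilon> \<tau> (Complex x y)) \<le> exp (- 2 * x * (Im \<tau> / 2)) / Gr n x * (exp (- y * Re \<tau>) * exp (y\<^sup>2 / 2) / (1/2))" by simp
  also have "\<dots> \<le> (C * exp (- \<delta> * \<bar>x\<bar>) * Gr n x) / Gr n x * D"
  proof (intro mult_mono divide_right_mono C(3))
   have "- y * Re \<tau> \<le> \<bar>y\<bar> * \<bar>Re \<tau>\<bar>" by (metis abs_ge_self abs_minus_cancel abs_mult mult_minus_left)
   also have "\<dots> \<le> E * \<bar>Re \<tau>\<bar>" using yE by (intro mult_right_mono) auto
   finally have 1: "exp (- y * Re \<tau>) \<le> exp (E * \<bar>Re \<tau>\<bar>)" by (simp only: exp_le_cancel_iff)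
   have "y\<^sup>2 \<le> E\<^sup>2" using yE by (metis abs_of_nonneg E0 abs_le_square_iff)
   then have "exp (y\<^sup>2 / 2) \<le> exp (E\<^sup>2 / 2)" by simp
   with 1 show "exp (- y * Re \<tau>) * exp (y\<^sup>2 / 2) / (1/2) \<le> D"
    unfolding D_def by (simp add: mult_mono)
  qed (use Gr_pos[of n x] C in \<open>auto simp: D_def\<close>)
  also have "\<dots> = (C * D) * exp (- \<delta> * \<bar>x\<bar>)" using Gr_pos[of n x] by simp
  finally show ?thesis .
 qed
 have fin: "finite pts" unfolding pts_def by (rule finite_zeros)
 have pnz: "Im p \<noteq> b0 \<and> Im p \<noteq> b1" if "p \<in> pts" for p using nz that by (simp add: pts_def)
 have hol: "Fk n \<epsilon> \<tau> holomorphic_on {z. b0 - 1 < Im z \<and> Im z < b1 + 1} - pts"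
  unfolding Fk_def
 proof (intro holomorphic_intros)
  show "G n holomorphic_on {z. b0 - 1 < Im z \<and> Im z < b1 + 1} - pts"
   using G_holomorphic by (rule holomorphic_on_subset) auto
  fix z assume "z \<in> {z. b0 - 1 < Im z \<and> Im z < b1 + 1} - pts"
  then show "G n z \<noteq> 0" by (auto simp: pts_def E_def)
 qed auto
 note cs = contour_shift[OF b zero_less_one fin pnz hol C(2) bnd]
 show "integrable lborel (\<lambda>x. Fk n \<epsilon> \<tau> (Complex x b0))" "integrable lborel (\<lambda>x. Fk n \<epsilon> \<tau> (Complex x b1))"
  using cs(1,2) by auto
 have "{p \<in> pts. b0 < Im p \<and> Im p < b1} = {l. G n l = 0 \<and> b0 < Im l \<and> Im l < b1}"
  by (auto simp: pts_def E_def)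
 then show "(\<integral>x. Fk n \<epsilon> \<tau> (Complex x b0) \<partial>lborel) = (\<integral>x. Fk n \<epsilon> \<tau> (Complex x b1) \<partial>lborel)
   + 2 * pi * \<i> * (\<Sum>p\<in>{l. G n l = 0 \<and> b0 < Im l \<and> Im l < b1}. residue (Fk n \<epsilon> \<tau>) p)"
  using cs(3) by simp
qed

lemma no_zeros_half:
 assumes "\<bar>Im l\<bar> \<le> 1/2" shows "G n l \<noteq> 0"
proof (rule G_nonzero_small)
 have "\<bar>Im l\<bar> * (\<beta> - \<alpha>) \<le> 1/2 * (\<beta> - \<alpha>)" using ab assms by (intro mult_right_mono) auto
 also have "\<dots> < pi / 2" using ab by simp
 finally show "\<bar>Im l\<bar> * (\<beta> - \<alpha>) < pi / 2" .
qed

lemma kker_line: "kker n \<epsilon> \<tau> = (\<integral>x. Fk n \<epsilon> \<tau> (Complex x 0) \<partial>lborel)"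
 unfolding kker_def by (simp add: complex_of_real_def)

lemma kker_half:
 assumes "0 \<le> \<epsilon>" "\<epsilon> \<le> 1" "\<alpha> < Im \<tau> / 2" "Im \<tau> / 2 < \<beta>" and s: "s = 1/2 \<or> s = -1/2"
 shows "kker n \<epsilon> \<tau> = (\<integral>x. Fk n \<epsilon> \<tau> (Complex x s) \<partial>lborel)"
proof -
 have nz: "G n l = 0 ==> Im l \<noteq> 0 \<and> Im l \<noteq> 1/2 \<and> Im l \<noteq> -1/2" for l
  using no_zeros_half[of l n] by auto
 have e1: "{l. G n l = 0 \<and> 0 < Im l \<and> Im l < 1/2} = {}"
 proof -
  have "G n l \<noteq> 0" if "0 < Im l" "Im l < 1/2" for l using that by (intro no_zeros_half) auto
  then show ?thesis by blast
 qed
 have e2: "{l. G n l = 0 \<and> -1/2 < Im l \<and> Im l < 0} = {}"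
 proof -
  have "G n l \<noteq> 0" if "-1/2 < Im l" "Im l < 0" for l using that by (intro no_zeros_half) auto
  then show ?thesis by blast
 qed
 from s show ?thesis
 proof
  assume s: "s = 1/2"
  show ?thesis unfolding kker_line s using Fk_contour(3)[OF assms(1-4), of 0 "1/2" n] nz unfolding e1 by simp
 next
  assume s: "s = -1/2"
  have "(\<integral>x. Fk n \<epsilon> \<tau> (Complex x (-1/2)) \<partial>lborel) = (\<integral>x. Fk n \<epsilon> \<tau> (Complex x 0) \<partial>lborel)"
   using Fk_contour(3)[OF assms(1-4), of "-1/2" 0 n] nz unfolding e2 by simp
  then show ?thesis unfolding kker_line s by (rule sym)
 qed
qed

text \<open>Integration over the zero-free lines \<open>Im l = 1/2\<close> and \<open>Im l = - 1/2\<close> produces the two one-sided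
 exponential bounds.\<close>

lemma kker_decay:
 assumes a: "\<alpha> < a" "a \<le> b" "b < \<beta>" and k: "0 < k" "k < 1"
 obtains C \<theta> where "C > 0" "0 < \<theta>" "\<theta> < 1"
  "\<And>n \<epsilon> \<tau>. \<lbrakk>0 \<le> \<epsilon>; \<epsilon> \<le> 1; a \<le> Im \<tau> / 2; Im \<tau> / 2 \<le> b\<rbrakk> \<Longrightarrow>
   (k * h (Im \<tau> / 2)) ^ n * cmod (kker n \<epsilon> \<tau>) \<le> C * \<theta> ^ n * exp (- \<bar>Re \<tau>\<bar> / 2)"
proof -
 obtain C \<theta> where C: "C > 0" "0 < \<theta>" "\<theta> < 1"
  "\<And>n \<epsilon> y c \<tau>. \<lbrakk>0 \<le> \<epsilon>; \<epsilon> \<le> 1; c > 0; \<And>\<xi>. c * Gr n \<xi> \<le> cmod (G n (Complex \<xi> y)); a \<le> Im \<tau> / 2; Im \<tau> / 2 \<le> b\<rbrakk> \<Longrightarrow>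
   (k * h (Im \<tau> / 2)) ^ n * cmod (\<integral>\<xi>. Fk n \<epsilon> \<tau> (Complex \<xi> y) \<partial>lborel) \<le> C * \<theta> ^ n * (exp (- y * Re \<tau>) * exp (y\<^sup>2 / 2) / c)"
  by (rule line_integral_bound[OF a k]) blast
 define c where "c = cos ((\<beta> - \<alpha>) / 2)"
 have c: "c > 0" unfolding c_def using ab by (intro cos_gt_zero) auto
 show ?thesis
 proof (rule that[of "C * exp (1/8) / c" \<theta>])
  fix n and \<epsilon> :: real and \<tau> assume eps: "0 \<le> \<epsilon>" "\<epsilon> \<le> 1" and \<tau>: "a \<le> Im \<tau> / 2" "Im \<tau> / 2 \<le> b"
  define s :: real where "s = (if Re \<tau> \<ge> 0 then 1/2 else -1/2)"
  have s: "s = 1/2 \<or> s = -1/2" "- s * Re \<tau> = - \<bar>Re \<tau>\<bar> / 2" "s\<^sup>2 = 1/4" by (auto simp: s_def power2_eq_square)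
  have "c * Gr n \<xi> \<le> cmod (G n (Complex \<xi> s))" for \<xi>
  proof -
   have "\<bar>s\<bar> * (\<beta> - \<alpha>) \<le> pi / 2" using ab by (auto simp: s_def)
   from G_lower_small[OF this, of n \<xi>] have le: "cos (s * (\<beta> - \<alpha>)) * Gr n \<xi> \<le> cmod (G n (Complex \<xi> s))" .
   have "s * (\<beta> - \<alpha>) = (\<beta> - \<alpha>) / 2 \<or> s * (\<beta> - \<alpha>) = - ((\<beta> - \<alpha>) / 2)"
    using s(1) by (elim disjE) (simp_all add: field_simps)
   then have "cos (s * (\<beta> - \<alpha>)) = c" unfolding c_def by (elim disjE) (simp_all only: cos_minus)
   with le show ?thesis by (simp only:)
  qed
  from C(4)[OF eps c this \<tau>] have "(k * h (Im \<tau> / 2)) ^ n * cmod (\<integral>\<xi>. Fk n \<epsilon> \<tau> (Complex \<xi> s) \<partial>lborel)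
    \<le> C * \<theta> ^ n * (exp (- \<bar>Re \<tau>\<bar> / 2) * exp (1/8) / c)" unfolding s(2,3) by simp
  moreover have "kker n \<epsilon> \<tau> = (\<integral>\<xi>. Fk n \<epsilon> \<tau> (Complex \<xi> s) \<partial>lborel)"
   using \<tau> a by (intro kker_half eps s) auto
  ultimately show "(k * h (Im \<tau> / 2)) ^ n * cmod (kker n \<epsilon> \<tau>) \<le> C * exp (1/8) / c * \<theta> ^ n * exp (- \<bar>Re \<tau>\<bar> / 2)"
   by (simp add: mult_ac)
 qed (use C c in auto)
qed

lemma kker_decay_fixed:
 assumes a: "\<alpha> < a" "a \<le> b" "b < \<beta>"
 obtains C where "C > 0"
  "\<And>\<epsilon> \<tau>. \<lbrakk>0 \<le> \<epsilon>; \<epsilon> \<le> 1; a \<le> Im \<tau> / 2; Im \<tau> / 2 \<le> b\<rbrakk> \<Longrightarrow> cmod (kker n \<epsilon> \<tau>) \<le> C * exp (- \<bar>Re \<tau>\<bar> / 2)"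
proof -
 have half: "0 < (1/2::real)" "(1/2::real) < 1" by auto
 obtain C \<theta> where C: "C > 0" "0 < \<theta>" "\<theta> < 1"
  "\<And>n \<epsilon> \<tau>. \<lbrakk>0 \<le> \<epsilon>; \<epsilon> \<le> 1; a \<le> Im \<tau> / 2; Im \<tau> / 2 \<le> b\<rbrakk> \<Longrightarrow>
   (1/2 * h (Im \<tau> / 2)) ^ n * cmod (kker n \<epsilon> \<tau>) \<le> C * \<theta> ^ n * exp (- \<bar>Re \<tau>\<bar> / 2)"
  by (rule kker_decay[OF a half]) blast
 obtain hm where hm: "hm > 0" "\<And>\<phi>. a \<le> \<phi> ==> \<phi> \<le> b ==> hm \<le> h \<phi>"
  using compact_subinterval_min[OF a] by blast
 show ?thesis
 proof (rule that[of "C * \<theta> ^ n / (1/2 * hm) ^ n"])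
  fix \<epsilon> :: real and \<tau> assume eps: "0 \<le> \<epsilon>" "\<epsilon> \<le> 1" and \<tau>: "a \<le> Im \<tau> / 2" "Im \<tau> / 2 \<le> b"
  have "(1/2 * hm) ^ n * cmod (kker n \<epsilon> \<tau>) \<le> (1/2 * h (Im \<tau> / 2)) ^ n * cmod (kker n \<epsilon> \<tau>)"
   using hm(1) hm(2)[OF \<tau>] by (intro mult_right_mono power_mono) auto
  also have "\<dots> \<le> C * \<theta> ^ n * exp (- \<bar>Re \<tau>\<bar> / 2)" by (rule C(4)[OF eps \<tau>])
  finally have "cmod (kker n \<epsilon> \<tau>) * (1/2 * hm) ^ n \<le> C * \<theta> ^ n * exp (- \<bar>Re \<tau>\<bar> / 2)" by (simp only: mult.commute)
  moreover have "(1/2 * hm) ^ n > 0" using hm(1) by simp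
  ultimately have "cmod (kker n \<epsilon> \<tau>) \<le> C * \<theta> ^ n * exp (- \<bar>Re \<tau>\<bar> / 2) / (1/2 * hm) ^ n"
   by (simp only: pos_le_divide_eq)
  then show "cmod (kker n \<epsilon> \<tau>) \<le> C * \<theta> ^ n / (1/2 * hm) ^ n * exp (- \<bar>Re \<tau>\<bar> / 2)"
   by (simp only: times_divide_eq_left)
 qed (use C hm in auto)
qed

lemma Gr_complex_nonzero: "G n (of_real \<xi>) \<noteq> 0"
 using Gr_pos[of n \<xi>] by (simp add: G_of_real)

lemma Fk_real_dominated:
 assumes a: "\<alpha> < a" "a \<le> b" "b < \<beta>"
 obtains C \<delta> where "C > 0" "\<delta> > 0"
  "\<And>\<epsilon> \<tau> \<xi>. \<lbrakk>0 \<le> \<epsilon>; \<epsilon> \<le> 1; a \<le> Im \<tau> / 2; Im \<tau> / 2 \<le> b\<rbrakk> \<Longrightarrow> cmod (Fk n \<epsilon> \<tau> (of_real \<xi>)) \<le> C * exp (- \<delta> * \<bar>\<xi>\<bar>)"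
proof -
 obtain C \<delta> where C: "C > 0" "\<delta> > 0"
  "\<And>\<xi> \<phi>. a \<le> \<phi> ==> \<phi> \<le> b ==> exp (- 2 * \<xi> * \<phi>) \<le> C * exp (- \<delta> * \<bar>\<xi>\<bar>) * Gr n \<xi>"
  by (rule core_bound_fixed[OF a]) blast
 show ?thesis
 proof (rule that[OF C(1,2)])
  fix \<epsilon> \<tau> \<xi> assume eps: "0 \<le> \<epsilon>" "\<epsilon> \<le> (1::real)" and \<tau>: "a \<le> Im \<tau> / 2" "Im \<tau> / 2 \<le> b"
  have "1 * Gr n \<xi> \<le> cmod (G n (Complex \<xi> 0))"
   using G_of_real[of n \<xi>] Gr_pos[of n \<xi>] by (simp add: complex_of_real_def[symmetric])
  from cmod_Fk_le[OF eps _ this, of \<tau>]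
  have "cmod (Fk n \<epsilon> \<tau> (of_real \<xi>)) \<le> exp (- 2 * \<xi> * (Im \<tau> / 2)) / Gr n \<xi>" by (simp add: complex_of_real_def)
  also have "\<dots> \<le> (C * exp (- \<delta> * \<bar>\<xi>\<bar>) * Gr n \<xi>) / Gr n \<xi>"
   using Gr_pos[of n \<xi>] C(3)[OF \<tau>] by (intro divide_right_mono) auto
  finally show "cmod (Fk n \<epsilon> \<tau> (of_real \<xi>)) \<le> C * exp (- \<delta> * \<bar>\<xi>\<bar>)" using Gr_pos[of n \<xi>] by simp
 qed
qed

lemma Fk_real_measurable: "(\<lambda>\<xi>. Fk n \<epsilon> \<tau> (of_real \<xi>)) \<in> borel_measurable lborel"
proof -
 have "continuous_on UNIV (\<lambda>\<xi>. Fk n \<epsilon> \<tau> (of_real \<xi>))"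
  unfolding Fk_def using Gr_complex_nonzero
  by (intro continuous_intros continuous_on_compose2[OF G_cont[of UNIV]]) auto
 then show ?thesis by (simp add: borel_measurable_continuous_onI)
qed

lemma open_strip: "open {\<tau>. A < Im \<tau> \<and> Im \<tau> < B}"
proof -
 have "{\<tau>. A < Im \<tau> \<and> Im \<tau> < B} = {\<tau>. A < Im \<tau>} \<inter> {\<tau>. Im \<tau> < B}" by auto
 then show ?thesis by (metis open_Int open_halfspace_Im_gt open_halfspace_Im_lt)
qed

lemma kker_holomorphic:
 assumes eps: "0 \<le> \<epsilon>" "\<epsilon> \<le> 1"
 shows "kker n \<epsilon> holomorphic_on {\<tau>. 2 * \<alpha> < Im \<tau> \<and> Im \<tau> < 2 * \<beta>}"
 unfolding kker_def[abs_def]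
proof (rule holomorphic_on_integral[OF open_strip Fk_real_measurable])
 show "(\<lambda>\<tau>. Fk n \<epsilon> \<tau> (complex_of_real \<xi>)) holomorphic_on {\<tau>. 2 * \<alpha> < Im \<tau> \<and> Im \<tau> < 2 * \<beta>}" for \<xi>
  unfolding Fk_def using Gr_complex_nonzero by (intro holomorphic_intros) auto
 fix \<tau> assume \<tau>: "\<tau> \<in> {\<tau>. 2 * \<alpha> < Im \<tau> \<and> Im \<tau> < 2 * \<beta>}"
 define r where "r = min (Im \<tau> - 2 * \<alpha>) (2 * \<beta> - Im \<tau>) / 2"
 have r: "r > 0" using \<tau> by (auto simp: r_def)
 define a b where "a = (Im \<tau> - r) / 2" and "b = (Im \<tau> + r) / 2"
 have a: "\<alpha> < a" "a \<le> b" "b < \<beta>" using \<tau> r by (auto simp: a_def b_def r_def min_def field_simps split: if_splits)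
 obtain C \<delta> where C: "C > 0" "\<delta> > 0"
  "\<And>\<epsilon> \<tau> \<xi>. \<lbrakk>0 \<le> \<epsilon>; \<epsilon> \<le> 1; a \<le> Im \<tau> / 2; Im \<tau> / 2 \<le> b\<rbrakk> \<Longrightarrow> cmod (Fk n \<epsilon> \<tau> (of_real \<xi>)) \<le> C * exp (- \<delta> * \<bar>\<xi>\<bar>)"
  by (rule Fk_real_dominated[OF a]) blast
 have "a \<le> Im w / 2 \<and> Im w / 2 \<le> b" if "w \<in> ball \<tau> r" for w
  using that abs_Im_le_cmod[of "\<tau> - w"] by (auto simp: a_def b_def dist_norm)
 then show "\<exists>r>0. \<exists>B. integrable lborel B \<and> (\<forall>w\<in>ball \<tau> r \<inter> {\<tau>. 2 * \<alpha> < Im \<tau> \<and> Im \<tau> < 2 * \<beta>}.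
   \<forall>\<xi>\<in>space lborel. cmod (Fk n \<epsilon> w (complex_of_real \<xi>)) \<le> B \<xi>)"
  using r C integrable_exp_abs[OF C(2)] eps
  by (intro exI[of _ r] conjI exI[of _ "\<lambda>\<xi>. C * exp (- \<delta> * \<bar>\<xi>\<bar>)"]) auto
qed

lemma kker_tendsto:
 assumes \<tau>: "\<alpha> < Im \<tau> / 2" "Im \<tau> / 2 < \<beta>"
 shows "(\<lambda>j. kker n (1 / real (Suc j)) \<tau>) \<longlonglongrightarrow> kker n 0 \<tau>"
 unfolding kker_def
proof -
 obtain C \<delta> where C: "C > 0" "\<delta> > 0"
  "\<And>\<epsilon> \<tau>' \<xi>. \<lbrakk>0 \<le> \<epsilon>; \<epsilon> \<le> 1; Im \<tau> / 2 \<le> Im \<tau>' / 2; Im \<tau>' / 2 \<le> Im \<tau> / 2\<rbrakk> \<Longrightarrow> cmod (Fk n \<epsilon> \<tau>' (of_real \<xi>)) \<le> C * exp (- \<delta> * \<bar>\<xi>\<bar>)"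
  by (rule Fk_real_dominated[OF \<tau>(1) order_refl \<tau>(2)]) blast
 have l0: "(\<lambda>j. complex_of_real (1 / real (Suc j))) \<longlonglongrightarrow> of_real 0"
  by (intro tendsto_of_real LIMSEQ_Suc lim_1_over_n)
 show "(\<lambda>j. \<integral>\<xi>. Fk n (1 / real (Suc j)) \<tau> (of_real \<xi>) \<partial>lborel) \<longlonglongrightarrow> (\<integral>\<xi>. Fk n 0 \<tau> (of_real \<xi>) \<partial>lborel)"
 proof (rule integral_dominated_convergence[where w = "\<lambda>\<xi>. C * exp (- \<delta> * \<bar>\<xi>\<bar>)"])
  show "integrable lborel (\<lambda>\<xi>. C * exp (- \<delta> * \<bar>\<xi>\<bar>))" using integrable_exp_abs[OF C(2)] by (rule integrable_mult_right)
  show "AE \<xi> in lborel. (\<lambda>j. Fk n (1 / real (Suc j)) \<tau> (of_real \<xi>)) \<longlonglongrightarrow> Fk n 0 \<tau> (of_real \<xi>)"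
  proof (rule AE_I2)
   fix \<xi> :: real
   show "(\<lambda>j. Fk n (1 / real (Suc j)) \<tau> (of_real \<xi>)) \<longlonglongrightarrow> Fk n 0 \<tau> (of_real \<xi>)"
    unfolding Fk_def by (intro tendsto_intros l0 Gr_complex_nonzero) auto
  qed
  show "AE \<xi> in lborel. cmod (Fk n (1 / real (Suc j)) \<tau> (of_real \<xi>)) \<le> C * exp (- \<delta> * \<bar>\<xi>\<bar>)" for j
   by (intro AE_I2 C(3)) (auto simp: field_simps)
 qed (rule Fk_real_measurable)+
qed

lemma kker_cnj: "kker n 0 (- cnj \<tau>) = cnj (kker n 0 \<tau>)"
proof -
 have "Fk n 0 (- cnj \<tau>) (of_real \<xi>) = cnj (Fk n 0 \<tau> (of_real \<xi>))" for \<xi>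
  by (simp add: Fk_def G_of_real exp_cnj)
 then show ?thesis by (simp add: kker_def)
qed

lemma higher_deriv_exp_linear: "(deriv ^^ j) (\<lambda>w. exp (c * w)) = (\<lambda>w. c ^ j * exp (c * w))" for c :: complex
proof (induction j)
 case (Suc j)
 have "deriv (\<lambda>w. c ^ j * exp (c * w)) w = c ^ Suc j * exp (c * w)" for w
  by (rule DERIV_imp_deriv) (auto intro!: derivative_eq_intros)
 then show ?case using Suc by auto
qed simp

text \<open>At a zero of order \<open>m\<close> the residue is a derivative of order \<open>m - 1\<close> of a product with
 \<open>exp (\<i> l \<tau>)\<close>. Differentiating the exponential yields powers of \<open>\<tau>\<close>, the origin of the logarithms.\<close>

lemma residue_Fk:
 assumes "G n l0 = 0"
 obtains R :: "complex poly" where "\<And>\<tau>. residue (Fk n 0 \<tau>) l0 = exp (\<i> * l0 * \<tau>) * poly R \<tau>"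
proof -
 obtain g r m where g: "0 < m" "0 < r" "ball l0 r \<subseteq> UNIV" "g holomorphic_on ball l0 r"
   "\<And>w. w \<in> ball l0 r ==> G n w = (w - l0) ^ m * g w" "\<And>w. w \<in> ball l0 r ==> g w \<noteq> 0"
  by (rule holomorphic_factor_zero_nonconstant[OF G_holomorphic open_UNIV connected_UNIV UNIV_I assms])
   (use G_not_constant_zero assms in blast)+
 obtain k where k: "m = Suc k" using g(1) by (cases m) auto
 define u where "u w = inverse (g w)" for w
 have u: "u holomorphic_on ball l0 r" unfolding u_def using g(4,6) by (intro holomorphic_intros) auto
 define R where "R = (\<Sum>i = 0..k. monom (of_nat (k choose i) * \<i> ^ i * (deriv ^^ (k - i)) u l0 / fact k) i)"
 show ?thesis
 proof (rule that[of R])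
  fix \<tau>
  have e: "(\<lambda>w. exp (\<i> * \<tau> * w)) holomorphic_on ball l0 r" by (intro holomorphic_intros)
  have "residue (Fk n 0 \<tau>) l0 = residue (\<lambda>w. (exp (\<i> * \<tau> * w) * u w) / (w - l0) ^ Suc k) l0"
  proof (rule residue_cong)
   show "eventually (\<lambda>w. Fk n 0 \<tau> w = (exp (\<i> * \<tau> * w) * u w) / (w - l0) ^ Suc k) (at l0)"
    unfolding eventually_at
   proof (intro exI[of _ r] conjI g(2) ballI impI)
    fix w assume "w \<noteq> l0 \<and> dist w l0 < r"
    then have "w \<in> ball l0 r" by (simp add: dist_commute)
    then have G: "G n w = (w - l0) ^ Suc k * g w" using g(5)[of w] unfolding k by blast
    have e: "\<i> * w * \<tau> - of_real 0 * w\<^sup>2 / 2 = \<i> * \<tau> * w" by simp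
    show "Fk n 0 \<tau> w = (exp (\<i> * \<tau> * w) * u w) / (w - l0) ^ Suc k"
     unfolding Fk_def u_def G e unfolding divide_inverse inverse_mult_distrib by (simp only: mult_ac)
   qed
  qed simp
  also have "\<dots> = (deriv ^^ k) (\<lambda>w. exp (\<i> * \<tau> * w) * u w) l0 / fact k"
   using g(2) by (intro residue_holomorphic_over_power[of "ball l0 r"] holomorphic_on_mult e u) auto
  also have "(deriv ^^ k) (\<lambda>w. exp (\<i> * \<tau> * w) * u w) l0
    = (\<Sum>i = 0..k. of_nat (k choose i) * (deriv ^^ i) (\<lambda>w. exp (\<i> * \<tau> * w)) l0 * (deriv ^^ (k - i)) u l0)"
   using g(2) by (intro higher_deriv_mult[OF e u open_ball]) auto
  also have "\<dots> / fact k = exp (\<i> * l0 * \<tau>) * poly R \<tau>"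
   unfolding R_def poly_sum sum_divide_distrib sum_distrib_left higher_deriv_exp_linear
   by (intro sum.cong) (auto simp: poly_monom power_mult_distrib mult_ac)
  finally show "residue (Fk n 0 \<tau>) l0 = exp (\<i> * l0 * \<tau>) * poly R \<tau>" .
 qed
qed

text \<open>Shifting the contour downwards splits the kernel into the contributions of the zeros of \<open>G n\<close>
 and a remainder that decays as fast as desired for \<open>Re \<tau> \<rightarrow> -\<infinity>\<close>.\<close>

lemma kker_residues:
 assumes \<tau>: "\<alpha> < Im \<tau> / 2" "Im \<tau> / 2 < \<beta>" and E: "E > 0" and nz: "\<And>l. G n l = 0 ==> Im l \<noteq> - E"
 shows "kker n 0 \<tau> = (\<integral>x. Fk n 0 \<tau> (Complex x (- E)) \<partial>lborel)
  - 2 * pi * \<i> * (\<Sum>l\<in>{l \<in> Z n. - E < Im l}. residue (Fk n 0 \<tau>) l)"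
proof -
 have "{l. G n l = 0 \<and> - E < Im l \<and> Im l < 0} = {l \<in> Z n. - E < Im l}" by (auto simp: Z_def)
 moreover have "G n l = 0 ==> Im l \<noteq> - E \<and> Im l \<noteq> 0" for l using nz no_zeros_half[of l n] by auto
 ultimately show ?thesis
  using Fk_contour(3)[of 0 \<tau> "-E" 0 n] \<tau> E unfolding kker_line by simp
qed

end

section \<open>The reproducing property on a strip\<close>

lemma complex_Fubini:
 fixes T :: "complex \<Rightarrow> complex"
 assumes "integrable lborel T"
 shows "(\<integral>u. T u \<partial>lborel) = (\<integral>\<psi>. \<integral>s. T (Complex s \<psi>) \<partial>lborel \<partial>lborel)"
  and "integrable (lborel \<Otimes>\<^sub>M lborel) (\<lambda>(s, \<psi>). T (Complex s \<psi>))"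
proof -
 have m: "(\<lambda>(x, y). Complex x y) \<in> borel_measurable (lborel \<Otimes>\<^sub>M lborel)"
  unfolding lborel_prod case_prod_beta Complex_eq
  by (simp, intro borel_measurable_continuous_onI continuous_intros)
 have T: "T \<in> borel_measurable borel" using assms by auto
 have eq: "(\<lambda>x. T (case x of (x, y) \<Rightarrow> Complex x y)) = (\<lambda>(s, \<psi>). T (Complex s \<psi>))" by auto
 have "integrable (distr (lborel \<Otimes>\<^sub>M lborel) borel (\<lambda>(x, y). Complex x y)) T"
  unfolding distr_Complex_lborel by (rule assms)
 then show i: "integrable (lborel \<Otimes>\<^sub>M lborel) (\<lambda>(s, \<psi>). T (Complex s \<psi>))"
  unfolding integrable_distr_eq[OF m T] eq .
 have "(\<integral>u. T u \<partial>lborel) = integral\<^sup>L (lborel \<Otimes>\<^sub>M lborel) (\<lambda>(s, \<psi>). T (Complex s \<psi>))"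
  by (subst distr_Complex_lborel[symmetric], subst integral_distr[OF m T]) (simp only: eq)
 also have "\<dots> = (\<integral>\<psi>. \<integral>s. T (Complex s \<psi>) \<partial>lborel \<partial>lborel)"
  using lborel_pair.integral_snd[OF i] by simp
 finally show "(\<integral>u. T u \<partial>lborel) = (\<integral>\<psi>. \<integral>s. T (Complex s \<psi>) \<partial>lborel \<partial>lborel)" .
qed

lemma gaussian_integrable:
 assumes "\<epsilon> > 0"
 shows "integrable lborel (\<lambda>\<xi>::real. exp (- \<epsilon> * \<xi>\<^sup>2 / 2))"
proof -
 have s: "1 / sqrt \<epsilon> > 0" using assms by simp
 have e: "exp (- \<epsilon> * \<xi>\<^sup>2 / 2) = sqrt (2 * pi * (1 / sqrt \<epsilon>)\<^sup>2) * normal_density 0 (1 / sqrt \<epsilon>) \<xi>" for \<xi>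
  using assms by (simp add: normal_density_def power_divide)
 show ?thesis unfolding e by (intro integrable_mult_right integrable_normal_density s)
qed

lemma gaussian_fourier:
 assumes "\<epsilon> > 0"
 shows "(\<integral>\<xi>. exp (\<i> * of_real (\<xi> * t)) * of_real (exp (- \<epsilon> * \<xi>\<^sup>2 / 2)) \<partial>lborel) =
  of_real (2 * pi / sqrt \<epsilon> * std_normal_density (t / sqrt \<epsilon>))"
proof -
 define f where "f x = std_normal_density x *\<^sub>R iexp (t / sqrt \<epsilon> * x)" for x
 have "char std_normal_distribution (t / sqrt \<epsilon>) = (\<integral>x. f x \<partial>lborel)"
  unfolding char_def f_def by (subst integral_density) auto
 also have "\<dots> = \<bar>sqrt \<epsilon>\<bar> *\<^sub>R (\<integral>x. f (0 + sqrt \<epsilon> * x) \<partial>lborel)"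
  using assms by (intro lborel_integral_real_affine) auto
 also have "(\<lambda>x. f (0 + sqrt \<epsilon> * x)) = (\<lambda>\<xi>. of_real (1 / sqrt (2 * pi)) * (exp (\<i> * of_real (\<xi> * t)) * of_real (exp (- \<epsilon> * \<xi>\<^sup>2 / 2))))"
 proof
  fix \<xi> :: real
  have A: "t / sqrt \<epsilon> * (0 + sqrt \<epsilon> * \<xi>) = \<xi> * t" using assms by simp
  have B: "- (0 + sqrt \<epsilon> * \<xi>)\<^sup>2 / 2 = - \<epsilon> * \<xi>\<^sup>2 / 2" using assms by (simp add: power_mult_distrib)
  show "f (0 + sqrt \<epsilon> * \<xi>) = of_real (1 / sqrt (2 * pi)) * (exp (\<i> * of_real (\<xi> * t)) * of_real (exp (- \<epsilon> * \<xi>\<^sup>2 / 2)))"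
   unfolding f_def std_normal_density_def scaleR_conv_of_real A B by (simp only: of_real_mult mult_ac)
 qed
 also have "\<bar>sqrt \<epsilon>\<bar> *\<^sub>R (\<integral>\<xi>. of_real (1 / sqrt (2 * pi)) * (exp (\<i> * of_real (\<xi> * t)) * of_real (exp (- \<epsilon> * \<xi>\<^sup>2 / 2))) \<partial>lborel)
   = of_real (sqrt \<epsilon> / sqrt (2 * pi)) * (\<integral>\<xi>. exp (\<i> * of_real (\<xi> * t)) * of_real (exp (- \<epsilon> * \<xi>\<^sup>2 / 2)) \<partial>lborel)"
  using assms by (simp add: scaleR_conv_of_real)
 finally have *: "of_real (exp (- (t / sqrt \<epsilon>)\<^sup>2 / 2)) = of_real (sqrt \<epsilon> / sqrt (2 * pi)) * (\<integral>\<xi>. exp (\<i> * of_real (\<xi> * t)) * of_real (exp (- \<epsilon> * \<xi>\<^sup>2 / 2)) \<partial>lborel)" (is "?e = ?s * ?I")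
  unfolding char_std_normal_distribution by simp
 have "of_real (sqrt (2 * pi) / sqrt \<epsilon>) * ?e = of_real (sqrt (2 * pi) / sqrt \<epsilon>) * ?s * ?I"
  unfolding * by (simp only: mult.assoc)
 also have "of_real (sqrt (2 * pi) / sqrt \<epsilon>) * ?s = (1::complex)"
  unfolding of_real_mult[symmetric] using assms by simp
 finally have "?I = of_real (sqrt (2 * pi) / sqrt \<epsilon> * exp (- (t / sqrt \<epsilon>)\<^sup>2 / 2))" by simp
 also have "sqrt (2 * pi) / sqrt \<epsilon> * exp (- (t / sqrt \<epsilon>)\<^sup>2 / 2) = 2 * pi / sqrt \<epsilon> * std_normal_density (t / sqrt \<epsilon>)"
 proof -
  have "2 * pi = sqrt (2 * pi) * sqrt (2 * pi)" by simp
  then have "sqrt (2 * pi) = 2 * pi / sqrt (2 * pi)" by (simp add: field_simps)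
  then have "sqrt (2 * pi) / sqrt \<epsilon> * exp (- (t / sqrt \<epsilon>)\<^sup>2 / 2) = 2 * pi / sqrt (2 * pi) / sqrt \<epsilon> * exp (- (t / sqrt \<epsilon>)\<^sup>2 / 2)"
   by (simp only:)
  then show ?thesis unfolding std_normal_density_def by (simp only: divide_inverse mult_ac mult_1)
 qed
 finally show ?thesis .
qed

context strip_weight
begin

text \<open>The modulus of the integrand on the line \<open>Im \<tau> = 2 \<psi>\<close>, multiplied by the weight at \<open>\<psi>\<close>: the
 majorant that justifies interchanging the two integrations.\<close>

definition Phi :: "nat \<Rightarrow> real \<Rightarrow> real \<Rightarrow> real \<Rightarrow> real" where
 "Phi n \<epsilon> \<xi> \<psi> = indicator {\<alpha><..<\<beta>} \<psi> * (wt n \<xi> \<psi> * exp (- \<epsilon> * \<xi>\<^sup>2 / 2) / Gr n \<xi>)"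

lemma Phi_nonneg: "Phi n \<epsilon> \<xi> \<psi> \<ge> 0"
 unfolding Phi_def using wt_nonneg[of \<psi> n \<xi>] Gr_pos[of n \<xi>] by (auto simp: indicator_def)

lemma Phi_integral:
 "integrable lborel (\<lambda>\<psi>. Phi n \<epsilon> \<xi> \<psi>)" "(\<integral>\<psi>. Phi n \<epsilon> \<xi> \<psi> \<partial>lborel) = exp (- \<epsilon> * \<xi>\<^sup>2 / 2)"
proof -
 define K where "K = exp (- \<epsilon> * \<xi>\<^sup>2 / 2) / Gr n \<xi>"
 define f where "f \<psi> = K * (indicator {\<alpha>..\<beta>} \<psi> *\<^sub>R wt n \<xi> \<psi>)" for \<psi>
 have ae: "AE \<psi> in lborel. f \<psi> = Phi n \<epsilon> \<xi> \<psi>"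
  using AE_lborel_singleton[of \<alpha>] AE_lborel_singleton[of \<beta>]
  by eventually_elim (auto simp: f_def Phi_def K_def indicator_def)
 have fi: "integrable lborel f"
  unfolding f_def using wt_integrable[of n \<xi>] unfolding set_integrable_def by (rule integrable_mult_right)
 have pm: "Phi n \<epsilon> \<xi> \<in> borel_measurable lborel"
 proof -
  have "(\<lambda>\<psi>. indicator {\<alpha><..<\<beta>} \<psi> *\<^sub>R (wt n \<xi> \<psi> * exp (- \<epsilon> * \<xi>\<^sup>2 / 2) / Gr n \<xi>)) \<in> borel_measurable borel"
  proof (rule borel_measurable_continuous_on_indicator)
   have "continuous_on {\<alpha><..<\<beta>} (wt n \<xi>)" by (rule continuous_on_subset[OF wt_cont]) auto
   then show "continuous_on {\<alpha><..<\<beta>} (\<lambda>\<psi>. wt n \<xi> \<psi> * exp (- \<epsilon> * \<xi>\<^sup>2 / 2) / Gr n \<xi>)"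
    using Gr_pos[of n \<xi>] by (intro continuous_intros) auto
  qed simp
  then show ?thesis by (simp add: Phi_def[abs_def])
 qed
 show "integrable lborel (\<lambda>\<psi>. Phi n \<epsilon> \<xi> \<psi>)"
  using integrable_cong_AE[OF _ pm ae] fi by auto
 have "(\<integral>\<psi>. Phi n \<epsilon> \<xi> \<psi> \<partial>lborel) = (\<integral>\<psi>. f \<psi> \<partial>lborel)"
  using integral_cong_AE[OF _ pm ae] fi by auto
 also have "\<dots> = K * Gr n \<xi>" by (simp add: f_def Gr_def set_lebesgue_integral_def)
 finally show "(\<integral>\<psi>. Phi n \<epsilon> \<xi> \<psi> \<partial>lborel) = exp (- \<epsilon> * \<xi>\<^sup>2 / 2)"
  using Gr_pos[of n \<xi>] by (simp add: K_def)
qed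

lemma Phi_measurable: "(\<lambda>(\<xi>, \<psi>). Phi n \<epsilon> \<xi> \<psi>) \<in> borel_measurable (lborel \<Otimes>\<^sub>M lborel)"
proof -
 let ?A = "UNIV \<times> {\<alpha><..<\<beta>} :: (real \<times> real) set"
 have meas: "(\<lambda>p. indicator ?A p *\<^sub>R (wt n (fst p) (snd p) * exp (- \<epsilon> * (fst p)\<^sup>2 / 2) / Gr n (fst p))) \<in> borel_measurable borel"
 proof (rule borel_measurable_continuous_on_indicator)
  show "?A \<in> sets borel" by (intro borel_open open_Times) auto
  have "continuous_on ?A (\<lambda>p. h (snd p))"
   by (rule continuous_on_compose2[OF cont_h]) (auto intro!: continuous_intros)
  moreover have "continuous_on ?A (\<lambda>p. Gr n (fst p))"
   by (rule continuous_on_compose2[OF Gr_cont[of UNIV]]) (auto intro!: continuous_intros)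
  ultimately show "continuous_on ?A (\<lambda>p. wt n (fst p) (snd p) * exp (- \<epsilon> * (fst p)\<^sup>2 / 2) / Gr n (fst p))"
   unfolding wt_def using Gr_pos[of n] by (intro continuous_intros) (auto simp: less_imp_neq[symmetric])
 qed
 have eq: "(\<lambda>p. indicator ?A p *\<^sub>R (wt n (fst p) (snd p) * exp (- \<epsilon> * (fst p)\<^sup>2 / 2) / Gr n (fst p))) = (\<lambda>(\<xi>, \<psi>). Phi n \<epsilon> \<xi> \<psi>)"
  by (auto simp: fun_eq_iff Phi_def indicator_def)
 show ?thesis using meas unfolding eq lborel_prod measurable_cong_sets[OF sets_lborel refl] .
qed

lemma Phi_integrable:
 assumes "\<epsilon> > 0"
 shows "integrable (lborel \<Otimes>\<^sub>M lborel) (\<lambda>(\<xi>, \<psi>). Phi n \<epsilon> \<xi> \<psi>)"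
proof (rule lborel_pair.Fubini_integrable[OF Phi_measurable])
 show "integrable lborel (\<lambda>\<xi>. \<integral>\<psi>. norm (case (\<xi>, \<psi>) of (\<xi>, \<psi>) \<Rightarrow> Phi n \<epsilon> \<xi> \<psi>) \<partial>lborel)"
  using gaussian_integrable[OF assms] Phi_nonneg by (simp add: Phi_integral)
qed (simp add: Phi_integral)

definition Bd :: "nat \<Rightarrow> real \<Rightarrow> real \<Rightarrow> real" where
 "Bd n \<epsilon> \<psi> = (\<integral>\<xi>. Phi n \<epsilon> \<xi> \<psi> \<partial>lborel)"

lemma Bd_integrable: "\<epsilon> > 0 ==> integrable lborel (Bd n \<epsilon>)"
 unfolding Bd_def[abs_def] using lborel_pair.integrable_snd[OF Phi_integrable] by simp

lemma Phi_line_integrable: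
 assumes "0 \<le> \<epsilon>" "\<alpha> < \<psi>" "\<psi> < \<beta>"
 shows "integrable lborel (\<lambda>\<xi>. Phi n \<epsilon> \<xi> \<psi>)"
proof -
 obtain C \<delta> where C: "C > 0" "\<delta> > 0"
  "\<And>\<xi> \<phi>. \<psi> \<le> \<phi> ==> \<phi> \<le> \<psi> ==> exp (- 2 * \<xi> * \<phi>) \<le> C * exp (- \<delta> * \<bar>\<xi>\<bar>) * Gr n \<xi>"
  by (rule core_bound_fixed[OF assms(2) order_refl assms(3)]) blast
 define F where "F \<xi> = complex_of_real (Phi n \<epsilon> \<xi> \<psi>)" for \<xi>
 have "integrable lborel F"
 proof (rule integrable_exp_decay[OF _ C(2)])
  have p: "Phi n \<epsilon> \<xi> \<psi> = exp (- 2 * \<xi> * \<psi>) * h \<psi> ^ Suc n * exp (- \<epsilon> * \<xi>\<^sup>2 / 2) / Gr n \<xi>" for \<xi>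
   using assms by (simp add: Phi_def wt_def)
  show "continuous_on UNIV F" unfolding F_def p
   using Gr_pos[of n] by (auto intro!: continuous_intros Gr_cont simp: less_imp_neq[symmetric])
  fix \<xi> :: real assume "0 \<le> \<bar>\<xi>\<bar>"
  have "exp (- \<epsilon> * \<xi>\<^sup>2 / 2) \<le> 1" using assms(1) by simp
  then have "Phi n \<epsilon> \<xi> \<psi> \<le> wt n \<xi> \<psi> * 1 / Gr n \<xi>"
   unfolding Phi_def using assms wt_nonneg[of \<psi> n \<xi>] Gr_pos[of n \<xi>]
   by (simp only: indicator_simps greaterThanLessThan_iff simp_thms mult_1) (intro divide_right_mono mult_left_mono, auto)
  also have "\<dots> = exp (- 2 * \<xi> * \<psi>) / Gr n \<xi> * h \<psi> ^ Suc n" by (simp add: wt_def)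
  also have "\<dots> \<le> (C * exp (- \<delta> * \<bar>\<xi>\<bar>) * Gr n \<xi>) / Gr n \<xi> * h \<psi> ^ Suc n"
   using Gr_pos[of n \<xi>] C(3)[of \<psi> \<xi>] h_nonneg[of \<psi>] assms
   by (intro mult_right_mono divide_right_mono) auto
  also have "\<dots> = (C * h \<psi> ^ Suc n) * exp (- \<delta> * \<bar>\<xi>\<bar>)" using Gr_pos[of n \<xi>] by simp
  finally show "cmod (F \<xi>) \<le> (C * h \<psi> ^ Suc n) * exp (- \<delta> * \<bar>\<xi>\<bar>)"
   using Phi_nonneg[of n \<epsilon> \<xi> \<psi>] by (simp add: F_def)
 qed
 from integrable_Re[OF this] show ?thesis by (simp add: F_def)
qed

lemma kker_Bd:
 assumes "0 < \<epsilon>" "\<epsilon> \<le> 1"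
 obtains K where "K > 0" "\<And>t \<psi>. \<alpha> < \<psi> ==> \<psi> < \<beta> ==>
  h \<psi> ^ Suc n * cmod (kker n \<epsilon> (Complex t (2 * \<psi>))) \<le> K * exp (- \<bar>t\<bar> / 2) * Bd n \<epsilon> \<psi>"
proof -
 define c where "c = cos ((\<beta> - \<alpha>) / 2)"
 have c: "c > 0" unfolding c_def using ab by (intro cos_gt_zero) auto
 show ?thesis
 proof (rule that[of "exp (1/8) / c"])
  fix t \<psi> assume \<psi>: "\<alpha> < \<psi>" "\<psi> < \<beta>"
  define \<tau> where "\<tau> = Complex t (2 * \<psi>)"
  define s :: real where "s = (if t \<ge> 0 then 1/2 else -1/2)"
  have s: "s = 1/2 \<or> s = -1/2" "- s * t = - \<bar>t\<bar> / 2" "s\<^sup>2 = 1/4" by (auto simp: s_def power2_eq_square)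
  have Gc: "c * Gr n \<xi> \<le> cmod (G n (Complex \<xi> s))" for \<xi>
  proof -
   have "\<bar>s\<bar> * (\<beta> - \<alpha>) \<le> pi / 2" using ab by (auto simp: s_def)
   from G_lower_small[OF this, of n \<xi>] have le: "cos (s * (\<beta> - \<alpha>)) * Gr n \<xi> \<le> cmod (G n (Complex \<xi> s))" .
   have "s * (\<beta> - \<alpha>) = (\<beta> - \<alpha>) / 2 \<or> s * (\<beta> - \<alpha>) = - ((\<beta> - \<alpha>) / 2)"
    using s(1) by (elim disjE) (simp_all add: field_simps)
   then have "cos (s * (\<beta> - \<alpha>)) = c" unfolding c_def by (elim disjE) (simp_all only: cos_minus)
   with le show ?thesis by (simp only:)
  qed
  have pt: "cmod (of_real (h \<psi> ^ Suc n) * Fk n \<epsilon> \<tau> (Complex x s)) \<le> exp (1/8) / c * exp (- \<bar>t\<bar> / 2) * Phi n \<epsilon> x \<psi>" for x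
  proof -
   have h0: "h \<psi> ^ Suc n \<ge> 0" using h_nonneg[of \<psi>] \<psi> by simp
   have "- \<epsilon> * (x\<^sup>2 - s\<^sup>2) / 2 \<le> - \<epsilon> * x\<^sup>2 / 2 + 1/8" using assms unfolding s(3) by (simp add: field_simps)
   then have e: "exp (- \<epsilon> * (x\<^sup>2 - s\<^sup>2) / 2) \<le> exp (- \<epsilon> * x\<^sup>2 / 2) * exp (1/8)"
    by (simp only: exp_add[symmetric] exp_le_cancel_iff)
   have "cmod (Fk n \<epsilon> \<tau> (Complex x s)) = exp (- 2 * x * \<psi>) * exp (- \<bar>t\<bar> / 2) * exp (- \<epsilon> * (x\<^sup>2 - s\<^sup>2) / 2) / cmod (G n (Complex x s))"
    unfolding cmod_Fk \<tau>_def complex.sel s(2) by simp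
   also have "\<dots> \<le> exp (- 2 * x * \<psi>) * exp (- \<bar>t\<bar> / 2) * (exp (- \<epsilon> * x\<^sup>2 / 2) * exp (1/8)) / (c * Gr n x)"
    using e Gc[of x] c Gr_pos[of n x] by (intro frac_le mult_left_mono) auto
   finally have F: "cmod (Fk n \<epsilon> \<tau> (Complex x s)) \<le> exp (- 2 * x * \<psi>) * exp (- \<bar>t\<bar> / 2) * (exp (- \<epsilon> * x\<^sup>2 / 2) * exp (1/8)) / (c * Gr n x)" .
   have "cmod (of_real (h \<psi> ^ Suc n) * Fk n \<epsilon> \<tau> (Complex x s)) = h \<psi> ^ Suc n * cmod (Fk n \<epsilon> \<tau> (Complex x s))"
    using h0 by (simp only: norm_mult norm_of_real abs_of_nonneg)
   also have "\<dots> \<le> h \<psi> ^ Suc n * (exp (- 2 * x * \<psi>) * exp (- \<bar>t\<bar> / 2) * (exp (- \<epsilon> * x\<^sup>2 / 2) * exp (1/8)) / (c * Gr n x))"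
    using h0 by (rule mult_left_mono[OF F])
   also have "\<dots> = exp (1/8) / c * exp (- \<bar>t\<bar> / 2) * Phi n \<epsilon> x \<psi>"
    using \<psi> by (simp add: Phi_def wt_def)
   finally show ?thesis .
  qed
  have nz: "G n l = 0 ==> Im l \<noteq> s \<and> Im l \<noteq> 1" if "\<bar>Im l\<bar> \<le> 1/2" for l using no_zeros_half[of l n] that by auto
  have "kker n \<epsilon> \<tau> = (\<integral>x. Fk n \<epsilon> \<tau> (Complex x s) \<partial>lborel)"
   using assms \<psi> by (intro kker_half s) (auto simp: \<tau>_def)
  then have "h \<psi> ^ Suc n * cmod (kker n \<epsilon> \<tau>) = cmod (\<integral>x. of_real (h \<psi> ^ Suc n) * Fk n \<epsilon> \<tau> (Complex x s) \<partial>lborel)"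
   using h_nonneg[of \<psi>] \<psi> by (simp add: norm_mult norm_power)
  also have "\<dots> \<le> (\<integral>x. exp (1/8) / c * exp (- \<bar>t\<bar> / 2) * Phi n \<epsilon> x \<psi> \<partial>lborel)"
  proof (rule norm_integral_le[OF _ _ pt])
   show ip: "integrable lborel (\<lambda>x. exp (1/8) / c * exp (- \<bar>t\<bar> / 2) * Phi n \<epsilon> x \<psi>)"
    using assms \<psi> by (intro integrable_mult_right Phi_line_integrable) auto
   have "continuous_on UNIV (\<lambda>x. Fk n \<epsilon> \<tau> (Complex x s))"
   proof -
    have "G n (Complex x s) \<noteq> 0" for x using no_zeros_half[of "Complex x s" n] s(1) by auto
    then show ?thesis unfolding Fk_def Complex_eq
     by (intro continuous_intros continuous_on_compose2[OF G_cont[of UNIV]]) (auto simp: Complex_eq)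
   qed
   then have "(\<lambda>x. of_real (h \<psi> ^ Suc n) * Fk n \<epsilon> \<tau> (Complex x s)) \<in> borel_measurable lborel"
    by (intro borel_measurable_times borel_measurable_const) (simp add: borel_measurable_continuous_onI)
   then show "integrable lborel (\<lambda>x. of_real (h \<psi> ^ Suc n) * Fk n \<epsilon> \<tau> (Complex x s))"
    by (rule Bochner_Integration.integrable_bound[OF ip]) (rule AE_I2, rule order_trans[OF pt], simp only: real_norm_def abs_ge_self)
  qed
  also have "\<dots> = exp (1/8) / c * exp (- \<bar>t\<bar> / 2) * Bd n \<epsilon> \<psi>" by (simp add: Bd_def)
  finally show "h \<psi> ^ Suc n * cmod (kker n \<epsilon> (Complex t (2 * \<psi>))) \<le> exp (1/8) / c * exp (- \<bar>t\<bar> / 2) * Bd n \<epsilon> \<psi>"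
   by (simp add: \<tau>_def)
 qed (use c in auto)
qed

text \<open>The weight cancels against \<open>Gr n\<close>: averaging the regularised kernel over \<open>\<psi>\<close> gives the
 Gaussian approximate identity.\<close>

lemma kker_average:
 assumes "0 < \<epsilon>" "\<epsilon> \<le> 1"
 shows "(\<integral>\<psi>. of_real (indicator {\<alpha><..<\<beta>} \<psi> * h \<psi> ^ Suc n) * kker n \<epsilon> (Complex t (2 * \<psi>)) \<partial>lborel)
  = of_real (2 * pi / sqrt \<epsilon> * std_normal_density (t / sqrt \<epsilon>))"
proof -
 define f where "f \<xi> \<psi> = exp (\<i> * of_real (\<xi> * t)) * complex_of_real (Phi n \<epsilon> \<xi> \<psi>)" for \<xi> \<psi>
 have fm: "(\<lambda>(\<xi>, \<psi>). f \<xi> \<psi>) \<in> borel_measurable (lborel \<Otimes>\<^sub>M lborel)"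
 proof -
  have "(\<lambda>p :: real \<times> real. exp (\<i> * of_real (fst p * t))) \<in> borel_measurable (lborel \<Otimes>\<^sub>M lborel)"
   unfolding lborel_prod by (simp, intro borel_measurable_continuous_onI continuous_intros)
  from borel_measurable_times[OF this measurable_compose[OF Phi_measurable[of n \<epsilon>] borel_measurable_of_real]]
  show ?thesis by (simp add: f_def case_prod_beta)
 qed
 have fi: "integrable (lborel \<Otimes>\<^sub>M lborel) (\<lambda>(\<xi>, \<psi>). f \<xi> \<psi>)"
 proof (rule Bochner_Integration.integrable_bound[OF Phi_integrable[OF assms(1), of n] fm])
  show "AE x in lborel \<Otimes>\<^sub>M lborel. norm (case x of (\<xi>, \<psi>) \<Rightarrow> f \<xi> \<psi>) \<le> norm (case x of (\<xi>, \<psi>) \<Rightarrow> Phi n \<epsilon> \<xi> \<psi>)"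
   by (rule AE_I2) (auto simp: f_def norm_mult)
 qed
 have eq: "of_real (indicator {\<alpha><..<\<beta>} \<psi> * h \<psi> ^ Suc n) * kker n \<epsilon> (Complex t (2 * \<psi>)) = (\<integral>\<xi>. f \<xi> \<psi> \<partial>lborel)" for \<psi>
 proof -
  have "of_real (indicator {\<alpha><..<\<beta>} \<psi> * h \<psi> ^ Suc n) * Fk n \<epsilon> (Complex t (2 * \<psi>)) (of_real \<xi>) = f \<xi> \<psi>" for \<xi>
  proof -
   have A: "\<i> * of_real \<xi> * Complex t (2 * \<psi>) - of_real \<epsilon> * (of_real \<xi>)\<^sup>2 / 2
     = \<i> * of_real (\<xi> * t) + of_real (- 2 * \<xi> * \<psi>) + of_real (- \<epsilon> * \<xi>\<^sup>2 / 2)"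
    by (simp add: complex_eq_iff power2_eq_square)
   have "Fk n \<epsilon> (Complex t (2 * \<psi>)) (of_real \<xi>) = exp (\<i> * of_real (\<xi> * t)) * of_real (exp (- 2 * \<xi> * \<psi>) * exp (- \<epsilon> * \<xi>\<^sup>2 / 2) / Gr n \<xi>)"
    unfolding Fk_def G_of_real A exp_add exp_of_real
    by (simp only: of_real_divide of_real_mult[of "exp _" "exp _"] times_divide_eq_right mult.assoc)
   then show ?thesis by (simp add: f_def Phi_def wt_def)
  qed
  then show ?thesis unfolding kker_def by (simp flip: integral_mult_right_zero)
 qed
 have "(\<integral>\<psi>. of_real (indicator {\<alpha><..<\<beta>} \<psi> * h \<psi> ^ Suc n) * kker n \<epsilon> (Complex t (2 * \<psi>)) \<partial>lborel)
   = (\<integral>\<xi>. \<integral>\<psi>. f \<xi> \<psi> \<partial>lborel \<partial>lborel)"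
  unfolding eq by (rule lborel_pair.Fubini_integral[OF fi])
 also have "\<dots> = (\<integral>\<xi>. exp (\<i> * of_real (\<xi> * t)) * of_real (exp (- \<epsilon> * \<xi>\<^sup>2 / 2)) \<partial>lborel)"
  unfolding f_def by (simp add: Phi_integral)
 also have "\<dots> = of_real (2 * pi / sqrt \<epsilon> * std_normal_density (t / sqrt \<epsilon>))" by (rule gaussian_fourier[OF assms(1)])
 finally show ?thesis .
qed

end

lemma exp_abs_diff_le:
 fixes x0 x :: real
 shows "exp (- \<bar>x0 - x\<bar> / 2) \<le> exp (\<bar>x0\<bar> / 2) * exp (- \<bar>x\<bar> / 2)"
  and "exp (- \<bar>x0 - x\<bar> / 2) \<le> exp (\<bar>x0\<bar> / 2) * exp (- \<bar>x\<bar> / 4)"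
proof -
 have "\<bar>x\<bar> \<le> \<bar>x0\<bar> + \<bar>x0 - x\<bar>" using abs_triangle_ineq4[of x0 "x0 - x"] by simp
 moreover have "- C / 2 \<le> B / 2 + - A / 2 \<and> - C / 2 \<le> B / 2 + - A / 4" if "A \<le> B + C" "A \<ge> 0" for A B C :: real
  using that by simp
 ultimately have "- \<bar>x0 - x\<bar> / 2 \<le> \<bar>x0\<bar> / 2 + - \<bar>x\<bar> / 2" "- \<bar>x0 - x\<bar> / 2 \<le> \<bar>x0\<bar> / 2 + - \<bar>x\<bar> / 4"
  using abs_ge_zero[of x] by blast+
 then show "exp (- \<bar>x0 - x\<bar> / 2) \<le> exp (\<bar>x0\<bar> / 2) * exp (- \<bar>x\<bar> / 2)"
  "exp (- \<bar>x0 - x\<bar> / 2) \<le> exp (\<bar>x0\<bar> / 2) * exp (- \<bar>x\<bar> / 4)"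
  by (simp_all only: exp_add[symmetric] exp_le_cancel_iff)
qed

context strip_weight
begin

abbreviation strip :: "complex set" where "strip \<equiv> {u. \<alpha> < Im u \<and> Im u < \<beta>}"

text \<open>Cauchy's theorem: the line \<open>Im u = \<psi>\<close> is moved to \<open>Im u = \<phi>\<close> for a product in which the decay of
 the kernel beats the growth of \<open>g\<close>. Afterwards the kernel is evaluated at imaginary part \<open>2 \<psi>\<close>,
 where \<open>kker_average\<close> applies.\<close>

lemma kker_strip_shift:
 fixes g :: "complex \<Rightarrow> complex"
 assumes eps: "0 \<le> \<epsilon>" "\<epsilon> \<le> 1" and g: "g holomorphic_on strip"
  and bnd: "\<And>a b. \<alpha> < a ==> a \<le> b ==> b < \<beta> ==> \<exists>C. \<forall>u. a \<le> Im u \<and> Im u \<le> b \<longrightarrow> cmod (g u) \<le> C * exp (\<bar>Re u\<bar> / 4)"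
  and \<phi>: "\<alpha> < \<phi>" "\<phi> < \<beta>" and \<psi>: "\<alpha> < \<psi>" "\<psi> < \<beta>"
 shows "(\<integral>s. kker n \<epsilon> (Complex (x0 - s) (\<phi> + \<psi>)) * g (Complex s \<psi>) \<partial>lborel)
  = (\<integral>s. kker n \<epsilon> (Complex (x0 - s) (2 * \<psi>)) * g (Complex s \<phi>) \<partial>lborel)"
proof -
 define F where "F u = kker n \<epsilon> (Complex x0 (\<phi> + 2 * \<psi>) - u) * g u" for u
 define b0 b1 where "b0 = min \<phi> \<psi>" and "b1 = max \<phi> \<psi>"
 have b: "\<alpha> < b0" "b0 \<le> b1" "b1 < \<beta>" "\<phi> + \<psi> = b0 + b1" using \<phi> \<psi> by (auto simp: b0_def b1_def)
 have inb: "b0 \<le> \<phi>" "\<phi> \<le> b1" "b0 \<le> \<psi>" "\<psi> \<le> b1" by (auto simp: b0_def b1_def)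
 define \<mu> where "\<mu> = min (b0 - \<alpha>) (\<beta> - b1)"
 have \<mu>: "\<mu> > 0" "\<mu> \<le> b0 - \<alpha>" "\<mu> \<le> \<beta> - b1" using b by (auto simp: \<mu>_def)
 obtain C1 where C1: "C1 > 0" "\<And>\<epsilon> \<tau>. \<lbrakk>0 \<le> \<epsilon>; \<epsilon> \<le> 1; b0 \<le> Im \<tau> / 2; Im \<tau> / 2 \<le> b1\<rbrakk> \<Longrightarrow> cmod (kker n \<epsilon> \<tau>) \<le> C1 * exp (- \<bar>Re \<tau>\<bar> / 2)"
  by (rule kker_decay_fixed[OF b(1,2,3)]) blast
 obtain C2 where C2: "\<And>u. b0 \<le> Im u ==> Im u \<le> b1 ==> cmod (g u) \<le> C2 * exp (\<bar>Re u\<bar> / 4)"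
  using bnd[OF b(1,2,3)] by blast
 have hol: "F holomorphic_on {z. b0 - \<mu> < Im z \<and> Im z < b1 + \<mu>} - {}"
 proof -
  have "(\<lambda>u. kker n \<epsilon> (Complex x0 (\<phi> + 2 * \<psi>) - u)) holomorphic_on {z. b0 - \<mu> < Im z \<and> Im z < b1 + \<mu>}"
  proof (rule holomorphic_on_compose_gen[OF _ kker_holomorphic[OF eps, of n], unfolded o_def])
   show "(\<lambda>u. Complex x0 (\<phi> + 2 * \<psi>) - u) holomorphic_on {z. b0 - \<mu> < Im z \<and> Im z < b1 + \<mu>}"
    by (intro holomorphic_intros)
   show "(\<lambda>u. Complex x0 (\<phi> + 2 * \<psi>) - u) ` {z. b0 - \<mu> < Im z \<and> Im z < b1 + \<mu>} \<subseteq> {\<tau>. 2 * \<alpha> < Im \<tau> \<and> Im \<tau> < 2 * \<beta>}"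
   proof safe
    fix u assume u: "b0 - \<mu> < Im u" "Im u < b1 + \<mu>"
    have im: "Im (Complex x0 (\<phi> + 2 * \<psi>) - u) = \<phi> + 2 * \<psi> - Im u" by simp
    show "2 * \<alpha> < Im (Complex x0 (\<phi> + 2 * \<psi>) - u)" unfolding im using u b inb \<mu> by linarith
    show "Im (Complex x0 (\<phi> + 2 * \<psi>) - u) < 2 * \<beta>" unfolding im using u b inb \<mu> by linarith
   qed
  qed
  moreover have "g holomorphic_on {z. b0 - \<mu> < Im z \<and> Im z < b1 + \<mu>}"
   by (rule holomorphic_on_subset[OF g]) (use \<mu> in auto)
  ultimately show ?thesis unfolding F_def Diff_empty by (rule holomorphic_on_mult)
 qed
 define C where "C = C1 * exp (\<bar>x0\<bar> / 2) * C2"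
 have decay: "cmod (F (Complex x y)) \<le> C * exp (- (1/4) * \<bar>x\<bar>)" if y: "b0 \<le> y" "y \<le> b1" for x y
 proof -
  have "cmod (kker n \<epsilon> (Complex x0 (\<phi> + 2 * \<psi>) - Complex x y)) \<le> C1 * exp (- \<bar>x0 - x\<bar> / 2)"
   using C1(2)[OF eps, of "Complex x0 (\<phi> + 2 * \<psi>) - Complex x y"] y b inb by simp
  also have "\<dots> \<le> C1 * (exp (\<bar>x0\<bar> / 2) * exp (- \<bar>x\<bar> / 2))"
   using C1(1) by (intro mult_left_mono exp_abs_diff_le) simp
  finally have 1: "cmod (kker n \<epsilon> (Complex x0 (\<phi> + 2 * \<psi>) - Complex x y)) \<le> C1 * (exp (\<bar>x0\<bar> / 2) * exp (- \<bar>x\<bar> / 2))" .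
  have 2: "cmod (g (Complex x y)) \<le> C2 * exp (\<bar>x\<bar> / 4)" using C2[of "Complex x y"] y by simp
  have "cmod (F (Complex x y)) \<le> (C1 * (exp (\<bar>x0\<bar> / 2) * exp (- \<bar>x\<bar> / 2))) * (C2 * exp (\<bar>x\<bar> / 4))"
   unfolding F_def norm_mult by (rule mult_mono[OF 1 2]) (use C1 in auto)
  also have "\<dots> = C * (exp (- \<bar>x\<bar> / 2) * exp (\<bar>x\<bar> / 4))" by (simp add: C_def)
  also have "exp (- \<bar>x\<bar> / 2) * exp (\<bar>x\<bar> / 4) = exp (- (1/4) * \<bar>x\<bar>)" by (simp add: exp_add[symmetric])
  finally show ?thesis .
 qed
 have "(\<integral>s. F (Complex s b0) \<partial>lborel) = (\<integral>s. F (Complex s b1) \<partial>lborel)"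
 proof (cases "b0 < b1")
  case True
  show ?thesis
   using contour_shift(3)[OF True \<mu>(1) finite.emptyI _ hol, of "1/4" 0 C] decay by simp
 next
  case False
  then have "b0 = b1" using b(2) by simp
  then show ?thesis by simp
 qed
 then have "(\<integral>s. F (Complex s \<psi>) \<partial>lborel) = (\<integral>s. F (Complex s \<phi>) \<partial>lborel)"
  by (cases "\<phi> \<le> \<psi>") (auto simp: b0_def b1_def)
 moreover have "F (Complex s \<psi>) = kker n \<epsilon> (Complex (x0 - s) (\<phi> + \<psi>)) * g (Complex s \<psi>)" for s
  by (simp add: F_def complex_diff add.commute)
 moreover have "F (Complex s \<phi>) = kker n \<epsilon> (Complex (x0 - s) (2 * \<psi>)) * g (Complex s \<phi>)" for s
  by (simp add: F_def complex_diff add.commute)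
 ultimately show ?thesis by simp
qed

lemma h_pow_Im_cont: "continuous_on strip (\<lambda>u. complex_of_real (h (Im u) ^ k))"
 by (intro continuous_intros continuous_on_compose2[OF cont_h]) auto

lemma line_cont:
 fixes g :: "complex \<Rightarrow> complex"
 assumes "g holomorphic_on strip" "\<alpha> < \<phi>" "\<phi> < \<beta>"
 shows "continuous_on UNIV (\<lambda>s. g (Complex s \<phi>))"
 using assms by (intro continuous_on_compose2[OF holomorphic_on_imp_continuous_on[OF assms(1)]])
  (auto simp: Complex_eq intro!: continuous_intros)

lemma regularised_reproducing:
 fixes g :: "complex \<Rightarrow> complex"
 assumes eps: "0 < \<epsilon>" "\<epsilon> \<le> 1" and g: "g holomorphic_on strip"
  and bnd: "\<And>a b. \<alpha> < a ==> a \<le> b ==> b < \<beta> ==> \<exists>C. \<forall>u. a \<le> Im u \<and> Im u \<le> b \<longrightarrow> cmod (g u) \<le> C * exp (\<bar>Re u\<bar> / 4)"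
  and \<phi>: "\<alpha> < \<phi>" "\<phi> < \<beta>"
  and int: "integrable lborel (\<lambda>u. indicator strip u *\<^sub>R (kker n \<epsilon> (Complex x0 \<phi> - cnj u) * g u * of_real (h (Im u) ^ Suc n)))"
 shows "(\<integral>u. indicator strip u *\<^sub>R (kker n \<epsilon> (Complex x0 \<phi> - cnj u) * g u * of_real (h (Im u) ^ Suc n)) \<partial>lborel)
  = 2 * pi * (\<integral>v. of_real (std_normal_density v) * g (Complex (x0 + sqrt \<epsilon> * v) \<phi>) \<partial>lborel)"
proof -
 define H where "H \<psi> = complex_of_real (indicator {\<alpha><..<\<beta>} \<psi> * h \<psi> ^ Suc n)" for \<psi>
 have eps': "0 \<le> \<epsilon>" using eps by simp
 have eq0: "indicator strip (Complex s \<psi>) *\<^sub>R (kker n \<epsilon> (Complex x0 \<phi> - cnj (Complex s \<psi>)) * g (Complex s \<psi>) * of_real (h (Im (Complex s \<psi>)) ^ Suc n))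
   = H \<psi> * (kker n \<epsilon> (Complex (x0 - s) (\<phi> + \<psi>)) * g (Complex s \<psi>))" for \<psi> s
 proof -
  have "Complex x0 \<phi> - cnj (Complex s \<psi>) = Complex (x0 - s) (\<phi> + \<psi>)" by (simp add: complex_eq_iff)
  then show ?thesis by (simp add: H_def indicator_def)
 qed
 have "(\<integral>u. indicator strip u *\<^sub>R (kker n \<epsilon> (Complex x0 \<phi> - cnj u) * g u * of_real (h (Im u) ^ Suc n)) \<partial>lborel)
   = (\<integral>\<psi>. \<integral>s. H \<psi> * (kker n \<epsilon> (Complex (x0 - s) (\<phi> + \<psi>)) * g (Complex s \<psi>)) \<partial>lborel \<partial>lborel)"
  unfolding complex_Fubini(1)[OF int] eq0 ..
 also have "\<dots> = (\<integral>\<psi>. \<integral>s. H \<psi> * (kker n \<epsilon> (Complex (x0 - s) (2 * \<psi>)) * g (Complex s \<phi>)) \<partial>lborel \<partial>lborel)"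
 proof (rule Bochner_Integration.integral_cong[OF refl])
  fix \<psi>
  show "(\<integral>s. H \<psi> * (kker n \<epsilon> (Complex (x0 - s) (\<phi> + \<psi>)) * g (Complex s \<psi>)) \<partial>lborel)
    = (\<integral>s. H \<psi> * (kker n \<epsilon> (Complex (x0 - s) (2 * \<psi>)) * g (Complex s \<phi>)) \<partial>lborel)"
  proof (cases "\<psi> \<in> {\<alpha><..<\<beta>}")
   case True
   then have "\<alpha> < \<psi>" "\<psi> < \<beta>" by auto
   from kker_strip_shift[OF eps' eps(2) g bnd \<phi> this, of n x0]
   show ?thesis by (simp only: integral_mult_right_zero)
  qed (simp add: H_def)
 qed
 also have "\<dots> = (\<integral>s. \<integral>\<psi>. H \<psi> * (kker n \<epsilon> (Complex (x0 - s) (2 * \<psi>)) * g (Complex s \<phi>)) \<partial>lborel \<partial>lborel)"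
 proof (rule lborel_pair.Fubini_integral)
  define f where "f = (\<lambda>(s, \<psi>). H \<psi> * (kker n \<epsilon> (Complex (x0 - s) (2 * \<psi>)) * g (Complex s \<phi>)))"
  obtain K where K: "K > 0" "\<And>t \<psi>. \<alpha> < \<psi> ==> \<psi> < \<beta> ==>
    h \<psi> ^ Suc n * cmod (kker n \<epsilon> (Complex t (2 * \<psi>))) \<le> K * exp (- \<bar>t\<bar> / 2) * Bd n \<epsilon> \<psi>"
   by (rule kker_Bd[OF eps, of n]) blast
  obtain C2 where C2: "\<And>u. \<phi> \<le> Im u ==> Im u \<le> \<phi> ==> cmod (g u) \<le> C2 * exp (\<bar>Re u\<bar> / 4)"
   using bnd[OF \<phi>(1) order_refl \<phi>(2)] by blast
  have Bd0: "Bd n \<epsilon> \<psi> \<ge> 0" for \<psi> unfolding Bd_def by (intro integral_nonneg_AE AE_I2 Phi_nonneg)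
  have C20: "C2 \<ge> 0" using order_trans[OF norm_ge_zero C2[of "Complex 0 \<phi>"]] by simp
  define D where "D = K * exp (\<bar>x0\<bar> / 2) * C2"
  have D0: "D \<ge> 0" using K C20 by (simp add: D_def)
  have fb: "cmod (f (s, \<psi>)) \<le> D * exp (- (1/4) * \<bar>s\<bar>) * Bd n \<epsilon> \<psi>" for s \<psi>
  proof (cases "\<psi> \<in> {\<alpha><..<\<beta>}")
   case True
   have h0: "h \<psi> ^ Suc n \<ge> 0" using h_nonneg[of \<psi>] True by simp
   have 1: "h \<psi> ^ Suc n * cmod (kker n \<epsilon> (Complex (x0 - s) (2 * \<psi>))) \<le> K * exp (- \<bar>x0 - s\<bar> / 2) * Bd n \<epsilon> \<psi>"
    using K(2)[of \<psi> "x0 - s"] True by simp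
   note e = exp_abs_diff_le(1)[of x0 s]
   have 2: "cmod (g (Complex s \<phi>)) \<le> C2 * exp (\<bar>s\<bar> / 4)" using C2[of "Complex s \<phi>"] by simp
   have "cmod (f (s, \<psi>)) = (h \<psi> ^ Suc n * cmod (kker n \<epsilon> (Complex (x0 - s) (2 * \<psi>)))) * cmod (g (Complex s \<phi>))"
    using True h_nonneg[of \<psi>] by (simp add: f_def H_def norm_mult norm_power)
   also have "\<dots> \<le> (K * exp (- \<bar>x0 - s\<bar> / 2) * Bd n \<epsilon> \<psi>) * (C2 * exp (\<bar>s\<bar> / 4))"
    using h0 K(1) Bd0[of \<psi>] by (intro mult_mono 1 2) auto
   also have "\<dots> \<le> (K * (exp (\<bar>x0\<bar> / 2) * exp (- \<bar>s\<bar> / 2)) * Bd n \<epsilon> \<psi>) * (C2 * exp (\<bar>s\<bar> / 4))"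
    using K(1) Bd0[of \<psi>] C20 by (intro mult_right_mono mult_left_mono e) auto
   also have "\<dots> = D * (exp (- \<bar>s\<bar> / 2) * exp (\<bar>s\<bar> / 4)) * Bd n \<epsilon> \<psi>" by (simp add: D_def)
   also have "exp (- \<bar>s\<bar> / 2) * exp (\<bar>s\<bar> / 4) = exp (- (1/4) * \<bar>s\<bar>)" by (simp add: exp_add[symmetric])
   finally show ?thesis .
  next
   case False
   then show ?thesis using D0 Bd0[of \<psi>] by (simp add: f_def H_def)
  qed
  have fm: "f \<in> borel_measurable (lborel \<Otimes>\<^sub>M lborel)"
  proof -
   let ?A = "UNIV \<times> {\<alpha><..<\<beta>} :: (real \<times> real) set"
   define f' where "f' p = of_real (h (snd p) ^ Suc n) * (kker n \<epsilon> (Complex (x0 - fst p) (2 * snd p)) * g (Complex (fst p) \<phi>))" for p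
   have "(\<lambda>p. indicator ?A p *\<^sub>R f' p) \<in> borel_measurable borel"
   proof (rule borel_measurable_continuous_on_indicator)
    show "?A \<in> sets borel" by (intro borel_open open_Times) auto
    have "continuous_on ?A (\<lambda>p. h (snd p))"
     by (rule continuous_on_compose2[OF cont_h]) (auto intro!: continuous_intros)
    moreover have "continuous_on ?A (\<lambda>p. kker n \<epsilon> (Complex (x0 - fst p) (2 * snd p)))"
     by (rule continuous_on_compose2[OF holomorphic_on_imp_continuous_on[OF kker_holomorphic[OF eps' eps(2), of n]]])
      (auto simp: Complex_eq intro!: continuous_intros)
    moreover have "continuous_on ?A (\<lambda>p. g (Complex (fst p) \<phi>))"
     by (rule continuous_on_compose2[OF line_cont[OF g \<phi>]]) (auto intro!: continuous_intros)
    ultimately show "continuous_on ?A f'" unfolding f'_def by (intro continuous_intros)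
   qed
   moreover have "(\<lambda>p. indicator ?A p *\<^sub>R f' p) = f"
    by (auto simp: fun_eq_iff f_def f'_def H_def indicator_def)
   ultimately have "f \<in> borel_measurable borel" by (simp only:)
   then show ?thesis unfolding lborel_prod measurable_cong_sets[OF sets_lborel refl] .
  qed
  have Bi: "integrable lborel (Bd n \<epsilon>)" by (rule Bd_integrable[OF eps(1)])
  have fpsi: "integrable lborel (\<lambda>\<psi>. f (s, \<psi>))" for s
  proof (rule Bochner_Integration.integrable_bound)
   show "integrable lborel (\<lambda>\<psi>. D * exp (- (1/4) * \<bar>s\<bar>) * Bd n \<epsilon> \<psi>)" using Bi by (rule integrable_mult_right)
   show "(\<lambda>\<psi>. f (s, \<psi>)) \<in> borel_measurable lborel" using fm by measurable
   show "AE \<psi> in lborel. norm (f (s, \<psi>)) \<le> norm (D * exp (- (1/4) * \<bar>s\<bar>) * Bd n \<epsilon> \<psi>)"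
    by (rule AE_I2, rule order_trans[OF fb], simp only: real_norm_def abs_ge_self)
  qed
  have "integrable (lborel \<Otimes>\<^sub>M lborel) f"
  proof (rule lborel_pair.Fubini_integrable[OF fm])
   show "integrable lborel (\<lambda>s. \<integral>\<psi>. norm (f (s, \<psi>)) \<partial>lborel)"
   proof (rule Bochner_Integration.integrable_bound)
    show "integrable lborel (\<lambda>s. D * (\<integral>\<psi>. Bd n \<epsilon> \<psi> \<partial>lborel) * exp (- (1/4) * \<bar>s\<bar>))"
     using integrable_exp_abs[of "1/4"] by (intro integrable_mult_right) simp
    have "(\<lambda>p. norm (f p)) \<in> borel_measurable (lborel \<Otimes>\<^sub>M lborel)" using fm by measurable
    then show "(\<lambda>s. \<integral>\<psi>. norm (f (s, \<psi>)) \<partial>lborel) \<in> borel_measurable lborel"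
     by (intro lborel.borel_measurable_lebesgue_integral) simp
    show "AE s in lborel. norm (\<integral>\<psi>. norm (f (s, \<psi>)) \<partial>lborel) \<le> norm (D * (\<integral>\<psi>. Bd n \<epsilon> \<psi> \<partial>lborel) * exp (- (1/4) * \<bar>s\<bar>))"
    proof (rule AE_I2)
     fix s :: real
     have "norm (\<integral>\<psi>. norm (f (s, \<psi>)) \<partial>lborel) \<le> (\<integral>\<psi>. D * exp (- (1/4) * \<bar>s\<bar>) * Bd n \<epsilon> \<psi> \<partial>lborel)"
     proof (rule norm_integral_le)
      show "integrable lborel (\<lambda>\<psi>. norm (f (s, \<psi>)))" using fpsi by (rule integrable_norm)
      show "integrable lborel (\<lambda>\<psi>. D * exp (- (1/4) * \<bar>s\<bar>) * Bd n \<epsilon> \<psi>)" using Bi by (rule integrable_mult_right)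
      show "norm (norm (f (s, \<psi>))) \<le> D * exp (- (1/4) * \<bar>s\<bar>) * Bd n \<epsilon> \<psi>" for \<psi> using fb[of s \<psi>] by simp
     qed
     also have "\<dots> = D * (\<integral>\<psi>. Bd n \<epsilon> \<psi> \<partial>lborel) * exp (- (1/4) * \<bar>s\<bar>)" by simp
     also have "\<dots> \<le> norm (D * (\<integral>\<psi>. Bd n \<epsilon> \<psi> \<partial>lborel) * exp (- (1/4) * \<bar>s\<bar>))"
      by (simp only: real_norm_def abs_ge_self)
     finally show "norm (\<integral>\<psi>. norm (f (s, \<psi>)) \<partial>lborel) \<le> norm (D * (\<integral>\<psi>. Bd n \<epsilon> \<psi> \<partial>lborel) * exp (- (1/4) * \<bar>s\<bar>))" .
    qed
   qed
   show "AE s in lborel. integrable lborel (\<lambda>\<psi>. f (s, \<psi>))" using fpsi by (intro AE_I2)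
  qed
  then show "integrable (lborel \<Otimes>\<^sub>M lborel) (\<lambda>(s, \<psi>). H \<psi> * (kker n \<epsilon> (Complex (x0 - s) (2 * \<psi>)) * g (Complex s \<phi>)))"
   by (simp only: f_def)
 qed
 also have "\<dots> = (\<integral>s. of_real (2 * pi / sqrt \<epsilon> * std_normal_density ((x0 - s) / sqrt \<epsilon>)) * g (Complex s \<phi>) \<partial>lborel)"
 proof (rule Bochner_Integration.integral_cong[OF refl])
  fix s
  have "(\<integral>\<psi>. H \<psi> * (kker n \<epsilon> (Complex (x0 - s) (2 * \<psi>)) * g (Complex s \<phi>)) \<partial>lborel)
    = (\<integral>\<psi>. H \<psi> * kker n \<epsilon> (Complex (x0 - s) (2 * \<psi>)) \<partial>lborel) * g (Complex s \<phi>)"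
   unfolding mult.assoc[symmetric] by (rule integral_mult_left_zero)
  then show "(\<integral>\<psi>. H \<psi> * (kker n \<epsilon> (Complex (x0 - s) (2 * \<psi>)) * g (Complex s \<phi>)) \<partial>lborel)
    = of_real (2 * pi / sqrt \<epsilon> * std_normal_density ((x0 - s) / sqrt \<epsilon>)) * g (Complex s \<phi>)"
   unfolding H_def kker_average[OF eps] .
 qed
 also have "\<dots> = \<bar>sqrt \<epsilon>\<bar> *\<^sub>R (\<integral>v. of_real (2 * pi / sqrt \<epsilon> * std_normal_density ((x0 - (x0 + sqrt \<epsilon> * v)) / sqrt \<epsilon>)) * g (Complex (x0 + sqrt \<epsilon> * v) \<phi>) \<partial>lborel)"
  using eps by (intro lborel_integral_real_affine) auto
 also have "(\<lambda>v. of_real (2 * pi / sqrt \<epsilon> * std_normal_density ((x0 - (x0 + sqrt \<epsilon> * v)) / sqrt \<epsilon>)) * g (Complex (x0 + sqrt \<epsilon> * v) \<phi>))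
   = (\<lambda>v. of_real (2 * pi / sqrt \<epsilon>) * (of_real (std_normal_density v) * g (Complex (x0 + sqrt \<epsilon> * v) \<phi>)))"
 proof
  fix v
  have "(x0 - (x0 + sqrt \<epsilon> * v)) / sqrt \<epsilon> = - v" using eps by (simp add: field_simps)
  moreover have "std_normal_density (- v) = std_normal_density v" by (simp add: std_normal_density_def)
  ultimately show "of_real (2 * pi / sqrt \<epsilon> * std_normal_density ((x0 - (x0 + sqrt \<epsilon> * v)) / sqrt \<epsilon>)) * g (Complex (x0 + sqrt \<epsilon> * v) \<phi>)
    = of_real (2 * pi / sqrt \<epsilon>) * (of_real (std_normal_density v) * g (Complex (x0 + sqrt \<epsilon> * v) \<phi>))"
   by (simp only: of_real_mult mult.assoc)
 qed
 also have "\<bar>sqrt \<epsilon>\<bar> *\<^sub>R (\<integral>v. of_real (2 * pi / sqrt \<epsilon>) * (of_real (std_normal_density v) * g (Complex (x0 + sqrt \<epsilon> * v) \<phi>)) \<partial>lborel)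
   = 2 * pi * (\<integral>v. of_real (std_normal_density v) * g (Complex (x0 + sqrt \<epsilon> * v) \<phi>) \<partial>lborel)"
  using eps by (simp add: scaleR_conv_of_real)
 finally show ?thesis .
qed

text \<open>The limit \<open>\<epsilon> \<rightarrow> 0\<close> of \<open>regularised_reproducing\<close>, by dominated convergence on both sides.\<close>

theorem strip_reproducing:
 fixes g :: "complex \<Rightarrow> complex"
 assumes g: "g holomorphic_on strip"
  and bnd: "\<And>a b. \<alpha> < a ==> a \<le> b ==> b < \<beta> ==> \<exists>C. \<forall>u. a \<le> Im u \<and> Im u \<le> b \<longrightarrow> cmod (g u) \<le> C * exp (\<bar>Re u\<bar> / 4)"
  and int: "integrable lborel (\<lambda>u. indicator strip u *\<^sub>R (exp (- \<bar>Re u\<bar> / 4) * h (Im u) ^ Suc n) *\<^sub>R g u)"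
  and \<sigma>: "\<sigma> \<in> strip"
 shows "(LINT u:strip|lborel. kker n 0 (\<sigma> - cnj u) * g u * of_real (h (Im u) ^ Suc n)) = 2 * pi * g \<sigma>"
proof -
 define x0 \<phi> where "x0 = Re \<sigma>" and "\<phi> = Im \<sigma>"
 have \<sigma>_eq: "\<sigma> = Complex x0 \<phi>" and \<phi>: "\<alpha> < \<phi>" "\<phi> < \<beta>" using \<sigma> by (auto simp: x0_def \<phi>_def)
 define T where "T \<epsilon> u = indicator strip u *\<^sub>R (kker n \<epsilon> (\<sigma> - cnj u) * g u * of_real (h (Im u) ^ Suc n))" for \<epsilon> u
 define W where "W u = indicator strip u *\<^sub>R (exp (- \<bar>Re u\<bar> / 4) * h (Im u) ^ Suc n) *\<^sub>R g u" for u
 define a b where "a = (\<alpha> + \<phi>) / 2" and "b = (\<phi> + \<beta>) / 2"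
 have ab': "\<alpha> < a" "a \<le> b" "b < \<beta>" using \<phi> by (auto simp: a_def b_def)
 obtain C1 where C1: "C1 > 0" "\<And>\<epsilon> \<tau>. \<lbrakk>0 \<le> \<epsilon>; \<epsilon> \<le> 1; a \<le> Im \<tau> / 2; Im \<tau> / 2 \<le> b\<rbrakk> \<Longrightarrow> cmod (kker n \<epsilon> \<tau>) \<le> C1 * exp (- \<bar>Re \<tau>\<bar> / 2)"
  by (rule kker_decay_fixed[OF ab', of n]) blast
 define D where "D = C1 * exp (\<bar>x0\<bar> / 2)"
 have TW: "cmod (T \<epsilon> u) \<le> D * norm (W u)" if eps: "0 \<le> \<epsilon>" "\<epsilon> \<le> 1" for \<epsilon> u
 proof (cases "u \<in> strip")
  case True
  have h0: "h (Im u) ^ Suc n \<ge> 0" using h_nonneg[of "Im u"] True by simp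
  have "cmod (kker n \<epsilon> (\<sigma> - cnj u)) \<le> C1 * exp (- \<bar>x0 - Re u\<bar> / 2)"
   using C1(2)[OF eps, of "\<sigma> - cnj u"] True by (simp add: x0_def a_def b_def \<phi>_def)
  also have "\<dots> \<le> C1 * (exp (\<bar>x0\<bar> / 2) * exp (- \<bar>Re u\<bar> / 4))"
   using C1(1) by (intro mult_left_mono exp_abs_diff_le) simp
  finally have k: "cmod (kker n \<epsilon> (\<sigma> - cnj u)) \<le> D * exp (- \<bar>Re u\<bar> / 4)" by (simp add: D_def)
  have "cmod (T \<epsilon> u) = cmod (kker n \<epsilon> (\<sigma> - cnj u)) * (cmod (g u) * h (Im u) ^ Suc n)"
   using True h_nonneg[of "Im u"] by (simp add: T_def norm_mult norm_power)
  also have "\<dots> \<le> (D * exp (- \<bar>Re u\<bar> / 4)) * (cmod (g u) * h (Im u) ^ Suc n)"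
   using h0 by (intro mult_right_mono[OF k]) auto
  also have "\<dots> = D * norm (W u)" using True h_nonneg[of "Im u"] by (simp add: W_def)
  finally show ?thesis .
 qed (simp add: T_def W_def)
 have Wi: "integrable lborel (\<lambda>u. D * norm (W u))" using int unfolding W_def[symmetric] by (intro integrable_mult_right integrable_norm)
 have Tm: "T \<epsilon> \<in> borel_measurable lborel" if eps: "0 \<le> \<epsilon>" "\<epsilon> \<le> 1" for \<epsilon>
 proof -
  have "T \<epsilon> \<in> borel_measurable borel"
   unfolding T_def[abs_def]
  proof (rule borel_measurable_continuous_on_indicator)
   show "strip \<in> sets borel" using open_strip by (rule borel_open)
   have "continuous_on strip (\<lambda>u. kker n \<epsilon> (\<sigma> - cnj u))"
   proof (rule continuous_on_compose2[OF holomorphic_on_imp_continuous_on[OF kker_holomorphic[OF eps, of n]]])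
    show "(\<lambda>u. \<sigma> - cnj u) ` strip \<subseteq> {\<tau>. 2 * \<alpha> < Im \<tau> \<and> Im \<tau> < 2 * \<beta>}" using \<sigma> by auto
   qed (intro continuous_intros)
   then show "continuous_on strip (\<lambda>u. kker n \<epsilon> (\<sigma> - cnj u) * g u * of_real (h (Im u) ^ Suc n))"
    by (intro continuous_on_mult h_pow_Im_cont holomorphic_on_imp_continuous_on[OF g])
  qed
  then show ?thesis by simp
 qed
 have Ti: "integrable lborel (T \<epsilon>)" if eps: "0 \<le> \<epsilon>" "\<epsilon> \<le> 1" for \<epsilon>
  by (rule Bochner_Integration.integrable_bound[OF Wi Tm[OF eps]])
   (rule AE_I2, rule order_trans[OF TW[OF eps]], simp only: real_norm_def abs_ge_self)
 define ee where "ee j = 1 / real (Suc j)" for j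
 have ee: "0 < ee j" "0 \<le> ee j" "ee j \<le> 1" for j by (auto simp: ee_def)
 have ee0: "ee \<longlonglongrightarrow> 0" unfolding ee_def by (intro LIMSEQ_Suc lim_1_over_n)
 have lim1: "(\<lambda>j. \<integral>u. T (ee j) u \<partial>lborel) \<longlonglongrightarrow> (\<integral>u. T 0 u \<partial>lborel)"
 proof (rule integral_dominated_convergence[OF _ _ Wi])
  show "AE u in lborel. (\<lambda>j. T (ee j) u) \<longlonglongrightarrow> T 0 u"
  proof (rule AE_I2)
   fix u
   show "(\<lambda>j. T (ee j) u) \<longlonglongrightarrow> T 0 u"
   proof (cases "u \<in> strip")
    case True
    then show ?thesis unfolding T_def ee_def using \<sigma>
     by (intro tendsto_intros kker_tendsto) auto
   qed (simp add: T_def)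
  qed
  show "AE u in lborel. norm (T (ee j) u) \<le> D * norm (W u)" for j by (intro AE_I2 TW ee)
 qed (use Tm ee in auto)
 define J where "J \<epsilon> = (\<integral>v. of_real (std_normal_density v) * g (Complex (x0 + sqrt \<epsilon> * v) \<phi>) \<partial>lborel)" for \<epsilon>
 have TJ: "(\<integral>u. T (ee j) u \<partial>lborel) = 2 * pi * J (ee j)" for j
  using regularised_reproducing[OF ee(1,3) g bnd \<phi>, of n j x0] Ti[OF ee(2,3), of j]
  unfolding T_def \<sigma>_eq J_def by blast
 obtain C2 where C2: "\<And>u. \<phi> \<le> Im u ==> Im u \<le> \<phi> ==> cmod (g u) \<le> C2 * exp (\<bar>Re u\<bar> / 4)"
  using bnd[OF \<phi>(1) order_refl \<phi>(2)] by blast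
 have C20: "C2 \<ge> 0" using order_trans[OF norm_ge_zero C2[of "Complex 0 \<phi>"]] by simp
 have lim2: "(\<lambda>j. J (ee j)) \<longlonglongrightarrow> (\<integral>v. of_real (std_normal_density v) * g (Complex x0 \<phi>) \<partial>lborel)"
  unfolding J_def
 proof (rule integral_dominated_convergence[where w = "\<lambda>v. C2 * exp (\<bar>x0\<bar> / 4) * (std_normal_density v * exp (\<bar>v\<bar> / 4))"])
  have "integrable lborel (\<lambda>v. complex_of_real (std_normal_density v * exp (\<bar>v\<bar> / 4)))"
  proof (rule integrable_exp_decay[where \<delta> = 1 and R = 3 and C = 1])
   show "continuous_on UNIV (\<lambda>v. complex_of_real (std_normal_density v * exp (\<bar>v\<bar> / 4)))"
    unfolding std_normal_density_def by (intro continuous_intros) auto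
   fix v :: real assume v: "3 \<le> \<bar>v\<bar>"
   have s: "1 / sqrt (2 * pi) \<le> 1" using pi_ge_two by (simp add: real_le_rsqrt divide_le_eq)
   have "3 * \<bar>v\<bar> \<le> v\<^sup>2" using mult_right_mono[OF v, of "\<bar>v\<bar>"] by (simp add: power2_eq_square)
   then have "- v\<^sup>2 / 2 + \<bar>v\<bar> / 4 \<le> - 1 * \<bar>v\<bar>" by simp
   then have "exp (- v\<^sup>2 / 2) * exp (\<bar>v\<bar> / 4) \<le> exp (- 1 * \<bar>v\<bar>)"
    by (simp only: exp_add[symmetric] exp_le_cancel_iff)
   then have "1 / sqrt (2 * pi) * (exp (- v\<^sup>2 / 2) * exp (\<bar>v\<bar> / 4)) \<le> 1 * exp (- 1 * \<bar>v\<bar>)"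
    using s by (intro mult_mono) auto
   then show "cmod (complex_of_real (std_normal_density v * exp (\<bar>v\<bar> / 4))) \<le> 1 * exp (- 1 * \<bar>v\<bar>)"
    unfolding norm_of_real std_normal_density_def by (simp add: abs_mult)
  qed simp
  from integrable_Re[OF this]
  show "integrable lborel (\<lambda>v. C2 * exp (\<bar>x0\<bar> / 4) * (std_normal_density v * exp (\<bar>v\<bar> / 4)))"
   by (intro integrable_mult_right) simp
  have gm: "continuous_on UNIV (\<lambda>v. g (Complex (x0 + sqrt \<epsilon> * v) \<phi>))" for \<epsilon>
   by (rule continuous_on_compose2[OF line_cont[OF g \<phi>]]) (auto intro!: continuous_intros)
  show "(\<lambda>v. of_real (std_normal_density v) * g (Complex (x0 + sqrt (ee j) * v) \<phi>)) \<in> borel_measurable lborel" for j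
   using borel_measurable_continuous_onI[OF gm[of "ee j"]] by simp
  show "(\<lambda>v. of_real (std_normal_density v) * g (Complex x0 \<phi>)) \<in> borel_measurable lborel" by simp
  show "AE v in lborel. (\<lambda>j. of_real (std_normal_density v) * g (Complex (x0 + sqrt (ee j) * v) \<phi>))
    \<longlonglongrightarrow> of_real (std_normal_density v) * g (Complex x0 \<phi>)"
  proof (rule AE_I2)
   fix v :: real
   have "(\<lambda>j. x0 + sqrt (ee j) * v) \<longlonglongrightarrow> x0 + sqrt 0 * v" by (intro tendsto_intros ee0)
   moreover have "isCont (\<lambda>s. g (Complex s \<phi>)) (x0 + sqrt 0 * v)"
    using line_cont[OF g \<phi>] by (simp add: continuous_on_eq_continuous_at)
   ultimately have "(\<lambda>j. g (Complex (x0 + sqrt (ee j) * v) \<phi>)) \<longlonglongrightarrow> g (Complex (x0 + sqrt 0 * v) \<phi>)"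
    by (rule isCont_tendsto_compose[rotated])
   then show "(\<lambda>j. of_real (std_normal_density v) * g (Complex (x0 + sqrt (ee j) * v) \<phi>))
    \<longlonglongrightarrow> of_real (std_normal_density v) * g (Complex x0 \<phi>)" by (intro tendsto_intros) simp
  qed
  show "AE v in lborel. cmod (of_real (std_normal_density v) * g (Complex (x0 + sqrt (ee j) * v) \<phi>))
    \<le> C2 * exp (\<bar>x0\<bar> / 4) * (std_normal_density v * exp (\<bar>v\<bar> / 4))" for j
  proof (rule AE_I2)
   fix v :: real
   have "sqrt (ee j) \<le> 1" using ee[of j] by simp
   then have "\<bar>sqrt (ee j) * v\<bar> \<le> \<bar>v\<bar>" using ee[of j] by (simp add: abs_mult mult_left_le_one_le)
   then have "\<bar>x0 + sqrt (ee j) * v\<bar> / 4 \<le> \<bar>x0\<bar> / 4 + \<bar>v\<bar> / 4"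
    using abs_triangle_ineq[of x0 "sqrt (ee j) * v"] by simp
   then have "exp (\<bar>x0 + sqrt (ee j) * v\<bar> / 4) \<le> exp (\<bar>x0\<bar> / 4) * exp (\<bar>v\<bar> / 4)"
    by (simp only: exp_add[symmetric] exp_le_cancel_iff)
   then have "C2 * exp (\<bar>x0 + sqrt (ee j) * v\<bar> / 4) \<le> C2 * (exp (\<bar>x0\<bar> / 4) * exp (\<bar>v\<bar> / 4))"
    using C20 by (rule mult_left_mono)
   moreover have "cmod (g (Complex (x0 + sqrt (ee j) * v) \<phi>)) \<le> C2 * exp (\<bar>x0 + sqrt (ee j) * v\<bar> / 4)"
    using C2[of "Complex (x0 + sqrt (ee j) * v) \<phi>"] by simp
   ultimately have "cmod (g (Complex (x0 + sqrt (ee j) * v) \<phi>)) \<le> C2 * (exp (\<bar>x0\<bar> / 4) * exp (\<bar>v\<bar> / 4))" by linarith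
   then have "std_normal_density v * cmod (g (Complex (x0 + sqrt (ee j) * v) \<phi>)) \<le> std_normal_density v * (C2 * (exp (\<bar>x0\<bar> / 4) * exp (\<bar>v\<bar> / 4)))"
    by (intro mult_left_mono) auto
   then show "cmod (of_real (std_normal_density v) * g (Complex (x0 + sqrt (ee j) * v) \<phi>))
    \<le> C2 * exp (\<bar>x0\<bar> / 4) * (std_normal_density v * exp (\<bar>v\<bar> / 4))"
    by (simp add: norm_mult mult_ac)
  qed
 qed
 have "(\<integral>v. of_real (std_normal_density v) * g (Complex x0 \<phi>) \<partial>lborel) = g \<sigma>"
  unfolding integral_mult_left_zero \<sigma>_eq by (simp add: integral_complex_of_real)
 then have "(\<lambda>j. 2 * pi * J (ee j)) \<longlonglongrightarrow> 2 * pi * g \<sigma>" using lim2 by (intro tendsto_intros) simp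
 then have "(\<integral>u. T 0 u \<partial>lborel) = 2 * pi * g \<sigma>" using lim1 unfolding TJ by (rule LIMSEQ_unique[rotated])
 then show ?thesis by (simp add: T_def set_lebesgue_integral_def)
qed

end

section \<open>The lens and its conformal map onto a strip\<close>

text \<open>In unitary coordinates \<open>(x, y)\<close> with \<open>x\<close> along \<open>a\<close> and \<open>A = \<bar>a\<bar>\<close>, the domain is
 \<open>{\<bar>y\<bar>\<^sup>2 < rho x}\<close> over the lens \<open>{rho > 0}\<close> in the \<open>x\<close>-plane with vertices \<open>pp\<close> and \<open>qq\<close>, the complex
 tangent points.\<close>

locale lens =
 fixes A r u v :: real
 assumes A_pos: "A > 0" and v_nonzero: "v \<noteq> 0" and on_unit: "u\<^sup>2 + v\<^sup>2 = 1" and on_r: "(u - A)\<^sup>2 + v\<^sup>2 = r\<^sup>2"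
begin

definition qq :: complex where "qq = Complex u v"
definition pp :: complex where "pp = Complex u (- v)"
definition d :: real where "d = 2 * \<bar>v\<bar>"
text \<open>The Moebius map \<open>ee\<close> takes \<open>qq\<close> to \<open>0\<close> and \<open>pp\<close> to \<open>\<infinity>\<close>, hence the two bounding circles to rays and
 the lens to a sector; its logarithm \<open>sg\<close> maps the lens onto the strip \<open>\<alpha> < Im s < \<beta>\<close>, with inverse
 \<open>X\<close>. The factor \<open>M\<close> describes both \<open>rho = h / \<bar>M\<bar>\<^sup>2\<close> and the derivative of \<open>X\<close>, of modulus
 \<open>1 / (d \<bar>M\<bar>\<^sup>2)\<close>. Each circle contributes a function \<open>hh w\<close>, up to a constant a shifted cosine.\<close>

definition \<theta>1 :: real where "\<theta>1 = arctan (u / v)"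
definition \<theta>2 :: real where "\<theta>2 = arctan ((u - A) / v)"
definition hh :: "real \<Rightarrow> real \<Rightarrow> real" where "hh w \<phi> = cos \<phi> - w / v * sin \<phi>"
definition h :: "real \<Rightarrow> real" where "h \<phi> = min (hh u \<phi>) (hh (u - A) \<phi>)"
definition \<alpha> :: real where "\<alpha> = - (pi / 2) - min \<theta>1 \<theta>2"
definition \<beta> :: real where "\<beta> = pi / 2 - max \<theta>1 \<theta>2"
definition rho :: "complex \<Rightarrow> real" where "rho x = min (1 - (cmod x)\<^sup>2) (r\<^sup>2 - (cmod (x - of_real A))\<^sup>2)"
definition X :: "complex \<Rightarrow> complex" where "X s = (qq + pp * exp s) / (1 + exp s)"
definition M :: "complex \<Rightarrow> complex" where "M s = (exp (s / 2) + exp (- s / 2)) / of_real d"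
definition ee :: "complex \<Rightarrow> complex" where "ee x = - (x - qq) / (x - pp)"
definition sg :: "complex \<Rightarrow> complex" where "sg x = Ln (ee x)"

lemma d_pos: "d > 0" using v_nonzero by (simp add: d_def)

lemma pp_neq_qq: "pp \<noteq> qq" using v_nonzero by (simp add: pp_def qq_def)

lemma theta_bounds: "- (pi/2) < \<theta>1" "\<theta>1 < pi/2" "- (pi/2) < \<theta>2" "\<theta>2 < pi/2"
 unfolding \<theta>1_def \<theta>2_def by (rule arctan_lbound arctan_ubound)+

lemma theta_neq: "\<theta>1 \<noteq> \<theta>2"
proof -
 have "u / v \<noteq> (u - A) / v" using A_pos v_nonzero by simp
 then show ?thesis unfolding \<theta>1_def \<theta>2_def by (simp only: arctan_eq_iff not_False_eq_True)
qed

lemma hh_cos: "hh w \<phi> = cos (\<phi> + arctan (w / v)) / cos (arctan (w / v))"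
proof -
 have c: "cos (arctan (w / v)) \<noteq> 0" by (rule cos_arctan_not_zero)
 have "w / v = sin (arctan (w / v)) / cos (arctan (w / v))"
  using tan_arctan[of "w / v"] by (simp add: tan_def)
 then have "hh w \<phi> = cos \<phi> - sin (arctan (w / v)) / cos (arctan (w / v)) * sin \<phi>" by (simp add: hh_def)
 also have "\<dots> = (cos \<phi> * cos (arctan (w / v)) - sin \<phi> * sin (arctan (w / v))) / cos (arctan (w / v))"
  using c by (simp add: diff_divide_distrib mult.commute)
 finally show ?thesis by (simp only: cos_add)
qed

lemma cos_arctan_pos: "cos (arctan x) > 0"
 by (intro cos_gt_zero_pi arctan_lbound arctan_ubound)

lemma h_cases: "h \<phi> = hh u \<phi> \<or> h \<phi> = hh (u - A) \<phi>" "h \<phi> \<le> hh u \<phi>" "h \<phi> \<le> hh (u - A) \<phi>"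
 by (auto simp: h_def min_def)

lemma hh_nonneg:
 assumes "w = u \<or> w = u - A" "\<alpha> \<le> \<phi>" "\<phi> \<le> \<beta>"
 shows "hh w \<phi> \<ge> 0"
proof -
 have "- (pi/2) \<le> \<phi> + arctan (w / v)" "\<phi> + arctan (w / v) \<le> pi/2"
  using assms by (auto simp: \<alpha>_def \<beta>_def \<theta>1_def \<theta>2_def min_def max_def split: if_splits)
 then have "cos (\<phi> + arctan (w / v)) \<ge> 0" by (intro cos_ge_zero)
 then show ?thesis unfolding hh_cos using cos_arctan_pos[of "w / v"] by simp
qed

lemma hh_pos:
 assumes "w = u \<or> w = u - A" "\<alpha> < \<phi>" "\<phi> < \<beta>"
 shows "hh w \<phi> > 0"
proof -
 have "- (pi/2) < \<phi> + arctan (w / v)" "\<phi> + arctan (w / v) < pi/2"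
  using assms by (auto simp: \<alpha>_def \<beta>_def \<theta>1_def \<theta>2_def min_def max_def split: if_splits)
 then have "cos (\<phi> + arctan (w / v)) > 0" by (intro cos_gt_zero_pi)
 then show ?thesis unfolding hh_cos using cos_arctan_pos[of "w / v"] by simp
qed

text \<open>For a cosine, \<open>cos (m + e) cos (m - e) = cos\<^sup>2 m cos\<^sup>2 e - sin\<^sup>2 m sin\<^sup>2 e\<close>.\<close>

lemma hh_midpoint: "hh w \<phi> * hh w \<psi> \<le> (hh w ((\<phi> + \<psi>) / 2))\<^sup>2 * (cos ((\<phi> - \<psi>) / 2))\<^sup>2"
proof -
 define t where "t = arctan (w / v)"
 have c: "cos t > 0" unfolding t_def by (rule cos_arctan_pos)
 define m e where "m = (\<phi> + \<psi>) / 2 + t" and "e = (\<phi> - \<psi>) / 2"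
 have eqs: "\<phi> + t = m + e" "\<psi> + t = m - e" by (simp_all add: m_def e_def field_simps)
 have "cos (\<phi> + t) * cos (\<psi> + t) = (cos m * cos e)\<^sup>2 - (sin m * sin e)\<^sup>2"
  unfolding eqs cos_add cos_diff by (simp add: power2_eq_square algebra_simps)
 then have "cos (\<phi> + t) * cos (\<psi> + t) \<le> (cos m)\<^sup>2 * (cos e)\<^sup>2" by (simp add: power_mult_distrib)
 then have "cos (\<phi> + t) * cos (\<psi> + t) / (cos t)\<^sup>2 \<le> (cos m)\<^sup>2 * (cos e)\<^sup>2 / (cos t)\<^sup>2"
  by (intro divide_right_mono) auto
 then show ?thesis unfolding hh_cos t_def[symmetric] m_def[symmetric] e_def[symmetric]
  by (simp add: power_divide power2_eq_square)
qed

lemma strip_weight_h: "strip_weight h \<alpha> \<beta>"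
proof
 show "\<alpha> < \<beta>" using theta_bounds by (auto simp: \<alpha>_def \<beta>_def min_def max_def)
 show "\<beta> - \<alpha> < pi" using theta_neq by (auto simp: \<alpha>_def \<beta>_def min_def max_def)
 show "continuous_on {\<alpha>..\<beta>} h" unfolding h_def hh_def by (intro continuous_intros)
 show "0 \<le> h \<phi>" if "\<alpha> \<le> \<phi>" "\<phi> \<le> \<beta>" for \<phi> using hh_nonneg[OF _ that] by (auto simp: h_def)
 show "0 < h \<phi>" if "\<alpha> < \<phi>" "\<phi> < \<beta>" for \<phi> using hh_pos[OF _ that] by (auto simp: h_def)
 show "h \<phi> * h \<psi> \<le> (h ((\<phi> + \<psi>) / 2))\<^sup>2 * (cos ((\<phi> - \<psi>) / 2))\<^sup>2"
  if "\<phi> \<in> {\<alpha>..\<beta>}" "\<psi> \<in> {\<alpha>..\<beta>}" for \<phi> \<psi>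
 proof -
  obtain w where w: "w = u \<or> w = u - A" "h ((\<phi> + \<psi>) / 2) = hh w ((\<phi> + \<psi>) / 2)" using h_cases(1) by blast
  have "h \<phi> * h \<psi> \<le> hh w \<phi> * hh w \<psi>"
  proof (rule mult_mono)
   show "h \<phi> \<le> hh w \<phi>" "h \<psi> \<le> hh w \<psi>" using w(1) h_cases(2,3) by auto
   show "0 \<le> hh w \<phi>" using hh_nonneg[OF w(1)] that by auto
   show "0 \<le> h \<psi>" using hh_nonneg that by (auto simp: h_def)
  qed
  also have "\<dots> \<le> (hh w ((\<phi> + \<psi>) / 2))\<^sup>2 * (cos ((\<phi> - \<psi>) / 2))\<^sup>2" by (rule hh_midpoint)
  finally show ?thesis by (simp only: w(2))
 qed
qed

sublocale strip_weight h \<alpha> \<beta> by (rule strip_weight_h)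

lemma alpha_beta_pi: "- pi < \<alpha>" "\<beta> < pi"
 using theta_bounds by (auto simp: \<alpha>_def \<beta>_def min_def max_def)

lemma strip_pi: "s \<in> strip ==> - pi < Im s \<and> Im s < pi"
 using alpha_beta_pi by auto

lemma cos_pos_range:
 assumes "cos x > 0" "- (3 * pi / 2) < x" "x < 3 * pi / 2"
 shows "- (pi/2) < x \<and> x < pi/2"
proof (rule ccontr)
 assume "\<not> (- (pi/2) < x \<and> x < pi/2)"
 then consider "x \<ge> pi/2" | "x \<le> - (pi/2)" by linarith
 then show False
 proof cases
  case 1
  then have "cos (x - pi) \<ge> 0" using assms by (intro cos_ge_zero) auto
  then show False using assms(1) by (simp add: cos_diff)
 next
  case 2
  then have "cos (x + pi) \<ge> 0" using assms by (intro cos_ge_zero) auto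
  then show False using assms(1) by (simp add: cos_add)
 qed
qed

lemma hh_pos_iff_range:
 assumes "hh u \<phi> > 0" "hh (u - A) \<phi> > 0" "- pi < \<phi>" "\<phi> < pi"
 shows "\<alpha> < \<phi> \<and> \<phi> < \<beta>"
proof -
 have "- (pi/2) < \<phi> + arctan (w / v) \<and> \<phi> + arctan (w / v) < pi/2" if "w = u \<or> w = u - A" for w
 proof (rule cos_pos_range)
  have "hh w \<phi> > 0" using assms that by auto
  then show "cos (\<phi> + arctan (w / v)) > 0" unfolding hh_cos using cos_arctan_pos[of "w / v"]
   by (simp add: zero_less_divide_iff)
  show "- (3 * pi / 2) < \<phi> + arctan (w / v)" "\<phi> + arctan (w / v) < 3 * pi / 2"
   using assms arctan_lbound[of "w / v"] arctan_ubound[of "w / v"] by linarith+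
 qed
 from this[of u] this[of "u - A"] show ?thesis by (auto simp: \<alpha>_def \<beta>_def \<theta>1_def \<theta>2_def min_def max_def)
qed

lemma hh_nonneg_range:
 assumes "hh u \<phi> \<ge> 0" "hh (u - A) \<phi> \<ge> 0" "- pi < \<phi>" "\<phi> < pi"
 shows "\<alpha> \<le> \<phi> \<and> \<phi> \<le> \<beta>"
proof -
 have "- (pi/2) \<le> \<phi> + arctan (w / v) \<and> \<phi> + arctan (w / v) \<le> pi/2" if w: "w = u \<or> w = u - A" for w
 proof -
  define x where "x = \<phi> + arctan (w / v)"
  have x: "- (3 * pi / 2) < x" "x < 3 * pi / 2"
   using assms arctan_lbound[of "w / v"] arctan_ubound[of "w / v"] unfolding x_def by linarith+
  have "hh w \<phi> \<ge> 0" using assms w by auto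
  then have c: "cos x \<ge> 0" unfolding hh_cos x_def using cos_arctan_pos[of "w / v"]
   by (simp add: zero_le_divide_iff)
  show ?thesis unfolding x_def[symmetric]
  proof (rule ccontr)
   assume "\<not> (- (pi/2) \<le> x \<and> x \<le> pi/2)"
   then consider "x > pi/2" | "x < - (pi/2)" by linarith
   then show False
   proof cases
    case 1
    then have "cos (x - pi) > 0" using x by (intro cos_gt_zero_pi) auto
    then show False using c by (simp add: cos_diff)
   next
    case 2
    then have "cos (x + pi) > 0" using x by (intro cos_gt_zero_pi) auto
    then show False using c by (simp add: cos_add)
   qed
  qed
 qed
 from this[of u] this[of "u - A"] show ?thesis by (auto simp: \<alpha>_def \<beta>_def \<theta>1_def \<theta>2_def min_def max_def)
qed

text \<open>In terms of \<open>e = - (x - qq) / (x - pp)\<close> the two defining functions of the lens become real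
 linear forms in \<open>e\<close>, divided by \<open>\<bar>1 + e\<bar>\<^sup>2\<close>.\<close>

lemma circle_identity:
 assumes "y * (1 + e) = Complex w v + Complex w (- v) * e"
 shows "(cmod (1 + e))\<^sup>2 * (w\<^sup>2 + v\<^sup>2 - (cmod y)\<^sup>2) = 4 * v * (v * Re e - w * Im e)"
proof -
 have "(cmod y)\<^sup>2 * (cmod (1 + e))\<^sup>2 = (cmod (Complex w v + Complex w (- v) * e))\<^sup>2"
  using arg_cong[OF assms, of "\<lambda>z. (cmod z)\<^sup>2"] by (simp add: norm_mult power_mult_distrib)
 moreover have "(cmod (Complex w v + Complex w (- v) * e))\<^sup>2 = (w + w * Re e + v * Im e)\<^sup>2 + (v + w * Im e - v * Re e)\<^sup>2"
  unfolding cmod_power2 by (simp add: power2_eq_square algebra_simps)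
 moreover have "(cmod (1 + e))\<^sup>2 = (1 + Re e)\<^sup>2 + (Im e)\<^sup>2" by (simp add: cmod_power2)
 ultimately show ?thesis by (simp add: power2_eq_square algebra_simps)
qed

lemma ee_eq:
 assumes "x \<noteq> pp"
 shows "x * (1 + ee x) = qq + pp * ee x" "1 + ee x = (qq - pp) / (x - pp)" "1 + ee x \<noteq> 0"
proof -
 show 1: "1 + ee x = (qq - pp) / (x - pp)" using assms by (simp add: ee_def field_simps)
 then show "1 + ee x \<noteq> 0" using assms pp_neq_qq by simp
 show "x * (1 + ee x) = qq + pp * ee x" using assms by (simp add: ee_def field_simps)
qed

lemma rho_identities:
 assumes x: "x * (1 + e) = qq + pp * e"
 shows "(cmod (1 + e))\<^sup>2 * (1 - (cmod x)\<^sup>2) = 4 * v * (v * Re e - u * Im e)"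
  and "(cmod (1 + e))\<^sup>2 * (r\<^sup>2 - (cmod (x - of_real A))\<^sup>2) = 4 * v * (v * Re e - (u - A) * Im e)"
proof -
 show "(cmod (1 + e))\<^sup>2 * (1 - (cmod x)\<^sup>2) = 4 * v * (v * Re e - u * Im e)"
  using circle_identity[of x e u] x on_unit by (simp add: qq_def pp_def mult.commute)
 have "(x - of_real A) * (1 + e) = Complex (u - A) v + Complex (u - A) (- v) * e"
 proof -
  have "qq - of_real A = Complex (u - A) v" "pp - of_real A = Complex (u - A) (- v)"
   by (simp_all add: qq_def pp_def complex_eq_iff)
  then show ?thesis using x by (simp add: algebra_simps flip: \<open>qq - of_real A = _\<close> \<open>pp - of_real A = _\<close>)
 qed
 from circle_identity[OF this]
 show "(cmod (1 + e))\<^sup>2 * (r\<^sup>2 - (cmod (x - of_real A))\<^sup>2) = 4 * v * (v * Re e - (u - A) * Im e)"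
  using on_r by simp
qed

lemma exp_not_minus_one:
 assumes "- pi < Im s" "Im s < pi"
 shows "1 + exp s \<noteq> 0"
proof
 assume "1 + exp s = 0"
 then have e: "exp s = -1" by (simp add: add_eq_0_iff)
 have "Ln (exp s) = s" using assms by (intro Ln_exp) auto
 then have "s = \<i> * of_real pi" using e by simp
 then show False using assms by simp
qed

lemma cmod_M:
 "(cmod (M s))\<^sup>2 = (cmod (1 + exp s))\<^sup>2 * exp (- Re s) / d\<^sup>2"
proof -
 have "(1 + exp s) * exp (- s / 2) = exp (s / 2) + exp (- s / 2)"
  by (simp add: distrib_right exp_add[symmetric])
 then have "M s = (1 + exp s) * exp (- s / 2) / of_real d" by (simp add: M_def)
 then have "cmod (M s) = cmod (1 + exp s) * exp (- Re s / 2) / d"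
  using d_pos by (simp add: norm_mult norm_divide)
 moreover have "(exp (- Re s / 2))\<^sup>2 = exp (- Re s)" by (simp add: power2_eq_square exp_add[symmetric])
 ultimately show ?thesis by (simp add: power_mult_distrib power_divide)
qed

lemma M_nonzero: "- pi < Im s ==> Im s < pi ==> M s \<noteq> 0"
 using cmod_M[of s] exp_not_minus_one[of s] d_pos by auto

lemma exp_Re_Im: "Re (exp s) = exp (Re s) * cos (Im s)" "Im (exp s) = exp (Re s) * sin (Im s)"
 by (simp_all add: Re_exp Im_exp)

lemma hh_exp: "4 * v * (v * Re (exp s) - w * Im (exp s)) = d\<^sup>2 * exp (Re s) * hh w (Im s)"
proof -
 have d2: "d\<^sup>2 = 4 * v * v" by (simp add: d_def power2_eq_square)
 show ?thesis using v_nonzero unfolding exp_Re_Im d2 hh_def by (simp add: field_simps)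
qed

lemma rho_M:
 assumes s: "- pi < Im s" "Im s < pi" and x: "x * (1 + exp s) = qq + pp * exp s"
 shows "1 - (cmod x)\<^sup>2 = hh u (Im s) / (cmod (M s))\<^sup>2" "r\<^sup>2 - (cmod (x - of_real A))\<^sup>2 = hh (u - A) (Im s) / (cmod (M s))\<^sup>2"
  "rho x = h (Im s) / (cmod (M s))\<^sup>2"
proof -
 have c: "(cmod (1 + exp s))\<^sup>2 > 0" using exp_not_minus_one[OF s] by simp
 have gen: "t = hh w (Im s) / (cmod (M s))\<^sup>2" if "(cmod (1 + exp s))\<^sup>2 * t = 4 * v * (v * Re (exp s) - w * Im (exp s))" for t w
 proof -
  have "t = d\<^sup>2 * exp (Re s) * hh w (Im s) / (cmod (1 + exp s))\<^sup>2"
   using that c unfolding hh_exp by (simp add: field_simps)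
  then show ?thesis unfolding cmod_M using c d_pos by (simp add: exp_minus field_simps)
 qed
 show 1: "1 - (cmod x)\<^sup>2 = hh u (Im s) / (cmod (M s))\<^sup>2" by (rule gen[OF rho_identities(1)[OF x]])
 show 2: "r\<^sup>2 - (cmod (x - of_real A))\<^sup>2 = hh (u - A) (Im s) / (cmod (M s))\<^sup>2" by (rule gen[OF rho_identities(2)[OF x]])
 have "(cmod (M s))\<^sup>2 > 0" using M_nonzero[OF s] by simp
 then show "rho x = h (Im s) / (cmod (M s))\<^sup>2" unfolding rho_def 1 2 h_def by (auto simp: min_def divide_le_cancel)
qed

lemma X_eq: "- pi < Im s ==> Im s < pi ==> X s * (1 + exp s) = qq + pp * exp s"
 using exp_not_minus_one[of s] by (simp add: X_def)

lemma X_not_pp: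
 assumes "- pi < Im s" "Im s < pi"
 shows "X s \<noteq> pp"
proof
 assume "X s = pp"
 then have "pp * (1 + exp s) = qq + pp * exp s" using X_eq[OF assms] by simp
 then show False using pp_neq_qq by (simp add: distrib_left)
qed

lemma ee_X:
 assumes "- pi < Im s" "Im s < pi"
 shows "ee (X s) = exp s"
proof -
 have "- (X s - qq) = exp s * (X s - pp)" using X_eq[OF assms] by (simp add: algebra_simps)
 then show ?thesis using X_not_pp[OF assms] by (simp add: ee_def)
qed

lemma sg_X: "- pi < Im s ==> Im s < pi ==> sg (X s) = s"
 unfolding sg_def by (simp add: ee_X Ln_exp)

definition good :: "complex set" where "good = {x. x \<noteq> pp \<and> ee x \<notin> \<real>\<^sub>\<le>\<^sub>0}"

lemma sg_good:
 assumes "x \<in> good"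
 shows "- pi < Im (sg x)" "Im (sg x) < pi" "exp (sg x) = ee x" "X (sg x) = x"
proof -
 have nz: "ee x \<noteq> 0" using assms by (auto simp: good_def)
 show e: "exp (sg x) = ee x" unfolding sg_def using nz by simp
 show "- pi < Im (sg x)" unfolding sg_def using nz by (rule mpi_less_Im_Ln)
 show "Im (sg x) < pi" unfolding sg_def using assms Im_Ln_less_pi[of "ee x"] nz by (auto simp: good_def complex_nonpos_Reals_iff)
 show "X (sg x) = x" unfolding X_def e using ee_eq[of x] assms by (simp add: good_def field_simps)
qed

lemma good_rho:
 assumes "x \<noteq> pp" "x \<noteq> qq" "cmod x \<le> 1"
 shows "x \<in> good"
proof -
 have "ee x \<notin> \<real>\<^sub>\<le>\<^sub>0"
 proof
  assume "ee x \<in> \<real>\<^sub>\<le>\<^sub>0"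
  then have e: "Re (ee x) \<le> 0" "Im (ee x) = 0" by (auto simp: complex_nonpos_Reals_iff)
  have "ee x \<noteq> 0" using assms by (simp add: ee_def)
  then have "Re (ee x) < 0" using e by (auto simp: complex_eq_iff)
  moreover have "v\<^sup>2 > 0" using v_nonzero by simp
  ultimately have "4 * (v\<^sup>2 * Re (ee x)) < 0" using mult_pos_neg[of "v\<^sup>2" "Re (ee x)"] by linarith
  moreover have "4 * v * (v * Re (ee x) - u * Im (ee x)) = 4 * (v\<^sup>2 * Re (ee x))"
   unfolding e(2) by (simp add: power2_eq_square)
  ultimately have "4 * v * (v * Re (ee x) - u * Im (ee x)) < 0" by linarith
  moreover have "(cmod (1 + ee x))\<^sup>2 * (1 - (cmod x)\<^sup>2) \<ge> 0"
   using assms(3) by (intro mult_nonneg_nonneg) (auto simp: power_le_one)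
  ultimately show False using rho_identities(1)[OF ee_eq(1)[OF assms(1)]] by simp
 qed
 then show ?thesis using assms by (simp add: good_def)
qed

definition DD :: "complex set" where "DD = {x. rho x > 0}"

lemma norm_pp_qq: "cmod pp = 1" "cmod qq = 1"
 using on_unit by (simp_all add: pp_def qq_def cmod_def)

lemma DD_good:
 assumes "x \<in> DD"
 shows "x \<in> good" "sg x \<in> strip"
proof -
 have 1: "(cmod x)\<^sup>2 < 1" "r\<^sup>2 - (cmod (x - of_real A))\<^sup>2 > 0" using assms by (auto simp: DD_def rho_def)
 then have "cmod x < 1" by (simp add: power_less_one_iff)
 then show g: "x \<in> good" using norm_pp_qq by (intro good_rho) auto
 note s = sg_good[OF g]
 have eq: "x * (1 + exp (sg x)) = qq + pp * exp (sg x)"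
  using X_eq[OF s(1,2)] s(4) by simp
 have c: "(cmod (M (sg x)))\<^sup>2 > 0" using M_nonzero[OF s(1,2)] by simp
 have "0 < hh u (Im (sg x)) / (cmod (M (sg x)))\<^sup>2" "0 < hh (u - A) (Im (sg x)) / (cmod (M (sg x)))\<^sup>2"
  using rho_M(1,2)[OF s(1,2) eq] 1 by linarith+
 then have "hh u (Im (sg x)) > 0" "hh (u - A) (Im (sg x)) > 0"
  using c by (simp_all only: zero_less_divide_iff) linarith+
 then show "sg x \<in> strip" using hh_pos_iff_range s(1,2) by simp
qed

lemma closure_good:
 assumes "x \<noteq> pp" "x \<noteq> qq" "(cmod x)\<^sup>2 \<le> 1" "(cmod (x - of_real A))\<^sup>2 \<le> r\<^sup>2"
 shows "x \<in> good" "\<alpha> \<le> Im (sg x)" "Im (sg x) \<le> \<beta>"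
proof -
 have "cmod x \<le> 1" using assms(3) by (simp add: abs_square_le_1)
 then show g: "x \<in> good" using assms by (intro good_rho) auto
 note s = sg_good[OF g]
 have eq: "x * (1 + exp (sg x)) = qq + pp * exp (sg x)"
  using X_eq[OF s(1,2)] s(4) by simp
 have c: "(cmod (M (sg x)))\<^sup>2 > 0" using M_nonzero[OF s(1,2)] by simp
 have "0 \<le> hh u (Im (sg x)) / (cmod (M (sg x)))\<^sup>2" "0 \<le> hh (u - A) (Im (sg x)) / (cmod (M (sg x)))\<^sup>2"
  using rho_M(1,2)[OF s(1,2) eq] assms(3,4) by linarith+
 then have "hh u (Im (sg x)) \<ge> 0" "hh (u - A) (Im (sg x)) \<ge> 0"
  using c by (simp_all only: zero_le_divide_iff) linarith+
 then show "\<alpha> \<le> Im (sg x)" "Im (sg x) \<le> \<beta>" using hh_nonneg_range s(1,2) by simp_all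
qed

lemma rho_sg:
 assumes "x \<in> good"
 shows "rho x = h (Im (sg x)) / (cmod (M (sg x)))\<^sup>2"
proof (rule rho_M(3))
 show "x * (1 + exp (sg x)) = qq + pp * exp (sg x)"
  using X_eq[OF sg_good(1,2)[OF assms]] sg_good(4)[OF assms] by simp
qed (use sg_good[OF assms] in auto)

lemma X_strip: "X ` strip = DD"
proof
 show "X ` strip \<subseteq> DD"
 proof
  fix x assume "x \<in> X ` strip"
  then obtain s where s: "s \<in> strip" "x = X s" by auto
  have p: "- pi < Im s" "Im s < pi" using strip_pi[OF s(1)] by auto
  have "rho x = h (Im s) / (cmod (M s))\<^sup>2" unfolding s(2) by (rule rho_M(3)[OF p X_eq[OF p]])
  also have "\<dots> > 0" using h_pos[of "Im s"] s(1) M_nonzero[OF p] by simp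
  finally show "x \<in> DD" by (simp add: DD_def)
 qed
 show "DD \<subseteq> X ` strip"
 proof
  fix x assume "x \<in> DD"
  note g = DD_good[OF this]
  show "x \<in> X ` strip" using sg_good(4)[OF g(1)] g(2) by (metis imageI)
 qed
qed

lemma X_inj: "inj_on X strip"
 by (rule inj_on_inverseI[of _ sg]) (use strip_pi sg_X in blast)

lemma X_holomorphic: "X holomorphic_on strip"
 unfolding X_def using exp_not_minus_one strip_pi by (intro holomorphic_intros) blast

lemma cmod_deriv_X:
 assumes "s \<in> strip"
 shows "cmod (deriv X s) = 1 / (d * (cmod (M s))\<^sup>2)"
proof -
 have nz: "1 + exp s \<noteq> 0" using exp_not_minus_one strip_pi[OF assms] by blast
 have "deriv X s = (pp - qq) * exp s / (1 + exp s)\<^sup>2"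
  unfolding X_def by (rule DERIV_imp_deriv)
   (use nz in \<open>auto intro!: derivative_eq_intros simp: power2_eq_square field_simps\<close>)
 then have "cmod (deriv X s) = cmod (pp - qq) * exp (Re s) / (cmod (1 + exp s))\<^sup>2"
  by (simp only: norm_divide norm_mult norm_power norm_exp_eq_Re)
 moreover have "cmod (pp - qq) = d"
 proof -
  have "pp - qq = \<i> * of_real (- 2 * v)" by (simp add: pp_def qq_def complex_eq_iff)
  then show ?thesis by (simp add: d_def norm_mult)
 qed
 ultimately show ?thesis unfolding cmod_M using nz d_pos
  by (simp add: exp_minus power2_eq_square divide_inverse)
qed

lemma open_good: "open good"
proof -
 have c: "continuous_on (- {pp}) ee" unfolding ee_def by (intro continuous_intros) auto
 have "good = - {pp} \<inter> ee -` (- \<real>\<^sub>\<le>\<^sub>0)" by (auto simp: good_def)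
 then show ?thesis using continuous_open_preimage[OF c, of "- \<real>\<^sub>\<le>\<^sub>0"] closed_nonpos_Reals_complex by (simp add: open_Compl)
qed

lemma sg_holomorphic: "sg holomorphic_on good"
 unfolding sg_def ee_def
 by (intro holomorphic_intros) (auto simp: good_def ee_def)

lemma M_holomorphic: "M holomorphic_on S"
 unfolding M_def using d_pos by (intro holomorphic_intros) auto

lemma open_DD: "open DD"
proof -
 have "continuous_on UNIV rho" unfolding rho_def by (intro continuous_intros)
 moreover have "DD = rho -` {0<..}" by (auto simp: DD_def)
 ultimately show ?thesis using open_vimage[of "{0<..}" rho] by simp
qed

lemma rho_cont: "continuous_on S rho" unfolding rho_def by (intro continuous_intros)

end

section \<open>Integrals over discs\<close>

lemma AE_Im_nonzero: "AE y in lborel. Im y \<noteq> 0"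
proof -
 have "{y. Im y = 0} = {y :: complex. \<i> \<bullet> y = 0}" by (simp add: inner_complex_def)
 then have "negligible {y. Im y = 0}" using negligible_hyperplane[of \<i> 0] by simp
 moreover have b: "{y. Im y = 0} \<in> sets borel"
  by (intro borel_closed closed_Collect_eq continuous_intros)
 ultimately have "{y. Im y = 0} \<in> null_sets lborel"
  using negligible_iff_null_sets[of "{y. Im y = 0}"] by (simp add: null_sets_def)
 from AE_not_in[OF this] show ?thesis by simp
qed

lemma circle_mean:
 fixes f :: "complex \<Rightarrow> complex"
 assumes f: "f holomorphic_on ball 0 R" and s: "exp s < R"
 shows "(\<integral>t. indicator {0<..<2 * pi} t *\<^sub>R (cnj (exp (Complex s t)) ^ n * f (exp (Complex s t))) \<partial>lborel)
  = 2 * pi * exp s ^ (2 * n) * ((deriv ^^ n) f 0 / fact n)"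
proof -
 define r where "r = exp s"
 have r: "r > 0" "r < R" using s by (auto simp: r_def)
 have e: "exp (Complex s t) = of_real r * cis t" for t
  by (simp add: r_def exp_eq_polar)
 define G where "G t = cnj (exp (Complex s t)) ^ n * f (exp (Complex s t))" for t
 have cont: "continuous_on UNIV G"
  unfolding G_def
 proof (intro continuous_intros)
  show "continuous_on UNIV (\<lambda>t. f (exp (Complex s t)))"
   by (rule continuous_on_compose2[OF holomorphic_on_imp_continuous_on[OF f]])
    (use s in \<open>auto simp: Complex_eq intro!: continuous_intros\<close>)
 qed
 have c1: "continuous_on (cball 0 r) f"
  using r by (intro continuous_on_subset[OF holomorphic_on_imp_continuous_on[OF f]]) auto
 have c2: "f holomorphic_on ball 0 r" using r by (intro holomorphic_on_subset[OF f]) auto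
 have "((\<lambda>u. f u / (u - 0) ^ Suc n) has_contour_integral (2 * pi * \<i>) / fact n * (deriv ^^ n) f 0) (circlepath 0 r)"
  by (rule Cauchy_has_contour_integral_higher_derivative_circlepath[OF c1 c2]) (use r in simp)
 then have "((\<lambda>t. f (of_real r * cis t) / (of_real r * cis t) ^ Suc n * of_real r * \<i> * cis t) has_integral
   (2 * pi * \<i>) / fact n * (deriv ^^ n) f 0) {0..2 * pi}"
  unfolding circlepath_def by (subst (asm) has_contour_integral_part_circlepath_iff) auto
 then have "((\<lambda>t. (f (of_real r * cis t) / (of_real r * cis t) ^ Suc n * of_real r * \<i> * cis t) * (of_real r ^ (2 * n) / \<i>)) has_integral
   ((2 * pi * \<i>) / fact n * (deriv ^^ n) f 0) * (of_real r ^ (2 * n) / \<i>)) {0..2 * pi}"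
  by (rule has_integral_mult_left)
 moreover have "(f (of_real r * cis t) / (of_real r * cis t) ^ Suc n * of_real r * \<i> * cis t) * (of_real r ^ (2 * n) / \<i>) = G t" for t
 proof -
  define y where "y = of_real r * cis t"
  have nz: "y \<noteq> 0" "cis t \<noteq> 0" "cmod y = r" using r by (simp_all add: y_def norm_mult)
  have "cnj y * y = of_real r ^ 2" using complex_norm_square[of y] nz(3) by (simp add: mult.commute)
  then have "cnj y ^ n * y ^ n = of_real r ^ (2 * n)"
   by (simp only: power_mult_distrib[symmetric] power_mult[symmetric])
  then have c: "cnj y ^ n = of_real r ^ (2 * n) / y ^ n"
   using nz(1) by (simp add: field_simps)
  have m: "(f y / y ^ Suc n * y * \<i>) * (of_real r ^ (2 * n) / \<i>) = cnj y ^ n * f y"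
   unfolding c using nz(1) by (simp add: field_simps)
  have g: "f y / y ^ Suc n * of_real r * \<i> * cis t = f y / y ^ Suc n * y * \<i>"
   unfolding y_def by (simp only: mult_ac)
  show ?thesis unfolding G_def e y_def[symmetric] g by (rule m)
 qed
 ultimately have "(G has_integral 2 * pi * r ^ (2 * n) * ((deriv ^^ n) f 0 / fact n)) {0..2 * pi}"
  by (simp add: field_simps)
 moreover have "set_integrable lborel {0..2 * pi} G"
  by (rule borel_integrable_atLeastAtMost') (rule continuous_on_subset[OF cont], simp)
 ultimately have "(LINT t:{0..2 * pi}|lborel. G t) = 2 * pi * r ^ (2 * n) * ((deriv ^^ n) f 0 / fact n)"
  using set_borel_integral_eq_integral(2) by (metis integral_unique)
 moreover have "(\<integral>t. indicator {0<..<2 * pi} t *\<^sub>R G t \<partial>lborel) = (LINT t:{0..2 * pi}|lborel. G t)"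
  unfolding set_lebesgue_integral_def
 proof (rule integral_cong_AE)
  have "G \<in> borel_measurable lborel" using cont by (simp add: borel_measurable_continuous_onI)
  then show "(\<lambda>t. indicator {0<..<2 * pi} t *\<^sub>R G t) \<in> borel_measurable lborel"
   "(\<lambda>t. indicator {0..2 * pi} t *\<^sub>R G t) \<in> borel_measurable lborel" by auto
  show "AE t in lborel. indicator {0<..<2 * pi} t *\<^sub>R G t = indicator {0..2 * pi} t *\<^sub>R G t"
   using AE_lborel_singleton[of 0] AE_lborel_singleton[of "2 * pi"]
   by eventually_elim (auto simp: indicator_def)
 qed
 ultimately show ?thesis unfolding G_def r_def by simp
qed

lemma radial_integral:
 fixes k c :: real
 assumes "k > 0"
 shows "(\<integral>s. indicator {..<c} s * exp (k * s) \<partial>lborel) = exp (k * c) / k"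
proof -
 have "(\<lambda>x. exp (- k * x)) absolutely_integrable_on {- c..}"
  using integrable_on_exp_minus_to_infinity[OF assms, of "- c"]
  by (intro nonnegative_absolutely_integrable_1) auto
 then have i: "set_integrable lborel {- c..} (\<lambda>x. exp (- k * x))"
  unfolding set_integrable_def by (subst (asm) integrable_completion) auto
 have "(\<integral>s. indicator {..<c} s * exp (k * s) \<partial>lborel) = (\<integral>s. indicator {..c} s * exp (k * s) \<partial>lborel)"
 proof (rule integral_cong_AE)
  show "AE s in lborel. indicator {..<c} s * exp (k * s) = indicator {..c} s * exp (k * s)"
   using AE_lborel_singleton[of c] by eventually_elim (auto simp: indicator_def)
 qed auto
 also have "\<dots> = \<bar>- 1\<bar> *\<^sub>R (\<integral>s. indicator {..c} (0 + (- 1) * s) * exp (k * (0 + (- 1) * s)) \<partial>lborel)"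
  by (rule lborel_integral_real_affine) simp
 also have "\<dots> = (LINT s:{- c..}|lborel. exp (- k * s))"
  unfolding set_lebesgue_integral_def by (simp, intro Bochner_Integration.integral_cong refl) (auto simp: indicator_def)
 also have "\<dots> = integral {- c..} (\<lambda>x. exp (- k * x))"
  by (rule set_borel_integral_eq_integral(2)[OF i])
 also have "\<dots> = exp (- k * (- c)) / k"
  by (rule integral_unique[OF has_integral_exp_minus_to_infinity[OF assms]])
 finally show ?thesis by simp
qed

text \<open>Orthogonality of the monomials on a disc, in the form in which it extracts a Taylor
 coefficient from an area integral. Polar coordinates are the conformal map \<open>exp\<close>.\<close>

lemma disc_formula:
 fixes f :: "complex \<Rightarrow> complex"
 assumes f: "f holomorphic_on ball 0 R" and R: "R > 0"
  and int: "set_integrable lborel (ball 0 R) (\<lambda>y. cnj y ^ n * f y)"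
 shows "(LINT y:ball 0 R|lborel. cnj y ^ n * f y) = pi * R ^ (2 * Suc n) / Suc n * ((deriv ^^ n) f 0 / fact n)"
proof -
 define S where "S = {w. Re w < ln R \<and> 0 < Im w \<and> Im w < 2 * pi}"
 have S: "open S"
 proof -
  have "S = {w. Re w < ln R} \<inter> ({w. 0 < Im w} \<inter> {w. Im w < 2 * pi})" by (auto simp: S_def)
  then show ?thesis by (simp add: open_Int open_halfspace_Re_lt open_halfspace_Im_gt open_halfspace_Im_lt)
 qed
 have inj: "inj_on exp S"
 proof (rule inj_onI)
  fix w z assume w: "w \<in> S" "z \<in> S" "exp w = exp z"
  then obtain k :: int where k: "w = z + (of_int (2 * k) * pi) * \<i>" by (auto simp: exp_eq)
  then have "Im w - Im z = 2 * pi * of_int k" by simp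
  moreover have "\<bar>Im w - Im z\<bar> < 2 * pi" using w by (auto simp: S_def)
  ultimately have "\<bar>2 * pi * of_int k\<bar> < 2 * pi * 1" by simp
  then have "\<bar>real_of_int k\<bar> < 1" by (simp add: abs_mult)
  then have "k = 0" by linarith
  then show "w = z" using k by simp
 qed
 have sub: "exp ` S \<subseteq> ball 0 R"
 proof
  fix y assume "y \<in> exp ` S"
  then obtain w where w: "w \<in> S" "y = exp w" by auto
  then have "exp (Re w) < exp (ln R)" by (simp add: S_def)
  then show "y \<in> ball 0 R" using w R by simp
 qed
 have sup: "y \<in> exp ` S" if y: "y \<in> ball 0 R" "Im y \<noteq> 0" for y
 proof -
  have y0: "y \<noteq> 0" using y by auto
  define w where "w = Complex (ln (cmod y)) (Arg2pi y)"
  have "exp w = y" using y0 Arg2pi_eq[of y] by (simp add: w_def Complex_eq exp_add exp_of_real[symmetric] mult.commute)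
    (metis exp_Ln exp_of_real mult.commute norm_eq_zero exp_ln zero_less_norm_iff)
  moreover have "Arg2pi y \<noteq> 0"
  proof
   assume "Arg2pi y = 0"
   then have "y = of_real (cmod y)" using Arg2pi_eq[of y] by simp
   then show False using y(2) by (metis Im_complex_of_real)
  qed
  then have "w \<in> S" using y y0 Arg2pi_ge_0[of y] Arg2pi_lt_2pi[of y] R by (simp add: S_def w_def)
  ultimately show ?thesis by (metis imageI)
 qed
 define F where "F y = cnj y ^ n * f y" for y
 have oS: "open (exp ` S)" by (rule open_mapping_thm3[OF _ S inj]) (intro holomorphic_intros)
 have contF: "continuous_on (ball 0 R) F" unfolding F_def
  by (intro continuous_intros holomorphic_on_imp_continuous_on f)
 have FmS: "(\<lambda>y. indicator (exp ` S) y *\<^sub>R F y) \<in> borel_measurable borel"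
  by (rule borel_measurable_continuous_on_indicator) (use oS continuous_on_subset[OF contF sub] in auto)
 have FmB: "(\<lambda>y. indicator (ball 0 R) y *\<^sub>R F y) \<in> borel_measurable borel"
  by (rule borel_measurable_continuous_on_indicator) (use contF in auto)
 have ae: "AE y in lborel. indicator (ball 0 R) y *\<^sub>R F y = indicator (exp ` S) y *\<^sub>R F y"
  using AE_Im_nonzero
 proof eventually_elim
  case (elim y)
  then have "y \<in> ball 0 R \<longleftrightarrow> y \<in> exp ` S" using sub sup by blast
  then show ?case by (simp add: indicator_def)
 qed
 have iS: "set_integrable lborel (exp ` S) F"
 proof -
  have "integrable lborel (\<lambda>y. indicator (ball 0 R) y *\<^sub>R F y)" using int by (simp add: set_integrable_def F_def[abs_def])
  then show ?thesis unfolding set_integrable_def using integrable_cong_AE[OF _ _ ae] FmS FmB by simp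
 qed
 have "(LINT y:ball 0 R|lborel. F y) = (LINT y:exp ` S|lborel. F y)"
  unfolding set_lebesgue_integral_def by (rule integral_cong_AE[OF _ _ ae]) (use FmS FmB in simp_all)
 also have "\<dots> = (LINT w:S|lborel. (cmod (deriv exp w))\<^sup>2 * F (exp w))"
  by (rule conformal_change_of_variables(2)[OF S _ inj FmS]) (intro holomorphic_intros)
 finally have eq1: "(LINT y:ball 0 R|lborel. F y) = (LINT w:S|lborel. (cmod (deriv exp w))\<^sup>2 * F (exp w))" .
 have "set_integrable lborel S (\<lambda>w. (cmod (deriv exp w))\<^sup>2 * F (exp w))"
  using conformal_change_of_variables(1)[OF S _ inj FmS] iS by (simp add: holomorphic_on_exp)
 then have iT: "integrable lborel (\<lambda>w. indicator S w *\<^sub>R ((cmod (deriv exp w))\<^sup>2 * F (exp w)))"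
  unfolding set_integrable_def .
 define an where "an = (deriv ^^ n) f 0 / fact n"
 have "(LINT w:S|lborel. (cmod (deriv exp w))\<^sup>2 * F (exp w))
   = (\<integral>s. \<integral>t. indicator S (Complex s t) *\<^sub>R ((cmod (deriv exp (Complex s t)))\<^sup>2 * F (exp (Complex s t))) \<partial>lborel \<partial>lborel)"
  unfolding set_lebesgue_integral_def complex_Fubini(1)[OF iT]
  using lborel_pair.Fubini_integral[OF complex_Fubini(2)[OF iT]] .
 also have "\<dots> = (\<integral>s. complex_of_real (indicator {..<ln R} s * exp (real (2 * Suc n) * s)) * (2 * pi * an) \<partial>lborel)"
 proof (rule Bochner_Integration.integral_cong[OF refl])
  fix s
  show "(\<integral>t. indicator S (Complex s t) *\<^sub>R ((cmod (deriv exp (Complex s t)))\<^sup>2 * F (exp (Complex s t))) \<partial>lborel)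
    = complex_of_real (indicator {..<ln R} s * exp (real (2 * Suc n) * s)) * (2 * pi * an)"
  proof (cases "s < ln R")
   case True
   then have "exp s < exp (ln R)" by (simp only: exp_less_cancel_iff)
   then have sR: "exp s < R" using R by simp
   have d: "deriv exp (Complex s t) = exp (Complex s t)" for t by (rule DERIV_imp_deriv) (rule DERIV_exp)
   have eq: "(\<lambda>t. indicator S (Complex s t) *\<^sub>R ((cmod (deriv exp (Complex s t)))\<^sup>2 * F (exp (Complex s t))))
     = (\<lambda>t. of_real ((exp s)\<^sup>2) * (indicator {0<..<2 * pi} t *\<^sub>R (cnj (exp (Complex s t)) ^ n * f (exp (Complex s t)))))"
    using True by (auto simp: fun_eq_iff d S_def F_def indicator_def)
   have "(\<integral>t. indicator S (Complex s t) *\<^sub>R ((cmod (deriv exp (Complex s t)))\<^sup>2 * F (exp (Complex s t))) \<partial>lborel)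
     = of_real ((exp s)\<^sup>2) * (2 * pi * exp s ^ (2 * n) * an)"
    unfolding eq integral_mult_right_zero circle_mean[OF f sR] an_def by simp
   also have "\<dots> = of_real ((exp s)\<^sup>2 * exp s ^ (2 * n)) * (2 * pi * an)" by simp
   also have "(exp s)\<^sup>2 * exp s ^ (2 * n) = exp (real (2 * Suc n) * s)"
   proof -
    have "(exp s)\<^sup>2 * exp s ^ (2 * n) = exp s ^ (2 * Suc n)" by (simp add: power_add[symmetric])
    then show ?thesis by (simp only: exp_of_nat_mult)
   qed
   finally show ?thesis using True by simp
  next
   case False
   then have "indicator S (Complex s t) = (0::real)" for t by (simp add: S_def)
   then show ?thesis using False by simp
  qed
 qed
 also have "\<dots> = complex_of_real (\<integral>s. indicator {..<ln R} s * exp (real (2 * Suc n) * s) \<partial>lborel) * (2 * pi * an)"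
  by (simp only: integral_mult_left_zero integral_complex_of_real)
 also have "(\<integral>s. indicator {..<ln R} s * exp (real (2 * Suc n) * s) \<partial>lborel) = exp (real (2 * Suc n) * ln R) / real (2 * Suc n)"
  by (rule radial_integral) simp
 also have "exp (real (2 * Suc n) * ln R) = R ^ (2 * Suc n)" using R by (simp only: exp_of_nat_mult exp_ln)
 also have "complex_of_real (R ^ (2 * Suc n) / real (2 * Suc n)) * (2 * pi * an) = complex_of_real (pi * R ^ (2 * Suc n) / Suc n) * an"
 proof -
  have "R ^ (2 * Suc n) / real (2 * Suc n) * (2 * pi) = pi * R ^ (2 * Suc n) / real (Suc n)"
  proof -
   have "x / (2 * N) * (2 * pi) = pi * x / N" if "N \<noteq> 0" for x N :: real using that by simp
   from this[of "real (Suc n)" "R ^ (2 * Suc n)"] show ?thesis unfolding of_nat_mult of_nat_numeral by (simp only: of_nat_eq_0_iff nat.distinct simp_thms)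
  qed
  then have "complex_of_real (R ^ (2 * Suc n) / real (2 * Suc n) * (2 * pi)) = complex_of_real (pi * R ^ (2 * Suc n) / real (Suc n))"
   by (simp only:)
  then show ?thesis by (simp only: of_real_mult mult.assoc[symmetric] of_real_numeral)
 qed
 finally show ?thesis using eq1 unfolding F_def an_def by (simp only:)
qed

section \<open>Separation of variables\<close>

context lens
begin

definition Om :: "(complex \<times> complex) set" where "Om = {(x, y). (cmod y)\<^sup>2 < rho x}"

lemma mem_Om: "(x, y) \<in> Om \<longleftrightarrow> (cmod y)\<^sup>2 < rho x" by (simp add: Om_def)

lemma Om_DD: "(x, y) \<in> Om ==> x \<in> DD"
 unfolding mem_Om DD_def mem_Collect_eq by (rule le_less_trans[OF zero_le_power2])

lemma open_Om: "open Om"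
proof -
 have "Om = {p. (cmod (snd p))\<^sup>2 < rho (fst p)}" by (auto simp: Om_def)
 also have "open \<dots>" unfolding rho_def by (intro open_Collect_less continuous_intros)
 finally show ?thesis .
qed

lemma Om_ball: "x \<in> DD ==> (x, y) \<in> Om \<longleftrightarrow> y \<in> ball 0 (sqrt (rho x))"
 by (simp add: mem_Om real_less_rsqrt real_sqrt_less_iff)
  (metis abs_norm_cancel real_sqrt_abs real_sqrt_less_iff)

definition hartogs :: "(complex \<times> complex \<Rightarrow> complex) \<Rightarrow> bool" where
 "hartogs F \<longleftrightarrow> continuous_on Om F \<and> (\<forall>x\<in>DD. (\<lambda>y. F (x, y)) holomorphic_on ball 0 (sqrt (rho x))) \<and>
   (\<forall>y. (\<lambda>x. F (x, y)) holomorphic_on {x. (x, y) \<in> Om})"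

definition coef :: "(complex \<times> complex \<Rightarrow> complex) \<Rightarrow> nat \<Rightarrow> complex \<Rightarrow> complex" where
 "coef F n x = (deriv ^^ n) (\<lambda>y. F (x, y)) 0 / fact n"

text \<open>By \<open>disc_formula\<close> the coefficient is an integral over a disc that can be kept fixed locally.\<close>

lemma coef_holomorphic:
 assumes F: "hartogs F"
 shows "coef F n holomorphic_on DD"
proof -
 have "coef F n field_differentiable at x0" if x0: "x0 \<in> DD" for x0
 proof -
  have rp: "rho x0 > 0" using x0 by (simp add: DD_def)
  define R where "R = sqrt (rho x0 / 2)"
  have R: "R > 0" "R\<^sup>2 = rho x0 / 2" using rp by (auto simp: R_def)
  have "open {x. R\<^sup>2 < rho x}" unfolding rho_def by (intro open_Collect_less continuous_intros)
  moreover have "x0 \<in> {x. R\<^sup>2 < rho x}" using rp R by simp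
  ultimately obtain r where r: "r > 0" "cball x0 r \<subseteq> {x. R\<^sup>2 < rho x}"
   using open_contains_cball by blast
  have rhoR: "R\<^sup>2 < rho x" if "x \<in> cball x0 r" for x using r(2) that by blast
  have xDD: "x \<in> DD" if "x \<in> cball x0 r" for x
   unfolding DD_def mem_Collect_eq by (rule le_less_trans[OF zero_le_power2 rhoR[OF that]])
  have yR: "(cmod y)\<^sup>2 \<le> R\<^sup>2" if "y \<in> cball 0 R" for y using that R by (intro power_mono) auto
  have inOm: "(x, y) \<in> Om" if "x \<in> cball x0 r" "y \<in> cball 0 R" for x y
   unfolding mem_Om using yR[OF that(2)] rhoR[OF that(1)] by linarith
  have "compact (cball x0 r \<times> cball (0::complex) R)" by (intro compact_Times compact_cball)
  moreover have sub: "cball x0 r \<times> cball 0 R \<subseteq> Om" using inOm by auto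
  ultimately have "bounded (F ` (cball x0 r \<times> cball 0 R))"
   using F by (intro compact_imp_bounded compact_continuous_image) (auto simp: hartogs_def intro: continuous_on_subset)
  then obtain B where B: "\<And>x y. x \<in> cball x0 r ==> y \<in> cball 0 R ==> cmod (F (x, y)) \<le> B"
   unfolding bounded_iff by (metis SigmaI image_eqI)
  define I where "I x y = indicator (ball 0 R) y *\<^sub>R (cnj y ^ n * F (x, y))" for x y
  have Im: "I x \<in> borel_measurable lborel" if "x \<in> cball x0 r" for x
  proof -
   have "(\<lambda>y. indicator (ball 0 R) y *\<^sub>R (cnj y ^ n * F (x, y))) \<in> borel_measurable borel"
   proof (rule borel_measurable_continuous_on_indicator)
    have "continuous_on (ball 0 R) (\<lambda>y. F (x, y))"
    proof (rule continuous_on_compose2[of Om F])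
     show "continuous_on Om F" using F by (simp add: hartogs_def)
     show "Pair x ` ball 0 R \<subseteq> Om" using inOm[OF that] by auto
    qed (intro continuous_intros)
    then show "continuous_on (ball 0 R) (\<lambda>y. cnj y ^ n * F (x, y))" by (intro continuous_intros)
   qed simp
   then show ?thesis by (simp add: I_def[abs_def])
  qed
  define D where "D y = indicator (ball (0::complex) R) y * (R ^ n * B)" for y
  have Di: "integrable lborel D"
   unfolding D_def using emeasure_bounded_finite[of "ball (0::complex) R"]
   by (intro integrable_mult_left integrable_real_indicator) auto
  have ID: "cmod (I x y) \<le> D y" if "x \<in> cball x0 r" for x y
  proof (cases "y \<in> ball 0 R")
   case True
   then have "cmod y ^ n * cmod (F (x, y)) \<le> R ^ n * B"
    using R(1) B[OF that, of y] by (intro mult_mono power_mono) auto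
   then show ?thesis using True by (simp add: I_def D_def norm_mult norm_power)
  qed (simp add: I_def D_def)
  have Ii: "integrable lborel (I x)" if "x \<in> cball x0 r" for x
   by (rule Bochner_Integration.integrable_bound[OF Di Im[OF that]])
    (rule AE_I2, rule order_trans[OF ID[OF that]], simp only: real_norm_def abs_ge_self)
  have holI: "(\<lambda>x. \<integral>y. I x y \<partial>lborel) holomorphic_on ball x0 r"
  proof (rule holomorphic_on_integral[OF open_ball])
   show "I x \<in> borel_measurable lborel" if "x \<in> ball x0 r" for x using Im that by simp
   show "(\<lambda>x. I x y) holomorphic_on ball x0 r" for y
   proof (cases "y \<in> ball 0 R")
    case True
    have "(\<lambda>x. F (x, y)) holomorphic_on ball x0 r"
     using F unfolding hartogs_def by (rule holomorphic_on_subset[OF conjunct2[OF conjunct2, THEN spec, of _ _ _ y]]) (use inOm True in auto)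
    then show ?thesis unfolding I_def using True by (simp) (intro holomorphic_intros)
   qed (simp add: I_def)
   show "\<exists>r'>0. \<exists>B. integrable lborel B \<and> (\<forall>w\<in>ball x r' \<inter> ball x0 r. \<forall>y\<in>space lborel. cmod (I w y) \<le> B y)" if "x \<in> ball x0 r" for x
    using Di ID by (intro exI[of _ "1::real"] conjI exI[of _ D]) auto
  qed
  have eq: "coef F n x = of_real (Suc n / (pi * R ^ (2 * Suc n))) * (\<integral>y. I x y \<partial>lborel)" if x: "x \<in> ball x0 r" for x
  proof -
   have xc: "x \<in> cball x0 r" using x by simp
   have "R < sqrt (rho x)" using rhoR[OF xc] R(1) by (simp add: real_less_rsqrt)
   then have "(\<lambda>y. F (x, y)) holomorphic_on ball 0 R"
    using F xDD[OF xc] unfolding hartogs_def by (meson holomorphic_on_subset less_imp_le subset_ball)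
   from disc_formula[OF this R(1), of n] Ii[OF xc]
   have "(\<integral>y. I x y \<partial>lborel) = complex_of_real (pi * R ^ (2 * Suc n) / Suc n) * coef F n x"
    unfolding I_def set_integrable_def set_lebesgue_integral_def coef_def by simp
   moreover have "complex_of_real (Suc n / (pi * R ^ (2 * Suc n))) * complex_of_real (pi * R ^ (2 * Suc n) / Suc n) = 1"
    unfolding of_real_mult[symmetric] using R(1) by (simp del: of_nat_Suc power_Suc)
   ultimately show ?thesis by (simp only: mult.assoc[symmetric] mult_1)
  qed
  have "(\<lambda>x. of_real (Suc n / (pi * R ^ (2 * Suc n))) * (\<integral>y. I x y \<partial>lborel)) holomorphic_on ball x0 r"
   using holI by (intro holomorphic_intros)
  then have "coef F n holomorphic_on ball x0 r"
   by (rule holomorphic_transform) (simp only: eq)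
  then show ?thesis using r(1) by (intro holomorphic_on_imp_differentiable_at[OF _ open_ball]) auto
 qed
 then show ?thesis unfolding holomorphic_on_def using field_differentiable_at_within by blast
qed

text \<open>Integration over the discs \<open>{\<bar>y\<bar>\<^sup>2 < rho x}\<close>, followed by the conformal map onto the strip: the
 weights \<open>h ^ Suc n\<close> arise from the area of the discs.\<close>

lemma transfer:
 assumes F: "hartogs F" and w: "continuous_on DD w"
  and int: "integrable (lborel \<Otimes>\<^sub>M lborel) (\<lambda>p. indicator Om p *\<^sub>R (w (fst p) * cnj (snd p) ^ n * F p))"
 defines "\<Psi> \<equiv> \<lambda>s. indicator strip s *\<^sub>R (complex_of_real (h (Im s) ^ Suc n / (d\<^sup>2 * cmod (M s) ^ (2 * n + 6))) * (w (X s) * coef F n (X s)))"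
 shows "integrable lborel \<Psi>"
  and "integral\<^sup>L (lborel \<Otimes>\<^sub>M lborel) (\<lambda>p. indicator Om p *\<^sub>R (w (fst p) * cnj (snd p) ^ n * F p))
   = of_real (pi / Suc n) * (\<integral>s. \<Psi> s \<partial>lborel)"
proof -
 define P where "P p = indicator Om p *\<^sub>R (w (fst p) * cnj (snd p) ^ n * F p)" for p
 define f1 where "f1 x = w x * of_real (rho x ^ Suc n) * coef F n x" for x
 define g1 where "g1 x = indicator DD x *\<^sub>R f1 x" for x
 have Pi: "integrable (lborel \<Otimes>\<^sub>M lborel) P" using int unfolding P_def .
 have g1m: "g1 \<in> borel_measurable borel"
  unfolding g1_def f1_def
 proof (rule borel_measurable_continuous_on_indicator)
  show "DD \<in> sets borel" using open_DD by (rule borel_open)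
  show "continuous_on DD (\<lambda>x. w x * of_real (rho x ^ Suc n) * coef F n x)"
   using holomorphic_on_imp_continuous_on[OF coef_holomorphic[OF F, of n]]
   by (intro continuous_on_mult w continuous_on_of_real continuous_on_power rho_cont)
 qed
 have inner: "(\<integral>y. P (x, y) \<partial>lborel) = of_real (pi / Suc n) * g1 x" if ix: "integrable lborel (\<lambda>y. P (x, y))" for x
 proof (cases "x \<in> DD \<and> w x \<noteq> 0")
  case True
  then have xD: "x \<in> DD" and wx: "w x \<noteq> 0" by auto
  define R where "R = sqrt (rho x)"
  have R: "R > 0" "R\<^sup>2 = rho x" using xD by (auto simp: R_def DD_def)
  have eq: "P (x, y) = w x * (indicator (ball 0 R) y *\<^sub>R (cnj y ^ n * F (x, y)))" for y
   using Om_ball[OF xD, of y] by (auto simp: P_def R_def indicator_def)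
  have "integrable lborel (\<lambda>y. inverse (w x) * P (x, y))" using ix by (rule integrable_mult_right)
  moreover have "inverse (w x) * P (x, y) = indicator (ball 0 R) y *\<^sub>R (cnj y ^ n * F (x, y))" for y
   unfolding eq using wx by (simp only: mult.assoc[symmetric] left_inverse mult_1 not_False_eq_True)
  ultimately have i: "set_integrable lborel (ball 0 R) (\<lambda>y. cnj y ^ n * F (x, y))"
   unfolding set_integrable_def by (simp only:)
  have "(\<lambda>y. F (x, y)) holomorphic_on ball 0 R" using F xD by (simp add: hartogs_def R_def)
  from disc_formula[OF this R(1) i]
  have "(\<integral>y. P (x, y) \<partial>lborel) = w x * (pi * R ^ (2 * Suc n) / Suc n * coef F n x)"
   unfolding eq integral_mult_right_zero by (simp only: set_lebesgue_integral_def coef_def)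
  also have "R ^ (2 * Suc n) = rho x ^ Suc n" unfolding power_mult R(2) ..
  finally show ?thesis using xD by (simp add: g1_def f1_def del: power_Suc of_nat_Suc)
 next
  case False
  have "P (x, y) = 0" for y using False Om_DD[of x y] by (auto simp: P_def indicator_def)
  then show ?thesis using False by (auto simp: g1_def f1_def)
 qed
 have ae: "AE x in lborel. (\<integral>y. P (x, y) \<partial>lborel) = of_real (pi / Suc n) * g1 x"
  using lborel_pair.AE_integrable_fst'[OF Pi] by eventually_elim (rule inner)
 have i1: "integrable lborel (\<lambda>x. \<integral>y. P (x, y) \<partial>lborel)" by (rule lborel_pair.integrable_fst'[OF Pi])
 have m2: "(\<lambda>x. of_real (pi / Suc n) * g1 x) \<in> borel_measurable lborel" using g1m by simp
 have "integrable lborel (\<lambda>x. of_real (pi / Suc n) * g1 x)"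
  using integrable_cong_AE[OF borel_measurable_integrable[OF i1] m2 ae] i1 by simp
 from integrable_mult_right[OF this, of "of_real (Suc n / pi)"]
 have "integrable lborel (\<lambda>x. (of_real (Suc n / pi) * of_real (pi / Suc n)) * g1 x)" by (simp only: mult.assoc)
 moreover have "complex_of_real (Suc n / pi) * of_real (pi / Suc n) = 1"
  unfolding of_real_mult[symmetric] by (simp del: of_nat_Suc)
 ultimately have g1i: "integrable lborel g1" by simp
 have CV: "set_integrable lborel (X ` strip) f1 \<longleftrightarrow> set_integrable lborel strip (\<lambda>s. (cmod (deriv X s))\<^sup>2 * f1 (X s))"
  "(LINT x:X ` strip|lborel. f1 x) = (LINT s:strip|lborel. (cmod (deriv X s))\<^sup>2 * f1 (X s))"
  by (rule conformal_change_of_variables[OF open_strip X_holomorphic X_inj]; use g1m in \<open>simp add: X_strip g1_def[abs_def]\<close>)+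
 have \<Psi>: "indicator strip s *\<^sub>R ((cmod (deriv X s))\<^sup>2 * f1 (X s)) = \<Psi> s" for s
 proof (cases "s \<in> strip")
  case True
  have p: "- pi < Im s" "Im s < pi" using strip_pi[OF True] by auto
  have Mp: "cmod (M s) > 0" using M_nonzero[OF p] by simp
  have "(cmod (deriv X s))\<^sup>2 * rho (X s) ^ Suc n = h (Im s) ^ Suc n / (d\<^sup>2 * cmod (M s) ^ (2 * n + 6))"
  proof -
   have "(cmod (deriv X s))\<^sup>2 * rho (X s) ^ Suc n = 1 / (d\<^sup>2 * (cmod (M s) ^ 4)) * (h (Im s) ^ Suc n / (cmod (M s) ^ (2 * Suc n)))"
    unfolding cmod_deriv_X[OF True] rho_M(3)[OF p X_eq[OF p]]
    by (simp add: power_divide power_mult_distrib power_mult[symmetric] del: power_Suc)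
   also have "\<dots> = h (Im s) ^ Suc n / (d\<^sup>2 * (cmod (M s) ^ 4 * cmod (M s) ^ (2 * Suc n)))" by simp
   also have "cmod (M s) ^ 4 * cmod (M s) ^ (2 * Suc n) = cmod (M s) ^ (2 * n + 6)"
    unfolding power_add[symmetric] by (simp add: add.commute)
   finally show ?thesis .
  qed
  then have "complex_of_real ((cmod (deriv X s))\<^sup>2) * of_real (rho (X s) ^ Suc n) = of_real (h (Im s) ^ Suc n / (d\<^sup>2 * cmod (M s) ^ (2 * n + 6)))"
   by (simp only: of_real_mult[symmetric])
  moreover have "complex_of_real ((cmod (deriv X s))\<^sup>2) * f1 (X s)
    = (complex_of_real ((cmod (deriv X s))\<^sup>2) * of_real (rho (X s) ^ Suc n)) * (w (X s) * coef F n (X s))"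
   unfolding f1_def by (simp only: mult_ac)
  ultimately show ?thesis using True by (simp only: \<Psi>_def)
 qed (simp add: \<Psi>_def)
 show "integrable lborel \<Psi>"
  using CV(1) g1i unfolding X_strip set_integrable_def g1_def[abs_def] \<Psi> by simp
 have "integral\<^sup>L (lborel \<Otimes>\<^sub>M lborel) P = (\<integral>x. \<integral>y. P (x, y) \<partial>lborel \<partial>lborel)"
  by (rule lborel_pair.integral_fst'[OF Pi, symmetric])
 also have "\<dots> = (\<integral>x. of_real (pi / Suc n) * g1 x \<partial>lborel)"
  by (rule integral_cong_AE[OF borel_measurable_integrable[OF i1] m2 ae])
 also have "\<dots> = of_real (pi / Suc n) * (\<integral>s. \<Psi> s \<partial>lborel)"
 proof -
  have "(\<integral>x. g1 x \<partial>lborel) = (\<integral>s. \<Psi> s \<partial>lborel)"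
   using CV(2) unfolding X_strip set_lebesgue_integral_def g1_def[abs_def] \<Psi> .
  then show ?thesis by (simp only: integral_mult_right_zero)
 qed
 finally show "integral\<^sup>L (lborel \<Otimes>\<^sub>M lborel) (\<lambda>p. indicator Om p *\<^sub>R (w (fst p) * cnj (snd p) ^ n * F p))
   = of_real (pi / Suc n) * (\<integral>s. \<Psi> s \<partial>lborel)" unfolding P_def .
qed

lemma integrable_Re_Im_product:
 fixes f g :: "real \<Rightarrow> real"
 assumes f: "integrable lborel f" and g: "integrable lborel g"
 shows "integrable lborel (\<lambda>s. complex_of_real (f (Re s) * g (Im s)))"
proof -
 have m: "(\<lambda>(x, y). Complex x y) \<in> borel_measurable (lborel \<Otimes>\<^sub>M lborel)"
  unfolding lborel_prod case_prod_beta Complex_eq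
  by (simp, intro borel_measurable_continuous_onI continuous_intros)
 have fm[measurable]: "f \<in> borel_measurable borel" "g \<in> borel_measurable borel" using f g by auto
 have pm: "(\<lambda>p. complex_of_real (f (fst p) * g (snd p))) \<in> borel_measurable (lborel \<Otimes>\<^sub>M lborel)" by measurable
 have "integrable (lborel \<Otimes>\<^sub>M lborel) (\<lambda>p. complex_of_real (f (fst p) * g (snd p)))"
 proof (rule lborel_pair.Fubini_integrable[OF pm])
  have "integrable lborel (\<lambda>x. norm (f x) * (\<integral>y. norm (g y) \<partial>lborel))"
   using integrable_norm[OF f] by (rule integrable_mult_left)
  then show "integrable lborel (\<lambda>x. \<integral>y. norm (complex_of_real (f (fst (x, y)) * g (snd (x, y)))) \<partial>lborel)"
   by (simp add: norm_mult)
  show "AE x in lborel. integrable lborel (\<lambda>y. complex_of_real (f (fst (x, y)) * g (snd (x, y))))"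
   using g by (intro AE_I2) (simp del: of_real_mult)
 qed
 then have "integrable (distr (lborel \<Otimes>\<^sub>M lborel) borel (\<lambda>(x, y). Complex x y)) (\<lambda>s. complex_of_real (f (Re s) * g (Im s)))"
  by (subst integrable_distr_eq[OF m]) (auto simp: case_prod_beta)
 then show ?thesis unfolding distr_Complex_lborel .
qed

text \<open>A square integrable majorant, up to constants, of the kernel in its second variable.\<close>

definition EE :: "complex \<Rightarrow> real" where
 "EE x = cmod (M (sg x)) ^ 3 * exp (- \<bar>Re (sg x)\<bar> / 4)"

lemma EE_cont: "continuous_on DD EE"
proof -
 have "continuous_on DD sg" using DD_good(1)
  by (intro continuous_on_subset[OF holomorphic_on_imp_continuous_on[OF sg_holomorphic]]) auto
 then show ?thesis unfolding EE_def
  by (intro continuous_intros continuous_on_compose2[OF holomorphic_on_imp_continuous_on[OF M_holomorphic[of UNIV]]]) auto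
qed

lemma EE_square_integrable:
 "integrable (lborel \<Otimes>\<^sub>M lborel) (\<lambda>p. indicator Om p * (EE (fst p))\<^sup>2)"
proof -
 define P where "P p = indicator Om p * (EE (fst p))\<^sup>2" for p
 have Pm: "P \<in> borel_measurable (lborel \<Otimes>\<^sub>M lborel)"
 proof -
  have "(\<lambda>p. indicator Om p *\<^sub>R (EE (fst p))\<^sup>2) \<in> borel_measurable borel"
  proof (rule borel_measurable_continuous_on_indicator)
   show "continuous_on Om (\<lambda>p. (EE (fst p))\<^sup>2)"
    by (intro continuous_intros continuous_on_compose2[OF EE_cont]) (auto dest: Om_DD)
  qed (use open_Om in auto)
  then show ?thesis unfolding lborel_prod measurable_cong_sets[OF sets_lborel refl] P_def[abs_def] by simp
 qed
 have fib: "integrable lborel (\<lambda>y. indicator (ball (0::complex) R) y * c)" for R c :: real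
  using emeasure_bounded_finite[of "ball (0::complex) R"]
  by (intro integrable_mult_left integrable_real_indicator) auto
 have eqP: "P (x, y) = indicator (ball 0 (sqrt (rho x))) y * (EE x)\<^sup>2" if "x \<in> DD" for x y
  using Om_ball[OF that, of y] by (auto simp: P_def indicator_def)
 have P0: "P (x, y) = 0" if "x \<notin> DD" for x y using that Om_DD[of x y] by (auto simp: P_def indicator_def)
 define f1 where "f1 x = complex_of_real (pi * rho x * (EE x)\<^sup>2)" for x
 have inner: "(\<integral>y. norm (P (x, y)) \<partial>lborel) = norm (indicator DD x *\<^sub>R f1 x)" for x
 proof (cases "x \<in> DD")
  case True
  define R where "R = sqrt (rho x)"
  have R: "R > 0" "R\<^sup>2 = rho x" using True by (auto simp: R_def DD_def)
  have i: "set_integrable lborel (ball 0 R) (\<lambda>y. cnj y ^ 0 * 1)"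
   unfolding set_integrable_def using integrable_of_real[OF fib[of R 1], where 'a = complex] by (simp add: scaleR_conv_of_real)
  have "(LINT y:ball 0 R|lborel. cnj y ^ 0 * 1) = complex_of_real (pi * R\<^sup>2)"
   using disc_formula[of "\<lambda>_. 1" R 0, OF _ R(1) i] by simp
  then have "complex_of_real (\<integral>y. indicator (ball (0::complex) R) y \<partial>lborel) = complex_of_real (pi * R\<^sup>2)"
   unfolding set_lebesgue_integral_def by (subst integral_complex_of_real[symmetric]) (simp add: scaleR_conv_of_real)
  then have area: "(\<integral>y. indicator (ball (0::complex) R) y \<partial>lborel) = pi * R\<^sup>2" by (simp only: of_real_eq_iff)
  have "(\<integral>y. norm (P (x, y)) \<partial>lborel) = (\<integral>y. indicator (ball (0::complex) R) y * (EE x)\<^sup>2 \<partial>lborel)"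
   using eqP[OF True] by (simp add: R_def abs_mult)
  also have "\<dots> = pi * R\<^sup>2 * (EE x)\<^sup>2" using area by simp
  finally have "(\<integral>y. norm (P (x, y)) \<partial>lborel) = pi * R\<^sup>2 * (EE x)\<^sup>2" .
  moreover have "rho x \<ge> 0" using True by (simp add: DD_def)
  ultimately show ?thesis using True R by (simp add: f1_def norm_mult norm_power)
 qed (simp add: P0)
 have "set_integrable lborel (X ` strip) f1 \<longleftrightarrow> set_integrable lborel strip (\<lambda>s. (cmod (deriv X s))\<^sup>2 * f1 (X s))"
 proof (rule conformal_change_of_variables(1)[OF open_strip X_holomorphic X_inj])
  have "continuous_on DD f1" unfolding f1_def by (intro continuous_intros rho_cont EE_cont)
  then show "(\<lambda>x. indicator (X ` strip) x *\<^sub>R f1 x) \<in> borel_measurable borel"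
   unfolding X_strip using open_DD by (intro borel_measurable_continuous_on_indicator) auto
 qed
 moreover have "set_integrable lborel strip (\<lambda>s. (cmod (deriv X s))\<^sup>2 * f1 (X s))"
 proof -
  obtain H where H: "H > 0" "\<And>\<phi>. \<alpha> \<le> \<phi> ==> \<phi> \<le> \<beta> ==> h \<phi> \<le> H" by (rule h_upper) blast
  have eq: "(cmod (deriv X s))\<^sup>2 * f1 (X s) = complex_of_real (pi / d\<^sup>2 * exp (- \<bar>Re s\<bar> / 2) * h (Im s))" if "s \<in> strip" for s
  proof -
   have p: "- pi < Im s" "Im s < pi" using strip_pi[OF that] by auto
   have Mp: "cmod (M s) > 0" using M_nonzero[OF p] by simp
   have "(cmod (deriv X s))\<^sup>2 * (pi * rho (X s) * (EE (X s))\<^sup>2) = pi / d\<^sup>2 * exp (- \<bar>Re s\<bar> / 2) * h (Im s)"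
   proof -
    have e: "(EE (X s))\<^sup>2 = cmod (M s) ^ 6 * exp (- \<bar>Re s\<bar> / 2)"
     unfolding EE_def sg_X[OF p] power_mult_distrib power_mult[symmetric]
     by (simp add: power2_eq_square exp_add[symmetric])
    have "(1 / (dd * m\<^sup>2))\<^sup>2 * (pi * (hh / m\<^sup>2) * (m ^ 6 * ee')) = pi / dd\<^sup>2 * ee' * hh"
     if "m > 0" "dd > 0" for m dd hh ee' :: real
     using that by (simp add: field_simps power2_eq_square eval_nat_numeral)
    from this[OF Mp d_pos] show ?thesis unfolding e cmod_deriv_X[OF that] rho_M(3)[OF p X_eq[OF p]]
     by (simp only:)
   qed
   then show ?thesis unfolding f1_def of_real_mult[symmetric] by (simp only:)
  qed
  have dom: "integrable lborel (\<lambda>s. complex_of_real (exp (- (1/2) * \<bar>Re s\<bar>) * (indicator {\<alpha>..\<beta>} (Im s) * (pi / d\<^sup>2 * H))))"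
   by (rule integrable_Re_Im_product[OF integrable_exp_abs integrable_indicator_Icc]) simp
  show ?thesis unfolding set_integrable_def
  proof (rule Bochner_Integration.integrable_bound[OF dom])
   have c: "continuous_on strip (\<lambda>s. complex_of_real (pi / d\<^sup>2 * exp (- \<bar>Re s\<bar> / 2) * h (Im s)))"
    by (intro continuous_intros continuous_on_compose2[OF cont_h]) auto
   have "(\<lambda>s. indicator strip s *\<^sub>R complex_of_real (pi / d\<^sup>2 * exp (- \<bar>Re s\<bar> / 2) * h (Im s))) \<in> borel_measurable borel"
    by (rule borel_measurable_continuous_on_indicator[OF _ c]) (rule borel_open[OF open_strip])
   moreover have "(\<lambda>s. indicator strip s *\<^sub>R complex_of_real (pi / d\<^sup>2 * exp (- \<bar>Re s\<bar> / 2) * h (Im s)))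
     = (\<lambda>s. indicator strip s *\<^sub>R ((cmod (deriv X s))\<^sup>2 * f1 (X s)))"
   proof
    fix s show "indicator strip s *\<^sub>R complex_of_real (pi / d\<^sup>2 * exp (- \<bar>Re s\<bar> / 2) * h (Im s))
     = indicator strip s *\<^sub>R ((cmod (deriv X s))\<^sup>2 * f1 (X s))"
     by (cases "s \<in> strip") (simp_all only: eq indicator_simps scaleR_zero_left not_False_eq_True)
   qed
   ultimately show "(\<lambda>s. indicator strip s *\<^sub>R ((cmod (deriv X s))\<^sup>2 * f1 (X s))) \<in> borel_measurable lborel" by simp
   show "AE s in lborel. norm (indicator strip s *\<^sub>R ((cmod (deriv X s))\<^sup>2 * f1 (X s)))
     \<le> norm (complex_of_real (exp (- (1/2) * \<bar>Re s\<bar>) * (indicator {\<alpha>..\<beta>} (Im s) * (pi / d\<^sup>2 * H))))"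
   proof (rule AE_I2)
    fix s :: complex
    show "norm (indicator strip s *\<^sub>R ((cmod (deriv X s))\<^sup>2 * f1 (X s)))
     \<le> norm (complex_of_real (exp (- (1/2) * \<bar>Re s\<bar>) * (indicator {\<alpha>..\<beta>} (Im s) * (pi / d\<^sup>2 * H))))"
    proof (cases "s \<in> strip")
     case True
     have "pi / d\<^sup>2 * exp (- \<bar>Re s\<bar> / 2) * h (Im s) \<le> pi / d\<^sup>2 * exp (- \<bar>Re s\<bar> / 2) * H"
      using True H(2)[of "Im s"] by (intro mult_left_mono) auto
     moreover have "h (Im s) \<ge> 0" using h_nonneg[of "Im s"] True by simp
     ultimately show ?thesis using True H(1) unfolding eq[OF True] norm_scaleR norm_of_real
      by (simp add: abs_mult mult_ac)
    qed simp
   qed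
  qed
 qed
 ultimately have "integrable lborel (\<lambda>x. indicator DD x *\<^sub>R f1 x)" unfolding X_strip set_integrable_def by simp
 from integrable_norm[OF this] have i: "integrable lborel (\<lambda>x. \<integral>y. norm (P (x, y)) \<partial>lborel)" unfolding inner .
 have "integrable (lborel \<Otimes>\<^sub>M lborel) P"
 proof (rule lborel_pair.Fubini_integrable[OF Pm i], rule AE_I2)
  fix x
  show "integrable lborel (\<lambda>y. P (x, y))"
   by (cases "x \<in> DD") (use eqP P0 fib in auto)
 qed
 then show ?thesis unfolding P_def .
qed

end

section \<open>The kernel as a series\<close>

lemma summable_Suc_geometric:
 fixes \<theta> :: real
 assumes "0 < \<theta>" "\<theta> < 1"
 shows "summable (\<lambda>n. real (Suc n) * \<theta> ^ n)"
 using geometric_deriv_sums[of \<theta>] assms by (simp add: sums_iff)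

context lens
begin

text \<open>Up to a constant, the reproducing kernel for the functions of the form \<open>f x * y ^ n\<close>. The powers of
 \<open>M\<close> absorb the Jacobian and the weights in \<open>transfer\<close>.\<close>

definition Kn :: "nat \<Rightarrow> complex \<Rightarrow> complex \<Rightarrow> complex \<Rightarrow> complex \<Rightarrow> complex" where
 "Kn n x y x' y' = of_nat (Suc n) * (y * cnj y') ^ n * (M (sg x) * cnj (M (sg x'))) ^ (n + 3) * kker n 0 (sg x - cnj (sg x'))"

definition Kt :: "complex \<Rightarrow> complex \<Rightarrow> complex \<Rightarrow> complex \<Rightarrow> complex" where
 "Kt x y x' y' = (\<Sum>n. Kn n x y x' y')"

lemma Kn_bound:
 assumes a: "\<alpha> < a" "a \<le> b" "b < \<beta>" and k: "0 < k" "k < 1"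
 obtains C \<theta> where "C > 0" "0 < \<theta>" "\<theta> < 1"
  "\<And>n x y x' y'. \<lbrakk>a \<le> (Im (sg x) + Im (sg x')) / 2; (Im (sg x) + Im (sg x')) / 2 \<le> b;
    cmod (y * M (sg x)) * cmod (y' * M (sg x')) \<le> k * h ((Im (sg x) + Im (sg x')) / 2)\<rbrakk> \<Longrightarrow>
    cmod (Kn n x y x' y') \<le> C * (real (Suc n) * \<theta> ^ n) * (cmod (M (sg x)) * cmod (M (sg x'))) ^ 3 * exp (- \<bar>Re (sg x) - Re (sg x')\<bar> / 2)"
proof -
 obtain C \<theta> where C: "C > 0" "0 < \<theta>" "\<theta> < 1"
  "\<And>n \<epsilon> \<tau>. \<lbrakk>0 \<le> \<epsilon>; \<epsilon> \<le> 1; a \<le> Im \<tau> / 2; Im \<tau> / 2 \<le> b\<rbrakk> \<Longrightarrow>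
   (k * h (Im \<tau> / 2)) ^ n * cmod (kker n \<epsilon> \<tau>) \<le> C * \<theta> ^ n * exp (- \<bar>Re \<tau>\<bar> / 2)"
  by (rule kker_decay[OF a k]) blast
 show ?thesis
 proof (rule that[OF C(1-3)])
  fix n x y x' y'
  assume m: "a \<le> (Im (sg x) + Im (sg x')) / 2" "(Im (sg x) + Im (sg x')) / 2 \<le> b"
   and le: "cmod (y * M (sg x)) * cmod (y' * M (sg x')) \<le> k * h ((Im (sg x) + Im (sg x')) / 2)"
  define \<tau> where "\<tau> = sg x - cnj (sg x')"
  have \<tau>: "Im \<tau> = Im (sg x) + Im (sg x')" "Re \<tau> = Re (sg x) - Re (sg x')" by (simp_all add: \<tau>_def)
  define P where "P = (cmod (M (sg x)) * cmod (M (sg x'))) ^ 3"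
  have "(y * cnj y') ^ n * (M (sg x) * cnj (M (sg x'))) ^ (n + 3)
    = ((y * M (sg x)) * cnj (y' * M (sg x'))) ^ n * (M (sg x) * cnj (M (sg x'))) ^ 3"
   unfolding power_add complex_cnj_mult power_mult_distrib by (simp only: mult_ac)
  then have "Kn n x y x' y' = of_nat (Suc n) * (((y * M (sg x)) * cnj (y' * M (sg x'))) ^ n * (M (sg x) * cnj (M (sg x'))) ^ 3) * kker n 0 \<tau>"
   unfolding Kn_def \<tau>_def by (simp only: mult.assoc)
  then have "cmod (Kn n x y x' y') = real (Suc n) * ((cmod (y * M (sg x)) * cmod (y' * M (sg x'))) ^ n * P) * cmod (kker n 0 \<tau>)"
   unfolding P_def by (simp only: norm_mult norm_power norm_of_nat complex_mod_cnj)
  also have "\<dots> \<le> real (Suc n) * ((k * h (Im \<tau> / 2)) ^ n * P) * cmod (kker n 0 \<tau>)"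
   unfolding \<tau>(1) using le by (intro mult_right_mono mult_left_mono power_mono) (auto simp: P_def)
  also have "\<dots> = real (Suc n) * P * ((k * h (Im \<tau> / 2)) ^ n * cmod (kker n 0 \<tau>))" by (simp only: mult_ac)
  also have "\<dots> \<le> real (Suc n) * P * (C * \<theta> ^ n * exp (- \<bar>Re \<tau>\<bar> / 2))"
   by (intro mult_left_mono C(4)) (use m \<tau> in \<open>auto simp: P_def\<close>)
  finally show "cmod (Kn n x y x' y') \<le> C * (real (Suc n) * \<theta> ^ n) * (cmod (M (sg x)) * cmod (M (sg x'))) ^ 3 * exp (- \<bar>Re (sg x) - Re (sg x')\<bar> / 2)"
   unfolding P_def[symmetric] \<tau>(2) by (simp only: mult_ac)
 qed
qed

lemma Kn_cnj: "cnj (Kn n x y x' y') = Kn n x' y' x y"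
proof -
 have "sg x' - cnj (sg x) = - cnj (sg x - cnj (sg x'))" by simp
 then have "kker n 0 (sg x' - cnj (sg x)) = cnj (kker n 0 (sg x - cnj (sg x')))" by (simp only: kker_cnj)
 then show ?thesis unfolding Kn_def by (simp add: mult_ac)
qed

lemma Om_factor:
 assumes "(x, y) \<in> Om"
 obtains k where "0 < k" "k < 1" "cmod (y * M (sg x)) \<le> k * sqrt (h (Im (sg x)))"
proof -
 have x: "x \<in> DD" using Om_DD[OF assms] .
 note g = DD_good[OF x]
 have hp: "h (Im (sg x)) > 0" using g(2) by (intro h_pos) auto
 have Mp: "(cmod (M (sg x)))\<^sup>2 > 0" using M_nonzero[OF sg_good(1,2)[OF g(1)]] by simp
 have "(cmod y)\<^sup>2 * (cmod (M (sg x)))\<^sup>2 < rho x * (cmod (M (sg x)))\<^sup>2"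
  using assms Mp unfolding mem_Om by (rule mult_strict_right_mono)
 also have "\<dots> = h (Im (sg x))" unfolding rho_sg[OF g(1)] using Mp by simp
 finally have "(cmod (y * M (sg x)))\<^sup>2 < h (Im (sg x))" by (simp only: norm_mult power_mult_distrib)
 then have lt: "cmod (y * M (sg x)) < sqrt (h (Im (sg x)))" by (rule real_less_rsqrt)
 have sp: "sqrt (h (Im (sg x))) > 0" using hp by simp
 define k where "k = (cmod (y * M (sg x)) / sqrt (h (Im (sg x))) + 1) / 2"
 have q: "0 \<le> cmod (y * M (sg x)) / sqrt (h (Im (sg x)))" "cmod (y * M (sg x)) / sqrt (h (Im (sg x))) < 1"
  using lt sp by (auto simp: divide_less_eq)
 have "cmod (y * M (sg x)) / sqrt (h (Im (sg x))) \<le> k"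
 proof -
  have "t \<le> (t + 1) / 2" if "t < 1" for t :: real using that by simp
  from this[OF q(2)] show ?thesis unfolding k_def .
 qed
 then have "cmod (y * M (sg x)) \<le> k * sqrt (h (Im (sg x)))" using sp by (simp only: pos_divide_le_eq)
 then show ?thesis using that[of k] q by (simp add: k_def)
qed

text \<open>This is why the series converges up to the boundary in one variable: terms are governed by
 \<open>\<bar>y M\<bar> \<bar>y' M'\<bar>\<close>, and \<open>\<bar>y M\<bar>\<^sup>2 \<le> h\<close> on the closed domain.\<close>

lemma h_midpoint_sqrt:
 assumes "\<phi> \<in> {\<alpha>..\<beta>}" "\<psi> \<in> {\<alpha>..\<beta>}"
 shows "sqrt (h \<phi>) * sqrt (h \<psi>) \<le> h ((\<phi> + \<psi>) / 2)"
proof -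
 have "(cos ((\<phi> - \<psi>) / 2))\<^sup>2 \<le> 1" using abs_cos_le_one[of "(\<phi> - \<psi>) / 2"] by (simp add: abs_square_le_1)
 then have "(h ((\<phi> + \<psi>) / 2))\<^sup>2 * (cos ((\<phi> - \<psi>) / 2))\<^sup>2 \<le> (h ((\<phi> + \<psi>) / 2))\<^sup>2 * 1" by (intro mult_left_mono) auto
 then have "h \<phi> * h \<psi> \<le> (h ((\<phi> + \<psi>) / 2))\<^sup>2" using midpoint[OF assms] by simp
 then have "sqrt (h \<phi> * h \<psi>) \<le> sqrt ((h ((\<phi> + \<psi>) / 2))\<^sup>2)" by (rule real_sqrt_le_mono)
 moreover have "0 \<le> h ((\<phi> + \<psi>) / 2)" using assms by (intro h_nonneg) auto
 ultimately show ?thesis by (simp add: real_sqrt_mult)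
qed

text \<open>For fixed \<open>(x', y')\<close> the series still converges on the following set, which contains the closure
 of the domain up to the two complex tangent points.\<close>

definition UU :: "real \<Rightarrow> complex \<Rightarrow> complex \<Rightarrow> (complex \<times> complex) set" where
 "UU k x' y' = {(x, y). x \<in> good \<and> 2 * \<alpha> < Im (sg x) + Im (sg x') \<and> Im (sg x) + Im (sg x') < 2 * \<beta> \<and>
   cmod (y * M (sg x)) * cmod (y' * M (sg x')) < k * h ((Im (sg x) + Im (sg x')) / 2)}"

lemma UU_closure:
 assumes z': "(x', y') \<in> Om" and k1: "0 < k1" "k1 < k" "cmod (y' * M (sg x')) \<le> k1 * sqrt (h (Im (sg x')))"
  and x: "x \<in> good" "\<alpha> \<le> Im (sg x)" "Im (sg x) \<le> \<beta>" and y: "(cmod y)\<^sup>2 \<le> rho x"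
 shows "(x, y) \<in> UU k x' y'"
  and "cmod (y * M (sg x)) * cmod (y' * M (sg x')) \<le> k1 * h ((Im (sg x) + Im (sg x')) / 2)"
proof -
 note g' = DD_good[OF Om_DD[OF z']]
 have i': "\<alpha> < Im (sg x')" "Im (sg x') < \<beta>" using g'(2) by auto
 have Mp: "(cmod (M (sg x)))\<^sup>2 > 0" using M_nonzero[OF sg_good(1,2)[OF x(1)]] by simp
 have "(cmod y)\<^sup>2 * (cmod (M (sg x)))\<^sup>2 \<le> rho x * (cmod (M (sg x)))\<^sup>2"
  using y Mp by (intro mult_right_mono) auto
 also have "\<dots> = h (Im (sg x))" unfolding rho_sg[OF x(1)] using Mp by simp
 finally have "(cmod (y * M (sg x)))\<^sup>2 \<le> h (Im (sg x))" by (simp only: norm_mult power_mult_distrib)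
 then have 1: "cmod (y * M (sg x)) \<le> sqrt (h (Im (sg x)))" by (rule real_le_rsqrt)
 have hn: "h (Im (sg x)) \<ge> 0" "h (Im (sg x')) \<ge> 0" using x(2,3) i' by (auto intro!: h_nonneg)
 have "cmod (y * M (sg x)) * cmod (y' * M (sg x')) \<le> sqrt (h (Im (sg x))) * (k1 * sqrt (h (Im (sg x'))))"
  using 1 k1 hn by (intro mult_mono) auto
 also have "\<dots> = k1 * (sqrt (h (Im (sg x))) * sqrt (h (Im (sg x'))))" by simp
 also have "\<dots> \<le> k1 * h ((Im (sg x) + Im (sg x')) / 2)"
  using x(2,3) i' k1 by (intro mult_left_mono h_midpoint_sqrt) auto
 finally show le: "cmod (y * M (sg x)) * cmod (y' * M (sg x')) \<le> k1 * h ((Im (sg x) + Im (sg x')) / 2)" .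
 have "h ((Im (sg x) + Im (sg x')) / 2) > 0" using x(2,3) i' by (intro h_pos) auto
 then have "k1 * h ((Im (sg x) + Im (sg x')) / 2) < k * h ((Im (sg x) + Im (sg x')) / 2)" using k1 by simp
 with le show "(x, y) \<in> UU k x' y'" using x i' by (simp add: UU_def)
qed

end

locale lens_domain = lens +
 fixes e1 e2 :: "complex ^ 2"
 assumes orthonormal: "hermitian e1 e1 = 1" "hermitian e2 e2 = 1" "hermitian e1 e2 = 0"
begin

definition hx :: "complex ^ 2 \<Rightarrow> complex" where "hx z = hermitian z e1"
definition hy :: "complex ^ 2 \<Rightarrow> complex" where "hy z = hermitian z e2"
definition Dom :: "(complex ^ 2) set" where "Dom = {z. (hx z, hy z) \<in> Om}"
definition T :: "complex \<times> complex \<Rightarrow> complex ^ 2" where "T p = fst p *s e1 + snd p *s e2"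

lemma hx_hol: "holomorphic_Cn_on hx S" and hy_hol: "holomorphic_Cn_on hy S"
 unfolding hx_def hy_def hermitian_def by (intro holomorphic_Cn_on_add holomorphic_Cn_on_mult holomorphic_Cn_on_nth holomorphic_Cn_on_const)+

lemma hx_cont: "continuous_on S hx" and hy_cont: "continuous_on S hy"
 using hx_hol hy_hol by (auto intro: holomorphic_Cn_on_imp_continuous_on)

lemma hermitian_T: "hermitian (x *s e1 + y *s e2) w = x * hermitian e1 w + y * hermitian e2 w"
 by (simp add: hermitian_def algebra_simps)

lemma hermitian_cnj: "hermitian w z = cnj (hermitian z w)"
 by (simp add: hermitian_def mult.commute)

lemma hx_T: "hx (T p) = fst p" and hy_T: "hy (T p) = snd p"
 using orthonormal hermitian_cnj[of e2 e1] by (simp_all add: hx_def hy_def T_def hermitian_T)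

lemma e_det: "e1 $ 1 * e2 $ 2 - e1 $ 2 * e2 $ 1 \<noteq> 0"
proof
 assume z: "e1 $ 1 * e2 $ 2 - e1 $ 2 * e2 $ 1 = 0"
 have o: "e1 $ 1 * cnj (e1 $ 1) + e1 $ 2 * cnj (e1 $ 2) = 1" "e1 $ 1 * cnj (e2 $ 1) + e1 $ 2 * cnj (e2 $ 2) = 0"
  "e2 $ 1 * cnj (e2 $ 1) + e2 $ 2 * cnj (e2 $ 2) = 1"
  using orthonormal by (simp_all add: hermitian_def)
 have "e1 $ 1 * (e2 $ 1 * cnj (e2 $ 1) + e2 $ 2 * cnj (e2 $ 2)) = e2 $ 1 * (e1 $ 1 * cnj (e2 $ 1) + e1 $ 2 * cnj (e2 $ 2))"
  using z by (simp add: algebra_simps)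
 then have "e1 $ 1 = 0" using o by simp
 moreover have "e1 $ 2 * (e2 $ 1 * cnj (e2 $ 1) + e2 $ 2 * cnj (e2 $ 2)) = e2 $ 2 * (e1 $ 1 * cnj (e2 $ 1) + e1 $ 2 * cnj (e2 $ 2))"
  using z by (simp add: algebra_simps)
 then have "e1 $ 2 = 0" using o by simp
 ultimately show False using o by simp
qed

lemma T_inj: "T (hx z, hy z) = z"
proof -
 define w where "w = T (hx z, hy z) - z"
 have "hermitian w e1 = 0" "hermitian w e2 = 0"
  using hx_T[of "(hx z, hy z)"] hy_T[of "(hx z, hy z)"]
  by (simp_all add: w_def hx_def hy_def hermitian_def algebra_simps)
 then have h: "w $ 1 * cnj (e1 $ 1) + w $ 2 * cnj (e1 $ 2) = 0" "w $ 1 * cnj (e2 $ 1) + w $ 2 * cnj (e2 $ 2) = 0"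
  by (simp_all add: hermitian_def)
 have D: "cnj (e1 $ 1) * cnj (e2 $ 2) - cnj (e1 $ 2) * cnj (e2 $ 1) \<noteq> 0"
 proof -
  have "cnj (e1 $ 1 * e2 $ 2 - e1 $ 2 * e2 $ 1) \<noteq> 0" using e_det by (simp only: complex_cnj_zero_iff not_False_eq_True)
  then show ?thesis by simp
 qed
 have "w $ 1 * (cnj (e1 $ 1) * cnj (e2 $ 2) - cnj (e1 $ 2) * cnj (e2 $ 1))
   = (w $ 1 * cnj (e1 $ 1) + w $ 2 * cnj (e1 $ 2)) * cnj (e2 $ 2) - (w $ 1 * cnj (e2 $ 1) + w $ 2 * cnj (e2 $ 2)) * cnj (e1 $ 2)"
  by (simp add: algebra_simps)
 then have "w $ 1 = 0" using h D by simp
 moreover have "w $ 2 * (cnj (e1 $ 1) * cnj (e2 $ 2) - cnj (e1 $ 2) * cnj (e2 $ 1))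
   = (w $ 2 * cnj (e2 $ 2) + w $ 1 * cnj (e2 $ 1)) * cnj (e1 $ 1) - (w $ 1 * cnj (e1 $ 1) + w $ 2 * cnj (e1 $ 2)) * cnj (e2 $ 1)"
  by (simp add: algebra_simps)
 then have "w $ 2 = 0" using h D by (simp add: add.commute)
 ultimately have "w = 0" by (simp add: vec_eq_iff forall_2)
 then show ?thesis by (simp add: w_def)
qed

lemma T_linear: "linear T"
 by (intro linearI) (simp_all add: T_def vec_eq_iff algebra_simps)

lemma T_bij: "bij T"
 by (rule bij_betw_byWitness[where f' = "\<lambda>z. (hx z, hy z)"]) (auto simp: hx_T hy_T T_inj)

lemma open_Dom: "open Dom"
proof -
 have "continuous_on UNIV (\<lambda>z. (hx z, hy z))" by (intro continuous_on_Pair hx_cont hy_cont)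
 from open_vimage[OF open_Om this] show ?thesis by (simp add: Dom_def vimage_def)
qed

definition Uz :: "real \<Rightarrow> complex ^ 2 \<Rightarrow> (complex ^ 2) set" where
 "Uz k \<zeta> = {z. (hx z, hy z) \<in> UU k (hx \<zeta>) (hy \<zeta>)}"

definition Gz :: "(complex ^ 2) set" where "Gz = {z. hx z \<in> good}"

lemma open_Gz: "open Gz"
 using open_vimage[OF open_good hx_cont[of UNIV]] by (simp add: Gz_def vimage_def)

lemma sg_hx_hol: "holomorphic_Cn_on (\<lambda>z. sg (hx z)) Gz"
 by (rule holomorphic_Cn_on_compose[OF sg_holomorphic open_good hx_hol]) (simp add: Gz_def)

lemma M_hx_hol: "holomorphic_Cn_on (\<lambda>z. M (sg (hx z))) Gz"
 by (rule holomorphic_Cn_on_compose[OF M_holomorphic open_UNIV sg_hx_hol]) simp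

lemma Uz_Gz: "Uz k \<zeta> \<subseteq> Gz" by (auto simp: Uz_def UU_def Gz_def)

lemma open_Uz: "open (Uz k \<zeta>)"
proof -
 define \<phi> where "\<phi> z = Im (sg (hx z)) + Im (sg (hx \<zeta>))" for z
 define V where "V = {z \<in> Gz. 2 * \<alpha> < \<phi> z \<and> \<phi> z < 2 * \<beta>}"
 have c\<phi>: "continuous_on Gz \<phi>" unfolding \<phi>_def
  by (intro continuous_intros holomorphic_Cn_on_imp_continuous_on sg_hx_hol)
 have "V = Gz \<inter> \<phi> -` {2 * \<alpha><..<2 * \<beta>}" by (auto simp: V_def)
 then have oV: "open V" using continuous_open_preimage[OF c\<phi> open_Gz, of "{2 * \<alpha><..<2 * \<beta>}"] by simp
 define f where "f z = k * h (\<phi> z / 2) - cmod (hy z * M (sg (hx z))) * cmod (hy \<zeta> * M (sg (hx \<zeta>)))" for z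
 have cM: "continuous_on V (\<lambda>z. M (sg (hx z)))"
  by (rule continuous_on_subset[OF holomorphic_Cn_on_imp_continuous_on[OF M_hx_hol]]) (auto simp: V_def)
 have "continuous_on V (\<lambda>z. \<phi> z / 2)" by (intro continuous_intros continuous_on_subset[OF c\<phi>]) (auto simp: V_def)
 then have "continuous_on V (\<lambda>z. h (\<phi> z / 2))"
  by (rule continuous_on_compose2[OF cont_h]) (auto simp: V_def)
 then have "continuous_on V f" unfolding f_def by (intro continuous_intros hy_cont cM)
 then have "open (V \<inter> f -` {0<..})" by (rule continuous_open_preimage[OF _ oV]) simp
 moreover have "V \<inter> f -` {0<..} = Uz k \<zeta>" by (auto simp: V_def f_def Uz_def UU_def \<phi>_def Gz_def)
 ultimately show ?thesis by simp
qed

lemma Kn_hol: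
 assumes \<zeta>: "\<zeta> \<in> Dom"
 shows "holomorphic_Cn_on (\<lambda>z. Kn n (hx z) (hy z) (hx \<zeta>) (hy \<zeta>)) (Uz k \<zeta>)"
 unfolding Kn_def
proof (intro holomorphic_Cn_on_mult holomorphic_Cn_on_const holomorphic_Cn_on_power hy_hol)
 show "holomorphic_Cn_on (\<lambda>z. M (sg (hx z))) (Uz k \<zeta>)" by (rule holomorphic_Cn_on_subset[OF M_hx_hol Uz_Gz])
 show "holomorphic_Cn_on (\<lambda>z. kker n 0 (sg (hx z) - cnj (sg (hx \<zeta>)))) (Uz k \<zeta>)"
 proof (rule holomorphic_Cn_on_compose[OF kker_holomorphic open_strip])
  have "holomorphic_Cn_on (\<lambda>z. sg (hx z) + (- cnj (sg (hx \<zeta>)))) (Uz k \<zeta>)"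
   by (intro holomorphic_Cn_on_add holomorphic_Cn_on_const holomorphic_Cn_on_subset[OF sg_hx_hol Uz_Gz])
  then show "holomorphic_Cn_on (\<lambda>z. sg (hx z) - cnj (sg (hx \<zeta>))) (Uz k \<zeta>)" by simp
 qed (auto simp: Uz_def UU_def)
qed

lemma Kt_hol:
 assumes \<zeta>: "\<zeta> \<in> Dom" and k: "0 < k" "k < 1"
 shows "holomorphic_Cn_on (\<lambda>z. Kt (hx z) (hy z) (hx \<zeta>) (hy \<zeta>)) (Uz k \<zeta>)"
proof -
 define f where "f z n = Kn n (hx z) (hy z) (hx \<zeta>) (hy \<zeta>)" for z n
 have dom: "\<exists>r>0. \<exists>B. integrable (count_space UNIV) B \<and> (\<forall>w\<in>ball z r \<inter> Uz k \<zeta>. \<forall>n\<in>space (count_space UNIV). cmod (f w n) \<le> B n)"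
  if z: "z \<in> Uz k \<zeta>" for z
 proof -
  define \<phi> where "\<phi> w = (Im (sg (hx w)) + Im (sg (hx \<zeta>))) / 2" for w
  define N where "N w = cmod (M (sg (hx w)))" for w
  have "\<alpha> < \<phi> z" "\<phi> z < \<beta>" using z by (auto simp: Uz_def UU_def \<phi>_def)
  define a b where "a = (\<alpha> + \<phi> z) / 2" and "b = (\<phi> z + \<beta>) / 2"
  have ab': "\<alpha> < a" "a \<le> b" "b < \<beta>" "a < \<phi> z" "\<phi> z < b" using \<open>\<alpha> < \<phi> z\<close> \<open>\<phi> z < \<beta>\<close> by (auto simp: a_def b_def)
  obtain C \<theta> where C: "C > 0" "0 < \<theta>" "\<theta> < 1"
   "\<And>n x y x' y'. \<lbrakk>a \<le> (Im (sg x) + Im (sg x')) / 2; (Im (sg x) + Im (sg x')) / 2 \<le> b;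
    cmod (y * M (sg x)) * cmod (y' * M (sg x')) \<le> k * h ((Im (sg x) + Im (sg x')) / 2)\<rbrakk> \<Longrightarrow>
    cmod (Kn n x y x' y') \<le> C * (real (Suc n) * \<theta> ^ n) * (cmod (M (sg x)) * cmod (M (sg x'))) ^ 3 * exp (- \<bar>Re (sg x) - Re (sg x')\<bar> / 2)"
   by (rule Kn_bound[OF ab'(1-3) k]) blast
  have "continuous_on (Uz k \<zeta>) \<phi>" unfolding \<phi>_def
   by (intro continuous_intros holomorphic_Cn_on_imp_continuous_on holomorphic_Cn_on_subset[OF sg_hx_hol Uz_Gz]) auto
  moreover have "continuous_on (Uz k \<zeta>) N" unfolding N_def
   by (intro continuous_intros holomorphic_Cn_on_imp_continuous_on holomorphic_Cn_on_subset[OF M_hx_hol Uz_Gz])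
  ultimately have cc: "continuous_on (Uz k \<zeta>) (\<lambda>w. (\<phi> w, N w))" by (rule continuous_on_Pair)
  have "open ({a<..<b} \<times> {..<N z + 1})" by (intro open_Times) auto
  from continuous_open_preimage[OF cc open_Uz this]
  have "open (Uz k \<zeta> \<inter> (\<lambda>w. (\<phi> w, N w)) -` ({a<..<b} \<times> {..<N z + 1}))" .
  moreover have "z \<in> Uz k \<zeta> \<inter> (\<lambda>w. (\<phi> w, N w)) -` ({a<..<b} \<times> {..<N z + 1})" using z ab' by simp
  ultimately obtain r where r: "r > 0" "ball z r \<subseteq> Uz k \<zeta> \<inter> (\<lambda>w. (\<phi> w, N w)) -` ({a<..<b} \<times> {..<N z + 1})"
   by (rule openE)
  define B where "B n = C * ((N z + 1) * N \<zeta>) ^ 3 * (real (Suc n) * \<theta> ^ n)" for n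
  have "integrable (count_space UNIV) B"
   unfolding integrable_count_space_nat_iff B_def
   using summable_mult[OF summable_Suc_geometric[OF C(2,3)], of "C * ((N z + 1) * N \<zeta>) ^ 3"] C
   by (simp add: N_def abs_mult add_nonneg_nonneg)
  moreover have "cmod (f w n) \<le> B n" if w: "w \<in> ball z r" for w n
  proof -
   have w': "a < \<phi> w" "\<phi> w < b" "N w < N z + 1" "w \<in> Uz k \<zeta>" using w r(2) by auto
   have "cmod (f w n) \<le> C * (real (Suc n) * \<theta> ^ n) * (N w * N \<zeta>) ^ 3 * exp (- \<bar>Re (sg (hx w)) - Re (sg (hx \<zeta>))\<bar> / 2)"
    unfolding f_def N_def by (rule C(4)) (use w' in \<open>auto simp: \<phi>_def Uz_def UU_def\<close>)
   also have "\<dots> \<le> C * (real (Suc n) * \<theta> ^ n) * ((N z + 1) * N \<zeta>) ^ 3 * 1"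
    using C w' by (intro mult_mono power_mono) (auto simp: N_def)
   finally show ?thesis by (simp add: B_def mult_ac)
  qed
  ultimately show ?thesis using r(1) by blast
 qed
 have hol: "holomorphic_Cn_on (\<lambda>z. \<integral>n. f z n \<partial>count_space UNIV) (Uz k \<zeta>)"
  by (rule holomorphic_Cn_on_integral[OF open_Uz _ _ dom]) (use Kn_hol[OF \<zeta>] in \<open>auto simp: f_def\<close>)
 have "(\<integral>n. f z n \<partial>count_space UNIV) = Kt (hx z) (hy z) (hx \<zeta>) (hy \<zeta>)" if z: "z \<in> Uz k \<zeta>" for z
 proof -
  obtain r B where r: "r > 0" "integrable (count_space UNIV) B"
   "\<forall>w\<in>ball z r \<inter> Uz k \<zeta>. \<forall>n\<in>space (count_space UNIV). cmod (f w n) \<le> B n" using dom[OF z] by blast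
  have "cmod (f z n) \<le> B n" for n using r(1,3) z by auto
  then have "integrable (count_space UNIV) (f z)"
   by (intro Bochner_Integration.integrable_bound[OF r(2)] AE_I2)
    (simp, rule order_trans[OF _ abs_ge_self[of "B _", folded real_norm_def]], simp)
  then show ?thesis unfolding Kt_def f_def[symmetric] by (rule integral_count_space_nat)
 qed
 from holomorphic_Cn_on_cong[OF open_Uz this, THEN iffD1, OF _ hol] show ?thesis by blast
qed

lemma Dom_Uz:
 assumes \<zeta>: "\<zeta> \<in> Dom" obtains k where "0 < k" "k < 1" "Dom \<subseteq> Uz k \<zeta>"
  "\<And>z. \<lbrakk>(cmod (hx z))\<^sup>2 + (cmod (hy z))\<^sup>2 \<le> 1; (cmod (hx z - of_real A))\<^sup>2 + (cmod (hy z))\<^sup>2 \<le> r\<^sup>2; hx z \<noteq> pp; hx z \<noteq> qq\<rbrakk> \<Longrightarrow> z \<in> Uz k \<zeta>"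
proof -
 have z': "(hx \<zeta>, hy \<zeta>) \<in> Om" using \<zeta> by (simp add: Dom_def)
 obtain k1 where k1: "0 < k1" "k1 < 1" "cmod (hy \<zeta> * M (sg (hx \<zeta>))) \<le> k1 * sqrt (h (Im (sg (hx \<zeta>))))"
  by (rule Om_factor[OF z'])
 define k where "k = (k1 + 1) / 2"
 have k: "k1 < k" "0 < k" "k < 1" using k1 by (auto simp: k_def)
 have cl: "z \<in> Uz k \<zeta>" if "(cmod (hx z))\<^sup>2 + (cmod (hy z))\<^sup>2 \<le> 1" "(cmod (hx z - of_real A))\<^sup>2 + (cmod (hy z))\<^sup>2 \<le> r\<^sup>2" "hx z \<noteq> pp" "hx z \<noteq> qq" for z
 proof -
  have "(cmod (hx z))\<^sup>2 \<le> 1" "(cmod (hx z - of_real A))\<^sup>2 \<le> r\<^sup>2"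
   using that(1,2) zero_le_power2[of "cmod (hy z)"] by linarith+
  note g = closure_good[OF that(3,4) this]
  have "(cmod (hy z))\<^sup>2 \<le> rho (hx z)" using that(1,2) by (simp add: rho_def)
  from UU_closure(1)[OF z' k1(1) k(1) k1(3) g this] show ?thesis by (simp add: Uz_def)
 qed
 moreover have "Dom \<subseteq> Uz k \<zeta>"
 proof
  fix z assume "z \<in> Dom"
  then have o: "(hx z, hy z) \<in> Om" by (simp add: Dom_def)
  note g = DD_good[OF Om_DD[OF o]]
  have "(cmod (hy z))\<^sup>2 \<le> rho (hx z)" using o by (simp add: mem_Om)
  from UU_closure(1)[OF z' k1(1) k(1) k1(3) g(1) _ _ this] g(2) show "z \<in> Uz k \<zeta>" by (simp add: Uz_def)
 qed
 ultimately show ?thesis using that k by blast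
qed

end

section \<open>The Bergman kernel\<close>

context strip_weight
begin

text \<open>The mean value property on discs of fixed radius.\<close>

lemma strip_growth:
 fixes g :: "complex \<Rightarrow> complex"
 assumes g: "g holomorphic_on strip"
  and int: "integrable lborel (\<lambda>u. indicator strip u *\<^sub>R (exp (- \<bar>Re u\<bar> / 4) * h (Im u) ^ Suc n) *\<^sub>R g u)"
  and ab: "\<alpha> < a" "a \<le> b" "b < \<beta>"
 shows "\<exists>C. \<forall>u. a \<le> Im u \<and> Im u \<le> b \<longrightarrow> cmod (g u) \<le> C * exp (\<bar>Re u\<bar> / 4)"
proof -
 define W where "W u = indicator strip u *\<^sub>R (exp (- \<bar>Re u\<bar> / 4) * h (Im u) ^ Suc n) *\<^sub>R g u" for u
 have Wi: "integrable lborel W" using int unfolding W_def .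
 define \<delta> where "\<delta> = min (a - \<alpha>) (\<beta> - b) / 2"
 have \<delta>: "\<delta> > 0" "\<alpha> < a - \<delta>" "b + \<delta> < \<beta>" using ab by (auto simp: \<delta>_def min_def field_simps)
 obtain hm where hm: "hm > 0" "\<And>\<phi>. a - \<delta> \<le> \<phi> ==> \<phi> \<le> b + \<delta> ==> hm \<le> h \<phi>"
  using compact_subinterval_min[of "a - \<delta>" "b + \<delta>"] \<delta> ab by auto
 define I where "I = (\<integral>u. norm (W u) \<partial>lborel)"
 define K where "K = exp (\<delta> / 4) / hm ^ Suc n"
 have "cmod (g u) \<le> (K * I / (pi * \<delta>\<^sup>2)) * exp (\<bar>Re u\<bar> / 4)" if u: "a \<le> Im u" "Im u \<le> b" for u
 proof -
  have inS: "u + y \<in> strip" "a - \<delta> \<le> Im (u + y)" "Im (u + y) \<le> b + \<delta>" "\<bar>Re (u + y)\<bar> \<le> \<bar>Re u\<bar> + \<delta>" if "y \<in> ball 0 \<delta>" for y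
   using that u \<delta> abs_Im_le_cmod[of y] abs_Re_le_cmod[of y] by auto
  have pw: "indicator (ball 0 \<delta>) y * cmod (g (u + y)) \<le> K * exp (\<bar>Re u\<bar> / 4) * norm (W (u + y))" for y
  proof (cases "y \<in> ball 0 \<delta>")
   case True
   note S = inS[OF True]
   have "1 = (exp (\<delta> / 4) * exp (\<bar>Re u\<bar> / 4) * exp (- (\<bar>Re u\<bar> + \<delta>) / 4)) * (hm ^ Suc n / hm ^ Suc n)"
    using hm(1) by (simp add: exp_add[symmetric] field_simps del: power_Suc)
   also have "\<dots> = K * exp (\<bar>Re u\<bar> / 4) * (exp (- (\<bar>Re u\<bar> + \<delta>) / 4) * hm ^ Suc n)" unfolding K_def by (simp del: power_Suc)
   also have "\<dots> \<le> K * exp (\<bar>Re u\<bar> / 4) * (exp (- \<bar>Re (u + y)\<bar> / 4) * h (Im (u + y)) ^ Suc n)"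
    using S hm by (intro mult_left_mono mult_mono power_mono) (auto simp: K_def)
   finally have "1 * cmod (g (u + y)) \<le> K * exp (\<bar>Re u\<bar> / 4) * (exp (- \<bar>Re (u + y)\<bar> / 4) * h (Im (u + y)) ^ Suc n) * cmod (g (u + y))"
    by (rule mult_right_mono) simp
   moreover have "norm (W (u + y)) = (exp (- \<bar>Re (u + y)\<bar> / 4) * h (Im (u + y)) ^ Suc n) * cmod (g (u + y))"
   proof -
    have "h (Im (u + y)) \<ge> 0" using S(1) by (intro h_nonneg) auto
    then show ?thesis unfolding W_def using S(1) by (simp add: abs_mult)
   qed
   ultimately show ?thesis using True by (simp only: indicator_simps mult_1 mult.assoc)
  qed (use hm in \<open>simp add: K_def\<close>)
  have Wt: "integrable lborel (\<lambda>y. norm (W (u + y)))"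
  proof -
   have "integrable (distr lborel borel ((+) u)) (\<lambda>y. norm (W y))" unfolding lborel_distr_plus by (rule integrable_norm[OF Wi])
   then show ?thesis by (subst (asm) integrable_distr_eq) (use borel_measurable_integrable[OF Wi] in auto)
  qed
  have It: "(\<integral>y. norm (W (u + y)) \<partial>lborel) = I"
  proof -
   have "I = (\<integral>z. norm (W z) \<partial>distr lborel borel ((+) u))" unfolding lborel_distr_plus I_def ..
   also have "\<dots> = (\<integral>y. norm (W (u + y)) \<partial>lborel)"
    by (rule integral_distr) (use borel_measurable_integrable[OF Wi] in auto)
   finally show ?thesis ..
  qed
  have gu: "(\<lambda>y. g (u + y)) holomorphic_on ball 0 \<delta>"
  proof -
   have sub: "(\<lambda>y. u + y) ` ball 0 \<delta> \<subseteq> strip" using inS(1) by blast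
   show ?thesis by (rule holomorphic_on_compose_gen[OF _ g sub, unfolded o_def]) (intro holomorphic_intros)
  qed
  have si: "integrable lborel (\<lambda>y. indicator (ball 0 \<delta>) y *\<^sub>R g (u + y))"
  proof (rule Bochner_Integration.integrable_bound[OF integrable_mult_right[OF Wt, of "K * exp (\<bar>Re u\<bar> / 4)"]])
   show "(\<lambda>y. indicator (ball 0 \<delta>) y *\<^sub>R g (u + y)) \<in> borel_measurable lborel"
    using borel_measurable_continuous_on_indicator[OF _ holomorphic_on_imp_continuous_on[OF gu]] by simp
   show "AE y in lborel. norm (indicator (ball 0 \<delta>) y *\<^sub>R g (u + y)) \<le> norm (K * exp (\<bar>Re u\<bar> / 4) * norm (W (u + y)))"
   proof (rule AE_I2)
    fix y
    have "norm (indicator (ball 0 \<delta>) y *\<^sub>R g (u + y)) \<le> K * exp (\<bar>Re u\<bar> / 4) * norm (W (u + y))" using pw[of y] by simp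
    then show "norm (indicator (ball 0 \<delta>) y *\<^sub>R g (u + y)) \<le> norm (K * exp (\<bar>Re u\<bar> / 4) * norm (W (u + y)))" by simp
   qed
  qed
  have "(LINT y:ball 0 \<delta>|lborel. cnj y ^ 0 * g (u + y)) = pi * \<delta> ^ (2 * Suc 0) / Suc 0 * ((deriv ^^ 0) (\<lambda>y. g (u + y)) 0 / fact 0)"
   by (rule disc_formula[OF gu \<delta>(1)]) (use si in \<open>simp add: set_integrable_def\<close>)
  then have "complex_of_real (pi * \<delta>\<^sup>2) * g u = (\<integral>y. indicator (ball 0 \<delta>) y *\<^sub>R g (u + y) \<partial>lborel)"
   by (simp add: set_lebesgue_integral_def)
  then have "cmod (complex_of_real (pi * \<delta>\<^sup>2) * g u) \<le> (\<integral>y. K * exp (\<bar>Re u\<bar> / 4) * norm (W (u + y)) \<partial>lborel)"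
   by (simp only:) (rule norm_integral_le[OF si integrable_mult_right[OF Wt]], rule order_trans[OF _ pw], simp)
  then have "(pi * \<delta>\<^sup>2) * cmod (g u) \<le> K * exp (\<bar>Re u\<bar> / 4) * I"
   using \<delta>(1) unfolding norm_mult norm_of_real by (simp add: It)
  then show ?thesis using \<delta>(1) by (simp add: field_simps)
 qed
 then show ?thesis by blast
qed

end

context lens
begin

lemma measurable_Om:
 fixes f :: "complex \<times> complex \<Rightarrow> 'b::real_normed_vector"
 assumes "continuous_on Om f"
 shows "(\<lambda>p. indicator Om p *\<^sub>R f p) \<in> borel_measurable (lborel \<Otimes>\<^sub>M lborel)"
 unfolding lborel_prod measurable_cong_sets[OF sets_lborel refl]
 by (rule borel_measurable_continuous_on_indicator[OF _ assms]) (use open_Om in auto)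

lemma Kn_dominated:
 assumes z: "(x, y) \<in> Om"
 obtains C \<theta> where "C > 0" "0 < \<theta>" "\<theta> < 1"
  "\<And>n x' y'. (x', y') \<in> Om ==> cmod (Kn n x y x' y') \<le> C * (real (Suc n) * \<theta> ^ n) * EE x'"
proof -
 obtain k where k: "0 < k" "k < 1" "cmod (y * M (sg x)) \<le> k * sqrt (h (Im (sg x)))" by (rule Om_factor[OF z])
 note gx = DD_good[OF Om_DD[OF z]]
 define a b where "a = (\<alpha> + Im (sg x)) / 2" and "b = (Im (sg x) + \<beta>) / 2"
 have ab': "\<alpha> < a" "a \<le> b" "b < \<beta>" using gx(2) by (auto simp: a_def b_def)
 obtain C \<theta> where C: "C > 0" "0 < \<theta>" "\<theta> < 1"
   "\<And>n x y x' y'. \<lbrakk>a \<le> (Im (sg x) + Im (sg x')) / 2; (Im (sg x) + Im (sg x')) / 2 \<le> b;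
    cmod (y * M (sg x)) * cmod (y' * M (sg x')) \<le> k * h ((Im (sg x) + Im (sg x')) / 2)\<rbrakk> \<Longrightarrow>
    cmod (Kn n x y x' y') \<le> C * (real (Suc n) * \<theta> ^ n) * (cmod (M (sg x)) * cmod (M (sg x'))) ^ 3 * exp (- \<bar>Re (sg x) - Re (sg x')\<bar> / 2)"
  by (rule Kn_bound[OF ab' k(1,2)]) blast
 define C' where "C' = C * cmod (M (sg x)) ^ 3 * exp (\<bar>Re (sg x)\<bar> / 2)"
 have "C' > 0" using C(1) M_nonzero[OF sg_good(1,2)[OF gx(1)]] by (simp add: C'_def)
 moreover have "cmod (Kn n x y x' y') \<le> C' * (real (Suc n) * \<theta> ^ n) * EE x'" if z': "(x', y') \<in> Om" for n x' y'
 proof -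
  note g' = DD_good[OF Om_DD[OF z']]
  have le: "(cmod y')\<^sup>2 \<le> rho x'" using z' by (simp add: mem_Om)
  have k2: "k < 2" using k by simp
  have i: "\<alpha> \<le> Im (sg x')" "Im (sg x') \<le> \<beta>" using g'(2) by auto
  have "cmod (y' * M (sg x')) * cmod (y * M (sg x)) \<le> k * h ((Im (sg x') + Im (sg x)) / 2)"
   by (rule UU_closure(2)[OF z k(1) k2 k(3) g'(1) i le])
  then have "cmod (Kn n x y x' y') \<le> C * (real (Suc n) * \<theta> ^ n) * (cmod (M (sg x)) * cmod (M (sg x'))) ^ 3 * exp (- \<bar>Re (sg x) - Re (sg x')\<bar> / 2)"
   using g'(2) by (intro C(4)) (auto simp: a_def b_def mult.commute add.commute)
  also have "\<dots> \<le> C * (real (Suc n) * \<theta> ^ n) * (cmod (M (sg x)) * cmod (M (sg x'))) ^ 3 * (exp (\<bar>Re (sg x)\<bar> / 2) * exp (- \<bar>Re (sg x')\<bar> / 4))"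
   using C by (intro mult_left_mono exp_abs_diff_le(2)) auto
  also have "\<dots> = C' * (real (Suc n) * \<theta> ^ n) * EE x'" unfolding C'_def EE_def power_mult_distrib by (simp only: mult_ac)
  finally show ?thesis .
 qed
 ultimately show ?thesis using that C(2,3) by blast
qed

text \<open>Through \<open>transfer\<close> this becomes \<open>strip_reproducing\<close> for the function \<open>coef F n / M ^ (n + 3)\<close> on the
 strip.\<close>

lemma Kn_reproducing:
 assumes F: "hartogs F" and int: "integrable (lborel \<Otimes>\<^sub>M lborel) (\<lambda>p. indicator Om p *\<^sub>R (EE (fst p) * cmod (F p)))"
  and z: "(x, y) \<in> Om"
 shows "integrable (lborel \<Otimes>\<^sub>M lborel) (\<lambda>p. indicator Om p *\<^sub>R (Kn n x y (fst p) (snd p) * F p))"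
  and "integral\<^sup>L (lborel \<Otimes>\<^sub>M lborel) (\<lambda>p. indicator Om p *\<^sub>R (Kn n x y (fst p) (snd p) * F p))
   = of_real (2 * pi\<^sup>2 / d\<^sup>2) * (coef F n x * y ^ n)"
proof -
 define \<sigma> where "\<sigma> = sg x"
 note gx = DD_good[OF Om_DD[OF z]]
 have \<sigma>: "\<sigma> \<in> strip" using gx(2) by (simp add: \<sigma>_def)
 have X\<sigma>: "X \<sigma> = x" using sg_good(4)[OF gx(1)] by (simp add: \<sigma>_def)
 have M\<sigma>: "M \<sigma> \<noteq> 0" using M_nonzero sg_good(1,2)[OF gx(1)] by (simp add: \<sigma>_def)
 have Fc: "continuous_on Om F" using F by (simp add: hartogs_def)
 define N where "N x' = cnj (M (sg x')) ^ (n + 3)" for x'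
 have csg: "continuous_on DD sg" using DD_good(1)
  by (intro continuous_on_subset[OF holomorphic_on_imp_continuous_on[OF sg_holomorphic]]) auto
 have cN: "continuous_on DD N" unfolding N_def
  by (intro continuous_intros continuous_on_compose2[OF holomorphic_on_imp_continuous_on[OF M_holomorphic[of UNIV]]] csg) auto
 define c0 where "c0 = of_nat (Suc n) * y ^ n * M \<sigma> ^ (n + 3)"
 define w where "w x' = c0 * (N x' * kker n 0 (\<sigma> - cnj (sg x')))" for x'
 have cw: "continuous_on DD w" unfolding w_def
 proof (intro continuous_intros cN)
  show "continuous_on DD (\<lambda>x'. kker n 0 (\<sigma> - cnj (sg x')))"
  proof (rule continuous_on_compose2[OF holomorphic_on_imp_continuous_on[OF kker_holomorphic[of 0 n]]])
   show "continuous_on DD (\<lambda>x'. \<sigma> - cnj (sg x'))" by (intro continuous_intros csg)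
   show "(\<lambda>x'. \<sigma> - cnj (sg x')) ` DD \<subseteq> {\<tau>. 2 * \<alpha> < Im \<tau> \<and> Im \<tau> < 2 * \<beta>}"
    using DD_good(2) \<sigma> by force
  qed auto
 qed
 define w0 where "w0 x' = N x' * of_real (exp (- \<bar>Re (sg x')\<bar> / 4))" for x'
 have cw0: "continuous_on DD w0" unfolding w0_def by (intro continuous_intros cN csg) auto
 have Kw: "Kn n x y x' y' = w x' * cnj y' ^ n" for x' y'
  unfolding Kn_def w_def c0_def N_def \<sigma>_def power_mult_distrib by (simp only: mult_ac)
 have meas: "(\<lambda>p. indicator Om p *\<^sub>R (\<omega> (fst p) * cnj (snd p) ^ n * F p)) \<in> borel_measurable (lborel \<Otimes>\<^sub>M lborel)"
  if "continuous_on DD \<omega>" for \<omega>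
  by (intro measurable_Om continuous_intros Fc continuous_on_compose2[OF that]) (auto dest: Om_DD)
 have i1: "integrable (lborel \<Otimes>\<^sub>M lborel) (\<lambda>p. indicator Om p *\<^sub>R (\<omega> (fst p) * cnj (snd p) ^ n * F p))"
  if c: "continuous_on DD \<omega>" and le: "\<And>x' y'. (x', y') \<in> Om ==> cmod (\<omega> x' * cnj y' ^ n) \<le> C * EE x'" for \<omega> C
 proof (rule Bochner_Integration.integrable_bound[OF integrable_mult_right[OF int, of C] meas[OF c]])
  have le': "norm (indicator Om p *\<^sub>R (\<omega> (fst p) * cnj (snd p) ^ n * F p)) \<le> C * (indicator Om p *\<^sub>R (EE (fst p) * cmod (F p)))" for p
  proof (cases "p \<in> Om")
   case True
   then have "cmod (\<omega> (fst p) * cnj (snd p) ^ n) * cmod (F p) \<le> C * EE (fst p) * cmod (F p)"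
    by (intro mult_right_mono le) auto
   then show ?thesis using True by (simp add: norm_mult mult.assoc)
  qed simp
  show "AE p in lborel \<Otimes>\<^sub>M lborel. norm (indicator Om p *\<^sub>R (\<omega> (fst p) * cnj (snd p) ^ n * F p))
    \<le> norm (C * (indicator Om p *\<^sub>R (EE (fst p) * cmod (F p))))"
   by (rule AE_I2, rule order_trans[OF le'], simp only: real_norm_def abs_ge_self)
 qed
 obtain C \<theta> where C: "C > 0" "0 < \<theta>" "\<theta> < 1"
  "\<And>n x' y'. (x', y') \<in> Om ==> cmod (Kn n x y x' y') \<le> C * (real (Suc n) * \<theta> ^ n) * EE x'" by (rule Kn_dominated[OF z]) blast
 have int1: "integrable (lborel \<Otimes>\<^sub>M lborel) (\<lambda>p. indicator Om p *\<^sub>R (w (fst p) * cnj (snd p) ^ n * F p))"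
  by (rule i1[OF cw]) (use C(4)[of _ _ n] Kw in auto)
 then show "integrable (lborel \<Otimes>\<^sub>M lborel) (\<lambda>p. indicator Om p *\<^sub>R (Kn n x y (fst p) (snd p) * F p))"
  unfolding Kw .
 obtain H where H: "H > 0" "\<And>\<phi>. \<alpha> \<le> \<phi> ==> \<phi> \<le> \<beta> ==> h \<phi> \<le> H" by (rule h_upper) blast
 have int0: "integrable (lborel \<Otimes>\<^sub>M lborel) (\<lambda>p. indicator Om p *\<^sub>R (w0 (fst p) * cnj (snd p) ^ n * F p))"
 proof (rule i1[OF cw0])
  fix x' y' assume z': "(x', y') \<in> Om"
  obtain k where k: "0 < k" "k < 1" "cmod (y' * M (sg x')) \<le> k * sqrt (h (Im (sg x')))" by (rule Om_factor[OF z'])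
  have hH: "0 \<le> h (Im (sg x'))" "h (Im (sg x')) \<le> H" using DD_good(2)[OF Om_DD[OF z']] by (auto intro!: h_nonneg H(2))
  have "k * sqrt (h (Im (sg x'))) \<le> 1 * sqrt H" using k hH by (intro mult_mono) auto
  then have b: "cmod (y' * M (sg x')) \<le> sqrt H" using k(3) by simp
  have "cmod (w0 x' * cnj y' ^ n) = cmod (y' * M (sg x')) ^ n * EE x'"
   unfolding w0_def N_def EE_def norm_mult norm_power complex_mod_cnj power_add power_mult_distrib norm_of_real by simp
  also have "\<dots> \<le> sqrt H ^ n * EE x'" using b by (intro mult_right_mono power_mono) (auto simp: EE_def)
  finally show "cmod (w0 x' * cnj y' ^ n) \<le> sqrt H ^ n * EE x'" .
 qed
 define g where "g s = coef F n (X s) / M s ^ (n + 3)" for s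
 have fac: "complex_of_real (h (Im s) ^ Suc n / (d\<^sup>2 * cmod (M s) ^ (2 * n + 6))) * (N (X s) * t * coef F n (X s))
   = of_real (1 / d\<^sup>2) * (t * g s * of_real (h (Im s) ^ Suc n))" if "s \<in> strip" for s t
 proof -
  have p: "- pi < Im s" "Im s < pi" using strip_pi[OF that] by auto
  have Ms: "M s \<noteq> 0" by (rule M_nonzero[OF p])
  have "complex_of_real (cmod (M s) ^ (2 * n + 6)) = of_real ((cmod (M s))\<^sup>2) ^ (n + 3)"
   unfolding of_real_power by (simp add: power_mult[symmetric] algebra_simps del: of_real_power)
  also have "\<dots> = M s ^ (n + 3) * cnj (M s) ^ (n + 3)"
   unfolding complex_norm_square power_mult_distrib ..
  finally have e: "complex_of_real (cmod (M s) ^ (2 * n + 6)) = M s ^ (n + 3) * cnj (M s) ^ (n + 3)" .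
  have e2: "complex_of_real (h (Im s) ^ Suc n / (d\<^sup>2 * cmod (M s) ^ (2 * n + 6)))
    = of_real (h (Im s) ^ Suc n) * of_real (1 / d\<^sup>2) / (M s ^ (n + 3) * cnj (M s) ^ (n + 3))"
   unfolding e[symmetric] by (simp del: of_real_power)
  have NX: "N (X s) = cnj (M s) ^ (n + 3)" unfolding N_def sg_X[OF p] ..
  have nz: "cnj (M s) ^ (n + 3) \<noteq> 0" using Ms by simp
  have "a * b / (m * m') * (m' * t * c) = b * (t * (c / m) * a)" if "m' \<noteq> 0" for a b m m' c :: complex
   using that by simp
  from this[OF nz] show ?thesis unfolding g_def e2 NX .
 qed
 have \<Psi>0: "integrable lborel (\<lambda>s. of_real (d\<^sup>2) * (indicator strip s *\<^sub>R (complex_of_real (h (Im s) ^ Suc n / (d\<^sup>2 * cmod (M s) ^ (2 * n + 6))) * (w0 (X s) * coef F n (X s)))))"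
  by (rule integrable_mult_right[OF transfer(1)[OF F cw0 int0]])
 have gi: "integrable lborel (\<lambda>s. indicator strip s *\<^sub>R (exp (- \<bar>Re s\<bar> / 4) * h (Im s) ^ Suc n) *\<^sub>R g s)"
 proof (rule Bochner_Integration.integrable_cong[OF refl, THEN iffD1, OF _ \<Psi>0])
  fix s
  show "of_real (d\<^sup>2) * (indicator strip s *\<^sub>R (complex_of_real (h (Im s) ^ Suc n / (d\<^sup>2 * cmod (M s) ^ (2 * n + 6))) * (w0 (X s) * coef F n (X s))))
   = indicator strip s *\<^sub>R (exp (- \<bar>Re s\<bar> / 4) * h (Im s) ^ Suc n) *\<^sub>R g s"
  proof (cases "s \<in> strip")
   case True
   have "sg (X s) = s" using sg_X strip_pi[OF True] by blast
   then show ?thesis using True d_pos unfolding w0_def fac[OF True] by (simp add: scaleR_conv_of_real del: power_Suc)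
  qed simp
 qed
 have gh: "g holomorphic_on strip" unfolding g_def
  using X_strip M_nonzero strip_pi
  by (intro holomorphic_intros M_holomorphic holomorphic_on_compose_gen[OF X_holomorphic coef_holomorphic[OF F], unfolded o_def]) auto
 note rep = strip_reproducing[OF gh strip_growth[OF gh gi] gi \<sigma>]
 have "(\<integral>s. indicator strip s *\<^sub>R (complex_of_real (h (Im s) ^ Suc n / (d\<^sup>2 * cmod (M s) ^ (2 * n + 6))) * (w (X s) * coef F n (X s))) \<partial>lborel)
   = (\<integral>s. (c0 * of_real (1 / d\<^sup>2)) * (indicator strip s *\<^sub>R (kker n 0 (\<sigma> - cnj s) * g s * of_real (h (Im s) ^ Suc n))) \<partial>lborel)"
 proof (rule Bochner_Integration.integral_cong[OF refl])
  fix s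
  show "indicator strip s *\<^sub>R (complex_of_real (h (Im s) ^ Suc n / (d\<^sup>2 * cmod (M s) ^ (2 * n + 6))) * (w (X s) * coef F n (X s)))
   = (c0 * of_real (1 / d\<^sup>2)) * (indicator strip s *\<^sub>R (kker n 0 (\<sigma> - cnj s) * g s * of_real (h (Im s) ^ Suc n)))"
  proof (cases "s \<in> strip")
   case True
   have "sg (X s) = s" using sg_X strip_pi[OF True] by blast
   then have "w (X s) = c0 * (N (X s) * kker n 0 (\<sigma> - cnj s))" by (simp add: w_def)
   then have "complex_of_real (h (Im s) ^ Suc n / (d\<^sup>2 * cmod (M s) ^ (2 * n + 6))) * (w (X s) * coef F n (X s))
    = c0 * (complex_of_real (h (Im s) ^ Suc n / (d\<^sup>2 * cmod (M s) ^ (2 * n + 6))) * (N (X s) * kker n 0 (\<sigma> - cnj s) * coef F n (X s)))"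
    by (simp only: mult_ac)
   then show ?thesis using True unfolding fac[OF True] by (simp only: indicator_simps scaleR_one mult.assoc)
  qed simp
 qed
 also have "\<dots> = c0 * of_real (1 / d\<^sup>2) * (2 * pi * g \<sigma>)"
  using rep unfolding set_lebesgue_integral_def by (simp only: integral_mult_right_zero)
 finally have I: "(\<integral>s. indicator strip s *\<^sub>R (complex_of_real (h (Im s) ^ Suc n / (d\<^sup>2 * cmod (M s) ^ (2 * n + 6))) * (w (X s) * coef F n (X s))) \<partial>lborel)
   = c0 * of_real (1 / d\<^sup>2) * (2 * pi * g \<sigma>)" .
 show "integral\<^sup>L (lborel \<Otimes>\<^sub>M lborel) (\<lambda>p. indicator Om p *\<^sub>R (Kn n x y (fst p) (snd p) * F p))
   = of_real (2 * pi\<^sup>2 / d\<^sup>2) * (coef F n x * y ^ n)"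
  unfolding Kw transfer(2)[OF F cw int1] I c0_def g_def X\<sigma>
  using M\<sigma> by (simp add: power2_eq_square field_simps del: of_nat_Suc)
qed

lemma Kt_dominated:
 assumes z: "(x, y) \<in> Om"
 obtains C B where "C > 0" "\<And>x' y'. (x', y') \<in> Om ==> summable (\<lambda>n. cmod (Kn n x y x' y')) \<and> cmod (Kt x y x' y') \<le> C * EE x'"
  "summable B" "\<And>n x' y'. (x', y') \<in> Om ==> cmod (Kn n x y x' y') \<le> B n * EE x'"
proof -
 obtain C \<theta> where C: "C > 0" "0 < \<theta>" "\<theta> < 1"
  "\<And>n x' y'. (x', y') \<in> Om ==> cmod (Kn n x y x' y') \<le> C * (real (Suc n) * \<theta> ^ n) * EE x'" by (rule Kn_dominated[OF z]) blast
 define B where "B n = C * (real (Suc n) * \<theta> ^ n)" for n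
 have B: "summable B" unfolding B_def by (rule summable_mult[OF summable_Suc_geometric[OF C(2,3)]])
 have "suminf B > 0" by (rule suminf_pos[OF B]) (use C in \<open>simp add: B_def\<close>)
 moreover have "summable (\<lambda>n. cmod (Kn n x y x' y')) \<and> cmod (Kt x y x' y') \<le> suminf B * EE x'" if o: "(x', y') \<in> Om" for x' y'
 proof -
  have s: "summable (\<lambda>n. cmod (Kn n x y x' y'))"
   by (rule summable_comparison_test'[OF summable_mult2[OF B, of "EE x'"], of 0]) (use C(4)[OF o] in \<open>simp add: B_def\<close>)
  have "cmod (Kt x y x' y') \<le> (\<Sum>n. cmod (Kn n x y x' y'))" unfolding Kt_def by (rule summable_norm[OF s])
  also have "\<dots> \<le> (\<Sum>n. B n * EE x')" by (rule suminf_le[OF _ s summable_mult2[OF B]]) (use C(4)[OF o] in \<open>simp add: B_def\<close>)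
  also have "\<dots> = suminf B * EE x'" by (rule suminf_mult2[OF B, symmetric])
  finally show ?thesis using s by simp
 qed
 ultimately show ?thesis using that[of "suminf B" B] B C(4) by (simp add: B_def)
qed

lemma Kt_cnj:
 assumes "(x, y) \<in> Om" "(x', y') \<in> Om"
 shows "cnj (Kt x y x' y') = Kt x' y' x y"
proof -
 obtain C B where "summable (\<lambda>n. cmod (Kn n x y x' y'))"
  by (rule Kt_dominated[OF assms(1)]) (use assms(2) in blast)
 then have "(\<lambda>n. Kn n x y x' y') sums Kt x y x' y'"
  unfolding Kt_def by (rule summable_sums[OF summable_norm_cancel])
 then have "(\<lambda>n. cnj (Kn n x y x' y')) sums cnj (Kt x y x' y')" by (simp only: sums_cnj)
 then have "(\<lambda>n. Kn n x' y' x y) sums cnj (Kt x y x' y')" unfolding Kn_cnj .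
 then show ?thesis unfolding Kt_def[of x'] by (simp add: sums_iff)
qed

text \<open>Summed over \<open>n\<close>, the components \<open>coef F n x * y ^ n\<close> add up to the Taylor series of \<open>F\<close> in \<open>y\<close>.\<close>

lemma Kt_reproducing:
 assumes F: "hartogs F" and int: "integrable (lborel \<Otimes>\<^sub>M lborel) (\<lambda>p. indicator Om p *\<^sub>R (EE (fst p) * cmod (F p)))"
  and z: "(x, y) \<in> Om"
 shows "integral\<^sup>L (lborel \<Otimes>\<^sub>M lborel) (\<lambda>p. indicator Om p *\<^sub>R (Kt x y (fst p) (snd p) * F p))
   = of_real (2 * pi\<^sup>2 / d\<^sup>2) * F (x, y)"
proof -
 obtain C B where C: "C > 0" "\<And>x' y'. (x', y') \<in> Om ==> summable (\<lambda>n. cmod (Kn n x y x' y')) \<and> cmod (Kt x y x' y') \<le> C * EE x'"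
  "summable B" "\<And>n x' y'. (x', y') \<in> Om ==> cmod (Kn n x y x' y') \<le> B n * EE x'" by (rule Kt_dominated[OF z]) blast
 define f where "f n p = indicator Om p *\<^sub>R (Kn n x y (fst p) (snd p) * F p)" for n p
 define I where "I = integral\<^sup>L (lborel \<Otimes>\<^sub>M lborel) (\<lambda>p. indicator Om p *\<^sub>R (EE (fst p) * cmod (F p)))"
 have fi: "integrable (lborel \<Otimes>\<^sub>M lborel) (f n)" for n unfolding f_def by (rule Kn_reproducing(1)[OF F int z])
 have fle: "norm (f n p) \<le> B n * (indicator Om p *\<^sub>R (EE (fst p) * cmod (F p)))" for n p
 proof (cases "p \<in> Om")
  case True
  then have "cmod (Kn n x y (fst p) (snd p)) * cmod (F p) \<le> B n * EE (fst p) * cmod (F p)"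
   by (intro mult_right_mono C(4)) auto
  then show ?thesis using True by (simp add: f_def norm_mult mult.assoc)
 qed (simp add: f_def)
 have s1: "summable (\<lambda>n. norm (f n p))" for p
  by (rule summable_comparison_test'[OF summable_mult2[OF C(3)], of 0]) (use fle in simp)
 have "(\<integral>p. norm (f n p) \<partial>(lborel \<Otimes>\<^sub>M lborel)) \<le> B n * I" for n
  unfolding I_def integral_mult_right_zero[symmetric]
  by (rule integral_mono[OF integrable_norm[OF fi] integrable_mult_right[OF int] fle])
 then have s2: "summable (\<lambda>n. \<integral>p. norm (f n p) \<partial>(lborel \<Otimes>\<^sub>M lborel))"
  by (intro summable_comparison_test'[OF summable_mult2[OF C(3)], of 0]) simp
 have "(\<lambda>n. integral\<^sup>L (lborel \<Otimes>\<^sub>M lborel) (f n)) sums (\<integral>p. (\<Sum>n. f n p) \<partial>(lborel \<Otimes>\<^sub>M lborel))"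
  by (rule sums_integral[OF fi AE_I2[OF s1] s2])
 moreover have "(\<Sum>n. f n p) = indicator Om p *\<^sub>R (Kt x y (fst p) (snd p) * F p)" for p
 proof (cases "p \<in> Om")
  case True
  then have s: "summable (\<lambda>n. Kn n x y (fst p) (snd p))" using C(2)[of "fst p" "snd p"] by - (rule summable_norm_cancel[of "\<lambda>n. Kn n x y (fst p) (snd p)"], simp)
  show ?thesis using True suminf_mult2[OF s, of "F p", symmetric] unfolding f_def Kt_def by simp
 qed (simp add: f_def)
 ultimately have 1: "(\<lambda>n. of_real (2 * pi\<^sup>2 / d\<^sup>2) * (coef F n x * y ^ n)) sums integral\<^sup>L (lborel \<Otimes>\<^sub>M lborel) (\<lambda>p. indicator Om p *\<^sub>R (Kt x y (fst p) (snd p) * F p))"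
  unfolding f_def Kn_reproducing(2)[OF F int z] by simp
 have x: "x \<in> DD" using Om_DD[OF z] .
 have "(\<lambda>y. F (x, y)) holomorphic_on ball 0 (sqrt (rho x))" using F x by (simp add: hartogs_def)
 from holomorphic_power_series[OF this] have "(\<lambda>n. coef F n x * y ^ n) sums F (x, y)"
  using z Om_ball[OF x] unfolding coef_def by fastforce
 then have "(\<lambda>n. of_real (2 * pi\<^sup>2 / d\<^sup>2) * (coef F n x * y ^ n)) sums (of_real (2 * pi\<^sup>2 / d\<^sup>2) * F (x, y))" by (rule sums_mult)
 with 1 show ?thesis by (rule sums_unique2)
qed

end

context lens_domain
begin

lemma T_Dom: "T p \<in> Dom \<longleftrightarrow> p \<in> Om" by (simp add: Dom_def hx_T hy_T)

lemma hartogs_T: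
 assumes f: "holomorphic_Cn_on f Dom"
 shows "hartogs (\<lambda>p. f (T p))"
 unfolding hartogs_def
proof (intro conjI ballI allI)
 show "continuous_on Om (\<lambda>p. f (T p))"
  by (rule continuous_on_compose2[OF holomorphic_Cn_on_imp_continuous_on[OF f]])
   (use T_Dom linear_continuous_on[OF linear_conv_bounded_linear[THEN iffD1, OF T_linear]] in auto)
 show "(\<lambda>y. f (T (x, y))) holomorphic_on ball 0 (sqrt (rho x))" if "x \<in> DD" for x
 proof -
  have "(\<lambda>y. f (x *s e1 + y *s e2)) holomorphic_on ball 0 (sqrt (rho x))"
   by (rule holomorphic_Cn_on_line[OF f]) (use T_Dom[of "(x, _)"] Om_ball[OF that] in \<open>simp add: T_def\<close>)
  then show ?thesis by (simp add: T_def)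
 qed
 show "(\<lambda>x. f (T (x, y))) holomorphic_on {x. (x, y) \<in> Om}" for y
 proof -
  have "(\<lambda>x. f (y *s e2 + x *s e1)) holomorphic_on {x. (x, y) \<in> Om}"
   by (rule holomorphic_Cn_on_line[OF f]) (use T_Dom[of "(_, y)"] in \<open>simp add: T_def add.commute\<close>)
  then show ?thesis by (simp add: T_def add.commute)
 qed
qed

lemma bergman_kernel_Dom:
 obtains c :: real where "c > 0" "is_bergman_kernel Dom (\<lambda>z \<zeta>. of_real c * Kt (hx z) (hy z) (hx \<zeta>) (hy \<zeta>))"
proof -
 obtain cT where cT: "cT > 0" "distr lborel borel T = density lborel (\<lambda>_. ennreal cT)"
  by (rule distr_lborel_linear[OF T_linear T_bij])
 have Tm: "T \<in> borel_measurable borel"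
  by (rule borel_measurable_continuous_onI) (rule linear_continuous_on[OF linear_conv_bounded_linear[THEN iffD1, OF T_linear]])
 note tr = integral_distr_lborel_const[OF cT Tm, folded lborel_prod]
 have ind: "indicator Dom (T p) = indicator Om p" for p by (simp add: indicator_def T_Dom)
 define c where "c = cT * d\<^sup>2 / (2 * pi\<^sup>2)"
 have c: "c > 0" using cT d_pos by (simp add: c_def)
 define K where "K z \<zeta> = complex_of_real c * Kt (hx z) (hy z) (hx \<zeta>) (hy \<zeta>)" for z \<zeta>
 have K_cnj: "cnj (K z \<zeta>) = K \<zeta> z" if "z \<in> Dom" "\<zeta> \<in> Dom" for z \<zeta>
  using that Kt_cnj by (simp add: K_def Dom_def)
 have K_hol: "holomorphic_Cn_on (\<lambda>\<zeta>. cnj (K z \<zeta>)) Dom" if z: "z \<in> Dom" for z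
 proof -
  obtain k where k: "0 < k" "k < 1" "Dom \<subseteq> Uz k z" by (rule Dom_Uz[OF z])
  have "holomorphic_Cn_on (\<lambda>\<zeta>. K \<zeta> z) Dom" unfolding K_def
   by (rule holomorphic_Cn_on_mult[OF holomorphic_Cn_on_const holomorphic_Cn_on_subset[OF Kt_hol[OF z k(1,2)] k(3)]])
  then show ?thesis by (subst holomorphic_Cn_on_cong[OF open_Dom K_cnj[OF z]])
 qed
 have mDom: "(\<lambda>z. indicator Dom z *\<^sub>R f z) \<in> borel_measurable borel" if "continuous_on Dom f" for f :: "complex ^ 2 \<Rightarrow> 'b::real_normed_vector"
  by (rule borel_measurable_continuous_on_indicator[OF _ that]) (use open_Dom in auto)
 have K_sq: "set_integrable lborel Dom (\<lambda>\<zeta>. (cmod (cnj (K z \<zeta>)))\<^sup>2)" if z: "z \<in> Dom" for z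
 proof -
  obtain C B where C: "C > 0" "\<And>x' y'. (x', y') \<in> Om ==> cmod (Kt (hx z) (hy z) x' y') \<le> C * EE x'"
   by (rule Kt_dominated[OF z[unfolded Dom_def mem_Collect_eq]]) blast
  have m: "(\<lambda>\<zeta>. indicator Dom \<zeta> *\<^sub>R (cmod (cnj (K z \<zeta>)))\<^sup>2) \<in> borel_measurable borel"
   by (intro mDom continuous_intros holomorphic_Cn_on_imp_continuous_on K_hol z)
  have le: "norm (indicator Dom (T p) *\<^sub>R (cmod (cnj (K z (T p))))\<^sup>2) \<le> (c * C)\<^sup>2 * (indicator Om p * (EE (fst p))\<^sup>2)" for p
  proof (cases "p \<in> Om")
   case True
   have "cmod (K z (T p)) \<le> c * (C * EE (fst p))"
    using C(2)[of "fst p" "snd p"] True c by (simp add: K_def hx_T hy_T norm_mult)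
   then have "(cmod (K z (T p)))\<^sup>2 \<le> (c * (C * EE (fst p)))\<^sup>2" by (intro power_mono) auto
   then show ?thesis using True by (simp add: ind power_mult_distrib mult.assoc)
  qed (simp add: ind)
  have "integrable (lborel \<Otimes>\<^sub>M lborel) (\<lambda>p. indicator Dom (T p) *\<^sub>R (cmod (cnj (K z (T p))))\<^sup>2)"
  proof (rule Bochner_Integration.integrable_bound[OF integrable_mult_right[OF EE_square_integrable, of "(c * C)\<^sup>2"]])
   show "(\<lambda>p. indicator Dom (T p) *\<^sub>R (cmod (cnj (K z (T p))))\<^sup>2) \<in> borel_measurable (lborel \<Otimes>\<^sub>M lborel)"
    unfolding lborel_prod measurable_cong_sets[OF sets_lborel refl] by (rule measurable_compose[OF Tm m])
   show "AE p in lborel \<Otimes>\<^sub>M lborel. norm (indicator Dom (T p) *\<^sub>R (cmod (cnj (K z (T p))))\<^sup>2) \<le> norm ((c * C)\<^sup>2 * (indicator Om p * (EE (fst p))\<^sup>2))"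
    by (rule AE_I2, rule order_trans[OF le], simp only: real_norm_def abs_ge_self)
  qed
  then show ?thesis unfolding set_integrable_def by (rule tr(1)[OF m, THEN iffD1])
 qed
 have rep: "(LINT \<zeta>:Dom|lborel. K z \<zeta> * f \<zeta>) = f z" if f: "f \<in> bergman_space Dom" and z: "z \<in> Dom" for f z
 proof -
  have fh: "holomorphic_Cn_on f Dom" and f2: "integrable lborel (\<lambda>z. indicator Dom z *\<^sub>R (cmod (f z))\<^sup>2)"
   using f by (auto simp: bergman_space_def set_integrable_def)
  have fc: "continuous_on Dom f" by (rule holomorphic_Cn_on_imp_continuous_on[OF fh])
  define F where "F p = f (T p)" for p
  have F: "hartogs F" unfolding F_def by (rule hartogs_T[OF fh])
  have Fc: "continuous_on Om F" using F by (simp add: hartogs_def)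
  have zO: "(hx z, hy z) \<in> Om" using z by (simp add: Dom_def)
  have F2: "integrable (lborel \<Otimes>\<^sub>M lborel) (\<lambda>p. indicator Om p *\<^sub>R (cmod (F p))\<^sup>2)"
   using tr(1)[of "\<lambda>z. indicator Dom z *\<^sub>R (cmod (f z))\<^sup>2"] f2 borel_measurable_integrable[OF f2] by (simp add: ind F_def)
  have le: "norm (indicator Om p *\<^sub>R (EE (fst p) * cmod (F p))) \<le> indicator Om p * (EE (fst p))\<^sup>2 + indicator Om p *\<^sub>R (cmod (F p))\<^sup>2" for p
  proof -
   have "2 * EE (fst p) * cmod (F p) \<le> (EE (fst p))\<^sup>2 + (cmod (F p))\<^sup>2" by (rule sum_squares_bound)
   moreover have "0 \<le> EE (fst p) * cmod (F p)" by (simp add: EE_def)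
   ultimately show ?thesis by (auto simp: indicator_def)
  qed
  have int: "integrable (lborel \<Otimes>\<^sub>M lborel) (\<lambda>p. indicator Om p *\<^sub>R (EE (fst p) * cmod (F p)))"
  proof (rule Bochner_Integration.integrable_bound[OF Bochner_Integration.integrable_add[OF EE_square_integrable F2]])
   show "(\<lambda>p. indicator Om p *\<^sub>R (EE (fst p) * cmod (F p))) \<in> borel_measurable (lborel \<Otimes>\<^sub>M lborel)"
    by (intro measurable_Om continuous_intros Fc continuous_on_compose2[OF EE_cont]) (auto dest: Om_DD)
   show "AE p in lborel \<Otimes>\<^sub>M lborel. norm (indicator Om p *\<^sub>R (EE (fst p) * cmod (F p))) \<le> norm (indicator Om p * (EE (fst p))\<^sup>2 + indicator Om p *\<^sub>R (cmod (F p))\<^sup>2)"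
    by (rule AE_I2, rule order_trans[OF le], simp only: real_norm_def abs_ge_self)
  qed
  have Kc: "continuous_on Dom (K z)"
   using continuous_on_cnj[OF holomorphic_Cn_on_imp_continuous_on[OF K_hol[OF z]]] by simp
  have m: "(\<lambda>\<zeta>. indicator Dom \<zeta> *\<^sub>R (K z \<zeta> * f \<zeta>)) \<in> borel_measurable borel"
   by (intro mDom continuous_intros Kc fc)
  have "cT *\<^sub>R (\<integral>\<zeta>. indicator Dom \<zeta> *\<^sub>R (K z \<zeta> * f \<zeta>) \<partial>lborel) = (\<integral>p. indicator Dom (T p) *\<^sub>R (K z (T p) * f (T p)) \<partial>(lborel \<Otimes>\<^sub>M lborel))"
   by (rule tr(2)[OF m, symmetric])
  also have "\<dots> = (\<integral>p. complex_of_real c * (indicator Om p *\<^sub>R (Kt (hx z) (hy z) (fst p) (snd p) * F p)) \<partial>(lborel \<Otimes>\<^sub>M lborel))"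
   by (rule Bochner_Integration.integral_cong[OF refl]) (simp add: ind K_def F_def hx_T hy_T mult.assoc)
  also have "\<dots> = complex_of_real c * (of_real (2 * pi\<^sup>2 / d\<^sup>2) * F (hx z, hy z))"
   unfolding integral_mult_right_zero Kt_reproducing[OF F int zO] ..
  also have "\<dots> = complex_of_real (c * (2 * pi\<^sup>2 / d\<^sup>2)) * f z" by (simp add: F_def T_inj)
  also have "c * (2 * pi\<^sup>2 / d\<^sup>2) = cT" using d_pos by (simp add: c_def)
  finally show ?thesis using cT(1) unfolding set_lebesgue_integral_def by (simp add: scaleR_conv_of_real)
 qed
 have "is_bergman_kernel Dom K" unfolding is_bergman_kernel_def
  using K_hol K_sq rep by (simp add: bergman_space_def)
 then show ?thesis using that[OF c] unfolding K_def by blast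
qed

end

section \<open>Asymptotic expansions\<close>

text \<open>Terms outside the finite set \<open>J\<close> are negligible to the given order, so any enumeration of the index
 set gives an asymptotic expansion. Numbers that enumerate nothing stand for zero terms.\<close>

lemma has_asymptotic_expansion_enumerate:
 fixes f :: "'a::topological_space \<Rightarrow> complex" and tt :: "'i \<Rightarrow> 'a \<Rightarrow> complex"
 assumes I: "countable I"
  and J: "\<And>N. N > 0 ==> \<exists>J\<subseteq>I. finite J \<and> (\<lambda>z. cmod (f z - (\<Sum>i\<in>J. tt i z))) \<in> O[at q within S](\<lambda>z. cmod (w z) powr N) \<and>
   (\<forall>i\<in>I - J. (\<lambda>z. cmod (tt i z)) \<in> O[at q within S](\<lambda>z. cmod (w z) powr N))"
 shows "has_asymptotic_expansion f (\<lambda>j z. if j \<in> to_nat_on I ` I then tt (from_nat_into I j) z else 0) w q S"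
 unfolding has_asymptotic_expansion_def
proof (intro allI impI)
 fix N :: real assume N: "N > 0"
 obtain J where J: "J \<subseteq> I" "finite J" and fJ: "(\<lambda>z. cmod (f z - (\<Sum>i\<in>J. tt i z))) \<in> O[at q within S](\<lambda>z. cmod (w z) powr N)"
  and tJ: "\<And>i. i \<in> I - J ==> (\<lambda>z. cmod (tt i z)) \<in> O[at q within S](\<lambda>z. cmod (w z) powr N)"
  using J[OF N] by blast
 have inj: "inj_on (to_nat_on I) I" by (rule inj_on_to_nat_on[OF I])
 obtain m0 where m0: "\<And>i. i \<in> J ==> to_nat_on I i < m0"
  using finite_nat_set_iff_bounded[THEN iffD1, OF finite_imageI[OF J(2), of "to_nat_on I"]] by auto
 show "\<forall>\<^sub>F m in sequentially. (\<lambda>z. cmod (f z - (\<Sum>j<m. if j \<in> to_nat_on I ` I then tt (from_nat_into I j) z else 0)))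
   \<in> O[at q within S](\<lambda>z. cmod (w z) powr N)"
  unfolding eventually_sequentially
 proof (intro exI[of _ m0] allI impI)
  fix m assume m: "m0 \<le> m"
  define A where "A = {i \<in> I. to_nat_on I i < m}"
  have fA: "finite A"
   by (rule finite_imageD[of "to_nat_on I"]) (auto simp: A_def intro: finite_subset[of _ "{..<m}"] inj_on_subset[OF inj])
  have JA: "J \<subseteq> A" using J(1) m0 m by (force simp: A_def)
  have sA: "(\<Sum>j<m. if j \<in> to_nat_on I ` I then tt (from_nat_into I j) z else 0) = (\<Sum>i\<in>A. tt i z)" for z
  proof -
   have "(\<Sum>j<m. if j \<in> to_nat_on I ` I then tt (from_nat_into I j) z else 0) = (\<Sum>j\<in>to_nat_on I ` A. tt (from_nat_into I j) z)"
    by (rule sum.mono_neutral_cong_right) (auto simp: A_def)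
   also have "\<dots> = (\<Sum>i\<in>A. tt (from_nat_into I (to_nat_on I i)) z)"
    by (rule sum.reindex_cong[OF inj_on_subset[OF inj] refl refl]) (auto simp: A_def)
   also have "\<dots> = (\<Sum>i\<in>A. tt i z)"
    by (rule sum.cong[OF refl]) (simp add: A_def from_nat_into_to_nat_on[OF I])
   finally show ?thesis .
  qed
  have "(\<lambda>z. cmod (f z - (\<Sum>i\<in>J. tt i z)) + (\<Sum>i\<in>A - J. cmod (tt i z))) \<in> O[at q within S](\<lambda>z. cmod (w z) powr N)"
   using tJ by (intro sum_in_bigo(1)[OF fJ] big_sum_in_bigo) (auto simp: A_def)
  moreover have "(\<lambda>z. cmod (f z - (\<Sum>i\<in>A. tt i z))) \<in> O[at q within S](\<lambda>z. cmod (f z - (\<Sum>i\<in>J. tt i z)) + (\<Sum>i\<in>A - J. cmod (tt i z)))"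
  proof (rule bigoI[of _ 1], rule always_eventually, rule allI)
   fix z
   have "(\<Sum>i\<in>A. tt i z) = (\<Sum>i\<in>A - J. tt i z) + (\<Sum>i\<in>J. tt i z)" by (rule sum.subset_diff[OF JA fA])
   then have "cmod (f z - (\<Sum>i\<in>A. tt i z)) = cmod ((f z - (\<Sum>i\<in>J. tt i z)) - (\<Sum>i\<in>A - J. tt i z))" by (simp add: algebra_simps)
   also have "\<dots> \<le> cmod (f z - (\<Sum>i\<in>J. tt i z)) + (\<Sum>i\<in>A - J. cmod (tt i z))"
    by (rule order_trans[OF norm_triangle_ineq4 add_left_mono[OF norm_sum]])
   finally show "norm (cmod (f z - (\<Sum>i\<in>A. tt i z))) \<le> 1 * norm (cmod (f z - (\<Sum>i\<in>J. tt i z)) + (\<Sum>i\<in>A - J. cmod (tt i z)))"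
    by simp
  qed
  ultimately show "(\<lambda>z. cmod (f z - (\<Sum>j<m. if j \<in> to_nat_on I ` I then tt (from_nat_into I j) z else 0)))
   \<in> O[at q within S](\<lambda>z. cmod (w z) powr N)" unfolding sA by (rule landau_o.big.trans[rotated])
 qed
qed

lemma power_le_exp_half:
 fixes b :: real assumes "b \<ge> 1"
 shows "\<exists>C\<ge>0. \<forall>s\<ge>0. (b + s) ^ D \<le> C * exp (s / 2)"
proof -
 define D' where "D' = 2 * real (Suc D)"
 have "(b + s) ^ D \<le> (b * D') ^ Suc D * exp (s / 2)" if s: "s \<ge> 0" for s
 proof -
  have D': "D' \<ge> 1" by (simp add: D'_def)
  have "s = D' * (s / D')" using D' by simp
  also have "\<dots> \<le> b * D' * (s / D')" using assms s D' by (intro mult_right_mono) auto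
  finally have "b + s \<le> b * D' + b * D' * (s / D')" using assms D' mult_left_mono[of 1 D' b] by linarith
  also have "\<dots> = b * D' * (1 + s / D')" by (simp add: algebra_simps)
  also have "\<dots> \<le> b * D' * exp (s / D')" using assms D' by (intro mult_left_mono exp_ge_add_one_self) auto
  finally have 1: "b + s \<le> b * D' * exp (s / D')" .
  have "(b + s) ^ D \<le> (b + s) ^ Suc D" using assms s by (intro power_increasing) auto
  also have "\<dots> \<le> (b * D' * exp (s / D')) ^ Suc D" using 1 assms s by (intro power_mono) auto
  also have "\<dots> = (b * D') ^ Suc D * exp (real (Suc D) * (s / D'))" unfolding power_mult_distrib exp_of_nat_mult ..
  also have "real (Suc D) * (s / D') = s / 2" unfolding D'_def by (simp del: of_nat_Suc)
  finally show ?thesis .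
 qed
 moreover have "(b * D') ^ Suc D \<ge> 0" using assms by (simp add: D'_def)
 ultimately show ?thesis by blast
qed

lemma poly_growth:
 fixes P :: "complex poly"
 shows "\<exists>C D. \<forall>X. cmod (poly P X) \<le> C * (1 + cmod X) ^ D"
proof (induction P)
 case (pCons a P)
 then obtain C D where C: "\<And>X. cmod (poly P X) \<le> C * (1 + cmod X) ^ D" by blast
 have "cmod (poly (pCons a P) X) \<le> (cmod a + C) * (1 + cmod X) ^ Suc D" for X
 proof -
  have 1: "1 \<le> (1 + cmod X) ^ Suc D" by (rule one_le_power) simp
  have C0: "0 \<le> C * (1 + cmod X) ^ D" using C[of X] norm_ge_zero order_trans by blast
  have "cmod (poly (pCons a P) X) \<le> cmod a + cmod X * cmod (poly P X)"
   using norm_triangle_ineq[of a "X * poly P X"] by (simp add: norm_mult)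
  also have "\<dots> \<le> cmod a * (1 + cmod X) ^ Suc D + (1 + cmod X) * (C * (1 + cmod X) ^ D)"
   using 1 C[of X] C0 mult_left_mono[OF 1, of "cmod a"] by (intro add_mono mult_mono) auto
  finally show ?thesis by (simp add: algebra_simps)
 qed
 then show ?case by blast
qed (auto intro: exI[of _ 0])

text \<open>An expansion in powers of \<open>t\<close> whose coefficients are polynomials in a parameter \<open>X\<close> (later a
 logarithm of \<open>t\<close>), with remainders of at most polynomial growth in \<open>X\<close>.\<close>

definition expandable :: "real \<Rightarrow> (complex \<Rightarrow> complex \<Rightarrow> complex) \<Rightarrow> bool" where
 "expandable \<rho> f \<longleftrightarrow> (\<exists>Q :: nat \<Rightarrow> complex poly. \<forall>n. \<exists>C D. \<forall>t\<in>cball 0 \<rho>. \<forall>X.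
   cmod (f t X - (\<Sum>m\<le>n. t ^ m * poly (Q m) X)) \<le> C * cmod t ^ Suc n * (1 + cmod X) ^ D)"

lemma expandable_holomorphic:
 assumes g: "g holomorphic_on ball 0 \<rho>0" and \<rho>: "\<rho> < \<rho>0"
 shows "expandable \<rho> (\<lambda>t X. g t)"
 unfolding expandable_def
proof (rule exI[of _ "\<lambda>m. [:(deriv ^^ m) g 0 / fact m:]"], rule allI)
 fix n
 define S where "S = cball (0::complex) \<rho>"
 have sub: "S \<subseteq> ball 0 \<rho>0" using \<rho> by (auto simp: S_def)
 have hol: "(deriv ^^ i) g holomorphic_on ball 0 \<rho>0" for i by (rule holomorphic_higher_deriv[OF g open_ball])
 have "bounded ((deriv ^^ Suc n) g ` S)"
  unfolding S_def by (intro compact_imp_bounded compact_continuous_image compact_cball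
   continuous_on_subset[OF holomorphic_on_imp_continuous_on[OF hol]]) (use sub in \<open>simp add: S_def\<close>)
 then obtain B where B: "\<And>t. t \<in> S ==> cmod ((deriv ^^ Suc n) g t) \<le> B" unfolding bounded_iff by blast
 show "\<exists>C D. \<forall>t\<in>cball 0 \<rho>. \<forall>X. cmod (g t - (\<Sum>m\<le>n. t ^ m * poly [:(deriv ^^ m) g 0 / fact m:] X)) \<le> C * cmod t ^ Suc n * (1 + cmod X) ^ D"
 proof (intro exI[of _ "B / fact n"] exI[of _ "0::nat"] ballI allI)
  fix t X :: complex assume t: "t \<in> cball 0 \<rho>"
  then have S0: "0 \<in> S" "t \<in> S" by (auto simp: S_def intro: order_trans[OF norm_ge_zero])
  have "cmod ((deriv ^^ 0) g t - (\<Sum>i\<le>n. (deriv ^^ i) g 0 * (t - 0) ^ i / fact i)) \<le> B * cmod (t - 0) ^ Suc n / fact n"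
  proof (rule complex_Taylor[where S = S and f = "\<lambda>i. (deriv ^^ i) g"])
   fix i x assume "x \<in> S" "i \<le> n"
   then show "((deriv ^^ i) g has_field_derivative (deriv ^^ Suc i) g x) (at x within S)"
    using holomorphic_derivI[OF hol open_ball, of x i] sub by (auto intro: DERIV_subset)
  qed (use B S0 in \<open>auto simp: S_def\<close>)
  then show "cmod (g t - (\<Sum>m\<le>n. t ^ m * poly [:(deriv ^^ m) g 0 / fact m:] X)) \<le> B / fact n * cmod t ^ Suc n * (1 + cmod X) ^ 0"
   by (simp add: mult.commute)
 qed
qed

lemma expandable_lincomb:
 assumes f: "expandable \<rho> f" and g: "expandable \<rho> g"
 shows "expandable \<rho> (\<lambda>t X. a * f t X + X * g t X)" (is ?th1) and "expandable \<rho> (\<lambda>t X. f t X - g t X)" (is ?th2)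
proof -
 obtain Q where Q: "\<And>n. \<exists>C D. \<forall>t\<in>cball 0 \<rho>. \<forall>X. cmod (f t X - (\<Sum>m\<le>n. t ^ m * poly (Q m) X)) \<le> C * cmod t ^ Suc n * (1 + cmod X) ^ D"
  using f unfolding expandable_def by blast
 obtain R where R: "\<And>n. \<exists>C D. \<forall>t\<in>cball 0 \<rho>. \<forall>X. cmod (g t X - (\<Sum>m\<le>n. t ^ m * poly (R m) X)) \<le> C * cmod t ^ Suc n * (1 + cmod X) ^ D"
  using g unfolding expandable_def by blast
 have both: "\<exists>C D. \<forall>t\<in>cball 0 \<rho>. \<forall>X. cmod (b * (f t X - (\<Sum>m\<le>n. t ^ m * poly (Q m) X)) + (X * e + e') * (g t X - (\<Sum>m\<le>n. t ^ m * poly (R m) X)))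
   \<le> C * cmod t ^ Suc n * (1 + cmod X) ^ D" for n b e e'
 proof -
  obtain C D where C: "\<And>t X. t \<in> cball 0 \<rho> ==> cmod (f t X - (\<Sum>m\<le>n. t ^ m * poly (Q m) X)) \<le> C * cmod t ^ Suc n * (1 + cmod X) ^ D"
   using Q by blast
  obtain C' D' where C': "\<And>t X. t \<in> cball 0 \<rho> ==> cmod (g t X - (\<Sum>m\<le>n. t ^ m * poly (R m) X)) \<le> C' * cmod t ^ Suc n * (1 + cmod X) ^ D'"
   using R by blast
  show ?thesis
  proof (intro exI[of _ "cmod b * \<bar>C\<bar> + (cmod e + cmod e') * \<bar>C'\<bar>"] exI[of _ "D + Suc D'"] ballI allI)
   fix t X :: complex assume t: "t \<in> cball 0 \<rho>"
   define u T where "u = 1 + cmod X" and "T = cmod t ^ Suc n"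
   have u: "u \<ge> 1" and T: "T \<ge> 0" by (auto simp: u_def T_def)
   have p: "u ^ D \<le> u ^ (D + Suc D')" "u ^ Suc D' \<le> u ^ (D + Suc D')" by (rule power_increasing[OF _ u], simp)+
   have "cmod (f t X - (\<Sum>m\<le>n. t ^ m * poly (Q m) X)) \<le> \<bar>C\<bar> * T * u ^ (D + Suc D')"
    by (rule order_trans[OF C[OF t]], unfold u_def[symmetric] T_def[symmetric], intro mult_mono p) (use u T in auto)
   then have 1: "cmod b * cmod (f t X - (\<Sum>m\<le>n. t ^ m * poly (Q m) X)) \<le> cmod b * (\<bar>C\<bar> * T * u ^ (D + Suc D'))"
    by (rule mult_left_mono) simp
   have e: "cmod (X * e + e') \<le> (cmod e + cmod e') * u"
   proof -
    have "cmod (X * e + e') \<le> cmod X * cmod e + cmod e'" using norm_triangle_ineq[of "X * e" e'] by (simp add: norm_mult)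
    also have "\<dots> \<le> (cmod e + cmod e') * u" unfolding u_def by (simp add: algebra_simps)
    finally show ?thesis .
   qed
   have "cmod (g t X - (\<Sum>m\<le>n. t ^ m * poly (R m) X)) \<le> \<bar>C'\<bar> * T * u ^ D'"
    by (rule order_trans[OF C'[OF t]], unfold u_def[symmetric] T_def[symmetric], intro mult_right_mono) (use u T in auto)
   then have "cmod (X * e + e') * cmod (g t X - (\<Sum>m\<le>n. t ^ m * poly (R m) X)) \<le> ((cmod e + cmod e') * u) * (\<bar>C'\<bar> * T * u ^ D')"
    using e by (intro mult_mono) (use u in auto)
   also have "\<dots> = (cmod e + cmod e') * (\<bar>C'\<bar> * T) * u ^ Suc D'" by simp
   also have "\<dots> \<le> (cmod e + cmod e') * (\<bar>C'\<bar> * T) * u ^ (D + Suc D')" using T by (intro mult_left_mono p) auto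
   finally have 2: "cmod (X * e + e') * cmod (g t X - (\<Sum>m\<le>n. t ^ m * poly (R m) X)) \<le> (cmod e + cmod e') * (\<bar>C'\<bar> * T) * u ^ (D + Suc D')" .
   have "cmod (b * (f t X - (\<Sum>m\<le>n. t ^ m * poly (Q m) X)) + (X * e + e') * (g t X - (\<Sum>m\<le>n. t ^ m * poly (R m) X)))
     \<le> cmod b * cmod (f t X - (\<Sum>m\<le>n. t ^ m * poly (Q m) X)) + cmod (X * e + e') * cmod (g t X - (\<Sum>m\<le>n. t ^ m * poly (R m) X))"
    unfolding norm_mult[symmetric] by (rule norm_triangle_ineq)
   also have "\<dots> \<le> cmod b * (\<bar>C\<bar> * T * u ^ (D + Suc D')) + (cmod e + cmod e') * (\<bar>C'\<bar> * T) * u ^ (D + Suc D')"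
    by (rule add_mono[OF 1 2])
   finally show "cmod (b * (f t X - (\<Sum>m\<le>n. t ^ m * poly (Q m) X)) + (X * e + e') * (g t X - (\<Sum>m\<le>n. t ^ m * poly (R m) X)))
     \<le> (cmod b * \<bar>C\<bar> + (cmod e + cmod e') * \<bar>C'\<bar>) * cmod t ^ Suc n * (1 + cmod X) ^ (D + Suc D')"
    unfolding u_def[symmetric] T_def[symmetric] by (simp only: distrib_right mult.assoc)
  qed
 qed
 have e1: "a * (f t X - (\<Sum>m\<le>n. t ^ m * poly (Q m) X)) + (X * 1 + 0) * (g t X - (\<Sum>m\<le>n. t ^ m * poly (R m) X))
   = a * f t X + X * g t X - (\<Sum>m\<le>n. t ^ m * poly (smult a (Q m) + pCons 0 (R m)) X)" for n t X
  by (simp add: algebra_simps sum_distrib_left sum.distrib)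
 have e2: "1 * (f t X - (\<Sum>m\<le>n. t ^ m * poly (Q m) X)) + (X * 0 + (-1)) * (g t X - (\<Sum>m\<le>n. t ^ m * poly (R m) X))
   = f t X - g t X - (\<Sum>m\<le>n. t ^ m * poly (Q m - R m) X)" for n t X
  by (simp add: algebra_simps sum_subtractf)
 show ?th1 unfolding expandable_def by (rule exI[of _ "\<lambda>m. smult a (Q m) + pCons 0 (R m)"]) (rule allI, rule both[of a _ 1 0, unfolded e1])
 show ?th2 unfolding expandable_def by (rule exI[of _ "\<lambda>m. Q m - R m"]) (rule allI, rule both[of 1 _ 0 "-1", unfolded e2])
qed

text \<open>Induction on \<open>R\<close>: by Horner's scheme only multiplication by \<open>X\<close> and by the holomorphic function
 \<open>\<l>\<close> has to be handled, and the latter is absorbed into \<open>g\<close>.\<close>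

lemma expandable_poly:
 fixes \<l> :: "complex \<Rightarrow> complex" and R :: "complex poly"
 assumes l: "\<l> holomorphic_on ball 0 \<rho>0" and \<rho>: "\<rho> < \<rho>0"
 shows "g holomorphic_on ball 0 \<rho>0 ==> expandable \<rho> (\<lambda>t X. g t * poly R (X - \<l> t))"
proof (induction R arbitrary: g)
 case 0
 show ?case using expandable_holomorphic[OF holomorphic_on_const[of 0] \<rho>] by simp
next
 case (pCons a R)
 have gl: "(\<lambda>t. g t * \<l> t) holomorphic_on ball 0 \<rho>0" by (intro holomorphic_intros l pCons.prems)
 have "expandable \<rho> (\<lambda>t X. (a * g t + X * (g t * poly R (X - \<l> t))) - (g t * \<l> t) * poly R (X - \<l> t))"
  by (intro expandable_lincomb expandable_holomorphic[OF pCons.prems \<rho>] pCons.IH pCons.prems gl)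
 then show ?case by (simp add: algebra_simps)
qed

lemma antiholomorphic_pcompose:
 fixes b :: "complex ^ 'n \<Rightarrow> complex"
 assumes b: "antiholomorphic_Cn_on b S" and e: "antiholomorphic_Cn_on e S"
 shows "antiholomorphic_poly_on (\<lambda>\<zeta>. smult (e \<zeta>) (pcompose q [:b \<zeta>, 1:])) S"
proof -
 have h: "holomorphic_Cn_on (\<lambda>\<zeta>. cnj (coeff (pcompose q [:b \<zeta>, 1:]) k)) S" for k
 proof (induction q arbitrary: k)
  case 0
  show ?case by (simp add: holomorphic_Cn_on_const)
 next
  case (pCons a q)
  have e: "coeff (pcompose (pCons a q) [:b \<zeta>, 1:]) k = coeff [:a:] k + b \<zeta> * coeff (pcompose q [:b \<zeta>, 1:]) k
    + (case k of 0 \<Rightarrow> 0 | Suc k' \<Rightarrow> coeff (pcompose q [:b \<zeta>, 1:]) k')" for \<zeta>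
   by (simp add: pcompose_pCons coeff_pCons)
  have "holomorphic_Cn_on (\<lambda>\<zeta>. cnj (case k of 0 \<Rightarrow> 0 | Suc k' \<Rightarrow> coeff (pcompose q [:b \<zeta>, 1:]) k')) S"
   by (cases k) (simp_all add: holomorphic_Cn_on_const pCons.IH)
  then show ?case unfolding e complex_cnj_add complex_cnj_mult using b unfolding antiholomorphic_Cn_on_def
   by (intro holomorphic_Cn_on_add holomorphic_Cn_on_mult holomorphic_Cn_on_const pCons.IH)
 qed
 have deg: "degree (smult (e \<zeta>) (pcompose q [:b \<zeta>, 1:])) \<le> degree q" for \<zeta>
  by (rule order_trans[OF degree_smult_le]) (simp add: degree_pcompose)
 have "antiholomorphic_Cn_on (\<lambda>\<zeta>. coeff (smult (e \<zeta>) (pcompose q [:b \<zeta>, 1:])) k) S" for k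
  using e unfolding antiholomorphic_Cn_on_def coeff_smult complex_cnj_mult by (intro holomorphic_Cn_on_mult h)
 with deg show ?thesis unfolding antiholomorphic_poly_on_def by blast
qed

section \<open>Shifting the contour in the kernel\<close>

context lens
begin

definition Bt :: "nat \<Rightarrow> complex \<Rightarrow> complex \<Rightarrow> complex \<Rightarrow> complex \<Rightarrow> complex \<Rightarrow> complex" where
 "Bt n l x y x' y' = - (2 * pi * \<i>) * (of_nat (Suc n) * (y * cnj y') ^ n * (M (sg x) * cnj (M (sg x'))) ^ (n + 3)
   * residue (Fk n 0 (sg x - cnj (sg x'))) l)"

definition ZE :: "real \<Rightarrow> (nat \<times> complex) set" where "ZE E = {(n, l). l \<in> Z n \<and> - E < Im l}"

lemma finite_ZE: "finite (ZE E)"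
 by (rule finite_subset[OF _ finite_Z_all[of E]]) (auto simp: ZE_def)

text \<open>On the line \<open>Im l = - E\<close> the bound \<open>line_integral_bound\<close> holds with the same constants for all \<open>n\<close>,
 so the shifted integrals can be summed; only finitely many residues are crossed.\<close>

lemma Kt_split:
 assumes z': "(x', y') \<in> Om" and E: "E > 0" and nz: "\<And>n l. G n l = 0 ==> Im l \<noteq> - E"
 obtains C where "C \<ge> 0" "\<And>x y. (x, y) \<in> Om ==>
  cmod (Kt x y x' y' - (\<Sum>(n, l)\<in>ZE E. Bt n l x y x' y')) \<le> C * (cmod (M (sg x)) ^ 3 * exp (E * Re (sg x)))"
proof -
 obtain k where k: "0 < k" "k < 1" "cmod (y' * M (sg x')) \<le> k * sqrt (h (Im (sg x')))" by (rule Om_factor[OF z'])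
 have k2: "k < 2" using k by simp
 note gx = DD_good[OF Om_DD[OF z']]
 define a b where "a = (\<alpha> + Im (sg x')) / 2" and "b = (Im (sg x') + \<beta>) / 2"
 have ab': "\<alpha> < a" "a \<le> b" "b < \<beta>" using gx(2) by (auto simp: a_def b_def)
 obtain c where c: "c > 0" "\<And>n \<xi>. c * Gr n \<xi> \<le> cmod (G n (Complex \<xi> (- E)))"
  by (rule G_lower_line[of "- E"]) (use nz in blast)+
 obtain C \<theta> where C: "C > 0" "0 < \<theta>" "\<theta> < 1"
  "\<And>n \<epsilon> y c \<tau>. \<lbrakk>0 \<le> \<epsilon>; \<epsilon> \<le> 1; c > 0; \<And>\<xi>. c * Gr n \<xi> \<le> cmod (G n (Complex \<xi> y)); a \<le> Im \<tau> / 2; Im \<tau> / 2 \<le> b\<rbrakk> \<Longrightarrow>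
   (k * h (Im \<tau> / 2)) ^ n * cmod (\<integral>\<xi>. Fk n \<epsilon> \<tau> (Complex \<xi> y) \<partial>lborel) \<le> C * \<theta> ^ n * (exp (- y * Re \<tau>) * exp (y\<^sup>2 / 2) / c)"
  by (rule line_integral_bound[OF ab' k(1,2)]) blast
 define S where "S = (\<Sum>n. real (Suc n) * \<theta> ^ n)"
 note sm = summable_Suc_geometric[OF C(2,3)]
 have S: "S \<ge> 0" unfolding S_def using C(2) by (intro suminf_nonneg sm) auto
 define C' where "C' = S * (C * cmod (M (sg x')) ^ 3 * exp (- (E * Re (sg x'))) * exp (E\<^sup>2 / 2) / c)"
 have "C' \<ge> 0" unfolding C'_def using S C(1) c(1) by (intro mult_nonneg_nonneg divide_nonneg_pos) auto
 moreover have "cmod (Kt x y x' y' - (\<Sum>(n, l)\<in>ZE E. Bt n l x y x' y')) \<le> C' * (cmod (M (sg x)) ^ 3 * exp (E * Re (sg x)))"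
  if z: "(x, y) \<in> Om" for x y
 proof -
  note g = DD_good[OF Om_DD[OF z]]
  define \<tau> where "\<tau> = sg x - cnj (sg x')"
  have \<tau>: "Im \<tau> = Im (sg x) + Im (sg x')" "Re \<tau> = Re (sg x) - Re (sg x')" by (simp_all add: \<tau>_def)
  have mid: "a \<le> Im \<tau> / 2" "Im \<tau> / 2 \<le> b" using g(2) by (auto simp: \<tau> a_def b_def)
  have mid': "\<alpha> < Im \<tau> / 2" "Im \<tau> / 2 < \<beta>" using mid ab' by auto
  define pre where "pre n = of_nat (Suc n) * (y * cnj y') ^ n * (M (sg x) * cnj (M (sg x'))) ^ (n + 3)" for n
  define An where "An n = pre n * (\<integral>\<xi>. Fk n 0 \<tau> (Complex \<xi> (- E)) \<partial>lborel)" for n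
  define bn where "bn n = (\<Sum>l\<in>{l \<in> Z n. - E < Im l}. Bt n l x y x' y')" for n
  have Kn: "Kn n x y x' y' = An n + bn n" for n
  proof -
   have "Kn n x y x' y' = pre n * kker n 0 \<tau>" unfolding Kn_def pre_def \<tau>_def ..
   also have "\<dots> = An n + - (2 * pi * \<i>) * (\<Sum>l\<in>{l \<in> Z n. - E < Im l}. pre n * residue (Fk n 0 \<tau>) l)"
   proof -
    have "kker n 0 \<tau> = (\<integral>\<xi>. Fk n 0 \<tau> (Complex \<xi> (- E)) \<partial>lborel) - 2 * pi * \<i> * (\<Sum>l\<in>{l \<in> Z n. - E < Im l}. residue (Fk n 0 \<tau>) l)"
     by (rule kker_residues[OF mid' E nz])
    moreover have "p * (I - w * S) = p * I + - w * (p * S)" for p I w S :: complex by algebra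
    ultimately show ?thesis unfolding An_def sum_distrib_left[symmetric] by (simp only:)
   qed
   also have "- (2 * pi * \<i>) * (\<Sum>l\<in>{l \<in> Z n. - E < Im l}. pre n * residue (Fk n 0 \<tau>) l) = bn n"
    unfolding bn_def Bt_def pre_def \<tau>_def sum_distrib_left[symmetric] ..
   finally show ?thesis .
  qed
  define W where "W = C * (cmod (M (sg x)) * cmod (M (sg x'))) ^ 3 * (exp (E * Re \<tau>) * exp (E\<^sup>2 / 2) / c)"
  have le: "cmod (y * M (sg x)) * cmod (y' * M (sg x')) \<le> k * h (Im \<tau> / 2)"
   unfolding \<tau> by (rule UU_closure(2)[OF z' k(1) k2 k(3) g(1)]) (use g(2) z in \<open>auto simp: mem_Om\<close>)
  have An: "cmod (An n) \<le> real (Suc n) * \<theta> ^ n * W" for n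
  proof -
   define J where "J = cmod (\<integral>\<xi>. Fk n 0 \<tau> (Complex \<xi> (- E)) \<partial>lborel)"
   define P where "P = (cmod (M (sg x)) * cmod (M (sg x'))) ^ 3"
   have P: "P \<ge> 0" by (simp add: P_def)
   have "cmod (pre n) = real (Suc n) * ((cmod (y * M (sg x)) * cmod (y' * M (sg x'))) ^ n * P)"
    unfolding pre_def P_def norm_mult norm_power norm_of_nat complex_mod_cnj power_add power_mult_distrib by (simp only: mult_ac)
   then have "cmod (An n) = real (Suc n) * ((cmod (y * M (sg x)) * cmod (y' * M (sg x'))) ^ n * P) * J"
    unfolding An_def J_def norm_mult by simp
   also have "\<dots> \<le> real (Suc n) * ((k * h (Im \<tau> / 2)) ^ n * P) * J"
    using le P by (intro mult_right_mono mult_left_mono power_mono) (auto simp: J_def)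
   also have "\<dots> = real (Suc n) * P * ((k * h (Im \<tau> / 2)) ^ n * J)" by (simp only: mult_ac)
   also have "\<dots> \<le> real (Suc n) * P * (C * \<theta> ^ n * (exp (- (- E) * Re \<tau>) * exp ((- E)\<^sup>2 / 2) / c))"
    unfolding J_def using P by (intro mult_left_mono C(4) c mid) auto
   finally show ?thesis unfolding W_def P_def by (simp only: mult_ac minus_minus power2_minus)
  qed
  have sA: "summable (\<lambda>n. cmod (An n))"
   by (rule summable_comparison_test'[OF summable_mult2[OF sm, of W], of 0]) (use An in simp)
  have fin: "finite {l \<in> Z n. - E < Im l}" for n
   by (rule finite_subset[OF _ finite_imageI[OF finite_ZE[of E], of snd]]) (force simp: ZE_def)
  have "ZE E = Sigma (fst ` ZE E) (\<lambda>n. {l \<in> Z n. - E < Im l})" by (force simp: ZE_def)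
  then have "(\<Sum>(n, l)\<in>ZE E. Bt n l x y x' y') = (\<Sum>n\<in>fst ` ZE E. bn n)"
   unfolding bn_def using finite_imageI[OF finite_ZE[of E], of fst] fin by (subst sum.Sigma) auto
  moreover have "bn sums (\<Sum>n\<in>fst ` ZE E. bn n)"
  proof (rule sums_finite)
   fix n assume "n \<notin> fst ` ZE E"
   then have "{l \<in> Z n. - E < Im l} = {}" by (force simp: ZE_def)
   then show "bn n = 0" unfolding bn_def by (simp only: sum.empty)
  qed (use finite_ZE in simp)
  moreover have "An sums suminf An" by (rule summable_sums[OF summable_norm_cancel[OF sA]])
  ultimately have "(\<lambda>n. An n + bn n) sums (suminf An + (\<Sum>(n, l)\<in>ZE E. Bt n l x y x' y'))" by (simp add: sums_add)
  then have "Kt x y x' y' = suminf An + (\<Sum>(n, l)\<in>ZE E. Bt n l x y x' y')" unfolding Kt_def Kn by (simp add: sums_iff)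
  then have "cmod (Kt x y x' y' - (\<Sum>(n, l)\<in>ZE E. Bt n l x y x' y')) = cmod (suminf An)" by simp
  also have "\<dots> \<le> (\<Sum>n. cmod (An n))" by (rule summable_norm[OF sA])
  also have "\<dots> \<le> (\<Sum>n. real (Suc n) * \<theta> ^ n * W)" by (rule suminf_le[OF An sA summable_mult2[OF sm]])
  also have "\<dots> = S * W" unfolding S_def by (rule suminf_mult2[OF sm, symmetric])
  also have "\<dots> = C' * (cmod (M (sg x)) ^ 3 * exp (E * Re (sg x)))"
  proof -
   have "exp (E * Re \<tau>) = exp (E * Re (sg x)) * exp (- (E * Re (sg x')))"
    unfolding \<tau> exp_add[symmetric] by (simp add: algebra_simps)
   then show ?thesis unfolding W_def C'_def power_mult_distrib by simp
  qed
  finally show ?thesis .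
 qed
 ultimately show ?thesis using that by blast
qed

end

section \<open>The expansion at a complex tangent point\<close>

locale lens_log = lens_domain +
 fixes L :: "complex ^ 2 \<Rightarrow> complex"
 assumes L_cont: "continuous_on Dom L"
  and L_exp: "\<And>z. z \<in> Dom ==> exp (L z) = of_real A * (hx z - qq)"
  and conn: "connected Dom"
begin

definition lt :: "complex \<Rightarrow> complex" where "lt t = Ln (1 - t / (pp - qq))"

lemma norm_pp_minus_qq: "cmod (pp - qq) = d"
proof -
 have "pp - qq = Complex 0 (- 2 * v)" by (simp add: pp_def qq_def complex_eq_iff)
 then show ?thesis by (simp add: d_def cmod_def real_sqrt_mult abs_mult)
qed

lemma lt_holomorphic: "lt holomorphic_on ball 0 d"
proof -
 have "1 - t / (pp - qq) \<notin> \<real>\<^sub>\<le>\<^sub>0" if "t \<in> ball 0 d" for t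
 proof -
  have "cmod (t / (pp - qq)) < 1" using that d_pos by (simp add: norm_divide norm_pp_minus_qq)
  then have "Re (t / (pp - qq)) < 1" using complex_Re_le_cmod le_less_trans by blast
  then show ?thesis by (simp add: complex_nonpos_Reals_iff)
 qed
 then show ?thesis unfolding lt_def using pp_neq_qq by (intro holomorphic_intros) auto
qed

lemma one_minus_t:
 assumes "z \<in> Dom"
 shows "1 - (hx z - qq) / (pp - qq) \<notin> \<real>\<^sub>\<le>\<^sub>0" "exp (- lt (hx z - qq)) = 1 + exp (sg (hx z))"
  "1 - (hx z - qq) / (pp - qq) = (pp - hx z) / (pp - qq)"
proof -
 have "hx z \<in> DD" using assms Om_DD by (simp add: Dom_def)
 then have g: "hx z \<in> good" by (rule DD_good)
 then have npp: "hx z \<noteq> pp" and e: "ee (hx z) \<notin> \<real>\<^sub>\<le>\<^sub>0" by (auto simp: good_def)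
 show 3: "1 - (hx z - qq) / (pp - qq) = (pp - hx z) / (pp - qq)" using pp_neq_qq by (simp add: field_simps)
 have "1 + ee (hx z) = (qq - pp) / (hx z - pp)" by (rule ee_eq(2)[OF npp])
 also have "\<dots> = inverse ((pp - hx z) / (pp - qq))"
  using npp pp_neq_qq by (simp add: divide_simps) (simp add: algebra_simps)
 finally have i: "1 + ee (hx z) = inverse (1 - (hx z - qq) / (pp - qq))" unfolding 3 .
 then have i': "1 - (hx z - qq) / (pp - qq) = inverse (1 + ee (hx z))" by simp
 show 1: "1 - (hx z - qq) / (pp - qq) \<notin> \<real>\<^sub>\<le>\<^sub>0"
 proof
  assume "1 - (hx z - qq) / (pp - qq) \<in> \<real>\<^sub>\<le>\<^sub>0"
  then have "1 + ee (hx z) \<in> \<real>\<^sub>\<le>\<^sub>0" unfolding i' by simp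
  then show False using e by (auto simp: complex_nonpos_Reals_iff)
 qed
 then have "1 - (hx z - qq) / (pp - qq) \<noteq> 0" by auto
 then show "exp (- lt (hx z - qq)) = 1 + exp (sg (hx z))"
  unfolding sg_good(3)[OF g] i lt_def exp_minus by simp
qed

text \<open>Both sides are logarithms of the same function up to a constant factor, so on the connected domain
 their difference is constant.\<close>

lemma sg_log: "\<exists>\<kappa>. \<forall>z\<in>Dom. sg (hx z) = L z - \<kappa> - lt (hx z - qq)"
proof (cases "Dom = {}")
 case False
 then obtain z0 where z0: "z0 \<in> Dom" by blast
 define f where "f z = L z - sg (hx z) - lt (hx z - qq)" for z
 have ex: "exp (f z) = of_real A * (pp - qq)" if z: "z \<in> Dom" for z
 proof -
  have "hx z \<in> DD" using z Om_DD by (simp add: Dom_def)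
  then have g: "hx z \<in> good" by (rule DD_good)
  have npp: "hx z \<noteq> pp" "ee (hx z) \<noteq> 0" using g by (auto simp: good_def)
  have "hx z \<noteq> qq" using npp(2) by (auto simp: ee_def)
  have "exp (f z) = exp (L z) / exp (sg (hx z)) / exp (lt (hx z - qq))" unfolding f_def exp_diff ..
  also have "\<dots> = of_real A * (hx z - qq) / ee (hx z) / ((pp - hx z) / (pp - qq))"
   unfolding L_exp[OF z] sg_good(3)[OF g] lt_def one_minus_t(3)[OF z] using npp pp_neq_qq by simp
  also have "\<dots> = of_real A * (pp - qq)"
   using npp \<open>hx z \<noteq> qq\<close> pp_neq_qq unfolding ee_def by (simp add: divide_simps) (simp add: algebra_simps)
  finally show ?thesis .
 qed
 have cf: "continuous_on Dom f"
 proof -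
  have "Dom \<subseteq> Gz" using DD_good(1) Om_DD by (auto simp: Dom_def Gz_def)
  then have "continuous_on Dom (\<lambda>z. sg (hx z))"
   by (rule continuous_on_subset[OF holomorphic_Cn_on_imp_continuous_on[OF sg_hx_hol]])
  moreover have "continuous_on Dom (\<lambda>z. lt (hx z - qq))" unfolding lt_def
   using one_minus_t(1) pp_neq_qq by (intro continuous_intros hx_cont) auto
  ultimately show ?thesis unfolding f_def by (intro continuous_intros L_cont)
 qed
 have "f constant_on Dom"
 proof (rule continuous_discrete_range_constant[OF conn cf])
  fix x assume x: "x \<in> Dom"
  have "1 \<le> cmod (f y - f x)" if y: "y \<in> Dom" "f y \<noteq> f x" for y
  proof -
   have "exp (f y) = exp (f x)" using ex x y by simp
   then obtain n :: int where n: "f y = f x + (of_int (2 * n) * pi) * \<i>" unfolding exp_eq by blast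
   then have "n \<noteq> 0" using y by auto
   have "cmod (f y - f x) = \<bar>of_int (2 * n) * pi\<bar>" unfolding n by (simp add: norm_mult abs_mult)
   also have "\<dots> = \<bar>of_int (2 * n)\<bar> * pi" by (simp add: abs_mult)
   also have "\<dots> \<ge> 1 * 1" using \<open>n \<noteq> 0\<close> pi_ge_two by (intro mult_mono) linarith+
   finally show ?thesis by simp
  qed
  then show "\<exists>e>0. \<forall>y. y \<in> Dom \<and> f y \<noteq> f x \<longrightarrow> e \<le> norm (f y - f x)" by (intro exI[of _ 1]) auto
 qed
 then obtain \<kappa> where "\<And>z. z \<in> Dom ==> f z = \<kappa>" by (auto simp: constant_on_def)
 then show ?thesis unfolding f_def by (intro exI[of _ \<kappa>]) (auto simp: algebra_simps)
qed auto

definition \<kappa> :: complex where "\<kappa> = (SOME \<kappa>. \<forall>z\<in>Dom. sg (hx z) = L z - \<kappa> - lt (hx z - qq))"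

lemma sg_L: "z \<in> Dom ==> sg (hx z) = L z - \<kappa> - lt (hx z - qq)"
 using someI_ex[OF sg_log] unfolding \<kappa>_def by blast

lemma M_L:
 assumes z: "z \<in> Dom"
 shows "M (sg (hx z)) = exp (\<kappa> / 2 - L z / 2 - lt (hx z - qq) / 2) / of_real d"
proof -
 have "M s = exp (- s / 2) * (1 + exp s) / of_real d" for s
  unfolding M_def by (simp add: distrib_left exp_add[symmetric])
 then have "M (sg (hx z)) = exp (- sg (hx z) / 2 + - lt (hx z - qq)) / of_real d"
  unfolding exp_add one_minus_t(2)[OF z] .
 also have "- sg (hx z) / 2 + - lt (hx z - qq) = \<kappa> / 2 - L z / 2 - lt (hx z - qq) / 2"
  unfolding sg_L[OF z] by (simp add: field_simps)
 finally show ?thesis .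
qed

definition near :: "complex ^ 2 \<Rightarrow> bool" where
 "near z \<longleftrightarrow> z \<in> Dom \<and> cmod (hx z - qq) < min (d / 2) (1 / A)"

lemma norm_exp_L: "z \<in> Dom ==> cmod (of_real A * (hx z - qq)) = exp (Re (L z))"
 unfolding L_exp[symmetric] by (rule norm_exp_eq_Re)

lemma near_bounds:
 obtains B where "B \<ge> 1" "\<And>z. near z ==> \<bar>Im (L z)\<bar> \<le> B" "\<And>z. near z ==> Re (sg (hx z)) \<le> Re (L z) + B"
  "\<And>z. near z ==> cmod (hy z) \<le> B * exp (Re (L z) / 2)" "\<And>z. near z ==> Re (L z) < 0"
  "\<And>z. near z ==> cmod (M (sg (hx z))) \<le> B * exp (- Re (L z) / 2)"
proof -
 have "bounded (lt ` cball 0 (d / 2))"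
  by (intro compact_imp_bounded compact_continuous_image compact_cball continuous_on_subset[OF holomorphic_on_imp_continuous_on[OF lt_holomorphic]])
   (use d_pos in auto)
 then obtain B0 where "\<And>t. t \<in> cball 0 (d / 2) ==> cmod (lt t) \<le> B0" unfolding bounded_iff by blast
 then have B0: "cmod (lt (hx z - qq)) \<le> B0" if "near z" for z using that by (simp add: near_def)
 define B where "B = 1 + pi + cmod \<kappa> + \<bar>B0\<bar> + (2 / A + 1) + exp (cmod \<kappa> + \<bar>B0\<bar>) / d"
 have parts: "0 \<le> cmod \<kappa>" "0 \<le> \<bar>B0\<bar>" "0 \<le> 2 / A + 1" "0 \<le> exp (cmod \<kappa> + \<bar>B0\<bar>) / d" "pi > 0" using A_pos d_pos by auto
 show ?thesis
 proof (rule that[of B])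
  show "B \<ge> 1" using parts unfolding B_def by linarith
  fix z assume n: "near z"
  then have z: "z \<in> Dom" by (simp add: near_def)
  have o: "(hx z, hy z) \<in> Om" using z by (simp add: Dom_def)
  note g = DD_good[OF Om_DD[OF o]]
  note l = B0[OF n]
  have pi: "\<bar>Im (sg (hx z))\<bar> \<le> pi" using sg_good(1,2)[OF g(1)] by auto
  have lb: "\<bar>Im (lt (hx z - qq))\<bar> \<le> B0" "\<bar>Re (lt (hx z - qq))\<bar> \<le> B0"
   using l abs_Im_le_cmod[of "lt (hx z - qq)"] abs_Re_le_cmod[of "lt (hx z - qq)"] by linarith+
  have eq: "Im (L z) = Im (sg (hx z)) + Im \<kappa> + Im (lt (hx z - qq))" "Re (sg (hx z)) = Re (L z) - Re \<kappa> - Re (lt (hx z - qq))"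
   using sg_L[OF z] by simp_all
  have k: "\<bar>Im \<kappa>\<bar> \<le> cmod \<kappa>" "\<bar>Re \<kappa>\<bar> \<le> cmod \<kappa>" by (rule abs_Im_le_cmod abs_Re_le_cmod)+
  show "\<bar>Im (L z)\<bar> \<le> B" unfolding B_def eq(1) using pi lb k parts by linarith
  show "Re (sg (hx z)) \<le> Re (L z) + B" unfolding B_def eq(2) using lb k parts by linarith
  have At: "A * cmod (hx z - qq) = exp (Re (L z))" using norm_exp_L[OF z] A_pos by (simp add: norm_mult)
  have "A * cmod (hx z - qq) < 1" using n A_pos by (simp add: near_def field_simps)
  then show "Re (L z) < 0" unfolding At by simp
  have "(cmod (hy z))\<^sup>2 \<le> 1 - (cmod (hx z))\<^sup>2" using o by (auto simp: mem_Om rho_def)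
  also have "\<dots> = (cmod qq - cmod (hx z)) * (1 + cmod (hx z))" using norm_pp_qq by (simp add: power2_eq_square algebra_simps)
  also have "\<dots> \<le> cmod (hx z - qq) * 2"
  proof (rule mult_mono)
   show "cmod qq - cmod (hx z) \<le> cmod (hx z - qq)" using norm_triangle_ineq2[of qq "hx z"] by (simp add: norm_minus_commute)
   have "(cmod (hy z))\<^sup>2 < 1 - (cmod (hx z))\<^sup>2" using o by (auto simp: mem_Om rho_def)
   then have "(cmod (hx z))\<^sup>2 \<le> 1" using zero_le_power2[of "cmod (hy z)"] by linarith
   then show "1 + cmod (hx z) \<le> 2" by (simp add: abs_square_le_1)
  qed auto
  also have "\<dots> = 2 / A * exp (Re (L z))" unfolding At[symmetric] using A_pos by simp
  also have "\<dots> \<le> (2 / A + 1)\<^sup>2 * exp (Re (L z))"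
  proof (rule mult_right_mono)
   have "x \<le> (x + 1)\<^sup>2" if "x \<ge> 0" for x :: real
    using that zero_le_power2[of x] unfolding power2_sum power_one mult_1_right by linarith
   then show "2 / A \<le> (2 / A + 1)\<^sup>2" using A_pos by simp
  qed simp
  also have "\<dots> = ((2 / A + 1) * exp (Re (L z) / 2))\<^sup>2" by (simp add: power_mult_distrib power2_eq_square exp_add[symmetric])
  finally have "cmod (hy z) \<le> (2 / A + 1) * exp (Re (L z) / 2)"
   by (rule power2_le_imp_le) (use parts in simp)
  also have "\<dots> \<le> B * exp (Re (L z) / 2)" by (rule mult_right_mono) (use parts in \<open>auto simp: B_def\<close>)
  finally show "cmod (hy z) \<le> B * exp (Re (L z) / 2)" .
  have "cmod (M (sg (hx z))) = exp (Re \<kappa> / 2 - Re (L z) / 2 - Re (lt (hx z - qq)) / 2) / d"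
   unfolding M_L[OF z] norm_divide norm_exp_eq_Re using d_pos by simp
  also have "\<dots> \<le> exp (cmod \<kappa> + \<bar>B0\<bar> + - Re (L z) / 2) / d"
  proof (intro divide_right_mono exp_le_cancel_iff[THEN iffD2])
   have "Re \<kappa> - Re (lt (hx z - qq)) \<le> 2 * cmod \<kappa> + 2 * \<bar>B0\<bar>" using lb k parts by linarith
   then show "Re \<kappa> / 2 - Re (L z) / 2 - Re (lt (hx z - qq)) / 2 \<le> cmod \<kappa> + \<bar>B0\<bar> + - Re (L z) / 2" by simp
  qed (use d_pos in simp)
  also have "\<dots> = exp (cmod \<kappa> + \<bar>B0\<bar>) / d * exp (- Re (L z) / 2)" unfolding exp_add by simp
  also have "\<dots> \<le> B * exp (- Re (L z) / 2)"
  proof (rule mult_right_mono)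
   show "exp (cmod \<kappa> + \<bar>B0\<bar>) / d \<le> B" unfolding B_def using parts by linarith
  qed simp
  finally show "cmod (M (sg (hx z))) \<le> B * exp (- Re (L z) / 2)" .
 qed
qed

text \<open>Since \<open>\<bar>exp (L z)\<bar>\<close> is the modulus of the expansion variable, \<open>exp (N * Re (L z))\<close> is its \<open>N\<close>-th power.\<close>

definition small :: "real \<Rightarrow> (complex ^ 2 \<Rightarrow> complex) \<Rightarrow> bool" where
 "small N f \<longleftrightarrow> (\<exists>C. \<forall>z. near z \<longrightarrow> cmod (f z) \<le> C * exp (N * Re (L z)))"

lemma smallI: "(\<And>z. near z ==> cmod (f z) \<le> C * exp (N' * Re (L z))) ==> N \<le> N' ==> small N f"
proof -
 assume f: "\<And>z. near z ==> cmod (f z) \<le> C * exp (N' * Re (L z))" and N: "N \<le> N'"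
 have "cmod (f z) \<le> \<bar>C\<bar> * exp (N * Re (L z))" if z: "near z" for z
 proof -
  obtain B where "\<And>z. near z ==> Re (L z) < 0" by (rule near_bounds) blast
  then have "N' * Re (L z) \<le> N * Re (L z)" using N z by (intro mult_right_mono_neg) (auto intro: less_imp_le)
  then have "C * exp (N' * Re (L z)) \<le> \<bar>C\<bar> * exp (N * Re (L z))" by (intro mult_mono) auto
  then show ?thesis using f[OF z] by linarith
 qed
 then show ?thesis unfolding small_def by blast
qed

lemma small_add: "small N f ==> small N g ==> small N (\<lambda>z. f z + g z)"
proof -
 assume "small N f" "small N g"
 then obtain C C' where "\<And>z. near z ==> cmod (f z) \<le> C * exp (N * Re (L z))" "\<And>z. near z ==> cmod (g z) \<le> C' * exp (N * Re (L z))"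
  unfolding small_def by blast
 then have "near z ==> cmod (f z + g z) \<le> (C + C') * exp (N * Re (L z))" for z
  unfolding distrib_right by (intro order_trans[OF norm_triangle_ineq add_mono])
 then show ?thesis unfolding small_def by blast
qed

lemma small_sum: "finite J ==> (\<And>i. i \<in> J ==> small N (f i)) ==> small N (\<lambda>z. \<Sum>i\<in>J. f i z)"
proof (induction J rule: finite_induct)
 case empty
 show ?case unfolding small_def by (intro exI[of _ 0]) simp
next
 case (insert i J)
 then show ?case by (simp add: small_add)
qed

lemma small_mult: "small N f ==> small N (\<lambda>z. c * f z)"
proof -
 assume "small N f"
 then obtain C where C: "\<And>z. near z ==> cmod (f z) \<le> C * exp (N * Re (L z))" unfolding small_def by blast
 have "near z ==> cmod (c * f z) \<le> (cmod c * C) * exp (N * Re (L z))" for z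
  unfolding norm_mult mult.assoc by (intro mult_left_mono C) auto
 then show ?thesis unfolding small_def by blast
qed

lemma hx_S: "hx (qq *s e1) = qq" and hy_S: "hy (qq *s e1) = 0"
 using hx_T[of "(qq, 0)"] hy_T[of "(qq, 0)"] by (simp_all add: T_def)

lemma small_bigo:
 assumes "small N f"
 shows "(\<lambda>z. cmod (f z)) \<in> O[at (qq *s e1) within Dom](\<lambda>z. cmod (of_real A * (hx z - qq)) powr N)"
proof -
 obtain C where C: "\<And>z. near z ==> cmod (f z) \<le> C * exp (N * Re (L z))" using assms unfolding small_def by blast
 have "continuous (at (qq *s e1)) hx" using hx_cont[of UNIV] by (simp add: continuous_on_eq_continuous_at)
 then have "((\<lambda>z. hx z) \<longlongrightarrow> qq) (at (qq *s e1) within Dom)"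
  unfolding continuous_at hx_S by (rule tendsto_within_subset) simp
 then have "\<forall>\<^sub>F z in at (qq *s e1) within Dom. dist (hx z) qq < min (d / 2) (1 / A)"
  by (rule tendstoD) (use d_pos A_pos in simp)
 moreover have "\<forall>\<^sub>F z in at (qq *s e1) within Dom. z \<in> Dom" by (simp add: eventually_at_filter)
 ultimately have "\<forall>\<^sub>F z in at (qq *s e1) within Dom. norm (cmod (f z)) \<le> C * norm (cmod (of_real A * (hx z - qq)) powr N)"
 proof eventually_elim
  case (elim z)
  then have n: "near z" by (simp add: near_def dist_norm)
  show ?case using C[OF n] unfolding norm_exp_L[OF elim(2)] by (simp add: powr_def)
 qed
 then show ?thesis by (rule bigoI)
qed

text \<open>A point of the domain satisfies \<open>\<bar>hy z\<bar>\<^sup>2 \<le> 2 \<bar>hx z - qq\<bar>\<close>, so each factor \<open>hy z\<close> is worth half a power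
 of the expansion variable; powers of the logarithm \<open>L\<close> are estimated by another half power.\<close>

lemma small_log_power:
 assumes f: "\<And>z. near z ==> cmod (f z) \<le> C * (1 + cmod (L z)) ^ D * exp (e * Re (L z))"
  and N: "N \<le> Re \<gamma> + real n / 2 - 1/2 + e"
 shows "small N (\<lambda>z. hy z ^ n * exp (\<gamma> * L z) * f z)"
proof -
 obtain B where B: "B \<ge> 1" "\<And>z. near z ==> \<bar>Im (L z)\<bar> \<le> B" "\<And>z. near z ==> Re (sg (hx z)) \<le> Re (L z) + B"
  "\<And>z. near z ==> cmod (hy z) \<le> B * exp (Re (L z) / 2)" "\<And>z. near z ==> Re (L z) < 0"
  by (rule near_bounds) blast
 obtain C1 where C1: "C1 \<ge> 0" "\<And>s. s \<ge> 0 ==> (1 + B + s) ^ D \<le> C1 * exp (s / 2)" using power_le_exp_half[of "1 + B" D] B(1) by auto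
 show ?thesis
 proof (rule smallI[OF _ N, of _ "B ^ n * exp (\<bar>Im \<gamma>\<bar> * B) * (\<bar>C\<bar> * C1)"])
  fix z assume n: "near z"
  define \<Lambda> where "\<Lambda> = Re (L z)"
  have \<Lambda>: "\<Lambda> < 0" using B(5)[OF n] by (simp add: \<Lambda>_def)
  have "cmod (hy z) ^ n \<le> (B * exp (\<Lambda> / 2)) ^ n" using B(4)[OF n] by (intro power_mono) (auto simp: \<Lambda>_def)
  also have "\<dots> = B ^ n * exp (real n / 2 * \<Lambda>)" unfolding power_mult_distrib exp_of_nat_mult[symmetric] by simp
  finally have 1: "cmod (hy z) ^ n \<le> B ^ n * exp (real n / 2 * \<Lambda>)" .
  have "- (Im \<gamma> * Im (L z)) \<le> \<bar>Im \<gamma>\<bar> * \<bar>Im (L z)\<bar>" by (simp add: abs_mult[symmetric])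
  also have "\<dots> \<le> \<bar>Im \<gamma>\<bar> * B" using B(2)[OF n] by (intro mult_left_mono) auto
  finally have "Re (\<gamma> * L z) \<le> \<bar>Im \<gamma>\<bar> * B + Re \<gamma> * \<Lambda>" unfolding times_complex.sel \<Lambda>_def by linarith
  then have 2: "cmod (exp (\<gamma> * L z)) \<le> exp (\<bar>Im \<gamma>\<bar> * B) * exp (Re \<gamma> * \<Lambda>)" unfolding norm_exp_eq_Re exp_add[symmetric] by simp
  have "cmod (L z) \<le> \<bar>\<Lambda>\<bar> + \<bar>Im (L z)\<bar>" unfolding \<Lambda>_def by (rule cmod_le)
  then have "1 + cmod (L z) \<le> 1 + B + (- \<Lambda>)" using B(2)[OF n] \<Lambda> by linarith
  then have "(1 + cmod (L z)) ^ D \<le> (1 + B + (- \<Lambda>)) ^ D" by (intro power_mono) auto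
  also have "\<dots> \<le> C1 * exp (- \<Lambda> / 2)" using C1(2)[of "- \<Lambda>"] \<Lambda> by simp
  finally have 3: "(1 + cmod (L z)) ^ D \<le> C1 * exp (- \<Lambda> / 2)" .
  have "cmod (f z) \<le> C * (1 + cmod (L z)) ^ D * exp (e * \<Lambda>)" using f[OF n] by (simp only: \<Lambda>_def)
  also have "\<dots> \<le> \<bar>C\<bar> * (C1 * exp (- \<Lambda> / 2)) * exp (e * \<Lambda>)" using 3 by (intro mult_right_mono mult_mono) auto
  finally have 4: "cmod (f z) \<le> \<bar>C\<bar> * (C1 * exp (- \<Lambda> / 2)) * exp (e * \<Lambda>)" .
  have "cmod (hy z ^ n * exp (\<gamma> * L z) * f z) = cmod (hy z) ^ n * cmod (exp (\<gamma> * L z)) * cmod (f z)" by (simp add: norm_mult norm_power)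
  also have "\<dots> \<le> B ^ n * exp (real n / 2 * \<Lambda>) * (exp (\<bar>Im \<gamma>\<bar> * B) * exp (Re \<gamma> * \<Lambda>)) * (\<bar>C\<bar> * (C1 * exp (- \<Lambda> / 2)) * exp (e * \<Lambda>))"
   using 1 2 4 B(1) by (intro mult_mono) auto
  also have "\<dots> = B ^ n * exp (\<bar>Im \<gamma>\<bar> * B) * (\<bar>C\<bar> * C1) * (exp (real n / 2 * \<Lambda>) * exp (Re \<gamma> * \<Lambda>) * exp (- \<Lambda> / 2) * exp (e * \<Lambda>))" by (simp only: mult_ac)
  also have "exp (real n / 2 * \<Lambda>) * exp (Re \<gamma> * \<Lambda>) * exp (- \<Lambda> / 2) * exp (e * \<Lambda>) = exp ((Re \<gamma> + real n / 2 - 1/2 + e) * \<Lambda>)"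
   unfolding exp_add[symmetric] by (simp add: algebra_simps)
  finally show "cmod (hy z ^ n * exp (\<gamma> * L z) * f z) \<le> B ^ n * exp (\<bar>Im \<gamma>\<bar> * B) * (\<bar>C\<bar> * C1) * exp ((Re \<gamma> + real n / 2 - 1/2 + e) * Re (L z))"
   unfolding \<Lambda>_def .
 qed
qed

text \<open>Near the tangent point \<open>sg (hx z) = L z - \<kappa> - lt t\<close> with \<open>t = hx z - qq\<close>, so a residue at \<open>l\<close> is
 \<open>hy z ^ n\<close> times \<open>exp (g0 n l * L z)\<close> times an expandable function of \<open>t\<close> and \<open>L z\<close>.\<close>

definition g0 :: "nat \<Rightarrow> complex \<Rightarrow> complex" where "g0 n l = \<i> * l - of_nat (n + 3) / 2"
definition RR :: "nat \<Rightarrow> complex \<Rightarrow> complex poly" where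
 "RR n l = (SOME R. \<forall>\<tau>. residue (Fk n 0 \<tau>) l = exp (\<i> * l * \<tau>) * poly R \<tau>)"
definition gg :: "nat \<Rightarrow> complex \<Rightarrow> complex \<Rightarrow> complex" where "gg n l t = exp ((- (\<i> * l) - of_nat (n + 3) / 2) * lt t)"
definition cc :: "nat \<Rightarrow> complex \<Rightarrow> complex ^ 2 \<Rightarrow> complex" where
 "cc n l \<zeta> = - (2 * pi * \<i>) * of_nat (Suc n) * exp (of_nat (n + 3) / 2 * \<kappa> - \<i> * l * \<kappa>) / of_real d ^ (n + 3)
   * (cnj (hy \<zeta>) ^ n * cnj (M (sg (hx \<zeta>))) ^ (n + 3) * exp (- (\<i> * l) * cnj (sg (hx \<zeta>))))"
definition ww :: "complex ^ 2 \<Rightarrow> complex" where "ww \<zeta> = - \<kappa> - cnj (sg (hx \<zeta>))"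

lemma Bt_L:
 assumes z: "z \<in> Dom" and l: "l \<in> Z n"
 shows "Bt n l (hx z) (hy z) (hx \<zeta>) (hy \<zeta>) = cc n l \<zeta> * (hy z ^ n * exp (g0 n l * L z) *
  (gg n l (hx z - qq) * poly (RR n l) ((L z + ww \<zeta>) - lt (hx z - qq))))"
proof -
 have "G n l = 0" using l by (simp add: Z_def)
 then have "\<exists>R. \<forall>\<tau>. residue (Fk n 0 \<tau>) l = exp (\<i> * l * \<tau>) * poly R \<tau>" using residue_Fk by metis
 then have res: "residue (Fk n 0 \<tau>) l = exp (\<i> * l * \<tau>) * poly (RR n l) \<tau>" for \<tau>
  unfolding RR_def by (rule someI2_ex) blast
 define t where "t = lt (hx z - qq)"
 define s where "s = cnj (sg (hx \<zeta>))"
 have \<tau>: "sg (hx z) - s = (L z + ww \<zeta>) - t" unfolding sg_L[OF z] ww_def t_def s_def by simp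
 have Mp: "M (sg (hx z)) ^ (n + 3) = exp (of_nat (n + 3) * (\<kappa> / 2 - L z / 2 - t / 2)) / of_real d ^ (n + 3)"
  unfolding M_L[OF z] power_divide exp_of_nat_mult t_def ..
 have ex: "exp (of_nat (n + 3) * (\<kappa> / 2 - L z / 2 - t / 2)) * exp (\<i> * l * ((L z + ww \<zeta>) - t))
   = exp (of_nat (n + 3) / 2 * \<kappa> - \<i> * l * \<kappa>) * exp (- (\<i> * l) * s) * exp (g0 n l * L z) * gg n l (hx z - qq)"
  unfolding gg_def g0_def exp_add[symmetric] t_def[symmetric] ww_def s_def[symmetric] by (rule arg_cong[of _ _ exp]) (simp add: field_simps)
 have "Bt n l (hx z) (hy z) (hx \<zeta>) (hy \<zeta>) = - (2 * pi * \<i>) * of_nat (Suc n) / of_real d ^ (n + 3) * (cnj (hy \<zeta>) ^ n * cnj (M (sg (hx \<zeta>))) ^ (n + 3)) * hy z ^ n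
   * (exp (of_nat (n + 3) * (\<kappa> / 2 - L z / 2 - t / 2)) * exp (\<i> * l * ((L z + ww \<zeta>) - t))) * poly (RR n l) ((L z + ww \<zeta>) - t)"
  unfolding Bt_def res s_def[symmetric] \<tau> power_mult_distrib Mp by (simp add: complex_cnj_power)
 then show ?thesis unfolding ex cc_def s_def[symmetric] t_def[symmetric] by (simp add: mult_ac)
qed

definition QQ :: "nat \<Rightarrow> complex \<Rightarrow> nat \<Rightarrow> complex poly" where
 "QQ n l = (SOME Q. \<forall>m. \<exists>C D. \<forall>t\<in>cball 0 (d / 2). \<forall>X.
   cmod (gg n l t * poly (RR n l) (X - lt t) - (\<Sum>j\<le>m. t ^ j * poly (Q j) X)) \<le> C * cmod t ^ Suc m * (1 + cmod X) ^ D)"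

lemma QQ: "\<exists>C D. \<forall>t\<in>cball 0 (d / 2). \<forall>X.
   cmod (gg n l t * poly (RR n l) (X - lt t) - (\<Sum>j\<le>m. t ^ j * poly (QQ n l j) X)) \<le> C * cmod t ^ Suc m * (1 + cmod X) ^ D"
proof -
 have "gg n l holomorphic_on ball 0 d" unfolding gg_def by (intro holomorphic_intros lt_holomorphic)
 then have "expandable (d / 2) (\<lambda>t X. gg n l t * poly (RR n l) (X - lt t))"
  by (intro expandable_poly[OF lt_holomorphic]) (use d_pos in auto)
 from someI_ex[OF this[unfolded expandable_def]] show ?thesis unfolding QQ_def by blast
qed

definition PP :: "complex \<Rightarrow> (nat \<times> complex) \<times> nat \<Rightarrow> complex ^ 2 \<Rightarrow> complex poly" where
 "PP c = (\<lambda>((n, l), m) \<zeta>. smult (c * cc n l \<zeta> / (of_real A ^ n * of_real A ^ m)) (pcompose (QQ n l m) [:ww \<zeta>, 1:]))"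

definition tt :: "complex \<Rightarrow> complex ^ 2 \<Rightarrow> (nat \<times> complex) \<times> nat \<Rightarrow> complex ^ 2 \<Rightarrow> complex" where
 "tt c \<zeta> = (\<lambda>((n, l), m) z. (of_real A * hy z) ^ n * exp ((g0 n l + of_nat m) * L z) * poly (PP c ((n, l), m) \<zeta>) (L z))"

lemma tt_eq:
 assumes z: "z \<in> Dom"
 shows "tt c \<zeta> ((n, l), m) z = c * cc n l \<zeta> * (hy z ^ n * exp (g0 n l * L z) * ((hx z - qq) ^ m * poly (QQ n l m) (L z + ww \<zeta>)))"
proof -
 have "exp ((g0 n l + of_nat m) * L z) = exp (g0 n l * L z) * (of_real A ^ m * (hx z - qq) ^ m)"
  unfolding power_mult_distrib[symmetric] L_exp[OF z, symmetric] exp_of_nat_mult[symmetric] exp_add[symmetric] by (simp add: algebra_simps)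
 then show ?thesis using A_pos unfolding tt_def PP_def by (simp add: poly_pcompose power_mult_distrib add.commute)
qed

lemma tt_small:
 assumes "N + 1 \<le> - Im l - 1 + real m"
 shows "small N (tt c \<zeta> ((n, l), m))"
proof -
 obtain C D where C: "\<And>X. cmod (poly (PP c ((n, l), m) \<zeta>) X) \<le> C * (1 + cmod X) ^ D" using poly_growth by blast
 have "small N (\<lambda>z. hy z ^ n * exp ((g0 n l + of_nat m) * L z) * poly (PP c ((n, l), m) \<zeta>) (L z))"
  by (rule small_log_power[where e = 0 and C = C and D = D]) (use C assms in \<open>auto simp: g0_def field_simps\<close>)
 from small_mult[OF this, of "of_real A ^ n"] show ?thesis
  by (simp add: tt_def power_mult_distrib mult.assoc)
qed

lemma residue_small:
 assumes l: "l \<in> Z n" and N: "N + 1 \<le> real m"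
 shows "small N (\<lambda>z. c * Bt n l (hx z) (hy z) (hx \<zeta>) (hy \<zeta>) - (\<Sum>j\<le>m. tt c \<zeta> ((n, l), j) z))"
proof -
 obtain C D where C: "\<And>t X. t \<in> cball 0 (d / 2) ==>
   cmod (gg n l t * poly (RR n l) (X - lt t) - (\<Sum>j\<le>m. t ^ j * poly (QQ n l j) X)) \<le> C * cmod t ^ Suc m * (1 + cmod X) ^ D"
  using QQ[of n l m] by blast
 define f where "f z = gg n l (hx z - qq) * poly (RR n l) ((L z + ww \<zeta>) - lt (hx z - qq)) - (\<Sum>j\<le>m. (hx z - qq) ^ j * poly (QQ n l j) (L z + ww \<zeta>))" for z
 define b where "b = 1 + cmod (ww \<zeta>)"
 have "small N (\<lambda>z. hy z ^ n * exp (g0 n l * L z) * f z)"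
 proof (rule small_log_power[where e = "real (Suc m)" and D = D and C = "\<bar>C\<bar> * b ^ D / A ^ Suc m"])
  fix z assume n: "near z"
  then have z: "z \<in> Dom" by (simp add: near_def)
  have t: "hx z - qq \<in> cball 0 (d / 2)" using n by (simp add: near_def)
  have "A * cmod (hx z - qq) = exp (Re (L z))" using norm_exp_L[OF z] A_pos unfolding norm_mult norm_of_real by simp
  then have At: "cmod (hx z - qq) = exp (Re (L z)) / A" using A_pos by (simp add: field_simps)
  have "1 + cmod (L z + ww \<zeta>) \<le> 1 + (cmod (L z) + cmod (ww \<zeta>))" using norm_triangle_ineq[of "L z" "ww \<zeta>"] by simp
  also have "\<dots> \<le> b * (1 + cmod (L z))" unfolding b_def by (simp add: algebra_simps)
  finally have 1: "(1 + cmod (L z + ww \<zeta>)) ^ D \<le> (b * (1 + cmod (L z))) ^ D" by (intro power_mono) auto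
  have "cmod (f z) \<le> C * cmod (hx z - qq) ^ Suc m * (1 + cmod (L z + ww \<zeta>)) ^ D" unfolding f_def by (rule C[OF t])
  also have "\<dots> \<le> \<bar>C\<bar> * cmod (hx z - qq) ^ Suc m * (b * (1 + cmod (L z))) ^ D"
   by (intro mult_mono 1) auto
  also have "\<dots> = \<bar>C\<bar> * b ^ D / A ^ Suc m * (1 + cmod (L z)) ^ D * exp (real (Suc m) * Re (L z))"
   unfolding At power_divide power_mult_distrib exp_of_nat_mult by simp
  finally show "cmod (f z) \<le> \<bar>C\<bar> * b ^ D / A ^ Suc m * (1 + cmod (L z)) ^ D * exp (real (Suc m) * Re (L z))" .
 qed (use N Z_Im[OF l] in \<open>simp add: g0_def field_simps\<close>)
 from small_mult[OF this, of "c * cc n l \<zeta>"] have s: "small N (\<lambda>z. c * cc n l \<zeta> * (hy z ^ n * exp (g0 n l * L z) * f z))" .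
 have "c * Bt n l (hx z) (hy z) (hx \<zeta>) (hy \<zeta>) - (\<Sum>j\<le>m. tt c \<zeta> ((n, l), j) z) = c * cc n l \<zeta> * (hy z ^ n * exp (g0 n l * L z) * f z)"
  if "near z" for z
 proof -
  have z: "z \<in> Dom" using that by (simp add: near_def)
  show ?thesis unfolding Bt_L[OF z l] tt_eq[OF z] f_def sum_distrib_left[symmetric] by (simp add: algebra_simps)
 qed
 then show ?thesis using s unfolding small_def by simp
qed

definition II :: "((nat \<times> complex) \<times> nat) set" where "II = (SIGMA n:UNIV. Z n) \<times> UNIV"

lemma countable_II: "countable II"
proof -
 have "(SIGMA n:UNIV. Z n) \<subseteq> (\<Union>k::nat. ZE (real k))"
 proof clarify
  fix n l assume "l \<in> Z n"
  moreover obtain k :: nat where "- Im l < real k" using reals_Archimedean2 by blast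
  ultimately show "(n, l) \<in> (\<Union>k::nat. ZE (real k))" by (auto simp: ZE_def intro!: exI[of _ k])
 qed
 then have "countable (SIGMA n:UNIV. Z n)"
  by (rule countable_subset) (intro countable_UN countable_finite finite_ZE countableI_type)
 then show ?thesis unfolding II_def by (rule countable_SIGMA) simp
qed

lemma Kt_expansion:
 assumes \<zeta>: "\<zeta> \<in> Dom" and N: "N > 0"
 shows "\<exists>J\<subseteq>II. finite J \<and> small N (\<lambda>z. c * Kt (hx z) (hy z) (hx \<zeta>) (hy \<zeta>) - (\<Sum>i\<in>J. tt c \<zeta> i z)) \<and> (\<forall>i\<in>II - J. small N (tt c \<zeta> i))"
proof -
 have z': "(hx \<zeta>, hy \<zeta>) \<in> Om" using \<zeta> by (simp add: Dom_def)
 \<comment> \<open>The factor \<open>\<bar>M\<bar> ^ 3\<close> of the remainder costs \<open>exp (- 3/2 * Re (L z))\<close>, a residue term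
  including its logarithms at most two powers.\<close>
 obtain E where E: "N + 2 < E" "\<And>n l. G n l = 0 ==> Im l \<noteq> - E" by (rule zero_free_line[of "N + 2"]) (use N in auto)
 have E0: "E > 0" using E N by simp
 obtain m :: nat where m: "N + 2 \<le> real m" using real_arch_simple by blast
 define J where "J = ZE E \<times> {..m}"
 have J: "J \<subseteq> II" "finite J" using finite_ZE by (auto simp: J_def II_def ZE_def)
 obtain C where C: "C \<ge> 0" "\<And>x y. (x, y) \<in> Om ==>
  cmod (Kt x y (hx \<zeta>) (hy \<zeta>) - (\<Sum>(n, l)\<in>ZE E. Bt n l x y (hx \<zeta>) (hy \<zeta>))) \<le> C * (cmod (M (sg x)) ^ 3 * exp (E * Re (sg x)))"
  by (rule Kt_split[OF z' E0 E(2)]) blast+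
 obtain B where B: "B \<ge> 1" "\<And>z. near z ==> Re (sg (hx z)) \<le> Re (L z) + B" "\<And>z. near z ==> cmod (M (sg (hx z))) \<le> B * exp (- Re (L z) / 2)"
  by (rule near_bounds) blast
 define r0 where "r0 z = Kt (hx z) (hy z) (hx \<zeta>) (hy \<zeta>) - (\<Sum>(n, l)\<in>ZE E. Bt n l (hx z) (hy z) (hx \<zeta>) (hy \<zeta>))" for z
 have s0: "small N r0"
 proof (rule smallI[of _ "C * (B ^ 3 * exp (E * B))" "E - 3/2"])
  fix z assume n: "near z"
  then have o: "(hx z, hy z) \<in> Om" by (simp add: near_def Dom_def)
  have "cmod (M (sg (hx z))) ^ 3 \<le> (B * exp (- Re (L z) / 2)) ^ 3" using B(3)[OF n] by (intro power_mono) auto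
  moreover have "exp (E * Re (sg (hx z))) \<le> exp (E * (Re (L z) + B))" using B(2)[OF n] E0 by simp
  ultimately have "cmod (M (sg (hx z))) ^ 3 * exp (E * Re (sg (hx z))) \<le> (B * exp (- Re (L z) / 2)) ^ 3 * exp (E * (Re (L z) + B))"
   using B(1) by (intro mult_mono) auto
  also have "\<dots> = B ^ 3 * exp (E * B) * exp ((E - 3/2) * Re (L z))"
   unfolding power_mult_distrib exp_of_nat_mult[symmetric] mult.assoc exp_add[symmetric] by (simp add: algebra_simps exp_add[symmetric])
  finally have le: "cmod (M (sg (hx z))) ^ 3 * exp (E * Re (sg (hx z))) \<le> B ^ 3 * exp (E * B) * exp ((E - 3/2) * Re (L z))" .
  show "cmod (r0 z) \<le> C * (B ^ 3 * exp (E * B)) * exp ((E - 3/2) * Re (L z))"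
   unfolding r0_def mult.assoc[of C] by (rule order_trans[OF C(2)[OF o] mult_left_mono[OF le C(1)]])
 qed (use E in simp)
 define r1 where "r1 z = (\<Sum>(n, l)\<in>ZE E. c * Bt n l (hx z) (hy z) (hx \<zeta>) (hy \<zeta>) - (\<Sum>j\<le>m. tt c \<zeta> ((n, l), j) z))" for z
 have "small N (\<lambda>z. \<Sum>p\<in>ZE E. (\<lambda>(n, l). c * Bt n l (hx z) (hy z) (hx \<zeta>) (hy \<zeta>) - (\<Sum>j\<le>m. tt c \<zeta> ((n, l), j) z)) p)"
 proof (rule small_sum[OF finite_ZE])
  fix p assume "p \<in> ZE E"
  then obtain n l where p: "p = (n, l)" "l \<in> Z n" by (auto simp: ZE_def)
  show "small N (\<lambda>z. (\<lambda>(n, l). c * Bt n l (hx z) (hy z) (hx \<zeta>) (hy \<zeta>) - (\<Sum>j\<le>m. tt c \<zeta> ((n, l), j) z)) p)"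
   unfolding p(1) prod.case by (rule residue_small[OF p(2)]) (use m in simp)
 qed
 then have s1: "small N r1" unfolding r1_def .
 have eq: "c * Kt (hx z) (hy z) (hx \<zeta>) (hy \<zeta>) - (\<Sum>i\<in>J. tt c \<zeta> i z) = c * r0 z + r1 z" for z
 proof -
  have "(\<Sum>i\<in>J. tt c \<zeta> i z) = (\<Sum>(n, l)\<in>ZE E. \<Sum>j\<le>m. tt c \<zeta> ((n, l), j) z)"
   unfolding J_def sum.cartesian_product' by (rule sum.cong[OF refl]) (simp add: split_beta)
  then show ?thesis unfolding r0_def r1_def by (simp add: split_beta sum_subtractf sum_distrib_left algebra_simps)
 qed
 have "small N (\<lambda>z. c * Kt (hx z) (hy z) (hx \<zeta>) (hy \<zeta>) - (\<Sum>i\<in>J. tt c \<zeta> i z))"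
  unfolding eq by (intro small_add small_mult s0 s1)
 moreover have "small N (tt c \<zeta> i)" if "i \<in> II - J" for i
 proof -
  obtain n l j where i1: "i = ((n, l), j)" by (metis surj_pair)
  have i: "l \<in> Z n" "\<not> (- E < Im l \<and> j \<le> m)" using that by (auto simp: i1 II_def J_def ZE_def)
  have "N + 1 \<le> - Im l - 1 + real j" using i(2) E(1) m Z_Im[OF i(1)] by (cases "j \<le> m") auto
  then show ?thesis unfolding i1 by (rule tt_small)
 qed
 ultimately show ?thesis using J by blast
qed

lemma PP_antiholomorphic: "antiholomorphic_poly_on (PP c i) Dom"
proof -
 obtain n l m where i: "i = ((n, l), m)" by (metis surj_pair)
 have sub: "Dom \<subseteq> Gz" using DD_good(1) Om_DD by (auto simp: Dom_def Gz_def)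
 note sgh = holomorphic_Cn_on_subset[OF sg_hx_hol sub] and Mh = holomorphic_Cn_on_subset[OF M_hx_hol sub]
 have "antiholomorphic_Cn_on ww Dom"
 proof -
  have "holomorphic_Cn_on (\<lambda>\<zeta>. - cnj \<kappa> + (- 1) * sg (hx \<zeta>)) Dom"
   by (rule holomorphic_Cn_on_add[OF holomorphic_Cn_on_const holomorphic_Cn_on_mult[OF holomorphic_Cn_on_const sgh]])
  then show ?thesis by (simp add: antiholomorphic_Cn_on_def ww_def)
 qed
 moreover have "antiholomorphic_Cn_on (\<lambda>\<zeta>. c * cc n l \<zeta> / (of_real A ^ n * of_real A ^ m)) Dom"
 proof -
  define k where "k = cnj (c * (- (2 * pi * \<i>) * of_nat (Suc n) * exp (of_nat (n + 3) / 2 * \<kappa> - \<i> * l * \<kappa>) / of_real d ^ (n + 3)) / (of_real A ^ n * of_real A ^ m))"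
  have "(\<lambda>x. exp (cnj (- (\<i> * l)) * x)) holomorphic_on UNIV" by (intro holomorphic_intros)
  from holomorphic_Cn_on_compose[OF this open_UNIV sgh]
  have "holomorphic_Cn_on (\<lambda>\<zeta>. exp (cnj (- (\<i> * l)) * sg (hx \<zeta>))) Dom" by simp
  then have "holomorphic_Cn_on (\<lambda>\<zeta>. k * (hy \<zeta> ^ n * M (sg (hx \<zeta>)) ^ (n + 3) * exp (cnj (- (\<i> * l)) * sg (hx \<zeta>)))) Dom"
   by (rule holomorphic_Cn_on_mult[OF holomorphic_Cn_on_const holomorphic_Cn_on_mult[OF
    holomorphic_Cn_on_mult[OF holomorphic_Cn_on_power[OF hy_hol] holomorphic_Cn_on_power[OF Mh]]]])
  moreover have "cnj (c * cc n l \<zeta> / (of_real A ^ n * of_real A ^ m)) = k * (hy \<zeta> ^ n * M (sg (hx \<zeta>)) ^ (n + 3) * exp (cnj (- (\<i> * l)) * sg (hx \<zeta>)))" for \<zeta>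
   unfolding k_def cc_def by (simp add: exp_cnj)
  ultimately show ?thesis unfolding antiholomorphic_Cn_on_def by simp
 qed
 ultimately show ?thesis unfolding i PP_def prod.case by (rule antiholomorphic_pcompose)
qed

theorem Kt_asymptotic_expansion:
 "\<exists>(n :: nat \<Rightarrow> nat) (\<gamma> :: nat \<Rightarrow> complex) (P :: nat \<Rightarrow> complex ^ 2 \<Rightarrow> complex poly).
   (\<forall>j. Re (\<gamma> j) > - 1 - real (n j) / 2) \<and> (\<forall>j. antiholomorphic_poly_on (P j) Dom) \<and>
   (\<forall>\<zeta>\<in>Dom. has_asymptotic_expansion (\<lambda>z. c * Kt (hx z) (hy z) (hx \<zeta>) (hy \<zeta>))
    (\<lambda>j z. (of_real A * hy z) ^ n j * exp (\<gamma> j * L z) * poly (P j \<zeta>) (L z))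
    (\<lambda>z. of_real A * (hx z - qq)) (qq *s e1) Dom)"
proof -
 define on where "on j \<longleftrightarrow> j \<in> to_nat_on II ` II" for j
 define i where "i j = from_nat_into II j" for j
 define n where "n j = (if on j then fst (fst (i j)) else 0)" for j
 define \<gamma> where "\<gamma> j = (if on j then g0 (fst (fst (i j))) (snd (fst (i j))) + of_nat (snd (i j)) else 0)" for j
 define P where "P j = (if on j then PP c (i j) else (\<lambda>_. 0))" for j
 have "Re (\<gamma> j) > - 1 - real (n j) / 2" for j
 proof (cases "on j")
  case True
  then have "II \<noteq> {}" by (auto simp: on_def)
  then have "i j \<in> II" unfolding i_def by (rule from_nat_into)
  then have "snd (fst (i j)) \<in> Z (fst (fst (i j)))" by (auto simp: II_def)
  from Z_Im[OF this] show ?thesis using True by (simp add: \<gamma>_def n_def g0_def field_simps)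
 qed (simp add: \<gamma>_def n_def)
 moreover have "antiholomorphic_poly_on (P j) Dom" for j
 proof (cases "on j")
  case False
  have "antiholomorphic_poly_on (\<lambda>_::complex^2. 0) Dom"
   by (simp add: antiholomorphic_poly_on_def antiholomorphic_Cn_on_def holomorphic_Cn_on_const)
  then show ?thesis using False by (simp add: P_def)
 qed (simp add: P_def PP_antiholomorphic)
 moreover have "has_asymptotic_expansion (\<lambda>z. c * Kt (hx z) (hy z) (hx \<zeta>) (hy \<zeta>))
    (\<lambda>j z. (of_real A * hy z) ^ n j * exp (\<gamma> j * L z) * poly (P j \<zeta>) (L z))
    (\<lambda>z. of_real A * (hx z - qq)) (qq *s e1) Dom" if \<zeta>: "\<zeta> \<in> Dom" for \<zeta>
 proof -
  have "has_asymptotic_expansion (\<lambda>z. c * Kt (hx z) (hy z) (hx \<zeta>) (hy \<zeta>))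
    (\<lambda>j z. if j \<in> to_nat_on II ` II then tt c \<zeta> (from_nat_into II j) z else 0) (\<lambda>z. of_real A * (hx z - qq)) (qq *s e1) Dom"
  proof (rule has_asymptotic_expansion_enumerate[OF countable_II])
   fix N :: real assume "N > 0"
   from Kt_expansion[OF \<zeta> this, of c] obtain J where J: "J \<subseteq> II" "finite J"
    and sm: "small N (\<lambda>z. c * Kt (hx z) (hy z) (hx \<zeta>) (hy \<zeta>) - (\<Sum>i\<in>J. tt c \<zeta> i z))" "\<forall>i\<in>II - J. small N (tt c \<zeta> i)"
    by (elim exE conjE) (rule that)
   show "\<exists>J\<subseteq>II. finite J \<and> (\<lambda>z. cmod (c * Kt (hx z) (hy z) (hx \<zeta>) (hy \<zeta>) - (\<Sum>i\<in>J. tt c \<zeta> i z))) \<in> O[at (qq *s e1) within Dom](\<lambda>z. cmod (of_real A * (hx z - qq)) powr N) \<and>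
     (\<forall>i\<in>II - J. (\<lambda>z. cmod (tt c \<zeta> i z)) \<in> O[at (qq *s e1) within Dom](\<lambda>z. cmod (of_real A * (hx z - qq)) powr N))"
    by (intro exI[of _ J] conjI J ballI small_bigo sm(1) bspec[OF sm(2)])
  qed
  moreover have "(if j \<in> to_nat_on II ` II then tt c \<zeta> (from_nat_into II j) z else 0) = (of_real A * hy z) ^ n j * exp (\<gamma> j * L z) * poly (P j \<zeta>) (L z)" for j z
   unfolding on_def[symmetric] i_def[symmetric] by (simp add: n_def \<gamma>_def P_def tt_def split_beta)
  ultimately show ?thesis by simp
 qed
 ultimately show ?thesis by blast
qed

end

section \<open>Two intersecting balls\<close>

lemma has_asymptotic_expansion_cong:
 assumes "\<And>z. z \<in> S ==> f z = g z" "has_asymptotic_expansion f t w q S"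
 shows "has_asymptotic_expansion g t w q S"
proof -
 have e: "(\<lambda>z. cmod (f z - b z)) \<in> O[at q within S](h) \<longleftrightarrow> (\<lambda>z. cmod (g z - b z)) \<in> O[at q within S](h)" for b h
  by (rule landau_o.big.in_cong) (simp add: eventually_at_filter assms(1))
 show ?thesis using assms(2) unfolding has_asymptotic_expansion_def e .
qed

lemma unitary_coordinates:
 assumes e: "hermitian e e = 1"
 shows "hermitian (perp e) (perp e) = 1" "z = hermitian z e *s e + hermitian z (perp e) *s perp e"
  "(norm z)\<^sup>2 = (cmod (hermitian z e))\<^sup>2 + (cmod (hermitian z (perp e)))\<^sup>2"
proof -
 have e': "e $ 1 * cnj (e $ 1) + e $ 2 * cnj (e $ 2) = 1" using e by (simp add: hermitian_def)
 note p = hermitian_def perp_def vector_2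
 show "hermitian (perp e) (perp e) = 1" using e' by (simp add: p algebra_simps)
 have "w * (e $ 1 * cnj (e $ 1) + e $ 2 * cnj (e $ 2)) = w" for w unfolding e' by simp
 from this[of "z $ 1"] this[of "z $ 2"]
 show "z = hermitian z e *s e + hermitian z (perp e) *s perp e"
  by (simp add: vec_eq_iff forall_2 p algebra_simps)
 have "complex_of_real ((cmod (hermitian z e))\<^sup>2 + (cmod (hermitian z (perp e)))\<^sup>2)
   = (z $ 1 * cnj (z $ 1) + z $ 2 * cnj (z $ 2)) * (e $ 1 * cnj (e $ 1) + e $ 2 * cnj (e $ 2))"
  unfolding of_real_add complex_norm_square by (simp add: p algebra_simps)
 also have "\<dots> = complex_of_real ((cmod (z $ 1))\<^sup>2 + (cmod (z $ 2))\<^sup>2)"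
  unfolding e' of_real_add complex_norm_square by simp
 finally have "(cmod (hermitian z e))\<^sup>2 + (cmod (hermitian z (perp e)))\<^sup>2 = (cmod (z $ 1))\<^sup>2 + (cmod (z $ 2))\<^sup>2"
  by (simp only: of_real_eq_iff)
 then show "(norm z)\<^sup>2 = (cmod (hermitian z e))\<^sup>2 + (cmod (hermitian z (perp e)))\<^sup>2"
  by (simp add: norm_vec_def L2_set_def sum_2)
qed

lemma inner_hermitian: "v \<bullet> w = Re (hermitian v w)" for v w :: "complex ^ 2"
 by (simp add: inner_vec_def sum_2 hermitian_def inner_complex_def)

lemma mem_max_complex_subspace_sphere:
 assumes "z \<in> sphere c r" "r > 0"
 shows "v \<in> max_complex_subspace (tangent_space (sphere c r) z) \<longleftrightarrow> hermitian v (z - c) = 0"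
proof -
 have s: "hermitian (k *s u) w = k * hermitian u w" for k u w by (simp add: hermitian_def algebra_simps)
 have ii: "\<i> *s (- \<i> *s v) = v" by (simp add: vec_eq_iff flip: mult.assoc)
 show ?thesis
  unfolding max_complex_subspace_def tangent_space_sphere[OF assms] inner_hermitian
 proof
  assume "v \<in> {v. Re (hermitian v (z - c)) = 0} \<inter> (\<lambda>v. \<i> *s v) ` {v. Re (hermitian v (z - c)) = 0}"
  then obtain u where "Re (hermitian v (z - c)) = 0" "v = \<i> *s u" "Re (hermitian u (z - c)) = 0" by blast
  then show "hermitian v (z - c) = 0" by (simp add: s complex_eq_iff)
 next
  assume h: "hermitian v (z - c) = 0"
  have "Re (hermitian (- \<i> *s v) (z - c)) = 0" "Re (hermitian v (z - c)) = 0" unfolding s h by simp_all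
  then show "v \<in> {v. Re (hermitian v (z - c)) = 0} \<inter> (\<lambda>v. \<i> *s v) ` {v. Re (hermitian v (z - c)) = 0}"
   by (intro IntI image_eqI[of _ _ "- \<i> *s v"]) (simp_all only: mem_Collect_eq ii)
 qed
qed

text \<open>The vector \<open>perp z\<close> spans the maximal complex subspace at \<open>z\<close> of the unit sphere. If it is tangent to
 the other sphere as well, then it is orthogonal to \<open>a\<close>, that is, \<open>z\<close> is a multiple of \<open>a\<close>.\<close>

lemma complex_tangent_point_on_line:
 assumes z: "z \<in> complex_tangent_points (sphere 0 1) (sphere a r)" and r: "r > 0"
 shows "hermitian z (perp a) = 0"
proof -
 have S: "z \<in> sphere 0 1" "z \<in> sphere a r"
  and eq: "max_complex_subspace (tangent_space (sphere 0 1) z) = max_complex_subspace (tangent_space (sphere a r) z)"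
  using z by (auto simp: complex_tangent_points_def)
 have "hermitian (perp z) (z - 0) = 0" by (simp add: hermitian_def perp_def vector_2)
 then have "perp z \<in> max_complex_subspace (tangent_space (sphere 0 1) z)"
  by (subst mem_max_complex_subspace_sphere[OF S(1)]) auto
 then have "hermitian (perp z) (z - a) = 0" unfolding eq mem_max_complex_subspace_sphere[OF S(2) r] .
 then have "cnj (hermitian (perp z) (z - a)) = 0" by simp
 then show ?thesis by (simp add: hermitian_def perp_def vector_2 algebra_simps)
qed

text \<open>The tangent point \<open>s\<close> plays the role of the vertex \<open>qq\<close>; the sign of \<open>v\<close> decides which of the two
 tangent points this is.\<close>

lemma lens_expansion:
 fixes a e s s' :: "complex ^ 2" and K :: "complex ^ 2 \<Rightarrow> complex ^ 2 \<Rightarrow> complex" and A r u v :: real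
 defines "\<Omega> \<equiv> ball 0 1 \<inter> ball a r"
 assumes A: "A > 0" and r: "r > 0" and e: "hermitian e e = 1" and a: "a = of_real A *s e"
  and v: "v \<noteq> 0" "u\<^sup>2 + v\<^sup>2 = 1" "(u - A)\<^sup>2 + v\<^sup>2 = r\<^sup>2"
  and s: "s = Complex u v *s e" "s' = Complex u (- v) *s e"
  and K: "is_bergman_kernel \<Omega> K"
 shows "\<forall>\<zeta>\<in>\<Omega>. \<exists>U F. open U \<and> closure \<Omega> - {s, s'} \<subseteq> U \<and> holomorphic_Cn_on F U \<and> (\<forall>z\<in>\<Omega>. F z = K z \<zeta>)" (is ?th1)
  and "\<forall>L. holomorphic_log_branch (\<lambda>z. hermitian (z - s) a) \<Omega> L \<longrightarrow>
     (\<exists>(n :: nat \<Rightarrow> nat) (\<gamma> :: nat \<Rightarrow> complex) (P :: nat \<Rightarrow> complex ^ 2 \<Rightarrow> complex poly).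
      (\<forall>j. Re (\<gamma> j) > - 1 - real (n j) / 2) \<and>
      (\<forall>j. antiholomorphic_poly_on (P j) \<Omega>) \<and>
      (\<forall>\<zeta>\<in>\<Omega>. has_asymptotic_expansion (\<lambda>z. K z \<zeta>)
        (\<lambda>j z. hermitian (z - s) (perp a) ^ n j * exp (\<gamma> j * L z) * poly (P j \<zeta>) (L z))
        (\<lambda>z. hermitian (z - s) a) s \<Omega>))" (is ?th2)
proof -
 note uc = unitary_coordinates[OF e]
 have ee: "hermitian e (perp e) = 0" by (rule hermitian_perp)
 interpret D: lens_domain A r u v e "perp e"
  by unfold_locales (use A v e uc(1) ee in auto)
 have pa: "perp a = of_real A *s perp e" unfolding a by (simp add: vec_eq_iff forall_2 perp_def vector_2)
 have lin: "hermitian (x - y) w = hermitian x w - hermitian y w" "hermitian (k *s x) w = k * hermitian x w"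
  "hermitian x (k *s w) = cnj k * hermitian x w" for x y w k by (simp_all add: hermitian_def algebra_simps)
 have na: "(norm (z - a))\<^sup>2 = (cmod (D.hx z - of_real A))\<^sup>2 + (cmod (D.hy z))\<^sup>2" for z
  unfolding uc(3)[of "z - a"] D.hx_def D.hy_def by (simp add: a lin e ee)
 have n0: "(norm z)\<^sup>2 = (cmod (D.hx z))\<^sup>2 + (cmod (D.hy z))\<^sup>2" for z
  unfolding D.hx_def D.hy_def by (rule uc(3))
 have b1: "z \<in> ball 0 1 \<longleftrightarrow> (norm z)\<^sup>2 < 1" for z :: "complex ^ 2" by (simp add: abs_square_less_1)
 have b2: "z \<in> ball a r \<longleftrightarrow> (norm (z - a))\<^sup>2 < r\<^sup>2" for z
  using r power_mono_iff[of r "norm (z - a)" 2] by (simp add: dist_norm norm_minus_commute not_le[symmetric])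
 have Dom: "D.Dom = \<Omega>"
  by (rule set_eqI) (unfold \<Omega>_def D.Dom_def mem_Collect_eq Int_iff b1 b2 na, unfold n0 D.mem_Om D.rho_def min_less_iff_conj, auto)
 have o: "open \<Omega>" unfolding \<Omega>_def by auto
 obtain c where c: "c > 0" "is_bergman_kernel \<Omega> (\<lambda>z \<zeta>. of_real c * D.Kt (D.hx z) (D.hy z) (D.hx \<zeta>) (D.hy \<zeta>))"
  using D.bergman_kernel_Dom unfolding Dom by blast
 have Keq: "of_real c * D.Kt (D.hx z) (D.hy z) (D.hx \<zeta>) (D.hy \<zeta>) = K z \<zeta>" if "z \<in> \<Omega>" "\<zeta> \<in> \<Omega>" for z \<zeta>
  by (rule is_bergman_kernel_unique[OF o c(2) K that])
 have dec: "z = D.hx z *s e + D.hy z *s perp e" for z unfolding D.hx_def D.hy_def by (rule uc(2))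
 show ?th1
 proof
  fix \<zeta> assume \<zeta>: "\<zeta> \<in> \<Omega>"
  then have \<zeta>D: "\<zeta> \<in> D.Dom" by (simp add: Dom)
  obtain k where k: "0 < k" "k < 1"
   "\<And>z. \<lbrakk>(cmod (D.hx z))\<^sup>2 + (cmod (D.hy z))\<^sup>2 \<le> 1; (cmod (D.hx z - of_real A))\<^sup>2 + (cmod (D.hy z))\<^sup>2 \<le> r\<^sup>2; D.hx z \<noteq> D.pp; D.hx z \<noteq> D.qq\<rbrakk> \<Longrightarrow> z \<in> D.Uz k \<zeta>"
   by (rule D.Dom_Uz[OF \<zeta>D]) blast
  have "closure \<Omega> - {s, s'} \<subseteq> D.Uz k \<zeta>"
  proof
   fix z assume z: "z \<in> closure \<Omega> - {s, s'}"
   have "closure \<Omega> \<subseteq> cball 0 1 \<inter> cball a r" unfolding \<Omega>_def by (rule closure_minimal) auto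
   then have zc: "norm z \<le> 1" "norm (z - a) \<le> r" using z by (auto simp: dist_norm norm_minus_commute)
   then have le: "(cmod (D.hx z))\<^sup>2 + (cmod (D.hy z))\<^sup>2 \<le> 1" "(cmod (D.hx z - of_real A))\<^sup>2 + (cmod (D.hy z))\<^sup>2 \<le> r\<^sup>2"
    unfolding n0[symmetric] na[symmetric] by (auto simp: abs_square_le_1 intro: power_mono)
   have ne: "D.hx z \<noteq> x" if x: "cmod x = 1" "x *s e \<in> {s, s'}" for x
   proof
    assume h: "D.hx z = x"
    then have "(cmod (D.hy z))\<^sup>2 \<le> 0" using le(1) x by simp
    then have "D.hy z = 0" by simp
    then have "z = x *s e" using dec[of z] h by simp
    then show False using z x by blast
   qed
   show "z \<in> D.Uz k \<zeta>"
    by (rule k(3)[OF le ne ne]) (use s D.norm_pp_qq in \<open>auto simp: D.pp_def D.qq_def\<close>)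
  qed
  moreover have "holomorphic_Cn_on (\<lambda>z. of_real c * D.Kt (D.hx z) (D.hy z) (D.hx \<zeta>) (D.hy \<zeta>)) (D.Uz k \<zeta>)"
   by (rule holomorphic_Cn_on_mult[OF holomorphic_Cn_on_const D.Kt_hol[OF \<zeta>D k(1,2)]])
  ultimately show "\<exists>U F. open U \<and> closure \<Omega> - {s, s'} \<subseteq> U \<and> holomorphic_Cn_on F U \<and> (\<forall>z\<in>\<Omega>. F z = K z \<zeta>)"
   using D.open_Uz Keq[OF _ \<zeta>] by blast
 qed
 show ?th2
 proof (intro allI impI)
  fix L assume L: "holomorphic_log_branch (\<lambda>z. hermitian (z - s) a) \<Omega> L"
  have h1: "hermitian (z - s) a = of_real A * (D.hx z - D.qq)" for z
   unfolding a s(1) lin D.hx_def D.qq_def by (simp add: lin e)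
  have h2: "hermitian (z - s) (perp a) = of_real A * D.hy z" for z
   unfolding pa s(1) lin D.hy_def by (simp add: lin ee)
  interpret DL: lens_log A r u v e "perp e" L
  proof unfold_locales
   show "continuous_on D.Dom L" using L by (auto simp: Dom holomorphic_log_branch_def intro: holomorphic_Cn_on_imp_continuous_on)
   show "exp (L z) = of_real A * (D.hx z - D.qq)" if "z \<in> D.Dom" for z
    using L that by (simp add: Dom holomorphic_log_branch_def h1)
   show "connected D.Dom" unfolding Dom \<Omega>_def by (intro convex_connected convex_Int convex_ball)
  qed
  have sq: "D.qq *s e = s" unfolding D.qq_def s ..
  obtain n \<gamma> P where ex: "\<forall>j. Re (\<gamma> j) > - 1 - real (n j) / 2" "\<forall>j. antiholomorphic_poly_on (P j) \<Omega>"
   "\<forall>\<zeta>\<in>\<Omega>. has_asymptotic_expansion (\<lambda>z. of_real c * D.Kt (D.hx z) (D.hy z) (D.hx \<zeta>) (D.hy \<zeta>))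
    (\<lambda>j z. hermitian (z - s) (perp a) ^ n j * exp (\<gamma> j * L z) * poly (P j \<zeta>) (L z)) (\<lambda>z. hermitian (z - s) a) s \<Omega>"
   using DL.Kt_asymptotic_expansion[of "of_real c", unfolded Dom h1[symmetric] h2[symmetric] sq] by blast
  have "has_asymptotic_expansion (\<lambda>z. K z \<zeta>)
    (\<lambda>j z. hermitian (z - s) (perp a) ^ n j * exp (\<gamma> j * L z) * poly (P j \<zeta>) (L z)) (\<lambda>z. hermitian (z - s) a) s \<Omega>" if "\<zeta> \<in> \<Omega>" for \<zeta>
   by (rule has_asymptotic_expansion_cong[OF Keq[OF _ that] ex(3)[rule_format, OF that]])
  with ex(1,2) show "\<exists>(n :: nat \<Rightarrow> nat) (\<gamma> :: nat \<Rightarrow> complex) (P :: nat \<Rightarrow> complex ^ 2 \<Rightarrow> complex poly).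
      (\<forall>j. Re (\<gamma> j) > - 1 - real (n j) / 2) \<and>
      (\<forall>j. antiholomorphic_poly_on (P j) \<Omega>) \<and>
      (\<forall>\<zeta>\<in>\<Omega>. has_asymptotic_expansion (\<lambda>z. K z \<zeta>)
        (\<lambda>j z. hermitian (z - s) (perp a) ^ n j * exp (\<gamma> j * L z) * poly (P j \<zeta>) (L z))
        (\<lambda>z. hermitian (z - s) a) s \<Omega>)" by blast
 qed
qed

theorem theorem1p1:
 fixes a p q :: "complex ^ 2"
  and r :: real
  and B1 B2 \<Omega> :: "(complex ^ 2) set"
  and K :: "complex ^ 2 \<Rightarrow> complex ^ 2 \<Rightarrow> complex"
 assumes r_pos: "r > 0"
  and B1: "B1 = ball 0 1"
  and B2: "B2 = ball a r"
  and nonempty: "frontier B1 \<inter> frontier B2 \<noteq> {}"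
  and transversal: "real_transversal (frontier B1) (frontier B2)"
  and \<Omega>: "\<Omega> = B1 \<inter> B2"
  and K: "is_bergman_kernel \<Omega> K"
  and pq: "p \<noteq> q" "complex_tangent_points (frontier B1) (frontier B2) = {p, q}"
 shows "(\<forall>\<zeta>\<in>\<Omega>. \<exists>U F. open U \<and> closure \<Omega> - {p, q} \<subseteq> U \<and> holomorphic_Cn_on F U \<and>
       (\<forall>z\<in>\<Omega>. F z = K z \<zeta>))
  \<and> (\<forall>s\<in>{p, q}. \<forall>L. holomorphic_log_branch (\<lambda>z. hermitian (z - s) a) \<Omega> L \<longrightarrow>
     (\<exists>(n :: nat \<Rightarrow> nat) (\<gamma> :: nat \<Rightarrow> complex) (P :: nat \<Rightarrow> complex ^ 2 \<Rightarrow> complex poly).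
      (\<forall>j. Re (\<gamma> j) > - 1 - real (n j) / 2) \<and>
      (\<forall>j. antiholomorphic_poly_on (P j) \<Omega>) \<and>
      (\<forall>\<zeta>\<in>\<Omega>. has_asymptotic_expansion (\<lambda>z. K z \<zeta>)
        (\<lambda>j z. hermitian (z - s) (perp a) ^ n j * exp (\<gamma> j * L z) * poly (P j \<zeta>) (L z))
        (\<lambda>z. hermitian (z - s) a) s \<Omega>)))"
proof -
 have S: "frontier B1 = sphere 0 1" "frontier B2 = sphere a r" using r_pos by (simp_all add: B1 B2 frontier_ball)
 have pS: "w \<in> sphere 0 1" "w \<in> sphere a r" if "w \<in> {p, q}" for w
  using that pq(2) unfolding S by (auto simp: complex_tangent_points_def)
 have pT: "w \<in> complex_tangent_points (sphere 0 1) (sphere a r)" if "w \<in> {p, q}" for w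
  using that pq(2) unfolding S by blast
 have "a \<noteq> 0"
 proof
  assume a0: "a = 0"
  have t: "tangent_space (sphere 0 1) p = {v. v \<bullet> p = 0}" "tangent_space (sphere a r) p = {v. v \<bullet> p = 0}"
   using tangent_space_sphere[of p 0 1] tangent_space_sphere[of p a r] pS[of p] r_pos by (auto simp: a0)
  have "{u + v | u v. u \<in> tangent_space (sphere 0 1) p \<and> v \<in> tangent_space (sphere a r) p} = UNIV"
   using transversal pS[of p] unfolding S real_transversal_def by blast
  then obtain x y where "p = x + y" "x \<bullet> p = 0" "y \<bullet> p = 0" unfolding t by blast
  then have "p \<bullet> p = 0" by (metis add_0 inner_add_left)
  then show False using pS[of p] by simp
 qed
 define A where "A = norm a"
 define e where "e = (1 / of_real A) *s a"
 have A: "A > 0" using \<open>a \<noteq> 0\<close> by (simp add: A_def)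
 have ae: "a = of_real A *s e" using A by (simp add: e_def vec_eq_iff)
 have "hermitian a a = of_real (A\<^sup>2)"
  unfolding A_def norm_vec_def L2_set_def sum_2 hermitian_def complex_norm_square[symmetric]
  by (simp add: real_sqrt_pow2 add_nonneg_nonneg flip: of_real_power)
 then have e: "hermitian e e = 1" using A by (simp add: e_def hermitian_def power2_eq_square add_divide_distrib[symmetric])
 note uc = unitary_coordinates[OF e]
 have x: "w = hermitian w e *s e" "(cmod (hermitian w e))\<^sup>2 = 1" "(cmod (hermitian w e - of_real A))\<^sup>2 = r\<^sup>2" if w: "w \<in> {p, q}" for w
 proof -
  have "hermitian w (perp a) = 0" by (rule complex_tangent_point_on_line[OF pT[OF w] r_pos])
  then have "of_real A * hermitian w (perp e) = 0" by (subst (asm) ae) (simp add: hermitian_def perp_def vector_2 algebra_simps)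
  then have 0: "hermitian w (perp e) = 0" using A by simp
  then show we: "w = hermitian w e *s e" using uc(2)[of w] by simp
  show "(cmod (hermitian w e))\<^sup>2 = 1" using uc(3)[of w] 0 pS(1)[OF w] by simp
  have "hermitian (w - a) e = hermitian w e - of_real A"
  proof -
   have "hermitian (w - a) e = hermitian w e - of_real A * hermitian e e" by (subst ae) (simp add: hermitian_def algebra_simps)
   then show ?thesis by (simp add: e)
  qed
  moreover have "hermitian (w - a) (perp e) = 0"
  proof -
   have "hermitian (w - a) (perp e) = hermitian w (perp e) - of_real A * hermitian e (perp e)" by (subst ae) (simp add: hermitian_def algebra_simps)
   then show ?thesis by (simp add: 0 hermitian_perp)
  qed
  moreover have "norm (w - a) = r" using pS(2)[OF w] by (simp add: dist_norm norm_minus_commute)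
  ultimately show "(cmod (hermitian w e - of_real A))\<^sup>2 = r\<^sup>2" using uc(3)[of "w - a"] by simp
 qed
 \<comment> \<open>On the complex line through \<open>a\<close> the two spheres cut out circles centred on the real axis, so the
  distinct intersection points are complex conjugate.\<close>
 define u v where "u = Re (hermitian p e)" and "v = Im (hermitian p e)"
 define u' v' where "u' = Re (hermitian q e)" and "v' = Im (hermitian q e)"
 have 1: "u\<^sup>2 + v\<^sup>2 = 1" "(u - A)\<^sup>2 + v\<^sup>2 = r\<^sup>2" using x(2,3)[of p] by (simp_all add: u_def v_def cmod_power2)
 have 2: "u'\<^sup>2 + v'\<^sup>2 = 1" "(u' - A)\<^sup>2 + v'\<^sup>2 = r\<^sup>2" using x(2,3)[of q] by (simp_all add: u'_def v'_def cmod_power2)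
 have "2 * A * u = 2 * A * u'" using 1 2 by (simp add: power2_diff algebra_simps)
 then have uu: "u' = u" using A by simp
 have "Complex u v' = hermitian q e" unfolding uu[symmetric] by (simp add: u'_def v'_def)
 then have P: "p = Complex u v *s e" "q = Complex u v' *s e" using x(1)[of p] x(1)[of q] by (simp_all add: u_def v_def)
 have "v'\<^sup>2 = v\<^sup>2" using 1 2 uu by simp
 moreover have "v' \<noteq> v" using pq(1) P by auto
 ultimately have v': "v' = - v" "v \<noteq> 0" by (auto simp: power2_eq_iff)
 have \<Omega>': "\<Omega> = ball 0 1 \<inter> ball a r" using \<Omega> B1 B2 by simp
 have K': "is_bergman_kernel (ball 0 1 \<inter> ball a r) K" using K \<Omega>' by simp
 note Lp = lens_expansion[OF A r_pos e ae v'(2) 1 P(1) P(2)[unfolded v'(1)] K', folded \<Omega>']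
 have nv: "- v \<noteq> 0" "u\<^sup>2 + (- v)\<^sup>2 = 1" "(u - A)\<^sup>2 + (- v)\<^sup>2 = r\<^sup>2" "p = Complex u (- (- v)) *s e" using v'(2) 1 P by simp_all
 note Lq = lens_expansion[OF A r_pos e ae nv(1-3) P(2)[unfolded v'(1)] nv(4) K', folded \<Omega>']
 show ?thesis using Lp Lq(2) by blast
qed

end
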